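(* Let $\gamma>0$ be a constant. Assume that $0\le f\in L^r(0,T;L^q(\Omega))$ with $r,q$ satisfying $$\frac1r+\frac{n}{2q}<1,$$ and that $0\le u_0\in L^\infty(\Omega)$. For $k\in\mathbb{N}$ let $u_k$ be the unique (non-negative) finite energy solution of $$(u_k)_t-\Delta u_k+(-\Delta)^su_k=\frac{T_k(f(x,t))}{\left(u_k+\frac1k\right)^\gamma}\ \text{in }\Omega_T,\quad u_k=0\ \text{in }(\mathbb{R}^n\setminus\Omega)\times(0,T),\quad u_k(x,0)=T_k(u_0(x))\ \text{in }\Omega.$$ Then there exists a positive constant $c$, independent of $k$, such that $$\|u_k\|_{L^\infty(\Omega_T)}\le c,$$ and the function $u$ obtained as the (pointwise a.e.) limit of $u_k$ as $k\to\infty$ satisfies $u\in L^\infty(\Omega_T)$. Moreover, if $\gamma\le1$, then $u\in L^2(0,T;H_0^1(\Omega))$.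
   Context: Standing assumptions: $n>2$, $\Omega\subset\mathbb{R}^n$ is a bounded domain with Lipschitz boundary, $s\in(0,1)$, $0<T<\infty$, $\Omega_T=\Omega\times(0,T)$. $T_k(\sigma)=\max\{-k,\min\{k,\sigma\}\}$. The fractional Laplacian acts in the space variable: $(-\Delta)^su(x,t)=c_{n,s}\,\mathrm{P.V.}\int_{\mathbb{R}^n}\frac{u(x,t)-u(y,t)}{|x-y|^{n+2s}}\,dy$; in the energy formulation below the constant $c_{n,s}$ is taken to be $1$. Energy (finite energy) solution: for $g\in L^2(\Omega_T)$, $v_0\in L^2(\Omega)$, a function $v$ is an energy solution of $v_t-\Delta v+(-\Delta)^sv=g$ in $\Omega_T$, $v=0$ in $(\mathbb{R}^n\setminus\Omega)\times(0,T)$, $v(\cdot,0)=v_0$ in $\Omega$, if $v\in L^2(0,T;H_0^1(\Omega))\cap\mathcal{C}([0,T],L^2(\Omega))$, $v_t\in L^2(0,T;H^{-1}(\Omega))$, $v(\cdot,t)\to v_0$ strongly in $L^2(\Omega)$ as $t\to0$, and for all $\phi\in L^2(0,T;H_0^1(\Omega))$ $$\int_0^T\langle v_t,\phi\rangle dt+\int_0^T\!\!\int_\Omega\nabla v\cdot\nabla\phi\,dx\,dt+\frac12\int_0^T\!\!\int_{\mathbb{R}^n}\!\int_{\mathbb{R}^n}\frac{(v(x,t)-v(y,t))(\phi(x,t)-\phi(y,t))}{|x-y|^{n+2s}}dx\,dy\,dt=\int_0^T\!\!\int_\Omega g\phi\,dx\,dt.$$ The solution $u_k$ above is meant in this sense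 with $g=T_k(f)/(u_k+\frac1k)^\gamma$ and $v_0=T_k(u_0)$. For each $k$ such a non-negative $u_k$ exists and is unique, and the sequence $\{u_k\}_k$ is increasing in $k$, so the pointwise limit $u$ is defined. *)

theory Defs
  imports "HOL-Analysis.Analysis" "HOL-Probability.Essential_Supremum"
begin

text \<open>
  Functions on \<open>\<Omega> \<times> (0,T)\<close> are curried, \<open>v x t\<close>, with the space variable first.
  Functions are representatives of their Lebesgue a.e. classes.
\<close>

subsection \<open>Domains with Lipschitz boundary\<close>

text \<open>
  Near every boundary point and after a rotation of the coordinates, \<open>\<Omega>\<close> is the strict
  epigraph of a Lipschitz function \<open>h\<close> of the coordinates orthogonal to the unit vector \<open>e\<close>.
\<close>

definition lipschitz_boundary :: "(real ^ 'n) set \<Rightarrow> bool" where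
  "lipschitz_boundary \<Omega> \<longleftrightarrow>
     (\<forall>z\<in>frontier \<Omega>. \<exists>r>0. \<exists>e h L. norm e = 1 \<and> L-lipschitz_on {x. x \<bullet> e = 0} h \<and>
        (\<forall>x\<in>ball z r. x \<in> \<Omega> \<longleftrightarrow> x \<bullet> e > h (x - (x \<bullet> e) *\<^sub>R e)))"

definition bounded_lipschitz_domain :: "(real ^ 'n) set \<Rightarrow> bool" where
  "bounded_lipschitz_domain \<Omega> \<longleftrightarrow>
     open \<Omega> \<and> connected \<Omega> \<and> \<Omega> \<noteq> {} \<and> bounded \<Omega> \<and> lipschitz_boundary \<Omega>"

subsection \<open>Lebesgue spaces\<close>

definition Lnorm :: "ennreal \<Rightarrow> 'a measure \<Rightarrow> ('a \<Rightarrow> 'b::real_normed_vector) \<Rightarrow> ennreal" where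
  "Lnorm p M f =
     (if p = \<infinity> then esssup M (\<lambda>x. ennreal (norm (f x)))
      else let I = (\<integral>\<^sup>+x. ennreal (norm (f x) powr enn2real p) \<partial>M)
           in if I = \<infinity> then \<infinity> else ennreal (enn2real I powr (1 / enn2real p)))"

definition Lspace :: "ennreal \<Rightarrow> 'a measure \<Rightarrow> ('a \<Rightarrow> 'b::real_normed_vector) set" where
  "Lspace p M = {f \<in> borel_measurable M. Lnorm p M f < \<infinity>}"

abbreviation cylinder :: "(real ^ 'n) set \<Rightarrow> real \<Rightarrow> ((real ^ 'n) \<times> real) measure" where
  "cylinder \<Omega> T \<equiv> lebesgue_on (\<Omega> \<times> {0<..<T})"

text \<open>
  \<open>L\<^sup>p(0,T;X)\<close> for a space \<open>X\<close> of functions on \<open>\<Omega>\<close> with norm \<open>nrm\<close>, as a space of measurable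
  functions on the cylinder. For \<open>X = L\<^sup>q\<close> this is the usual mixed-norm space. For \<open>X = H\<^sub>0\<^sup>1\<close>,
  which is separable, strong measurability of \<open>t \<mapsto> v(\<cdot>,t)\<close> follows from joint
  measurability by Pettis' theorem, so this is the Bochner space.
\<close>

definition Lspace_time ::
  "ennreal \<Rightarrow> (real ^ 'n) set \<Rightarrow> real \<Rightarrow> ((real ^ 'n) \<Rightarrow> real) set \<Rightarrow> (((real ^ 'n) \<Rightarrow> real) \<Rightarrow> real)
     \<Rightarrow> ((real ^ 'n) \<Rightarrow> real \<Rightarrow> real) set" where
  "Lspace_time p \<Omega> T X nrm =
     {v. (\<lambda>(x, t). v x t) \<in> borel_measurable (cylinder \<Omega> T) \<and>
         (AE t in lebesgue_on {0<..<T}. (\<lambda>x. v x t) \<in> X) \<and>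
         (\<lambda>t. nrm (\<lambda>x. v x t)) \<in> Lspace p (lebesgue_on {0<..<T})}"

definition LrLq :: "ennreal \<Rightarrow> ennreal \<Rightarrow> (real ^ 'n) set \<Rightarrow> real \<Rightarrow> ((real ^ 'n) \<Rightarrow> real \<Rightarrow> real) set" where
  "LrLq r q \<Omega> T =
     Lspace_time r \<Omega> T (Lspace q (lebesgue_on \<Omega>)) (\<lambda>w. enn2real (Lnorm q (lebesgue_on \<Omega>) w))"

text \<open>\<open>v \<in> C([0,T], L\<^sup>2(\<Omega>))\<close>\<close>

definition cont_L2 :: "(real ^ 'n) set \<Rightarrow> real \<Rightarrow> ((real ^ 'n) \<Rightarrow> real \<Rightarrow> real) \<Rightarrow> bool" where
  "cont_L2 \<Omega> T v \<longleftrightarrow>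
     (\<forall>t\<in>{0..T}. (\<lambda>x. v x t) \<in> Lspace 2 (lebesgue_on \<Omega>)) \<and>
     (\<forall>t\<in>{0..T}. ((\<lambda>\<tau>. Lnorm 2 (lebesgue_on \<Omega>) (\<lambda>x. v x \<tau> - v x t)) \<longlongrightarrow> 0) (at t within {0..T}))"

subsection \<open>Test functions\<close>

primrec iter_deriv :: "'a::euclidean_space list \<Rightarrow> ('a \<Rightarrow> real) \<Rightarrow> 'a \<Rightarrow> real" where
  "iter_deriv [] \<phi> = \<phi>"
| "iter_deriv (b # bs) \<phi> = (\<lambda>x. frechet_derivative (iter_deriv bs \<phi>) (at x) b)"

definition Cc_infinity :: "'a::euclidean_space set \<Rightarrow> ('a \<Rightarrow> real) set" where
  "Cc_infinity S =
     {\<phi>. (\<forall>bs x. iter_deriv bs \<phi> differentiable (at x)) \<and>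
         compact (closure {x. \<phi> x \<noteq> 0}) \<and> closure {x. \<phi> x \<noteq> 0} \<subseteq> S}"

subsection \<open>Sobolev spaces\<close>

definition is_weak_gradient ::
  "(real ^ 'n) set \<Rightarrow> ((real ^ 'n) \<Rightarrow> real) \<Rightarrow> ((real ^ 'n) \<Rightarrow> real ^ 'n) \<Rightarrow> bool" where
  "is_weak_gradient \<Omega> w G \<longleftrightarrow>
     (\<forall>\<phi>\<in>Cc_infinity \<Omega>. \<forall>i.
        (LINT x|lebesgue_on \<Omega>. w x * frechet_derivative \<phi> (at x) (axis i 1)) =
        - (LINT x|lebesgue_on \<Omega>. (G x $ i) * \<phi> x))"

definition H1 :: "(real ^ 'n) set \<Rightarrow> ((real ^ 'n) \<Rightarrow> real) set" where
  "H1 \<Omega> = {w \<in> Lspace 2 (lebesgue_on \<Omega>).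
             \<exists>G\<in>Lspace 2 (lebesgue_on \<Omega>). is_weak_gradient \<Omega> w G}"

definition weak_gradient :: "(real ^ 'n) set \<Rightarrow> ((real ^ 'n) \<Rightarrow> real) \<Rightarrow> (real ^ 'n) \<Rightarrow> real ^ 'n" where
  "weak_gradient \<Omega> w = (SOME G. G \<in> Lspace 2 (lebesgue_on \<Omega>) \<and> is_weak_gradient \<Omega> w G)"

definition H1_norm :: "(real ^ 'n) set \<Rightarrow> ((real ^ 'n) \<Rightarrow> real) \<Rightarrow> real" where
  "H1_norm \<Omega> w =
     sqrt ((LINT x|lebesgue_on \<Omega>. (w x)\<^sup>2) + (LINT x|lebesgue_on \<Omega>. (norm (weak_gradient \<Omega> w x))\<^sup>2))"

definition H10 :: "(real ^ 'n) set \<Rightarrow> ((real ^ 'n) \<Rightarrow> real) set" where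
  "H10 \<Omega> = {w \<in> H1 \<Omega>. \<exists>\<psi>. (\<forall>j::nat. \<psi> j \<in> Cc_infinity \<Omega>) \<and>
                          (\<lambda>j. H1_norm \<Omega> (\<lambda>x. w x - \<psi> j x)) \<longlonglongrightarrow> 0}"

definition L2H10 :: "(real ^ 'n) set \<Rightarrow> real \<Rightarrow> ((real ^ 'n) \<Rightarrow> real \<Rightarrow> real) set" where
  "L2H10 \<Omega> T = Lspace_time 2 \<Omega> T (H10 \<Omega>) (H1_norm \<Omega>)"

text \<open>The dual \<open>H\<^sup>-\<^sup>1(\<Omega>)\<close>; only the values of a functional on \<open>H\<^sub>0\<^sup>1(\<Omega>)\<close> matter.\<close>

definition Hneg1 :: "(real ^ 'n) set \<Rightarrow> (((real ^ 'n) \<Rightarrow> real) \<Rightarrow> real) set" where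
  "Hneg1 \<Omega> =
     {F. (\<forall>w1\<in>H10 \<Omega>. \<forall>w2\<in>H10 \<Omega>. \<forall>a b. F (\<lambda>x. a * w1 x + b * w2 x) = a * F w1 + b * F w2) \<and>
         (\<exists>C. \<forall>w\<in>H10 \<Omega>. \<bar>F w\<bar> \<le> C * H1_norm \<Omega> w)}"

definition Hneg1_norm :: "(real ^ 'n) set \<Rightarrow> (((real ^ 'n) \<Rightarrow> real) \<Rightarrow> real) \<Rightarrow> real" where
  "Hneg1_norm \<Omega> F = (SUP w\<in>{w \<in> H10 \<Omega>. H1_norm \<Omega> w \<le> 1}. \<bar>F w\<bar>)"

text \<open>The second conjunct is strong (Bochner) measurability.\<close>

definition L2Hneg1 ::
  "(real ^ 'n) set \<Rightarrow> real \<Rightarrow> (real \<Rightarrow> ((real ^ 'n) \<Rightarrow> real) \<Rightarrow> real) set" where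
  "L2Hneg1 \<Omega> T =
     {F. (AE t in lebesgue_on {0<..<T}. F t \<in> Hneg1 \<Omega>) \<and>
         (\<exists>\<sigma>. (\<forall>j::nat. simple_function (lebesgue_on {0<..<T}) (\<sigma> j) \<and>
                         (\<forall>t\<in>{0<..<T}. \<sigma> j t \<in> Hneg1 \<Omega>)) \<and>
              (AE t in lebesgue_on {0<..<T}.
                 (\<lambda>j. Hneg1_norm \<Omega> (\<lambda>w. F t w - \<sigma> j t w)) \<longlonglongrightarrow> 0)) \<and>
         (\<lambda>t. Hneg1_norm \<Omega> (F t)) \<in> Lspace 2 (lebesgue_on {0<..<T})}"

definition is_weak_time_deriv ::
  "(real ^ 'n) set \<Rightarrow> real \<Rightarrow> ((real ^ 'n) \<Rightarrow> real \<Rightarrow> real) \<Rightarrow>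
     (real \<Rightarrow> ((real ^ 'n) \<Rightarrow> real) \<Rightarrow> real) \<Rightarrow> bool" where
  "is_weak_time_deriv \<Omega> T v F \<longleftrightarrow>
     (\<forall>w\<in>H10 \<Omega>. \<forall>\<psi>\<in>Cc_infinity {0<..<T}.
        (LINT t|lebesgue_on {0<..<T}. F t w * \<psi> t) =
        - (LINT t|lebesgue_on {0<..<T}. (LINT x|lebesgue_on \<Omega>. v x t * w x) * deriv \<psi> t))"

subsection \<open>Energy solutions\<close>

definition zero_ext ::
  "(real ^ 'n) set \<Rightarrow> ((real ^ 'n) \<Rightarrow> real \<Rightarrow> real) \<Rightarrow> (real ^ 'n) \<Rightarrow> real \<Rightarrow> real" where
  "zero_ext \<Omega> \<phi> x t = (if x \<in> \<Omega> then \<phi> x t else 0)"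

text \<open>
  Test functions live on \<open>\<Omega>\<close>, hence their extension by zero in the nonlocal term. At \<open>x = y\<close>
  the integrand is \<open>0 / 0 = 0\<close>.
\<close>

definition energy_solution ::
  "(real ^ 'n) set \<Rightarrow> real \<Rightarrow> real \<Rightarrow> ((real ^ 'n) \<Rightarrow> real \<Rightarrow> real) \<Rightarrow> ((real ^ 'n) \<Rightarrow> real) \<Rightarrow>
     ((real ^ 'n) \<Rightarrow> real \<Rightarrow> real) \<Rightarrow> bool" where
  "energy_solution \<Omega> T s g v0 v \<longleftrightarrow>
     (\<lambda>(x, t). g x t) \<in> Lspace 2 (cylinder \<Omega> T) \<and> v0 \<in> Lspace 2 (lebesgue_on \<Omega>) \<and>
     v \<in> L2H10 \<Omega> T \<and> cont_L2 \<Omega> T v \<and>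
     (AE (x, t) in cylinder (- \<Omega>) T. v x t = 0) \<and>
     ((\<lambda>t. Lnorm 2 (lebesgue_on \<Omega>) (\<lambda>x. v x t - v0 x)) \<longlongrightarrow> 0) (at_right 0) \<and>
     (\<exists>v\<^sub>t\<in>L2Hneg1 \<Omega> T. is_weak_time_deriv \<Omega> T v v\<^sub>t \<and>
        (\<forall>\<phi>\<in>L2H10 \<Omega> T.
           (LINT t|lebesgue_on {0<..<T}. v\<^sub>t t (\<lambda>x. \<phi> x t))
           + (LINT t|lebesgue_on {0<..<T}. LINT x|lebesgue_on \<Omega>.
                weak_gradient \<Omega> (\<lambda>x. v x t) x \<bullet> weak_gradient \<Omega> (\<lambda>x. \<phi> x t) x)
           + 1 / 2 * (LINT t|lebesgue_on {0<..<T}. LINT y|lebesgue. LINT x|lebesgue.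
                (v x t - v y t) * (zero_ext \<Omega> \<phi> x t - zero_ext \<Omega> \<phi> y t)
                / norm (x - y) powr (real CARD('n) + 2 * s))
           = (LINT t|lebesgue_on {0<..<T}. LINT x|lebesgue_on \<Omega>. g x t * \<phi> x t)))"

definition trunc :: "real \<Rightarrow> real \<Rightarrow> real" where
  "trunc k \<sigma> = max (- k) (min k \<sigma>)"

end

theory Submission
  imports Defs
begin

text \<open>
  All solutions are replaced by Borel representatives that vanish outside the domain; membership in
  the Sobolev space becomes approximability by test functions in a norm on the whole space, and
  difference quotients give the Sobolev inequality in its weak form. Testing with a time-independent
  function on a short interval and averaging replaces Steklov regularisation and yields an energy
  inequality for smooth truncations. Applied to the truncation above level \<open>k\<close> it gives a
  Stampacchia recursion, because the singular right-hand side is at most \<open>f\<close> where the solution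
  exceeds one; the condition on the exponents makes the recursion superlinear. Comparison makes the
  sequence monotone, and testing with the solution itself bounds its gradient when the exponent of
  the singularity is at most one.
\<close>

text \<open>The time derivative is only a functional, so no chain rule in time is at hand for
  nonlinear functions of the solution. Convexity supplies a one-sided version: for a primitive
  \<open>Ph\<close> of a nondecreasing \<open>gf\<close>,
  \<open>Ph b - Ph a <= gf b * (b - a)\<close>. The increment over \<open>{a<..b}\<close> is thus
  tested with the truncation frozen at b, at the price of the energy of its difference to the
  truncation at intermediate times. Continuity in time holds in L2 only, so gradients at different
  times are compared through difference quotients of a fixed scale, whose error has a small time
  integral but no pointwise bound; hence the averaging over b. The truncations come from exp(-1/x):
  smooth, bounded by 1 and of slope in [0,1], so that composition preserves test functions and does
  not raise energies. A Sobolev inequality for level sets suffices, since the recursion sees the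
  solution only through its level sets. With \<open>sg\<close> = 1 - 1/r and \<open>dl\<close> = 1 -
  1/q - (1 - 2/n) \<open>sg\<close>, the condition 1/r + n/(2q) < 1 says precisely that
  \<open>dl + sg > 1\<close>.\<close>

abbreviation "bmb \<equiv> borel_measurable borel"
abbreviation "frd \<equiv> frechet_derivative"
abbreviation "Cci \<equiv> Cc_infinity"
abbreviation chf :: "'a set => 'a => real" where "chf \<equiv> indicator"

section \<open>Smooth functions and the algebra of their derivatives\<close>

definition smooth :: "('a::euclidean_space => real) => bool" where
 "smooth f \<longleftrightarrow> (\<forall>bs x. iter_deriv bs f differentiable (at x))"

lemma iter_deriv_append: "iter_deriv (xs @ ys) f = iter_deriv xs (iter_deriv ys f)"
 by (induction xs) auto

text \<open>Coinduction: iterated derivatives never leave an invariant class, so higher derivatives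
  need no formula.\<close>

lemma smooth_coinduct:
 assumes "P f"
  and step: "!!f. P f ==> (\<forall>x. f differentiable (at x)) & (\<forall>b. P (%x. frd f (at x) b))"
 shows "smooth f"
proof -
 have "P (iter_deriv bs f)" for bs by (induction bs) (use assms(1) step in auto)
 then show ?thesis unfolding smooth_def using step by blast
qed

lemma smooth_differentiable: "smooth f ==> f differentiable (at x)"
 unfolding smooth_def by (metis iter_deriv.simps(1))

lemma smooth_frechet_derivative:
 assumes "smooth f" shows "smooth (%x. frd f (at x) b)" unfolding smooth_def
proof (intro allI)
 fix bs x
 have "iter_deriv bs (%x. frd f (at x) b) = iter_deriv (bs @ [b]) f" by (simp add: iter_deriv_append)
 then show "iter_deriv bs (%x. frd f (at x) b) differentiable (at x)" using assms by (simp only: smooth_def)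
qed

lemma smooth_has_derivative: "smooth f ==> (f has_derivative frd f (at x)) (at x)"
 using frechet_derivative_works smooth_differentiable by blast

lemma smooth_continuous_on: "smooth f ==> continuous_on A f"
 using smooth_differentiable differentiable_imp_continuous_within by (metis continuous_at_imp_continuous_on)

text \<open>Differentiating a composition or a reciprocal leaves the family one started with, but
  only by sums and products. The coinduction is therefore run with the generated algebra as its
  invariant.\<close>

inductive_set alg_hull :: "('a::euclidean_space => real) set => ('a => real) set" for S where
 base: "f : S ==> f : alg_hull S"
| const: "(%x. c) : alg_hull S"
| add: "f : alg_hull S ==> g : alg_hull S ==> (%x. f x + g x) : alg_hull S"
| mult: "f : alg_hull S ==> g : alg_hull S ==> (%x. f x * g x) : alg_hull S"

lemma alg_hull_smooth:
 assumes S: "!!f. f : S ==> (\<forall>x. f differentiable (at x)) & (\<forall>b. (%x. frd f (at x) b) : alg_hull S)"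
  and "f : alg_hull S"
 shows "smooth f"
proof (rule smooth_coinduct[of "%f. f : alg_hull S"])
 fix f assume "f : alg_hull S"
 then show "(\<forall>x. f differentiable (at x)) & (\<forall>b. (%x. frd f (at x) b) : alg_hull S)"
 proof (induction)
  case (base f)
  then show ?case using S by blast
 next
  case (const c)
  then show ?case by (auto simp: alg_hull.const)
 next
  case (add f g)
  have "frd (%x. f x + g x) (at x) b
    = frd f (at x) b + frd g (at x) b" for x b
  proof -
   have "((%x. f x + g x) has_derivative
     (%h. frd f (at x) h + frd g (at x) h)) (at x)" by (intro has_derivative_add) (use add.IH frechet_derivative_works in blast)+
   from frechet_derivative_at[OF this] show ?thesis by metis
  qed
  moreover have "(%x. frd f (at x) b + frd g (at x) b) : alg_hull S" for b using add.IH by (intro alg_hull.add) auto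
  ultimately show ?case using add.IH by auto
 next
  case (mult f g)
  have "frd (%x. f x * g x) (at x) b
    = f x * frd g (at x) b + frd f (at x) b * g x" for x b
  proof -
   have "((%x. f x * g x) has_derivative
     (%h. f x * frd g (at x) h + frd f (at x) h * g x)) (at x)" by (intro has_derivative_mult) (use mult.IH frechet_derivative_works in blast)+
   from frechet_derivative_at[OF this] show ?thesis by metis
  qed
  moreover have "(%x. f x * frd g (at x) b + frd f (at x) b * g x) : alg_hull S" for b using mult by (intro alg_hull.add alg_hull.mult) auto
  ultimately show ?case using mult.IH by auto
 qed
qed fact

lemma smooth_alg_hull_Collect: "f : alg_hull (Collect smooth) ==> smooth f"
proof (erule alg_hull_smooth[rotated], intro conjI allI)
 fix f :: "'a => real" and b x assume "f : Collect smooth"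
 then show "f differentiable (at x)" "(%x. frd f (at x) b) : alg_hull (Collect smooth)"
  by (simp_all add: smooth_differentiable smooth_frechet_derivative alg_hull.base)
qed

lemma smooth_const: "smooth (%x. c)"
 by (rule smooth_alg_hull_Collect) (rule alg_hull.const)

lemma smooth_add: "smooth f ==> smooth g ==> smooth (%x. f x + g x)"
 by (intro smooth_alg_hull_Collect alg_hull.add alg_hull.base) auto

lemma smooth_mult: "smooth f ==> smooth g ==> smooth (%x. f x * g x)"
 by (intro smooth_alg_hull_Collect alg_hull.mult alg_hull.base) auto

lemma smooth_cmult: "smooth f ==> smooth (%x. c * f x)"
 by (intro smooth_mult smooth_const)

lemma smooth_diff: "smooth f ==> smooth g ==> smooth (%x. f x - g x)"
 using smooth_add[of f "%x. (-1) * g x"] smooth_cmult[of g "-1"] by simp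

lemma smooth_prod: "(!!i. i : I ==> smooth (f i)) ==> smooth (%x. \<Prod>i\<in>I. f i x)"
 by (induction I rule: infinite_finite_induct) (auto intro: smooth_const smooth_mult)

lemma smooth_inner: "smooth (%x. x \<bullet> a)"
proof -
 have d: "((%x. x \<bullet> a) has_derivative (%h. h \<bullet> a)) (at x)" for x by (auto intro!: derivative_eq_intros)
 have "(%x. frd (%x. x \<bullet> a) (at x) b) = (%x. b \<bullet> a)" for b using frechet_derivative_at[OF d] by metis
 then show ?thesis using d by (intro alg_hull_smooth[of "{%x. x \<bullet> a}"])
   (auto intro!: alg_hull.const alg_hull.base simp: differentiable_def)
qed

text \<open>By the chain rule a derivative of g(f) is g'(f) times a derivative of f. The
  compositions of f with all smooth functions, joined with all smooth functions, are thus closed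
  under differentiation up to the generated algebra.\<close>

lemma smooth_compose:
 fixes g :: "real => real"
 assumes g: "smooth g" and f: "smooth f"
 shows "smooth (%x. g (f x))"
proof -
 define S where "S = {%x. g (f x) |g. smooth g} \<union> Collect smooth"
 show ?thesis
 proof (rule alg_hull_smooth[of S])
  show "(%x. g (f x)) : alg_hull S" using g by (auto simp: S_def intro!: alg_hull.base)
  fix k assume "k : S"
  then consider g where "k = (%x. g (f x))" "smooth g" | "smooth k" by (auto simp: S_def)
  then show "(\<forall>x. k differentiable (at x)) & (\<forall>b. (%x. frd k (at x) b) : alg_hull S)"
  proof cases
   case (1 g)
   have d: "((%x. g (f x)) has_derivative (%h. frd g (at (f x)) (frd f (at x) h))) (at x)" for x
    by (rule has_derivative_compose[OF smooth_has_derivative[OF f] smooth_has_derivative[OF 1(2)]])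
   have "frd (%x. g (f x)) (at x) b = frd g (at (f x)) 1 * frd f (at x) b" for x b
   proof -
    have "frd g (at (f x)) y = frd g (at (f x)) 1 * y" for y using linear_scale[OF has_derivative_linear[OF smooth_has_derivative[OF 1(2), of "f x"]], of y 1]
     by simp
    then show ?thesis using frechet_derivative_at[OF d] by metis
   qed
   moreover have "(%x. frd g (at (f x)) 1 * frd f (at x) b) : alg_hull S" for b
    using smooth_frechet_derivative[OF 1(2), of 1] smooth_frechet_derivative[OF f, of b] by (intro alg_hull.mult alg_hull.base) (auto simp: S_def)
   moreover have "(%x. g (f x)) differentiable (at x)" for x using d differentiable_def by blast
   ultimately show ?thesis using 1(1) by auto
  next
   case 2
   then show ?thesis by (auto simp: S_def intro!: alg_hull.base smooth_frechet_derivative smooth_differentiable)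
  qed
 qed
qed

lemma smooth_inverse:
 assumes g: "smooth g" and nz: "!!x. g x ~= 0"
 shows "smooth (%x. 1 / g x)"
proof (rule alg_hull_smooth[of "{%x. 1 / g x} \<union> Collect smooth"])
 fix k assume "k : {%x. 1 / g x} \<union> Collect smooth"
 then consider "k = (%x. 1 / g x)" | "smooth k" by auto
 then show "(\<forall>x. k differentiable (at x)) & (\<forall>b. (%x. frd k (at x) b) : alg_hull ({%x. 1 / g x} \<union> Collect smooth))"
 proof cases
  case 1
  have d: "((%x. 1 / g x) has_derivative (%h. (1 / g x) * ((1 / g x) * (-1 * frd g (at x) h)))) (at x)" for x
   using nz by (auto intro!: derivative_eq_intros smooth_has_derivative g simp: field_simps)
  have "(%x. frd (%x. 1 / g x) (at x) b) =
   (%x. (1 / g x) * ((1 / g x) * (-1 * frd g (at x) b)))" for b using frechet_derivative_at[OF d] by metis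
  moreover have "(%x. (1 / g x) * ((1 / g x) * (-1 * frd g (at x) b))) : alg_hull ({%x. 1 / g x} \<union> Collect smooth)" for b
   using smooth_frechet_derivative[OF g] by (intro alg_hull.mult alg_hull.base) (auto intro: smooth_const)
  ultimately show ?thesis using 1 d by (auto simp: differentiable_def)
 next
  case 2
  then show ?thesis by (auto intro!: alg_hull.base smooth_frechet_derivative smooth_differentiable)
 qed
qed (auto intro: alg_hull.base)

section \<open>The flat function exp(-1/x) and a smooth step\<close>

definition eta :: "real => real" where
 "eta x = (if x > 0 then exp (- (1 / x)) else 0)"

lemma poly_over_exp_tendsto_0: "((%x::real. poly p x * exp (- x)) \<longlongrightarrow> 0) at_top"
proof (induction p)
 case 0
 then show ?case by simp
next
 case (pCons a p)
 have "((%x::real. poly q x * exp (- x)) \<longlongrightarrow> 0) at_top" for q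
 proof -
  have "((%x::real. \<Sum>i\<le>degree q. coeff q i * (x ^ i / exp x)) \<longlongrightarrow> (\<Sum>i\<le>degree q. coeff q i * 0)) at_top"
   by (intro tendsto_sum tendsto_mult tendsto_const tendsto_power_div_exp_0)
  then show ?thesis by (simp add: poly_altdef sum_divide_distrib exp_minus divide_inverse sum_distrib_right mult.assoc)
 qed
 then show ?case .
qed

text \<open>The functions p(1/x) exp(-1/x), extended by 0, are closed under differentiation: the new
  polynomial is (p - p') X^2, the factor X^2 coming from the derivative of 1/x. At 0 the difference
  quotient has the same form with p X in place of p, and the exponential beats any
  polynomial.\<close>

lemma eta_family_deriv:
 fixes p :: "real poly"
 defines "F \<equiv> %p x. if x > 0 then poly p (1 / x) * exp (- (1 / x)) else 0"
 shows "(F p has_real_derivative F ((p - pderiv p) * [:0, 0, 1:]) x) (at x)"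
proof -
 consider "x > 0" | "x < 0" | "x = 0" by linarith
 then show ?thesis
 proof cases
  case 1
  have "((%x. poly p (1 / x) * exp (- (1 / x))) has_real_derivative F ((p - pderiv p) * [:0, 0, 1:]) x) (at x)" using 1 unfolding F_def
   by (auto intro!: derivative_eq_intros DERIV_chain2[OF poly_DERIV] simp: field_simps power2_eq_square)
  moreover have "eventually (%x. F p x = poly p (1 / x) * exp (- (1 / x))) (nhds x)"
   using eventually_nhds_in_open[of "{0<..}" x] 1 by (auto simp: F_def elim!: eventually_mono)
  ultimately show ?thesis by (subst DERIV_cong_ev[OF refl _ refl])
 next
  case 2
  have "eventually (%x. F p x = 0) (nhds x)" using eventually_nhds_in_open[of "{..<0}" x] 2 by (auto simp: F_def elim!: eventually_mono)
  moreover have "F ((p - pderiv p) * [:0, 0, 1:]) x = 0" using 2 by (simp add: F_def)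
  ultimately show ?thesis by (subst DERIV_cong_ev[of x x _ "%_. 0"]) auto
 next
  case 3
  have "((%h. F p h / h) \<longlongrightarrow> 0) (at 0)"
  proof (rule filterlim_split_at)
   have "eventually (%h. 0 = F p h / h) (at_left (0::real))" by (auto simp: F_def eventually_at_filter)
   then show "((%h. F p h / h) \<longlongrightarrow> 0) (at_left 0)" by (rule Lim_transform_eventually[OF tendsto_const])
   have "((%h::real. poly (p * [:0,1:]) (inverse h) * exp (- inverse h)) \<longlongrightarrow> 0) (at_right 0)"
    by (rule filterlim_compose[OF poly_over_exp_tendsto_0 filterlim_inverse_at_top_right])
   moreover have "eventually (%h. poly (p * [:0,1:]) (inverse h) * exp (- inverse h) = F p h / h) (at_right (0::real))"
    unfolding eventually_at_right_field F_def by (intro exI[of _ 1]) (auto simp: field_simps)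
   ultimately show "((%h. F p h / h) \<longlongrightarrow> 0) (at_right 0)" by (rule Lim_transform_eventually)
  qed
  then have "(F p has_real_derivative 0) (at 0)" by (auto simp: has_field_derivative_iff F_def)
  then show ?thesis using 3 by (simp add: F_def)
 qed
qed

lemma eta_smooth: "smooth eta"
proof -
 define F :: "real poly => real => real" where "F = (%p x. if x > 0 then poly p (1 / x) * exp (- (1 / x)) else 0)"
 have d: "(F p has_real_derivative F ((p - pderiv p) * [:0, 0, 1:]) x) (at x)" for p x unfolding F_def by (rule eta_family_deriv)
 have "smooth (F 1)"
 proof (rule alg_hull_smooth[of "range F"])
  fix f assume "f : range F"
  then obtain p where p: "f = F p" by auto
  have "(%x. frd f (at x) b) = (%x. F ((p - pderiv p) * [:0, 0, 1:]) x * b)" for b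
   unfolding p using frechet_derivative_at[OF d[unfolded has_field_derivative_def]] by metis
  moreover have "(%x. F ((p - pderiv p) * [:0, 0, 1:]) x * b) : alg_hull (range F)" for b by (intro alg_hull.mult alg_hull.const alg_hull.base) auto
  moreover have "f differentiable (at x)" for x unfolding p using d real_differentiable_def by blast
  ultimately show "(\<forall>x. f differentiable (at x)) & (\<forall>b. (%x. frd f (at x) b) : alg_hull (range F))" by auto
 qed (auto intro: alg_hull.base)
 moreover have "F 1 = eta" by (auto simp: F_def eta_def)
 ultimately show ?thesis by simp
qed

lemma eta_nonneg: "0 <= eta x" and eta_le_1: "eta x <= 1" and eta_pos_iff: "0 < eta x \<longleftrightarrow> 0 < x"
 and eta_nonpos: "x <= 0 ==> eta x = 0" by (auto simp: eta_def)

lemma eta_mono: "x <= y ==> eta x <= eta y"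
 by (auto simp: eta_def frac_le)

text \<open>For x > 0 the derivative is y^2 exp(-y) with y = 1/x, and it is at most 1 because y <= 1
  + y/2 + (y/2)^2/2 <= exp(y/2). A slope in [0,1] is what a truncation needs in order not to raise
  energies.\<close>

lemma eta_deriv_bounds: "\<exists>d. (eta has_real_derivative d) (at x) & 0 <= d & d <= 1"
proof -
 define F :: "real poly => real => real" where "F = (%p x. if x > 0 then poly p (1 / x) * exp (- (1 / x)) else 0)"
 have "(F 1 has_real_derivative F ((1 - pderiv 1) * [:0, 0, 1:]) x) (at x)" unfolding F_def by (rule eta_family_deriv)
 moreover have "F 1 = eta" by (auto simp: F_def eta_def)
 moreover have "F ((1 - pderiv 1) * [:0, 0, 1:]) x = (if x > 0 then (1/x)^2 * exp (- (1 / x)) else 0)" by (simp add: F_def power2_eq_square pderiv_1)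
 moreover have "y^2 * exp (- y) <= 1" if "y > 0" for y :: real
 proof -
  have "y <= 1 + y/2 + (y/2)^2/2" using sum_squares_ge_zero[of "y/4 - 1" 0] zero_le_power2[of "y - 2"] by (simp add: power2_eq_square field_simps)
  also have "\<dots> <= exp (y/2)" using exp_lower_Taylor_quadratic[of "y/2"] that by simp
  finally have "y^2 <= exp (y/2) ^ 2" using that by (intro power_mono) auto
  also have "\<dots> = exp y" by (simp flip: exp_double)
  finally show ?thesis by (simp add: exp_minus field_simps)
 qed
 ultimately show ?thesis by (intro exI[of _ "F ((1 - pderiv 1) * [:0, 0, 1:]) x"]) auto
qed

lemma mono_lip_of_deriv:
 fixes g :: "real => real"
 assumes "!!x. \<exists>d. (g has_real_derivative d) (at x) & 0 <= d & d <= 1" and "x <= y"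
 shows "0 <= g y - g x & g y - g x <= y - x"
proof -
 have "g x <= g y" by (rule DERIV_nonneg_imp_nondecreasing[OF assms(2)]) (use assms(1) in blast)
 moreover have "x - g x <= y - g y"
 proof (rule DERIV_nonneg_imp_nondecreasing[OF assms(2)])
  fix z
  obtain d where "(g has_real_derivative d) (at z)" "d <= 1" using assms(1) by blast
  then show "\<exists>y. ((%x. x - g x) has_real_derivative y) (at z) & 0 <= y" by (intro exI[of _ "1 - d"]) (auto intro!: derivative_eq_intros)
 qed
 ultimately show ?thesis by linarith
qed

text \<open>The denominator never vanishes since x or 1 - x is positive. The step serves to
  approximate indicators of time intervals.\<close>

definition smooth_step :: "real => real" where
 "smooth_step x = eta x * (1 / (eta x + eta (1 - x)))"

lemma smooth_step_smooth: "smooth smooth_step"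
proof -
 have "smooth (%x. eta (1 - x))" using smooth_diff[OF smooth_const[of 1] smooth_inner[of "1::real"]]
  by (intro smooth_compose[OF eta_smooth, of "%x. 1 - x"]) simp
 moreover have "eta x + eta (1 - x) ~= 0" for x using eta_pos_iff[of x] eta_pos_iff[of "1-x"] eta_nonneg[of x] eta_nonneg[of "1-x"] by linarith
 ultimately show ?thesis unfolding smooth_step_def[abs_def] by (rule smooth_mult[OF eta_smooth smooth_inverse[OF smooth_add[OF eta_smooth]]])
qed

lemma smooth_step_0: "x <= 0 ==> smooth_step x = 0"
 by (simp add: smooth_step_def eta_nonpos)

lemma smooth_step_1: "x >= 1 ==> smooth_step x = 1"
 using eta_pos_iff[of x] by (simp add: smooth_step_def eta_nonpos)

lemma smooth_step_bounds: "0 <= smooth_step x" "smooth_step x <= 1"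
 using eta_nonneg[of x] eta_nonneg[of "1-x"] by (auto simp: smooth_step_def divide_le_eq_1)

section \<open>Test functions\<close>

lemma Cc_infinity_iff:
 "ph : Cci S \<longleftrightarrow> smooth ph & compact (closure {x. ph x ~= 0}) & closure {x. ph x ~= 0} \<subseteq> S"
 by (simp add: Cc_infinity_def smooth_def)

lemma Cc_infinityI:
 assumes "smooth ph" "compact K" "K \<subseteq> S" "!!x. x \<notin> K ==> ph x = 0"
 shows "ph : Cci S"
proof -
 have "closure {x. ph x ~= 0} \<subseteq> K" by (rule closure_minimal) (use assms compact_imp_closed in auto)
 moreover from this have "compact (closure {x. ph x ~= 0})" by (meson assms(2) bounded_subset closed_closure compact_eq_bounded_closed)
 ultimately show ?thesis using assms by (auto simp: Cc_infinity_iff)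
qed

lemma Cc_infinityE:
 assumes "ph : Cci S"
 obtains K where "smooth ph" "compact K" "K \<subseteq> S" "\<forall>x. x \<notin> K --> ph x = 0"
proof (rule that[of "closure {x. ph x ~= 0}"])
 show "\<forall>x. x \<notin> closure {x. ph x ~= 0} --> ph x = 0" using closure_subset[of "{x. ph x ~= 0}"] by blast
qed (use assms Cc_infinity_iff in auto)

lemma Cc_infinity_lincomb:
 assumes "f : Cci S" "g : Cci S"
 shows "(%x. a * f x + b * g x) : Cci S"
proof -
 obtain K where K: "smooth f" "compact K" "K \<subseteq> S" "\<forall>x. x \<notin> K --> f x = 0" by (rule Cc_infinityE[OF assms(1)])
 obtain L where L: "smooth g" "compact L" "L \<subseteq> S" "\<forall>x. x \<notin> L --> g x = 0" by (rule Cc_infinityE[OF assms(2)])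
 show ?thesis
 proof (rule Cc_infinityI[of _ "K \<union> L"])
  show "smooth (%x. a * f x + b * g x)" by (rule smooth_add[OF smooth_cmult[OF K(1)] smooth_cmult[OF L(1)]])
  show "compact (K \<union> L)" using K(2) L(2) by (rule compact_Un)
  show "K \<union> L \<subseteq> S" using K(3) L(3) by blast
  show "a * f x + b * g x = 0" if "x \<notin> K \<union> L" for x using that K(4) L(4) by simp
 qed
qed

lemma Cc_infinity_compose:
 fixes g :: "real => real"
 assumes "f : Cci S" "smooth g" "g 0 = 0"
 shows "(%x. g (f x)) : Cci S"
proof -
 obtain K where K: "smooth f" "compact K" "K \<subseteq> S" "\<forall>x. x \<notin> K --> f x = 0" by (rule Cc_infinityE[OF assms(1)])
 show ?thesis
 proof (rule Cc_infinityI[of _ K])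
  show "smooth (%x. g (f x))" by (rule smooth_compose[OF assms(2) K(1)])
  show "g (f x) = 0" if "x \<notin> K" for x using that K(4) assms(3) by simp
 qed (rule K(2), rule K(3))
qed

lemma Cc_infinity_zero: "(%x. 0) : Cci S"
 by (rule Cc_infinityI[of _ "{}"]) (auto intro: smooth_const)

lemma Cc_infinity_frechet_derivative:
 assumes "f : Cci S"
 shows "(%x. frd f (at x) b) : Cci S"
proof -
 obtain K where K: "smooth f" "compact K" "K \<subseteq> S" "\<forall>x. x \<notin> K --> f x = 0" by (rule Cc_infinityE[OF assms(1)])
 have "frd f (at x) b = 0" if "x \<notin> K" for x
 proof -
  have "(f has_derivative (%_. 0)) (at x)"
  proof (rule has_derivative_transform_within_open[of "%_. 0" _ _ _ "- K"])
   show "open (- K)" using K(2) compact_imp_closed by blast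
  qed (use that K in auto)
  from frechet_derivative_at[OF this] show ?thesis by metis
 qed
 then show ?thesis by (rule Cc_infinityI[OF smooth_frechet_derivative[OF K(1)] K(2) K(3)])
qed

text \<open>As m grows, a factor exp(-1/(m c)) with c > 0 tends to 1. Indicators of open boxes are
  thus pointwise limits of test functions supported in one fixed closed box, which takes the place
  of mollification.\<close>

definition box_bump :: "'a::euclidean_space => 'a => nat => 'a => real" where
 "box_bump a b m x = (\<Prod>i\<in>Basis. eta (real m * ((x \<bullet> i - a \<bullet> i) * (b \<bullet> i - x \<bullet> i))))"

lemma box_bump_Cc_infinity:
 assumes "cbox a b \<subseteq> S" "!!i. i : Basis ==> a \<bullet> i <= b \<bullet> i"
 shows "box_bump a b m : Cci S"
proof (rule Cc_infinityI[of _ "cbox a b"])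
 show "smooth (box_bump a b m)" unfolding box_bump_def[abs_def]
  by (intro smooth_prod smooth_compose[OF eta_smooth] smooth_mult smooth_diff smooth_const smooth_inner)
 fix x assume "x \<notin> cbox a b"
 then obtain i where i: "i : Basis" "\<not> (a \<bullet> i <= x \<bullet> i & x \<bullet> i <= b \<bullet> i)" by (auto simp: mem_box)
 then have "(x \<bullet> i - a \<bullet> i) * (b \<bullet> i - x \<bullet> i) <= 0" using assms(2)[OF i(1)] by (auto simp: mult_le_0_iff)
 then have "eta (real m * ((x \<bullet> i - a \<bullet> i) * (b \<bullet> i - x \<bullet> i))) = 0" by (intro eta_nonpos) (simp add: mult_nonneg_nonpos)
 then show "box_bump a b m x = 0" unfolding box_bump_def using i(1) by (intro prod_zero) auto
qed (use assms in auto)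

lemma box_bump_bounds: "0 <= box_bump a b m x" "box_bump a b m x <= 1"
 by (auto simp: box_bump_def eta_nonneg eta_le_1 intro!: prod_nonneg prod_le_1)

lemma box_bump_tendsto:
 assumes "!!i. i : Basis ==> a \<bullet> i <= b \<bullet> i"
 shows "(%m. box_bump a b m x) \<longlonglongrightarrow> indicator (box a b) x"
proof (cases "x : box a b")
 case True
 have "(%m. eta (real m * c)) \<longlonglongrightarrow> 1" if "c > 0" for c
 proof -
  have "(%m. exp (- (inverse c * (1 / real m)))) \<longlonglongrightarrow> exp (- (inverse c * 0))" by (intro tendsto_intros lim_1_over_n)
  moreover have "eventually (%m. exp (- (inverse c * (1 / real m))) = eta (real m * c)) sequentially"
   using that by (intro eventually_sequentiallyI[of 1]) (auto simp: eta_def field_simps)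
  ultimately show ?thesis using Lim_transform_eventually by fastforce
 qed
 then have "(%m. box_bump a b m x) \<longlonglongrightarrow> (\<Prod>i\<in>(Basis::'a set). 1)"
  unfolding box_bump_def using True by (intro tendsto_prod) (auto simp: mem_box)
 then show ?thesis using True by simp
next
 case False
 then obtain i where i: "i : Basis" "\<not> (a \<bullet> i < x \<bullet> i & x \<bullet> i < b \<bullet> i)" by (auto simp: mem_box)
 then have "(x \<bullet> i - a \<bullet> i) * (b \<bullet> i - x \<bullet> i) <= 0" using assms[OF i(1)] by (auto simp: mult_le_0_iff)
 then have "box_bump a b m x = 0" for m unfolding box_bump_def using i(1) by (intro prod_zero bexI[of _ i] eta_nonpos) (auto simp: mult_nonneg_nonpos)
 then show ?thesis using False by simp
qed

section \<open>Square-integrable functions: inner product, squared norm, completeness\<close>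

definition L2 :: "'a measure => ('a => real) => bool" where
 "L2 M f \<longleftrightarrow> f : borel_measurable M & integrable M (%x. (f x)\<^sup>2)"

definition ip :: "'a measure => ('a => real) => ('a => real) => real" where
 "ip M f g = (LINT x|M. f x * g x)"

definition sqn :: "'a measure => ('a => real) => real" where
 "sqn M f = (LINT x|M. (f x)\<^sup>2)"

abbreviation "nsq \<equiv> sqn lborel"
abbreviation "ipl \<equiv> ip lborel"
abbreviation "L2l \<equiv> L2 lborel"

lemma L2_measurable: "L2 M f ==> f : borel_measurable M"
 by (simp add: L2_def)

lemma L2_integrable_sq: "L2 M f ==> integrable M (%x. (f x)\<^sup>2)"
 by (simp add: L2_def)

lemma L2_integrable_mult:
 assumes "L2 M f" "L2 M g"
 shows "integrable M (%x. f x * g x)"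
proof (rule Bochner_Integration.integrable_bound)
 show "integrable M (%x. (f x)\<^sup>2 + (g x)\<^sup>2)" using assms by (simp add: L2_def)
 show "(%x. f x * g x) : borel_measurable M" using assms by (auto simp: L2_def)
 show "AE x in M. norm (f x * g x) <= norm ((f x)\<^sup>2 + (g x)\<^sup>2)"
 proof (rule AE_I2)
  fix x
  have "2 * (\<bar>f x\<bar> * \<bar>g x\<bar>) <= \<bar>f x\<bar>\<^sup>2 + \<bar>g x\<bar>\<^sup>2"
   using sum_squares_bound[of "\<bar>f x\<bar>" "\<bar>g x\<bar>"] by (simp add: mult.assoc)
  moreover have "0 <= \<bar>f x\<bar> * \<bar>g x\<bar>" by simp
  ultimately have "\<bar>f x\<bar> * \<bar>g x\<bar> <= \<bar>f x\<bar>\<^sup>2 + \<bar>g x\<bar>\<^sup>2" by linarith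
  then show "norm (f x * g x) <= norm ((f x)\<^sup>2 + (g x)\<^sup>2)" by (simp add: abs_mult)
 qed
qed

lemma L2_bound:
 assumes "L2 M g" "f : borel_measurable M" "AE x in M. \<bar>f x\<bar> <= \<bar>g x\<bar>"
 shows "L2 M f" unfolding L2_def
proof (intro conjI Bochner_Integration.integrable_bound[OF L2_integrable_sq[OF assms(1)]])
 show "AE x in M. norm ((f x)\<^sup>2) <= norm ((g x)\<^sup>2)"
  using assms(3) by eventually_elim (metis abs_le_square_iff abs_of_nonneg real_norm_def zero_le_power2)
qed (use assms(2) in auto)

lemma L2_lincomb:
 assumes f: "L2 M f" and g: "L2 M g"
 shows "L2 M (%x. a * f x + b * g x)"
proof -
 have "integrable M (%x. a\<^sup>2 * (f x)\<^sup>2 + 2 * a * b * (f x * g x) + b\<^sup>2 * (g x)\<^sup>2)"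
  using L2_integrable_sq[OF f] L2_integrable_sq[OF g] L2_integrable_mult[OF f g] by (intro Bochner_Integration.integrable_add integrable_mult_right) auto
 moreover have "(%x. (a * f x + b * g x)\<^sup>2) = (%x. a\<^sup>2 * (f x)\<^sup>2 + 2 * a * b * (f x * g x) + b\<^sup>2 * (g x)\<^sup>2)"
  by (simp add: power2_eq_square algebra_simps)
 ultimately show ?thesis using f g by (auto simp: L2_def)
qed

lemma L2_diff: "L2 M f ==> L2 M g ==> L2 M (%x. f x - g x)"
 using L2_lincomb[of M f g 1 "-1"] by simp

lemma L2_cmult: "L2 M f ==> L2 M (%x. a * f x)"
 using L2_lincomb[of M f f a 0] by simp

lemma L2_zero: "L2 M (%x. 0)"
 by (simp add: L2_def)

lemma ip_sym: "ip M f g = ip M g f"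
 by (simp add: ip_def mult.commute)

lemma ip_self: "ip M f f = sqn M f"
 by (simp add: ip_def sqn_def power2_eq_square)

lemma ip_lincomb_left:
 assumes "L2 M f" "L2 M g" "L2 M h"
 shows "ip M (%x. a * f x + b * g x) h = a * ip M f h + b * ip M g h"
proof -
 have "ip M (%x. a * f x + b * g x) h = (LINT x|M. a * (f x * h x) + b * (g x * h x))"
  unfolding ip_def by (intro Bochner_Integration.integral_cong) (auto simp: algebra_simps)
 also have "\<dots> = a * ip M f h + b * ip M g h" unfolding ip_def using L2_integrable_mult assms by (subst Bochner_Integration.integral_add) auto
 finally show ?thesis .
qed

lemma ip_lincomb_right:
 assumes "L2 M f" "L2 M g" "L2 M h"
 shows "ip M h (%x. a * f x + b * g x) = a * ip M h f + b * ip M h g" using ip_lincomb_left[OF assms] by (simp add: ip_sym)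

lemma ip_diff_left: "L2 M f ==> L2 M g ==> L2 M h ==> ip M (%x. f x - g x) h = ip M f h - ip M g h"
 using ip_lincomb_left[of M f g h 1 "-1"] by simp

lemma ip_diff_right: "L2 M f ==> L2 M g ==> L2 M h ==> ip M h (%x. f x - g x) = ip M h f - ip M h g"
 using ip_lincomb_right[of M f g h 1 "-1"] by simp

lemma sqn_nonneg: "0 <= sqn M f"
 by (simp add: sqn_def)

lemma sqn_cmult: "sqn M (%x. a * f x) = a\<^sup>2 * sqn M f"
 by (simp add: sqn_def power_mult_distrib)

lemma sqn_lincomb:
 assumes "L2 M f" "L2 M g"
 shows "sqn M (%x. a * f x + b * g x) = a\<^sup>2 * sqn M f + 2 * a * b * ip M f g + b\<^sup>2 * sqn M g"
proof -
 have "sqn M (%x. a * f x + b * g x) = ip M (%x. a * f x + b * g x) (%x. a * f x + b * g x)" by (simp add: ip_self)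
 also have "\<dots> = a * (a * ip M f f + b * ip M f g) + b * (a * ip M g f + b * ip M g g)" using assms L2_lincomb[OF assms]
  by (simp add: ip_lincomb_left ip_lincomb_right)
 also have "\<dots> = a\<^sup>2 * sqn M f + 2 * a * b * ip M f g + b\<^sup>2 * sqn M g" by (simp add: ip_sym[of M g f] ip_self power2_eq_square algebra_simps)
 finally show ?thesis .
qed

lemma sqn_commute: "sqn M (%x. f x - g x) = sqn M (%x. g x - f x)"
 by (simp add: sqn_def power2_commute)

lemma sqn_mono:
 assumes "L2 M g" "f : borel_measurable M" "AE x in M. \<bar>f x\<bar> <= \<bar>g x\<bar>"
 shows "sqn M f <= sqn M g" unfolding sqn_def
proof (rule integral_mono_AE)
 show "AE x in M. (f x)\<^sup>2 <= (g x)\<^sup>2" using assms(3) by eventually_elim (simp add: abs_le_square_iff)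
qed (use assms L2_bound[OF assms] in \<open>auto simp: L2_def\<close>)

text \<open>Shared core of the Cauchy-Schwarz inequalities for the L2 product and for the energy
  forms. Nonnegativity is used at the minimiser -b/c, or, if c = 0, at a t where the affine function
  would take the value -1.\<close>

lemma discriminant_bound:
 fixes a b c :: real
 assumes "!!t. 0 <= a + 2 * t * b + t\<^sup>2 * c" "0 <= c"
 shows "b\<^sup>2 <= a * c"
proof (cases "c = 0")
 case True
 have "b = 0"
 proof (rule ccontr)
  assume "b ~= 0"
  then show False using assms(1)[of "- (a + 1) / (2 * b)"] True by (simp add: field_simps)
 qed
 then show ?thesis using True by simp
next
 case False
 then show ?thesis using assms(1)[of "- b / c"] assms(2) by (simp add: field_simps power2_eq_square)
qed

lemma ip_Cauchy_Schwarz: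
 assumes "L2 M f" "L2 M g"
 shows "(ip M f g)\<^sup>2 <= sqn M f * sqn M g"
proof (rule discriminant_bound)
 fix t
 show "0 <= sqn M f + 2 * t * ip M f g + t\<^sup>2 * sqn M g" using sqn_nonneg[of M "%x. 1 * f x + t * g x"] sqn_lincomb[OF assms, of 1 t] by simp
qed (rule sqn_nonneg)

lemma ip_Cauchy_Schwarz_sqrt:
 assumes "L2 M f" "L2 M g"
 shows "\<bar>ip M f g\<bar> <= sqrt (sqn M f) * sqrt (sqn M g)" using real_sqrt_le_mono[OF ip_Cauchy_Schwarz[OF assms]] by (simp add: real_sqrt_mult)

lemma sqrt_sqn_triangle:
 assumes "L2 M f" "L2 M g"
 shows "sqrt (sqn M (%x. f x + g x)) <= sqrt (sqn M f) + sqrt (sqn M g)"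
proof (rule real_le_lsqrt)
 have "sqn M (%x. f x + g x) = sqn M f + 2 * ip M f g + sqn M g" using sqn_lincomb[OF assms, of 1 1] by simp
 also have "\<dots> <= sqn M f + 2 * (sqrt (sqn M f) * sqrt (sqn M g)) + sqn M g" using ip_Cauchy_Schwarz_sqrt[OF assms] by (simp add: abs_le_iff)
 also have "\<dots> = (sqrt (sqn M f) + sqrt (sqn M g))\<^sup>2" by (simp add: power2_eq_square algebra_simps sqn_nonneg)
 finally show "sqn M (%x. f x + g x) <= (sqrt (sqn M f) + sqrt (sqn M g))\<^sup>2" .
qed (simp add: sqn_nonneg)

lemma sqn_add_le:
 assumes "L2 M f" "L2 M g"
 shows "sqn M (%x. f x + g x) <= 2 * sqn M f + 2 * sqn M g"
proof -
 have "0 <= sqn M f - 2 * ip M f g + sqn M g" using sqn_lincomb[OF assms, of 1 "-1"] sqn_nonneg[of M "%x. 1 * f x + (-1) * g x"] by simp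
 then show ?thesis using sqn_lincomb[OF assms, of 1 1] by simp
qed

lemma sqrt_sqn_triangle_diff:
 assumes "L2 M f" "L2 M g" "L2 M h"
 shows "sqrt (sqn M (%x. f x - h x)) <= sqrt (sqn M (%x. f x - g x)) + sqrt (sqn M (%x. g x - h x))"
 using sqrt_sqn_triangle[OF L2_diff[OF assms(1,2)] L2_diff[OF assms(2,3)]] by simp

lemma ip_tendsto:
 assumes f: "!!j. L2 M (f j)" "L2 M f'" "((%j. sqn M (%x. f j x - f' x)) \<longlongrightarrow> 0) F"
  and g: "!!j. L2 M (g j)" "L2 M g'" "((%j. sqn M (%x. g j x - g' x)) \<longlongrightarrow> 0) F"
 shows "((%j. ip M (f j) (g j)) \<longlongrightarrow> ip M f' g') F"
proof -
 let ?a = "%j. sqrt (sqn M (%x. f j x - f' x))" and ?b = "%j. sqrt (sqn M (%x. g j x - g' x))"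
 have a: "(?a \<longlongrightarrow> 0) F" and b: "(?b \<longlongrightarrow> 0) F" using tendsto_real_sqrt[OF f(3)] tendsto_real_sqrt[OF g(3)] by simp_all
 have bd: "norm (ip M (f j) (g j) - ip M f' g')
   <= ?a j * ?b j + ?a j * sqrt (sqn M g') + sqrt (sqn M f') * ?b j" for j
 proof -
  have df: "L2 M (%x. f j x - f' x)" and dg: "L2 M (%x. g j x - g' x)" using f g by (auto intro: L2_diff)
  have "ip M (f j) (g j) - ip M f' g' = ip M (%x. f j x - f' x) (%x. g j x - g' x)
    + ip M (%x. f j x - f' x) g' + ip M f' (%x. g j x - g' x)" using f g df dg by (simp add: ip_diff_left ip_diff_right)
  then show ?thesis using ip_Cauchy_Schwarz_sqrt[OF df dg] ip_Cauchy_Schwarz_sqrt[OF df g(2)]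
    ip_Cauchy_Schwarz_sqrt[OF f(2) dg] by simp
 qed
 have "((%j. ?a j * ?b j + ?a j * sqrt (sqn M g') + sqrt (sqn M f') * ?b j) \<longlongrightarrow> 0 * 0 + 0 * sqrt (sqn M g') + sqrt (sqn M f') * 0) F"
  by (intro tendsto_intros a b)
 then have "((%j. ip M (f j) (g j) - ip M f' g') \<longlongrightarrow> 0) F" by (intro Lim_null_comparison[OF always_eventually[OF allI[OF bd]]]) simp
 then show ?thesis by (simp add: LIM_zero_iff)
qed

lemma sqn_tendsto:
 assumes "!!j. L2 M (f j)" "L2 M f'" "((%j. sqn M (%x. f j x - f' x)) \<longlongrightarrow> 0) F"
 shows "((%j. sqn M (f j)) \<longlongrightarrow> sqn M f') F" using ip_tendsto[OF assms assms] by (simp add: ip_self)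

lemma sqn_nn_integral: "L2 M f ==> (\<integral>\<^sup>+x. ennreal ((f x)\<^sup>2) \<partial>M) = ennreal (sqn M f)"
 unfolding sqn_def by (subst nn_integral_eq_integral) (auto simp: L2_def)

lemma L2I_nn:
 assumes "f : borel_measurable M" "(\<integral>\<^sup>+x. ennreal ((f x)\<^sup>2) \<partial>M) < \<infinity>"
 shows "L2 M f" unfolding L2_def using assms by (auto intro!: integrableI_nonneg)

lemma L2_nn_leI:
 assumes "f : borel_measurable M" "(\<integral>\<^sup>+x. ennreal ((f x)\<^sup>2) \<partial>M) <= ennreal c" "0 <= c"
 shows "L2 M f" "sqn M f <= c"
proof -
 show "L2 M f" using assms by (intro L2I_nn) (auto intro: le_less_trans)
 from sqn_nn_integral[OF this] show "sqn M f <= c" using assms(2,3) by simp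
qed

lemma sqn_Fatou:
 assumes f: "!!j. L2 M (f j)" and lim: "AE x in M. (%j. f j x) \<longlonglongrightarrow> g x"
  and g: "g : borel_measurable M" and bd: "!!j. sqn M (f j) <= c"
 shows "L2 M g & sqn M g <= c"
proof -
 have "(\<integral>\<^sup>+x. ennreal ((g x)\<^sup>2) \<partial>M) = (\<integral>\<^sup>+x. liminf (%j. ennreal ((f j x)\<^sup>2)) \<partial>M)"
 proof (rule nn_integral_cong_AE)
  show "AE x in M. ennreal ((g x)\<^sup>2) = liminf (%j. ennreal ((f j x)\<^sup>2))" using lim
  proof eventually_elim
   fix x assume "(%j. f j x) \<longlonglongrightarrow> g x"
   then have "(%j. ennreal ((f j x)\<^sup>2)) \<longlonglongrightarrow> ennreal ((g x)\<^sup>2)" by (intro tendsto_ennrealI tendsto_power)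
   from lim_imp_Liminf[OF _ this] show "ennreal ((g x)\<^sup>2) = liminf (%j. ennreal ((f j x)\<^sup>2))" by simp
  qed
 qed
 also have "\<dots> <= liminf (%j. \<integral>\<^sup>+x. ennreal ((f j x)\<^sup>2) \<partial>M)"
  by (rule nn_integral_liminf) (use f in \<open>auto simp: L2_def\<close>)
 also have "\<dots> <= ennreal c"
 proof -
  have "liminf (%j. \<integral>\<^sup>+x. ennreal ((f j x)\<^sup>2) \<partial>M) <= liminf (%j::nat. ennreal c)"
   by (rule Liminf_mono) (use bd f in \<open>simp add: sqn_nn_integral ennreal_leI\<close>)
  then show ?thesis by (simp add: Liminf_const)
 qed
 finally have "(\<integral>\<^sup>+x. ennreal ((g x)\<^sup>2) \<partial>M) <= ennreal c" .
 moreover have "0 <= c" using bd[of 0] sqn_nonneg[of M "f 0"] by linarith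
 ultimately show ?thesis using L2_nn_leI[OF g] by blast
qed

lemma sqn_dominated_tendsto:
 assumes f: "!!j. f j : borel_measurable M" and lim: "AE x in M. (%j. f j x) \<longlonglongrightarrow> 0"
  and w: "L2 M w" and bd: "!!j. AE x in M. \<bar>f j x\<bar> <= \<bar>w x\<bar>"
 shows "(%j. sqn M (f j)) \<longlonglongrightarrow> 0"
proof -
 have "(%j. LINT x|M. (f j x)\<^sup>2) \<longlonglongrightarrow> (LINT x|M. 0)"
 proof (rule integral_dominated_convergence)
  show "AE x in M. (%j. (f j x)\<^sup>2) \<longlonglongrightarrow> 0" using lim by eventually_elim (use tendsto_power[of _ 0 _ 2] in fastforce)
  show "AE x in M. norm ((f j x)\<^sup>2) <= (w x)\<^sup>2" for j using bd[of j] by eventually_elim (simp add: abs_le_square_iff)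
 qed (use f w in \<open>auto simp: L2_def\<close>)
 then show ?thesis by (simp add: sqn_def)
qed

lemma L2_AE_subseq:
 assumes f: "!!j. L2 M (f j)" "L2 M g" and lim: "(%j. sqn M (%x. f j x - g x)) \<longlonglongrightarrow> 0"
 shows "\<exists>r::nat=>nat. strict_mono r & (AE x in M. (%j. f (r j) x) \<longlonglongrightarrow> g x)"
proof -
 have "\<exists>r::nat=>nat. strict_mono r & (AE x in M. (%j. (f (r j) x - g x)\<^sup>2) \<longlonglongrightarrow> 0)"
 proof (rule tendsto_L1_AE_subseq)
  show "integrable M (%x. (f j x - g x)\<^sup>2)" for j using L2_diff[OF f(1) f(2)] by (simp add: L2_def)
  show "(%j. LINT x|M. norm ((f j x - g x)\<^sup>2)) \<longlonglongrightarrow> 0" using lim by (simp add: sqn_def)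
 qed
 then obtain r :: "nat => nat" where r: "strict_mono r" "AE x in M. (%j. (f (r j) x - g x)\<^sup>2) \<longlonglongrightarrow> 0" by blast
 from r(2) have "AE x in M. (%j. f (r j) x) \<longlonglongrightarrow> g x"
 proof eventually_elim
  fix x assume "(%j. (f (r j) x - g x)\<^sup>2) \<longlonglongrightarrow> 0"
  from tendsto_real_sqrt[OF this] have "(%j. \<bar>f (r j) x - g x\<bar>) \<longlonglongrightarrow> 0" by simp
  then have "(%j. f (r j) x - g x) \<longlonglongrightarrow> 0" by (rule tendsto_rabs_zero_cancel)
  then show "(%j. f (r j) x) \<longlonglongrightarrow> g x" by (simp add: LIM_zero_iff)
 qed
 with r(1) show ?thesis by blast
qed

text \<open>Along a subsequence whose squared increments have integral at most 4^-k, weights 2^k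
  still leave a finite sum. At almost every point the increments are then dominated by a geometric
  sequence, so the subsequence converges; Fatou's lemma identifies the limit in norm.\<close>

theorem L2_complete:
 assumes f: "!!j::nat. L2 M (f j)"
  and cauchy: "!!e. e > 0 ==> \<exists>N. \<forall>i\<ge>N. \<forall>j\<ge>N. sqn M (%x. f i x - f j x) <= e"
 shows "\<exists>g. L2 M g & (%j. sqn M (%x. f j x - g x)) \<longlonglongrightarrow> 0"
proof -
 have "\<forall>k::nat. \<exists>N. \<forall>i\<ge>N. \<forall>j\<ge>N. sqn M (%x. f i x - f j x) <= (1/4) ^ k" using cauchy by simp
 then obtain N where N: "!!k i j. i >= N k ==> j >= N k ==> sqn M (%x. f i x - f j x) <= (1/4) ^ k" by metis
 \<comment> \<open>Partial sums make the subsequence monotone while keeping it above every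
   \<open>N k\<close>.\<close>
 define r where "r = (%k::nat. (\<Sum>i\<le>k. N i) + k)"
 have rN: "N k <= r k" "k <= r k" "r k <= r (Suc k)" for k by (auto simp: r_def intro: trans_le_add1 member_le_sum)
 define d where "d = (%k x. f (r (Suc k)) x - f (r k) x)"
 have d: "L2 M (d k)" and dle: "sqn M (d k) <= (1/4) ^ k" for k using f N[of k "r (Suc k)" "r k"] rN[of k] by (auto simp: d_def intro: L2_diff)
 have "(\<integral>\<^sup>+x. (\<Sum>k. ennreal (2 ^ k * (d k x)\<^sup>2)) \<partial>M) = (\<Sum>k. \<integral>\<^sup>+x. ennreal (2 ^ k * (d k x)\<^sup>2) \<partial>M)"
  by (rule nn_integral_suminf) (use L2_measurable[OF d] in auto)
 also have "\<dots> = (\<Sum>k. ennreal (2 ^ k * sqn M (d k)))"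
  using L2_measurable[OF d] by (simp add: ennreal_mult nn_integral_cmult sqn_nn_integral[OF d] sqn_nonneg)
 also have "\<dots> <= (\<Sum>k. ennreal ((1/2) ^ k))"
 proof (intro suminf_le allI summableI ennreal_leI)
  fix k
  have "2 ^ k * sqn M (d k) <= 2 ^ k * (1/4) ^ k" using dle by (intro mult_left_mono) auto
  also have "\<dots> = (1/2::real) ^ k" by (simp flip: power_mult_distrib)
  finally show "2 ^ k * sqn M (d k) <= (1/2) ^ k" .
 qed
 also have "\<dots> = ennreal (\<Sum>k. (1/2) ^ k)" by (rule suminf_ennreal2) (auto intro: summable_geometric)
 also have "\<dots> < \<infinity>" by simp
 finally have "(\<integral>\<^sup>+x. (\<Sum>k. ennreal (2 ^ k * (d k x)\<^sup>2)) \<partial>M) ~= \<infinity>" by simp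
 then have "AE x in M. (\<Sum>k. ennreal (2 ^ k * (d k x)\<^sup>2)) ~= \<infinity>" by (intro nn_integral_PInf_AE) (use L2_measurable[OF d] in auto)
 then have conv: "AE x in M. convergent (%k. f (r k) x)"
 proof eventually_elim
  fix x assume fin: "(\<Sum>k. ennreal (2 ^ k * (d k x)\<^sup>2)) ~= \<infinity>"
  define C where "C = enn2real (\<Sum>k. ennreal (2 ^ k * (d k x)\<^sup>2))"
  have dC: "\<bar>d k x\<bar> <= sqrt C * (1 / sqrt 2) ^ k" for k
  proof -
   define u where "u = (%k. ennreal (2 ^ k * (d k x)\<^sup>2))"
   have "sum u {k} <= suminf u" by (rule sum_le_suminf) auto
   then have "u k <= suminf u" by simp
   also have "suminf u = ennreal C" using fin by (simp add: C_def u_def less_top)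
   finally have "2 ^ k * (d k x)\<^sup>2 <= C" by (simp add: u_def C_def)
   then have "(d k x)\<^sup>2 <= C / 2 ^ k" by (simp add: field_simps)
   from real_sqrt_le_mono[OF this] have "\<bar>d k x\<bar> <= sqrt (C / 2 ^ k)" by simp
   also have "\<dots> = sqrt C * (1 / sqrt 2) ^ k" by (simp add: real_sqrt_divide real_sqrt_power power_one_over)
   finally show ?thesis .
  qed
  have "summable (%k. sqrt C * (1 / sqrt 2) ^ k)" by (intro summable_mult summable_geometric) simp
  then have "summable (%k. d k x)" by (rule summable_comparison_test'[where N=0]) (simp add: dC)
  then have "(%n. \<Sum>k<n. d k x) \<longlonglongrightarrow> (\<Sum>k. d k x)" by (rule summable_LIMSEQ)
  moreover have "(\<Sum>k<n. d k x) = f (r n) x - f (r 0) x" for n unfolding d_def by (rule sum_lessThan_telescope)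
  ultimately have "(%n. f (r n) x - f (r 0) x + f (r 0) x) \<longlonglongrightarrow> (\<Sum>k. d k x) + f (r 0) x" by (intro tendsto_add tendsto_const) simp
  then show "convergent (%k. f (r k) x)" by (auto simp: convergent_def)
 qed
 define g where "g = (%x. lim (%k. f (r k) x))"
 have g: "g : borel_measurable M" unfolding g_def by (rule borel_measurable_lim_metric) (use L2_measurable[OF f] in auto)
 have lim: "AE x in M. (%k. f (r k) x) \<longlonglongrightarrow> g x" using conv by eventually_elim (simp add: g_def convergent_LIMSEQ_iff)
 have est: "L2 M (%x. f i x - g x) & sqn M (%x. f i x - g x) <= (1/4) ^ k" if "i >= N k" for i k
 proof (rule sqn_Fatou[of M "%j x. f i x - f (r (j + k)) x"])
  show "L2 M (%x. f i x - f (r (j + k)) x)" for j using f by (intro L2_diff)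
  show "AE x in M. (%j. f i x - f (r (j + k)) x) \<longlonglongrightarrow> f i x - g x" using lim
  proof eventually_elim
   fix x assume "(%k. f (r k) x) \<longlonglongrightarrow> g x"
   from LIMSEQ_ignore_initial_segment[OF this, of k]
   show "(%j. f i x - f (r (j + k)) x) \<longlonglongrightarrow> f i x - g x" by (intro tendsto_diff tendsto_const)
  qed
  show "(%x. f i x - g x) : borel_measurable M" using g L2_measurable[OF f] by auto
  have "r (j + k) >= N k" for j
  proof -
   have "r k <= r (j + k)" by (rule lift_Suc_mono_le[of r]) (use rN in auto)
   then show ?thesis using rN(1)[of k] by linarith
  qed
  then show "sqn M (%x. f i x - f (r (j + k)) x) <= (1/4) ^ k" for j using N[OF that] by blast
 qed
 have "L2 M g" using L2_diff[OF f[of "N 0"] conjunct1[OF est[of 0 "N 0"]]] by simp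
 moreover have "(%j. sqn M (%x. f j x - g x)) \<longlonglongrightarrow> 0"
 proof (rule LIMSEQ_I)
  fix e :: real assume "e > 0"
  then obtain k where "(1/4::real) ^ k < e" using real_arch_pow_inv[of e "1/4"] by auto
  then show "\<exists>no. \<forall>n\<ge>no. norm (sqn M (%x. f n x - g x) - 0) < e"
   using est[of k] sqn_nonneg[of M] by (intro exI[of _ "N k"]) (force intro: le_less_trans)
 qed
 ultimately show ?thesis by blast
qed

section \<open>Translations and difference quotients\<close>

lemma lborel_shift:
 fixes f :: "'a::euclidean_space => 'b::{banach,second_countable_topology}" and h :: 'a
 shows "(LBINT x. f (x + h)) = (LBINT x. f x)"
  and "f : borel_measurable lborel ==> integrable lborel (%x. f (x + h)) \<longleftrightarrow> integrable lborel f"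
proof -
 have *: "distr lborel borel (%x. x + h) = (lborel :: 'a measure)" using lborel_distr_plus[of h] by (simp add: add.commute[of _ h])
 show "f : borel_measurable lborel ==> integrable lborel (%x. f (x + h)) \<longleftrightarrow> integrable lborel f"
  using integrable_distr_eq[of "%x. x + h" lborel borel f] * by simp
 have meas: "(LBINT x. f (x + h)) = (LBINT x. f x)" if "f : borel_measurable lborel" for f :: "'a => 'b" and h
 proof -
  have *: "distr lborel borel (%x. x + h) = (lborel :: 'a measure)" using lborel_distr_plus[of h] by (simp add: add.commute[of _ h])
  show ?thesis using integral_distr[of "%x. x + h" lborel borel f] that * by simp
 qed
 show "(LBINT x. f (x + h)) = (LBINT x. f x)"
 proof (cases "f : borel_measurable lborel")
  \<comment> \<open>Without measurability both integrals have the default value 0 of a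
    non-integrable function.\<close>
  case False
  then have "\<not> integrable lborel f" by auto
  moreover have "\<not> integrable lborel (%x. f (x + h))"
  proof
   assume "integrable lborel (%x. f (x + h))"
   then have "(%x. f (x + h)) : bmb" by auto
   from measurable_compose[OF _ this, of "%x. x - h" borel] have "f : bmb" by simp
   with False show False by simp
  qed
  ultimately show ?thesis by (simp add: not_integrable_integral_eq)
 qed (rule meas)
qed

lemma nn_integral_lborel_shift:
 fixes h :: "'a::euclidean_space"
 assumes "f : bmb"
 shows "(\<integral>\<^sup>+x. f (x + h) \<partial>lborel) = (\<integral>\<^sup>+x. f x \<partial>lborel)"
proof -
 have "distr lborel borel (%x. x + h) = (lborel :: 'a measure)" using lborel_distr_plus[of h] by (simp add: add.commute[of _ h])
 then show ?thesis using nn_integral_distr[of "%x. x + h" lborel borel f] assms by simp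
qed

lemma L2_shift:
 fixes f :: "'a::euclidean_space => real"
 assumes "L2l f"
 shows "L2l (%x. f (x + h))" "nsq (%x. f (x + h)) = nsq f"
proof -
 have m: "(%x. f (x + h)) : borel_measurable lborel" using measurable_compose[OF _ L2_measurable[OF assms], of "%x. x + h"] by simp
 have "integrable lborel (%x. (f (x + h))\<^sup>2)" using lborel_shift(2)[of "%x. (f x)\<^sup>2" h] assms by (auto simp: L2_def)
 with m show "L2l (%x. f (x + h))" by (simp add: L2_def)
 show "nsq (%x. f (x + h)) = nsq f" unfolding sqn_def by (rule lborel_shift(1)[of "%x. (f x)\<^sup>2"])
qed

definition Inc :: "'a::euclidean_space => ('a => real) => 'a => real" where
 "Inc h f x = f (x + h) - f x"

lemma L2_Inc: "L2l f ==> L2l (Inc h f)"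
 unfolding Inc_def[abs_def] by (intro L2_diff L2_shift)

lemma sqn_Inc_le: "L2l f ==> nsq (Inc h f) <= 4 * nsq f"
 using sqn_add_le[OF L2_shift(1), of f "%x. - 1 * f x" h] L2_cmult[of lborel f "-1"]
  sqn_cmult[of lborel "-1" f] L2_shift(2)[of f h] by (simp add: Inc_def[abs_def])

lemma Inc_diff: "Inc h (%x. f x - g x) = (%x. Inc h f x - Inc h g x)"
 by (simp add: Inc_def fun_eq_iff)

definition pd :: "'n::finite => ((real^'n) => real) => (real^'n) => real" where
 "pd i ps x = frd ps (at x) (axis i 1)"

lemma frechet_derivative_pd:
 assumes "smooth ps"
 shows "frd ps (at x) h = (\<Sum>i\<in>UNIV. h $ i * pd i ps x)"
proof -
 interpret linear "frd ps (at x)" using has_derivative_linear smooth_has_derivative[OF assms] by blast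
 have "frd ps (at x) h = frd ps (at x) (\<Sum>i\<in>UNIV. (h $ i) *\<^sub>R axis i 1)" using basis_expansion[of h] by (simp add: scalar_mult_eq_scaleR)
 also have "\<dots> = (\<Sum>i\<in>UNIV. h $ i * pd i ps x)" by (simp add: sum scaleR pd_def)
 finally show ?thesis .
qed

lemma pd_Cc_infinity: "ps : Cci S ==> pd i ps : Cci S"
 unfolding pd_def[abs_def] by (rule Cc_infinity_frechet_derivative)

lemma Cc_infinity_smooth: "ps : Cci S ==> smooth ps"
 by (simp add: Cc_infinity_iff)

lemma Cc_infinity_continuous: "ps : Cci S ==> continuous_on A ps"
 by (rule smooth_continuous_on[OF Cc_infinity_smooth])

lemma Cc_infinity_borel: "ps : Cci S ==> ps : bmb"
 by (rule borel_measurable_continuous_onI[OF Cc_infinity_continuous])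

lemma Cc_infinity_outside: "ps : Cci S ==> x \<notin> S ==> ps x = 0"
 using closure_subset[of "{x. ps x ~= 0}"] by (auto simp: Cc_infinity_iff)

lemma Cc_infinity_bounded:
 assumes "ps : Cci S"
 obtains C where "0 <= C" "\<forall>x. \<bar>ps x\<bar> <= C"
proof -
 obtain K where K: "smooth ps" "compact K" "K \<subseteq> S" "\<forall>x. x \<notin> K --> ps x = 0" by (rule Cc_infinityE[OF assms])
 have "bounded (ps ` K)" by (intro compact_imp_bounded compact_continuous_image smooth_continuous_on K)
 then obtain C where C: "!!y. y : ps ` K ==> norm y <= C" unfolding bounded_iff by blast
 have "\<bar>ps x\<bar> <= max C 0" for x using C[of "ps x"] K(4) by (cases "x : K") (auto simp: max_def)
 then show thesis using that[of "max C 0"] by simp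
qed

lemma compact_support_L2:
 fixes f :: "'a::euclidean_space => real"
 assumes "f : bmb" "bounded K" "!!x. x \<notin> K ==> f x = 0" "!!x. \<bar>f x\<bar> <= C"
 shows "integrable lborel f" "L2l f"
proof -
 obtain a b where ab: "K \<subseteq> cbox a b" using bounded_subset_cbox_symmetric[OF assms(2)] by blast
 have ind: "integrable lborel (%x. D * chf (cbox a b) x)" for D by (intro integrable_mult_right) (auto simp: emeasure_lborel_cbox_eq)
 show "integrable lborel f"
 proof (rule Bochner_Integration.integrable_bound[OF ind[of C]])
  show "AE x in lborel. norm (f x) <= norm (C * chf (cbox a b) x)"
  proof (intro AE_I2)
   fix x show "norm (f x) <= norm (C * chf (cbox a b) x)" using assms(3)[of x] assms(4)[of x] ab by (cases "x : K") (auto simp: indicator_def)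
  qed
 qed (use assms(1) in simp)
 have "integrable lborel (%x. (f x)\<^sup>2)"
 proof (rule Bochner_Integration.integrable_bound[OF ind[of "C\<^sup>2"]])
  show "AE x in lborel. norm ((f x)\<^sup>2) <= norm (C\<^sup>2 * chf (cbox a b) x)"
  proof (intro AE_I2)
   fix x
   have "(f x)\<^sup>2 <= C\<^sup>2" using power_mono[OF assms(4)[of x], of 2] by simp
   then show "norm ((f x)\<^sup>2) <= norm (C\<^sup>2 * chf (cbox a b) x)" using assms(3)[of x] ab by (cases "x : K") (auto simp: indicator_def)
  qed
 qed (use assms(1) in simp)
 then show "L2l f" using assms(1) by (simp add: L2_def)
qed

lemma Cc_infinity_L2:
 assumes "ps : Cci S"
 shows "integrable lborel ps" "L2l ps"
proof -
 obtain K where K: "smooth ps" "compact K" "K \<subseteq> S" "\<forall>x. x \<notin> K --> ps x = 0" by (rule Cc_infinityE[OF assms])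
 obtain C where "0 <= C" "\<forall>x. \<bar>ps x\<bar> <= C" by (rule Cc_infinity_bounded[OF assms])
 then show "integrable lborel ps" "L2l ps" using compact_support_L2[OF Cc_infinity_borel[OF assms] compact_imp_bounded[OF K(2)]] K(4) by blast+
qed

lemma Cc_infinity_lipschitz:
 fixes ps :: "(real^'n::finite) => real"
 assumes "ps : Cci S"
 obtains C where "0 <= C" "\<forall>x y. \<bar>ps x - ps y\<bar> <= C * norm (x - y)"
proof -
 have "\<forall>i. \<exists>C\<ge>0. \<forall>x. \<bar>pd i ps x\<bar> <= C" using Cc_infinity_bounded[OF pd_Cc_infinity[OF assms]] by metis
 then obtain C where C: "!!i. 0 <= C i" "!!i x. \<bar>pd i ps x\<bar> <= C i" by metis
 have "\<bar>ps x - ps y\<bar> <= sum C UNIV * norm (x - y)" for x y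
 proof -
  have "norm (ps x - ps y) <= sum C UNIV * norm (x - y)"
  proof (rule differentiable_bound[of UNIV ps "%x. frd ps (at x)"])
   show "(ps has_derivative frd ps (at x)) (at x within UNIV)" for x using smooth_has_derivative[OF Cc_infinity_smooth[OF assms]] by simp
   show "onorm (frd ps (at x)) <= sum C UNIV" for x
   proof (rule onorm_bound)
    fix h :: "real^'n"
    have "norm (frd ps (at x) h) <= (\<Sum>i\<in>UNIV. \<bar>h $ i * pd i ps x\<bar>)"
     unfolding frechet_derivative_pd[OF Cc_infinity_smooth[OF assms]] by (simp add: sum_abs)
    also have "\<dots> <= (\<Sum>i\<in>UNIV. norm h * C i)" unfolding abs_mult by (intro sum_mono mult_mono C component_le_norm_cart) auto
    also have "\<dots> = sum C UNIV * norm h" by (simp add: sum_distrib_left mult.commute)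
    finally show "norm (frd ps (at x) h) <= sum C UNIV * norm h" .
   qed (intro sum_nonneg C)
  qed auto
  then show ?thesis by simp
 qed
 moreover have "0 <= sum C UNIV" by (intro sum_nonneg C)
 ultimately show thesis using that[of "sum C UNIV"] by blast
qed

text \<open>The step is h/(m+1), so every index is admissible and m = 0 gives the plain
  increment.\<close>

definition DQ :: "nat => 'a::euclidean_space => ('a => real) => 'a => real" where
 "DQ m h f x = real (Suc m) * Inc (h /\<^sub>R real (Suc m)) f x"

lemma L2_DQ: "L2l f ==> L2l (DQ m h f)"
 unfolding DQ_def[abs_def] by (intro L2_cmult L2_Inc)

lemma Cc_difference_quotient:
 fixes ps :: "(real^'n::finite) => real" and h :: "real^'n"
 assumes ps: "ps : Cci S"
 shows "\<exists>K C. bounded K & (\<forall>m. \<forall>x::real^'n. x \<notin> K --> DQ m h ps x = 0 & frd ps (at x) h = 0) &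
     (\<forall>m. \<forall>x::real^'n. \<bar>DQ m h ps x\<bar> <= C & \<bar>frd ps (at x) h\<bar> <= C)" (is ?A)
  and "(%m. DQ m h ps x) \<longlonglongrightarrow> frd ps (at x) h"
proof -
 obtain K where K: "smooth ps" "compact K" "K \<subseteq> S" "\<forall>x. x \<notin> K --> ps x = 0" by (rule Cc_infinityE[OF ps])
 obtain L where L0: "0 <= L" and "\<forall>x y. \<bar>ps x - ps y\<bar> <= L * norm (x - y)" by (rule Cc_infinity_lipschitz[OF ps])
 then have L: "\<bar>ps x - ps y\<bar> <= L * norm (x - y)" for x y by blast
 obtain r where r: "!!x. x : K ==> norm x <= r" using compact_imp_bounded[OF K(2)] unfolding bounded_iff by blast
 show conv: "(%m. DQ m h ps x) \<longlonglongrightarrow> frd ps (at x) h" for x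
 proof (cases "h = 0")
  case True
  then show ?thesis using linear_0[OF has_derivative_linear[OF smooth_has_derivative[OF K(1)]], of x] by (simp add: DQ_def Inc_def)
 next
  case False
  have "((%t. ps (x + t *\<^sub>R h)) has_derivative (%t. frd ps (at (x + 0 *\<^sub>R h)) (0 + t *\<^sub>R h))) (at 0)"
   by (rule has_derivative_compose[of "%t. x + t *\<^sub>R h" _ 0 UNIV ps, simplified])
     (auto intro!: derivative_eq_intros smooth_has_derivative K)
  moreover have "(%t. frd ps (at (x + 0 *\<^sub>R h)) (0 + t *\<^sub>R h)) = (*) (frd ps (at x) h)"
   using linear_scale[OF has_derivative_linear[OF smooth_has_derivative[OF K(1)]], of x _ h] by (auto simp: fun_eq_iff)
  ultimately have "((%t. ps (x + t *\<^sub>R h)) has_real_derivative frd ps (at x) h) (at 0)" by (simp add: has_field_derivative_def)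
  then have "((%t. (ps (x + t *\<^sub>R h) - ps x) / t) \<longlongrightarrow> frd ps (at x) h) (at 0)" by (simp add: has_field_derivative_iff)
  moreover have "filterlim (%m. 1 / real (Suc m)) (at 0) sequentially" using LIMSEQ_Suc[OF lim_1_over_n] by (intro filterlim_atI) auto
  ultimately have "(%m. (ps (x + (1 / real (Suc m)) *\<^sub>R h) - ps x) / (1 / real (Suc m))) \<longlonglongrightarrow> frd ps (at x) h"
   by (rule filterlim_compose)
  then show ?thesis by (simp add: DQ_def Inc_def divide_inverse mult.commute)
 qed
 \<comment> \<open>Steps of every scale move a point by at most \<open>norm h\<close>, so one
   enlarged ball contains all supports.\<close>
 show ?A
 proof (intro exI[of _ "cball 0 (r + norm h)"] exI[of _ "L * norm h"] conjI allI impI)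
  fix m and x :: "real^'n"
  { fix m assume x: "x \<notin> cball 0 (r + norm h)"
   have nh: "norm (h /\<^sub>R real (Suc m)) <= norm h" by (simp add: inverse_eq_divide divide_le_eq mult_le_cancel_left1 distrib_left)
   have "x \<notin> K" using x r[of x] norm_ge_zero[of h] by auto
   moreover have "x + h /\<^sub>R real (Suc m) \<notin> K"
    using x r[of "x + h /\<^sub>R real (Suc m)"] norm_diff_ineq[of x "h /\<^sub>R real (Suc m)"] nh by auto
   ultimately have "DQ m h ps x = 0" using K(4) by (simp add: DQ_def Inc_def) }
  note * = this
  assume x: "x \<notin> cball 0 (r + norm h)"
  show "DQ m h ps x = 0" using *[OF x] .
  show "frd ps (at x) h = 0" using conv[of x] *[OF x] by (simp add: LIMSEQ_const_iff)
 next
  { fix m x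
   have "\<bar>DQ m h ps x\<bar> = real (Suc m) * \<bar>ps (x + h /\<^sub>R real (Suc m)) - ps x\<bar>" by (simp add: DQ_def Inc_def abs_mult)
   also have "\<dots> <= real (Suc m) * (L * norm (x + h /\<^sub>R real (Suc m) - x))" by (intro mult_left_mono L) auto
   also have "\<dots> = L * norm h" by simp
   finally have "\<bar>DQ m h ps x\<bar> <= L * norm h" . }
  note * = this
  fix m x
  show "\<bar>DQ m h ps x\<bar> <= L * norm h" by (rule *)
  show "\<bar>frd ps (at x) h\<bar> <= L * norm h" by (rule LIMSEQ_le_const2[OF tendsto_rabs[OF conv]]) (use * in blast)
 qed simp
qed

text \<open>The quotients share a bounded support and a Lipschitz bound, which gives dominated
  convergence. The integral of a derivative vanishes because increments of an integrable function
  integrate to 0 by translation invariance; integration by parts rests on this.\<close>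

lemma Cc_difference_quotient_L2:
 fixes ps :: "(real^'n::finite) => real"
 assumes ps: "ps : Cci S"
 shows "(%m. nsq (%x. DQ m h ps x - frd ps (at x) h)) \<longlonglongrightarrow> 0"
  and "(LBINT x. frd ps (at x) h) = 0"
proof -
 let ?q = "%m::nat. %x. DQ m h ps x"
 let ?d = "%x. frd ps (at x) h"
 obtain K C where K: "bounded K" "!!m x. x \<notin> K ==> ?q m x = 0" "!!x. x \<notin> K ==> ?d x = 0"
  "!!m x. \<bar>?q m x\<bar> <= C" "!!x. \<bar>?d x\<bar> <= C" using Cc_difference_quotient(1)[OF ps, of h] by metis
 have conv: "(%m. ?q m x) \<longlonglongrightarrow> ?d x" for x by (rule Cc_difference_quotient(2)[OF ps])
 obtain a b where ab: "K \<subseteq> cbox a b" using bounded_subset_cbox_symmetric[OF K(1)] by blast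
 have psm: "ps : bmb" by (rule Cc_infinity_borel[OF ps])
 have dm: "?d : bmb" by (rule Cc_infinity_borel[OF Cc_infinity_frechet_derivative[OF ps]])
 have qm: "?q m : bmb" for m unfolding DQ_def Inc_def using measurable_compose[OF _ psm, of "%x. x + h /\<^sub>R real (Suc m)" borel] psm by simp
 let ?w = "%x. 2 * C * chf (cbox a b) x"
 have C0: "0 <= C" using K(5)[of undefined] by linarith
 have w: "L2l ?w" "integrable lborel ?w" using compact_support_L2[of ?w "cbox a b" "2 * C"] C0 by (auto simp: indicator_def)
 have le: "\<bar>?q m x - ?d x\<bar> <= \<bar>?w x\<bar>" for m x
 proof (cases "x : K")
  case True
  then have "x : cbox a b" using ab by blast
  then show ?thesis using K(4)[of m x] K(5)[of x] by simp
 next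
  case False
  then show ?thesis using K(2)[of x m] K(3)[of x] by simp
 qed
 show "(%m. nsq (%x. ?q m x - ?d x)) \<longlonglongrightarrow> 0"
 proof (rule sqn_dominated_tendsto[OF _ _ w(1)])
  show "AE x in lborel. (%m. ?q m x - ?d x) \<longlonglongrightarrow> 0" using conv by (intro AE_I2) (simp add: LIM_zero)
  show "AE x in lborel. \<bar>?q m x - ?d x\<bar> <= \<bar>?w x\<bar>" for m using le by (intro AE_I2)
 qed (use qm dm in simp)
 have "(%m. LBINT x. ?q m x) \<longlonglongrightarrow> (LBINT x. ?d x)"
 proof (rule integral_dominated_convergence[OF _ _ w(2)])
  show "AE x in lborel. norm (?q m x) <= ?w x" for m
  proof (intro AE_I2)
   fix x show "norm (?q m x) <= ?w x" using K(2)[of x m] K(4)[of m x] C0 ab by (cases "x : K") (auto simp: indicator_def)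
  qed
 qed (use conv qm dm in auto)
 moreover have "(LBINT x. ?q m x) = 0" for m
 proof -
  have "integrable lborel ps" by (rule Cc_infinity_L2[OF ps])
  then show ?thesis using lborel_shift[of ps "h /\<^sub>R real (Suc m)"] psm by (simp add: DQ_def Inc_def)
 qed
 ultimately show "(LBINT x. ?d x) = 0" by (simp add: LIMSEQ_const_iff)
qed

lemma Cc_infinity_mult:
 assumes "ph : Cci S" "smooth ps"
 shows "(%x. ps x * ph x) : Cci S"
proof -
 obtain K where K: "smooth ph" "compact K" "K \<subseteq> S" "\<forall>x. x \<notin> K --> ph x = 0" by (rule Cc_infinityE[OF assms(1)])
 show ?thesis by (rule Cc_infinityI[OF smooth_mult[OF assms(2) K(1)] K(2,3)]) (use K(4) in simp)
qed

lemma Cc_by_parts: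
 fixes ps :: "(real^'n::finite) => real"
 assumes ps: "ps : Cci S" and ph: "ph : Cci S"
 shows "ipl ps (pd i ph) = - ipl (pd i ps) ph"
proof -
 have d: "((%x. ps x * ph x) has_derivative (%h. ps x * frd ph (at x) h + frd ps (at x) h * ph x)) (at x)" for x
  by (intro has_derivative_mult smooth_has_derivative Cc_infinity_smooth[OF ph] Cc_infinity_smooth[OF ps])
 have "frd (%x. ps x * ph x) (at x) (axis i 1) = ps x * pd i ph x + pd i ps x * ph x" for x
  unfolding pd_def using fun_cong[OF frechet_derivative_at[OF d[of x]], of "axis i 1"] by simp
 then have "(LBINT x. ps x * pd i ph x + pd i ps x * ph x) = 0"
  using Cc_difference_quotient_L2(2)[OF Cc_infinity_mult[OF ph Cc_infinity_smooth[OF ps]], of "axis i 1"] by simp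
 then have "ipl ps (pd i ph) + ipl (pd i ps) ph = 0" unfolding ip_def
  using L2_integrable_mult[OF Cc_infinity_L2(2)[OF ps] Cc_infinity_L2(2)[OF pd_Cc_infinity[OF ph]]]
   L2_integrable_mult[OF Cc_infinity_L2(2)[OF pd_Cc_infinity[OF ps]] Cc_infinity_L2(2)[OF ph]] by simp
 then show ?thesis by linarith
qed

text \<open>A long increment is a sum of translates of short ones, and translation preserves the
  norm.\<close>

lemma sqn_Inc_scale:
 assumes "L2l f"
 shows "sqrt (nsq (Inc (real m *\<^sub>R h) f)) <= real m * sqrt (nsq (Inc h f))"
proof (induction m)
 case 0
 then show ?case by (simp add: Inc_def[abs_def] sqn_def)
next
 case (Suc m)
 have "Inc (real (Suc m) *\<^sub>R h) f = (%x. Inc h f (x + real m *\<^sub>R h) + Inc (real m *\<^sub>R h) f x)" by (simp add: Inc_def fun_eq_iff algebra_simps)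
 then have "sqrt (nsq (Inc (real (Suc m) *\<^sub>R h) f)) <= sqrt (nsq (%x. Inc h f (x + real m *\<^sub>R h))) + sqrt (nsq (Inc (real m *\<^sub>R h) f))"
  using sqrt_sqn_triangle[OF L2_shift(1)[OF L2_Inc[OF assms]] L2_Inc[OF assms]] by simp
 also have "\<dots> <= sqrt (nsq (Inc h f)) + real m * sqrt (nsq (Inc h f))" using Suc.IH L2_shift(2)[OF L2_Inc[OF assms], of h] by simp
 finally show ?case by (simp add: algebra_simps)
qed

text \<open>By \<open>sqn_Inc_scale\<close> the increment by h is bounded in norm by its difference
  quotient of any scale, hence by the limit, the directional derivative. This replaces an
  integration along segments.\<close>

lemma Cc_sqn_Inc:
 fixes ps :: "(real^'n::finite) => real"
 assumes ps: "ps : Cci S"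
 shows "nsq (Inc h ps) <= (norm h)\<^sup>2 * (\<Sum>i\<in>UNIV. nsq (pd i ps))"
proof -
 let ?d = "%x. frd ps (at x) h"
 have L: "L2l ps" by (rule Cc_infinity_L2[OF ps])
 have Ld: "L2l ?d" by (rule Cc_infinity_L2[OF Cc_infinity_frechet_derivative[OF ps]])
 have "(%m. sqrt (nsq (%x. DQ m h ps x))) \<longlonglongrightarrow> sqrt (nsq ?d)"
  by (intro tendsto_real_sqrt sqn_tendsto Cc_difference_quotient_L2(1)[OF ps] Ld L2_DQ L)
 moreover have "sqrt (nsq (Inc h ps)) <= sqrt (nsq (%x. DQ m h ps x))" for m
  using sqn_Inc_scale[OF L, of "Suc m" "h /\<^sub>R real (Suc m)"] by (simp add: DQ_def sqn_cmult real_sqrt_mult)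
 ultimately have "sqrt (nsq (Inc h ps)) <= sqrt (nsq ?d)" by (intro LIMSEQ_le_const) auto
 then have "nsq (Inc h ps) <= nsq ?d" by simp
 also have "\<dots> <= (LBINT x. (norm h)\<^sup>2 * (\<Sum>i\<in>UNIV. (pd i ps x)\<^sup>2))" unfolding sqn_def
 proof (rule integral_mono)
  show "integrable lborel (%x. (norm h)\<^sup>2 * (\<Sum>i\<in>UNIV. (pd i ps x)\<^sup>2))"
   by (intro integrable_mult_right Bochner_Integration.integrable_sum L2_integrable_sq Cc_infinity_L2[OF pd_Cc_infinity[OF ps]])
  fix x
  have "?d x = h \<bullet> (\<chi> i. pd i ps x)" unfolding frechet_derivative_pd[OF Cc_infinity_smooth[OF ps]] by (simp add: inner_vec_def)
  then have "(?d x)\<^sup>2 <= (norm h * norm (\<chi> i. pd i ps x))\<^sup>2"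
   using Cauchy_Schwarz_ineq2[of h "\<chi> i. pd i ps x"] by (metis abs_ge_zero power2_abs power_mono)
  also have "(norm (\<chi> i. pd i ps x))\<^sup>2 = (\<Sum>i\<in>UNIV. (pd i ps x)\<^sup>2)" by (simp add: norm_vec_def L2_set_def sum_nonneg)
  then have "(norm h * norm (\<chi> i. pd i ps x))\<^sup>2 = (norm h)\<^sup>2 * (\<Sum>i\<in>UNIV. (pd i ps x)\<^sup>2)" by (simp add: power_mult_distrib)
  finally show "(?d x)\<^sup>2 <= (norm h)\<^sup>2 * (\<Sum>i\<in>UNIV. (pd i ps x)\<^sup>2)" .
 qed (rule L2_integrable_sq[OF Ld])
 also have "\<dots> = (norm h)\<^sup>2 * (\<Sum>i\<in>UNIV. nsq (pd i ps))" unfolding sqn_def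
  by (simp add: Bochner_Integration.integral_sum L2_integrable_sq Cc_infinity_L2[OF pd_Cc_infinity[OF ps]])
 finally show ?thesis .
qed

lemma squeeze_0:
 fixes f g :: "'a => real"
 assumes "(g \<longlongrightarrow> 0) F" "!!j. 0 <= f j" "!!j. f j <= g j"
 shows "(f \<longlongrightarrow> 0) F" by (rule tendsto_sandwich[OF _ _ tendsto_const assms(1)]) (use assms in auto)

section \<open>The space \<open>H0\<close> and its gradients\<close>

definition gip :: "('n::finite => (real^'n) => real) => ('n => (real^'n) => real) => real" where
 "gip a b = (\<Sum>i\<in>UNIV. ipl (a i) (b i))"

text \<open>Squared H1 distance of pairs of a function and a candidate gradient. The gradient is
  carried as data because it is not yet known to be determined by the function.\<close>

definition pdist :: "((real^'n) => real) => ('n::finite => (real^'n) => real) => ((real^'n) => real) => ('n => (real^'n) => real) => real" where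
 "pdist v a w b = nsq (%x. v x - w x) + (\<Sum>i\<in>UNIV. nsq (%x. a i x - b i x))"

text \<open>\<open>H0 Om w g\<close> says that \<open>w\<close>, extended by zero, lies in the closure of the test functions for the
 \<open>H\<^sup>1\<close>-norm, with gradient \<open>g\<close>.\<close>

definition H0 :: "(real^'n) set => ((real^'n) => real) => ('n::finite => (real^'n) => real) => bool" where
 "H0 Om w g \<longleftrightarrow> L2l w & (\<forall>x. x \<notin> Om --> w x = 0) &
   (\<forall>i. L2l (g i) & (\<forall>x. x \<notin> Om --> g i x = 0)) &
   (\<exists>ps::nat => _. (\<forall>j. ps j : Cci Om) & (%j. pdist (ps j) (%i. pd i (ps j)) w g) \<longlonglongrightarrow> 0)"

lemma gip_self: "gip a a = (\<Sum>i\<in>UNIV. nsq (a i))"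
 by (simp add: gip_def ip_self)

lemma gip_self_nonneg: "0 <= gip a a"
 unfolding gip_self by (intro sum_nonneg sqn_nonneg)

lemma gip_sym: "gip a b = gip b a"
 by (simp add: gip_def ip_sym)

lemma gip_lincomb_right:
 assumes "!!i. L2l (a i)" "!!i. L2l (b i)" "!!i. L2l (c i)"
 shows "gip c (%i x. s * a i x + t * b i x) = s * gip c a + t * gip c b" unfolding gip_def by (simp add: ip_lincomb_right assms sum.distrib sum_distrib_left)

lemma gip_lincomb_left:
 assumes "!!i. L2l (a i)" "!!i. L2l (b i)" "!!i. L2l (c i)"
 shows "gip (%i x. s * a i x + t * b i x) c = s * gip a c + t * gip b c" unfolding gip_def by (simp add: ip_lincomb_left assms sum.distrib sum_distrib_left)

lemma gip_lincomb_self: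
 assumes "!!i. L2l (a i)" "!!i. L2l (b i)"
 shows "gip (%i x. s * a i x + t * b i x) (%i x. s * a i x + t * b i x)
  = s\<^sup>2 * gip a a + 2 * s * t * gip a b + t\<^sup>2 * gip b b"
proof -
 have "!!i. L2l (%x. s * a i x + t * b i x)" using assms by (intro L2_lincomb)
 then show ?thesis using assms by (simp add: gip_lincomb_left gip_lincomb_right gip_sym[of b a] power2_eq_square algebra_simps)
qed

lemma pdist_nonneg: "0 <= pdist v a w b"
 unfolding pdist_def by (intro add_nonneg_nonneg sum_nonneg sqn_nonneg)

lemma pdist_ge:
 "nsq (%x. v x - w x) <= pdist v a w b"
 "nsq (%x. a i x - b i x) <= pdist v a w b"
proof -
 show "nsq (%x. v x - w x) <= pdist v a w b" unfolding pdist_def by (simp add: sum_nonneg sqn_nonneg)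
 have "nsq (%x. a i x - b i x) <= (\<Sum>i\<in>UNIV. nsq (%x. a i x - b i x))" by (rule member_le_sum) (auto simp: sqn_nonneg)
 then show "nsq (%x. a i x - b i x) <= pdist v a w b" unfolding pdist_def using sqn_nonneg[of lborel "%x. v x - w x"] by linarith
qed

lemma pdist_lincomb:
 fixes v w v' w' :: "(real^'n::finite) => real"
 assumes "L2l v" "L2l w" "L2l v'" "L2l w'"
  "!!i. L2l (a i)" "!!i. L2l (b i)" "!!i. L2l (a' i)" "!!i. L2l (b' i)"
 shows "pdist (%x. s * v x + t * v' x) (%i x. s * a i x + t * a' i x)
   (%x. s * w x + t * w' x) (%i x. s * b i x + t * b' i x) <= 2 * s\<^sup>2 * pdist v a w b + 2 * t\<^sup>2 * pdist v' a' w' b'"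
proof -
 have *: "nsq (%x. (s * f x + t * f' x) - (s * h x + t * h' x)) \<le>
   2 * s\<^sup>2 * nsq (%x. f x - h x) + 2 * t\<^sup>2 * nsq (%x. f' x - h' x)"
  if "L2l f" "L2l h" "L2l f'" "L2l h'" for f h f' h' :: "(real^'n) => real"
 proof -
  have "nsq (%x. s * (f x - h x) + t * (f' x - h' x)) <= 2 * nsq (%x. s * (f x - h x)) + 2 * nsq (%x. t * (f' x - h' x))"
   using that by (intro sqn_add_le L2_cmult L2_diff)
  moreover have "(%x. s * (f x - h x) + t * (f' x - h' x)) = (%x. (s * f x + t * f' x) - (s * h x + t * h' x))" by (simp add: algebra_simps)
  ultimately show ?thesis by (simp add: sqn_cmult)
 qed
 have "(\<Sum>i\<in>UNIV. nsq (%x. (s * a i x + t * a' i x) - (s * b i x + t * b' i x)))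
   <= (\<Sum>i\<in>UNIV. 2 * s\<^sup>2 * nsq (%x. a i x - b i x) + 2 * t\<^sup>2 * nsq (%x. a' i x - b' i x))" using assms by (intro sum_mono *)
 then show ?thesis unfolding pdist_def using *[OF assms(1-4)] by (simp add: sum.distrib sum_distrib_left[symmetric] algebra_simps)
qed

lemma pdist_triangle:
 fixes u v w :: "(real^'n::finite) => real"
 assumes "L2l u" "L2l v" "L2l w"
  "!!i. L2l (a i)" "!!i. L2l (b i)" "!!i. L2l (c i)"
 shows "pdist u a w c <= 2 * pdist u a v b + 2 * pdist v b w c"
proof -
 have *: "nsq (%x. f x - h x) <= 2 * nsq (%x. f x - g x) + 2 * nsq (%x. g x - h x)"
  if "L2l f" "L2l g" "L2l h" for f g h :: "(real^'n) => real" using sqn_add_le[OF L2_diff[OF that(1,2)] L2_diff[OF that(2,3)]] by simp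
 have "(\<Sum>i\<in>UNIV. nsq (%x. a i x - c i x)) <= (\<Sum>i\<in>UNIV. 2 * nsq (%x. a i x - b i x) + 2 * nsq (%x. b i x - c i x))"
  using assms by (intro sum_mono *)
 then show ?thesis unfolding pdist_def using *[OF assms(1-3)] by (simp add: sum.distrib sum_distrib_left[symmetric])
qed

lemma H0_L2: "H0 Om w g ==> L2l w"
 and H0_grad_L2: "H0 Om w g ==> L2l (g i)"
 and H0_outside: "H0 Om w g ==> x \<notin> Om ==> w x = 0"
 and H0_grad_outside: "H0 Om w g ==> x \<notin> Om ==> g i x = 0" by (auto simp: H0_def)

lemma H0_approx:
 assumes "H0 Om w g"
 obtains ps :: "nat => _" where "\<forall>j. ps j : Cci Om" "(%j. pdist (ps j) (%i. pd i (ps j)) w g) \<longlonglongrightarrow> 0"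
 using assms unfolding H0_def by blast

lemma Cc_pd_L2: "ps : Cci S ==> L2l (pd i ps)"
 by (rule Cc_infinity_L2(2)[OF pd_Cc_infinity])

lemma H0_Cc: "ps : Cci Om ==> H0 Om ps (%i. pd i ps)"
 unfolding H0_def by (intro conjI allI impI exI[of _ "%_. ps"])
  (auto simp: pdist_def sqn_def Cc_infinity_L2 Cc_pd_L2 intro: Cc_infinity_outside[OF pd_Cc_infinity] Cc_infinity_outside)

lemma pd_lincomb:
 assumes "ph : Cci S" "ps : Cci S"
 shows "pd i (%x. a * ph x + b * ps x) x = a * pd i ph x + b * pd i ps x"
proof -
 have d: "((%x. a * ph x + b * ps x) has_derivative (%h. a * frd ph (at x) h + b * frd ps (at x) h)) (at x)"
  by (intro has_derivative_add has_derivative_mult_right smooth_has_derivative Cc_infinity_smooth[OF assms(1)] Cc_infinity_smooth[OF assms(2)])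
 show ?thesis unfolding pd_def using fun_cong[OF frechet_derivative_at[OF d], of "axis i 1"] by simp
qed

lemma H0_lincomb:
 assumes w: "H0 Om w g" and w': "H0 Om w' g'"
 shows "H0 Om (%x. a * w x + b * w' x) (%i x. a * g i x + b * g' i x)"
proof -
 obtain ps :: "nat => _" where ps: "\<forall>j. ps j : Cci Om" "(%j. pdist (ps j) (%i. pd i (ps j)) w g) \<longlonglongrightarrow> 0" by (rule H0_approx[OF w])
 obtain ph :: "nat => _" where ph: "\<forall>j. ph j : Cci Om" "(%j. pdist (ph j) (%i. pd i (ph j)) w' g') \<longlonglongrightarrow> 0"
  by (rule H0_approx[OF w'])
 define \<xi> where "\<xi> = (%j x. a * ps j x + b * ph j x)"
 have \<xi>: "\<xi> j : Cci Om" for j unfolding \<xi>_def using ps(1) ph(1) by (intro Cc_infinity_lincomb) auto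
 have pd\<xi>: "pd i (\<xi> j) = (%x. a * pd i (ps j) x + b * pd i (ph j) x)" for i j
  unfolding \<xi>_def using pd_lincomb[OF spec[OF ps(1)] spec[OF ph(1)]] by (simp add: fun_eq_iff)
 have le: "pdist (\<xi> j) (%i. pd i (\<xi> j)) (%x. a * w x + b * w' x) (%i x. a * g i x + b * g' i x)
   <= 2 * a\<^sup>2 * pdist (ps j) (%i. pd i (ps j)) w g + 2 * b\<^sup>2 * pdist (ph j) (%i. pd i (ph j)) w' g'" for j unfolding pd\<xi> unfolding \<xi>_def
  by (intro pdist_lincomb Cc_infinity_L2(2)[OF spec[OF ps(1)]] Cc_infinity_L2(2)[OF spec[OF ph(1)]]
    Cc_pd_L2[OF spec[OF ps(1)]] Cc_pd_L2[OF spec[OF ph(1)]] H0_L2[OF w] H0_L2[OF w'] H0_grad_L2[OF w] H0_grad_L2[OF w'])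
 have "(%j. 2 * a\<^sup>2 * pdist (ps j) (%i. pd i (ps j)) w g + 2 * b\<^sup>2 * pdist (ph j) (%i. pd i (ph j)) w' g') \<longlonglongrightarrow> 2 * a\<^sup>2 * 0 + 2 * b\<^sup>2 * 0"
  by (intro tendsto_intros ps ph)
 then have "(%j. pdist (\<xi> j) (%i. pd i (\<xi> j)) (%x. a * w x + b * w' x) (%i x. a * g i x + b * g' i x)) \<longlonglongrightarrow> 0"
  using squeeze_0[OF _ pdist_nonneg le] by simp
 with \<xi> show ?thesis unfolding H0_def using w w' by (auto simp: H0_def intro!: L2_lincomb)
qed

lemma H0_diff:
 assumes "H0 Om w g" "H0 Om w' g'"
 shows "H0 Om (%x. w x - w' x) (%i x. g i x - g' i x)" using H0_lincomb[OF assms, of 1 "-1"] by simp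

lemma H0_zero: "H0 Om (%x. 0) (%i x. 0)"
 using H0_lincomb[OF H0_Cc[OF Cc_infinity_zero] H0_Cc[OF Cc_infinity_zero], of Om 0 0] by simp

text \<open>Diagonal choice: for each k a test function within 1/(k+1) of the k-th member.\<close>

lemma H0_closed:
 assumes w: "!!k::nat. H0 Om (w k) (g k)" and lim: "(%k. pdist (w k) (g k) v h) \<longlonglongrightarrow> 0"
  and v: "L2l v" "!!x. x \<notin> Om ==> v x = 0" and h: "!!i. L2l (h i)" "!!i x. x \<notin> Om ==> h i x = 0"
 shows "H0 Om v h"
proof -
 have "\<exists>ps. ps : Cci Om & pdist ps (%i. pd i ps) v h <= 2 * (1 / real (Suc k)) + 2 * pdist (w k) (g k) v h" for k
 proof -
  obtain ps :: "nat => _" where ps: "\<forall>j. ps j : Cci Om" "(%j. pdist (ps j) (%i. pd i (ps j)) (w k) (g k)) \<longlonglongrightarrow> 0"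
   by (rule H0_approx[OF w])
  have "eventually (%j. pdist (ps j) (%i. pd i (ps j)) (w k) (g k) < 1 / real (Suc k)) sequentially" by (rule order_tendstoD(2)[OF ps(2)]) simp
  then obtain j where j: "pdist (ps j) (%i. pd i (ps j)) (w k) (g k) < 1 / real (Suc k)" by (rule eventually_happens'[OF sequentially_bot, THEN exE])
  have "pdist (ps j) (%i. pd i (ps j)) v h <= 2 * pdist (ps j) (%i. pd i (ps j)) (w k) (g k) + 2 * pdist (w k) (g k) v h"
   by (intro pdist_triangle Cc_infinity_L2(2)[OF spec[OF ps(1)]] Cc_pd_L2[OF spec[OF ps(1)]] H0_L2[OF w] H0_grad_L2[OF w] v h)
  with j ps(1) show ?thesis by (intro exI[of _ "ps j"]) auto
 qed
 then obtain ps where ps: "!!k. ps k : Cci Om"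
  "!!k. pdist (ps k) (%i. pd i (ps k)) v h <= 2 * (1 / real (Suc k)) + 2 * pdist (w k) (g k) v h" by metis
 have "(%k. 2 * (1 / real (Suc k)) + 2 * pdist (w k) (g k) v h) \<longlonglongrightarrow> 2 * 0 + 2 * 0"
  by (intro tendsto_add tendsto_mult tendsto_const lim LIMSEQ_Suc[OF lim_1_over_n])
 then have "(%k. pdist (ps k) (%i. pd i (ps k)) v h) \<longlonglongrightarrow> 0" using squeeze_0[OF _ pdist_nonneg ps(2)] by simp
 with ps(1) show ?thesis unfolding H0_def using v h by auto
qed

lemma H0_sqn_Inc:
 assumes w: "H0 Om w g"
 shows "nsq (Inc h w) <= (norm h)\<^sup>2 * gip g g"
proof -
 obtain ps :: "nat => _" where ps: "\<forall>j. ps j : Cci Om" "(%j. pdist (ps j) (%i. pd i (ps j)) w g) \<longlonglongrightarrow> 0" by (rule H0_approx[OF w])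
 have L: "L2l (ps j)" for j by (rule Cc_infinity_L2(2)[OF spec[OF ps(1)]])
 have "(%j. nsq (%x. ps j x - w x)) \<longlonglongrightarrow> 0" by (rule squeeze_0[OF ps(2) sqn_nonneg pdist_ge(1)])
 then have "(%j. 4 * nsq (%x. ps j x - w x)) \<longlonglongrightarrow> 0" by (rule tendsto_mult_right_zero)
 then have "(%j. nsq (%x. Inc h (ps j) x - Inc h w x)) \<longlonglongrightarrow> 0"
  by (rule squeeze_0[OF _ sqn_nonneg sqn_Inc_le[OF L2_diff[OF L H0_L2[OF w]], of h, unfolded Inc_diff]])
 then have 1: "(%j. nsq (Inc h (ps j))) \<longlonglongrightarrow> nsq (Inc h w)" by (intro sqn_tendsto L2_Inc L H0_L2[OF w])
 have 2: "(%j. (norm h)\<^sup>2 * (\<Sum>i\<in>UNIV. nsq (pd i (ps j)))) \<longlonglongrightarrow> (norm h)\<^sup>2 * (\<Sum>i\<in>UNIV. nsq (g i))"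
 proof (intro tendsto_mult tendsto_const tendsto_sum sqn_tendsto Cc_pd_L2[OF spec[OF ps(1)]] H0_grad_L2[OF w])
  fix i
  show "(%j. nsq (%x. pd i (ps j) x - g i x)) \<longlonglongrightarrow> 0"
   by (rule squeeze_0[OF ps(2) sqn_nonneg]) (rule pdist_ge(2)[where a = "%i. pd i (ps j)" for j])
 qed
 show ?thesis unfolding gip_self by (rule LIMSEQ_le[OF 1 2]) (use Cc_sqn_Inc[OF spec[OF ps(1)]] in blast)
qed

lemma H0_sqn_DQ:
 assumes w: "H0 Om w g"
 shows "nsq (DQ m (axis i 1) w) <= gip g g"
proof -
 have "nsq (DQ m (axis i 1) w) = (real (Suc m))\<^sup>2 * nsq (Inc (axis i 1 /\<^sub>R real (Suc m)) w)" unfolding DQ_def[abs_def] by (rule sqn_cmult)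
 also have "\<dots> <= (real (Suc m))\<^sup>2 * ((norm (axis i (1::real) /\<^sub>R real (Suc m)))\<^sup>2 * gip g g)"
  by (intro mult_left_mono H0_sqn_Inc[OF w]) simp
 also have "\<dots> = gip g g" by (simp add: power_mult_distrib power_divide field_simps)
 finally show ?thesis .
qed

text \<open>Density: for test functions the quotients converge, and on the remainder
  \<open>H0_sqn_DQ\<close> bounds them uniformly in m. The gradient is thus a limit built from
  \<open>w\<close> alone; measurability of energies in time will come from this.\<close>

lemma H0_DQ_tendsto:
 assumes w: "H0 Om w g"
 shows "(%m. nsq (%x. DQ m (axis i 1) w x - g i x)) \<longlonglongrightarrow> 0"
proof (rule LIMSEQ_I)
 fix e :: real assume e: "e > 0"
 let ?e = "axis i (1::real)"
 \<comment> \<open>Three errors of size \<open>sqrt e / 4\<close> in norm must add up to less than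
   \<open>sqrt e\<close>.\<close>
 define d where "d = (sqrt e / 4)\<^sup>2"
 have d: "d > 0" "sqrt d = sqrt e / 4" using e by (auto simp: d_def)
 obtain ps :: "nat => _" where ps: "\<forall>j. ps j : Cci Om" "(%j. pdist (ps j) (%i. pd i (ps j)) w g) \<longlonglongrightarrow> 0" by (rule H0_approx[OF w])
 obtain j where j: "pdist (ps j) (%i. pd i (ps j)) w g < d" by (rule eventually_happens'[OF sequentially_bot order_tendstoD(2)[OF ps(2) d(1)], THEN exE])
 define ph where "ph = ps j"
 have ph: "ph : Cci Om" "pdist ph (%i. pd i ph) w g < d" using ps(1) j by (auto simp: ph_def)
 note L = Cc_infinity_L2(2)[OF ph(1)] Cc_pd_L2[OF ph(1)] H0_L2[OF w] H0_grad_L2[OF w]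
 have H: "H0 Om (%x. w x - ph x) (%i x. g i x - pd i ph x)" by (intro H0_diff w H0_Cc ph)
 have "gip (%i x. g i x - pd i ph x) (%i x. g i x - pd i ph x) <= pdist ph (%i. pd i ph) w g"
  by (simp add: gip_self pdist_def sqn_commute[of lborel "g _"] sqn_nonneg)
 then have 1: "sqrt (nsq (DQ m ?e (%x. w x - ph x))) <= sqrt e / 4" for m
  unfolding d(2)[symmetric] using H0_sqn_DQ[OF H, of m i] ph(2) by (intro real_sqrt_le_mono) linarith
 have 3: "sqrt (nsq (%x. pd i ph x - g i x)) <= sqrt e / 4"
  unfolding d(2)[symmetric] using pdist_ge(2)[where a = "%i. pd i ph" and v = ph and w = w and b = g and i = i] ph(2) by (intro real_sqrt_le_mono) linarith
 have "eventually (%m. nsq (%x. DQ m ?e ph x - pd i ph x) < d) sequentially"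
  using order_tendstoD(2)[OF Cc_difference_quotient_L2(1)[OF ph(1)] d(1)] by (simp add: pd_def)
 then obtain N where N: "!!m. m >= N ==> nsq (%x. DQ m ?e ph x - pd i ph x) < d" unfolding eventually_sequentially by blast
 have "nsq (%x. DQ m ?e w x - g i x) < e" if "m >= N" for m
 proof -
  have 2: "sqrt (nsq (%x. DQ m ?e ph x - pd i ph x)) <= sqrt e / 4" unfolding d(2)[symmetric] using N[OF that] by simp
  have "sqrt (nsq (%x. DQ m ?e w x - g i x)) <= sqrt (nsq (%x. DQ m ?e w x - DQ m ?e ph x)) + sqrt (nsq (%x. DQ m ?e ph x - g i x))"
   by (intro sqrt_sqn_triangle_diff L2_DQ L)
  also have "sqrt (nsq (%x. DQ m ?e ph x - g i x)) <= sqrt (nsq (%x. DQ m ?e ph x - pd i ph x)) + sqrt (nsq (%x. pd i ph x - g i x))"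
   by (intro sqrt_sqn_triangle_diff L2_DQ L)
  also have "(%x. DQ m ?e w x - DQ m ?e ph x) = DQ m ?e (%x. w x - ph x)" by (simp add: DQ_def Inc_def fun_eq_iff algebra_simps)
  finally have "sqrt (nsq (%x. DQ m ?e w x - g i x)) <= 3 * (sqrt e / 4)" using 1[of m] 2 3 by linarith
  also have "\<dots> < sqrt e" using e by simp
  finally show ?thesis by simp
 qed
 then show "\<exists>no. \<forall>n\<ge>no. norm (nsq (%x. DQ n ?e w x - g i x) - 0) < e" by (auto simp: sqn_nonneg)
qed

definition dqform :: "nat => ((real^'n::finite) => real) => ((real^'n) => real) => real" where
 "dqform m u w = gip (%i. DQ m (axis i 1) u) (%i. DQ m (axis i 1) w)"

lemma dqform_tendsto:
 assumes "H0 Om u a" "H0 Om w b"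
 shows "(%m. dqform m u w) \<longlonglongrightarrow> gip a b" unfolding dqform_def gip_def
 by (intro tendsto_sum ip_tendsto L2_DQ H0_L2[OF assms(1)] H0_L2[OF assms(2)] H0_grad_L2[OF assms(1)]
   H0_grad_L2[OF assms(2)] H0_DQ_tendsto[OF assms(1)] H0_DQ_tendsto[OF assms(2)])

text \<open>Smoothness and \<open>G 0 = 0\<close> keep the approximating functions in the test
  class. Their gradients are compared by splitting into G'(ps) (grad ps - g), controlled by G' <= 1,
  and (G'(ps) - G'(w)) g, controlled by dominated convergence. The second part needs pointwise
  convergence, hence the subsequence \<open>r\<close>.\<close>

lemma H0_compose:
 fixes G G' :: "real => real" and w :: "(real^'n::finite) => real"
 assumes w: "H0 Om w g" and G: "smooth G" "G 0 = 0" "!!x. (G has_real_derivative G' x) (at x)"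
  "!!x. 0 <= G' x" "!!x. G' x <= 1" "continuous_on UNIV G'"
 shows "H0 Om (%x. G (w x)) (%i x. G' (w x) * g i x)"
proof -
 have lip: "\<bar>G x - G y\<bar> <= \<bar>x - y\<bar>" for x y
 proof -
  have ex: "\<exists>d. (G has_real_derivative d) (at x) & 0 <= d & d <= 1" for x using G(3-5) by blast
  show ?thesis using mono_lip_of_deriv[OF ex, of x y] mono_lip_of_deriv[OF ex, of y x] by (cases "x <= y") auto
 qed
 have Gm: "G : bmb" by (rule borel_measurable_continuous_onI[OF smooth_continuous_on[OF G(1)]])
 have G'm: "G' : bmb" by (rule borel_measurable_continuous_onI[OF G(6)])
 have comp_m: "(%x. G (f x)) : borel_measurable lborel" "(%x. G' (f x)) : borel_measurable lborel"
  if "L2l f" for f :: "(real^'n) => real" using measurable_compose[OF L2_measurable[OF that] Gm] measurable_compose[OF L2_measurable[OF that] G'm] by auto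
 have GL: "L2l (%x. G (f x))" if "L2l f" for f :: "(real^'n) => real" by (rule L2_bound[OF that comp_m(1)[OF that]]) (use lip[of _ 0] G(2) in auto)
 have G'L: "L2l (%x. G' (f x) * h x)" "nsq (%x. G' (f x) * h x) <= nsq h"
  if "L2l f" "L2l h" for f h :: "(real^'n) => real"
 proof -
  have m: "(%x. G' (f x) * h x) : borel_measurable lborel" using comp_m(2)[OF that(1)] L2_measurable[OF that(2)] by auto
  have ae: "AE x in lborel. \<bar>G' (f x) * h x\<bar> <= \<bar>h x\<bar>" using G(4,5) by (auto simp: abs_mult intro!: mult_left_le_one_le)
  show "L2l (%x. G' (f x) * h x)" by (rule L2_bound[OF that(2) m ae])
  show "nsq (%x. G' (f x) * h x) <= nsq h" by (rule sqn_mono[OF that(2) m ae])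
 qed
 obtain ps0 :: "nat => _" where ps0: "\<forall>j. ps0 j : Cci Om" "(%j. pdist (ps0 j) (%i. pd i (ps0 j)) w g) \<longlonglongrightarrow> 0"
  by (rule H0_approx[OF w])
 have "(%j. nsq (%x. ps0 j x - w x)) \<longlonglongrightarrow> 0" by (rule squeeze_0[OF ps0(2) sqn_nonneg pdist_ge(1)])
 then obtain r :: "nat => nat" where r: "strict_mono r" "AE x in lborel. (%j. ps0 (r j) x) \<longlonglongrightarrow> w x"
  using L2_AE_subseq[of lborel ps0 w] Cc_infinity_L2(2)[OF spec[OF ps0(1)]] H0_L2[OF w] by blast
 define ps where "ps = (%j. ps0 (r j))"
 have ps: "ps j : Cci Om" for j using ps0(1) by (simp add: ps_def)
 have pslim: "(%j. pdist (ps j) (%i. pd i (ps j)) w g) \<longlonglongrightarrow> 0"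
  unfolding ps_def using LIMSEQ_subseq_LIMSEQ[OF ps0(2) r(1)] by (simp add: o_def)
 have ae: "AE x in lborel. (%j. ps j x) \<longlonglongrightarrow> w x" using r(2) by (simp add: ps_def)
 note L = Cc_infinity_L2(2)[OF ps] Cc_pd_L2[OF ps] H0_L2[OF w] H0_grad_L2[OF w]
 have pdG: "pd i (%x. G (ps j x)) = (%x. G' (ps j x) * pd i (ps j) x)" for i j
 proof
  fix x
  have d: "((%x. G (ps j x)) has_derivative (%h. G' (ps j x) * frd (ps j) (at x) h)) (at x)"
   by (rule has_derivative_compose[OF smooth_has_derivative[OF Cc_infinity_smooth[OF ps]] G(3)[unfolded has_field_derivative_def]])
  show "pd i (%x. G (ps j x)) x = G' (ps j x) * pd i (ps j) x" unfolding pd_def using fun_cong[OF frechet_derivative_at[OF d], of "axis i 1"] by simp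
 qed
 have 1: "(%j. nsq (%x. G (ps j x) - G (w x))) \<longlonglongrightarrow> 0"
 proof (rule squeeze_0[OF pslim sqn_nonneg])
  fix j
  have "nsq (%x. G (ps j x) - G (w x)) <= nsq (%x. ps j x - w x)" using comp_m(1)[OF L(1)] comp_m(1)[OF L(3)] lip by (intro sqn_mono L2_diff L) auto
  then show "nsq (%x. G (ps j x) - G (w x)) <= pdist (ps j) (%i. pd i (ps j)) w g" by (rule order_trans[OF _ pdist_ge(1)])
 qed
 have 2: "(%j. nsq (%x. G' (ps j x) * pd i (ps j) x - G' (w x) * g i x)) \<longlonglongrightarrow> 0" for i
 proof -
  have a: "(%j. nsq (%x. (G' (ps j x) - G' (w x)) * g i x)) \<longlonglongrightarrow> 0"
  proof (rule sqn_dominated_tendsto[OF _ _ L(4)])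
   show "(%x. (G' (ps j x) - G' (w x)) * g i x) : borel_measurable lborel" for j using comp_m(2)[OF L(1)] comp_m(2)[OF L(3)] L2_measurable[OF L(4)] by auto
   show "AE x in lborel. (%j. (G' (ps j x) - G' (w x)) * g i x) \<longlonglongrightarrow> 0" using ae
   proof eventually_elim
    fix x assume "(%j. ps j x) \<longlonglongrightarrow> w x"
    then have "(%j. G' (ps j x)) \<longlonglongrightarrow> G' (w x)"
     using G(6) by (intro isCont_tendsto_compose[of _ G']) (auto simp: continuous_on_eq_continuous_at)
    then show "(%j. (G' (ps j x) - G' (w x)) * g i x) \<longlonglongrightarrow> 0" by (intro tendsto_mult_left_zero) (simp add: LIM_zero)
   qed
   show "AE x in lborel. \<bar>(G' (ps j x) - G' (w x)) * g i x\<bar> <= \<bar>g i x\<bar>" for j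
   proof (rule AE_I2)
    fix x
    have "\<bar>G' (ps j x) - G' (w x)\<bar> <= 1" using G(4)[of "ps j x"] G(4)[of "w x"] G(5)[of "ps j x"] G(5)[of "w x"] by linarith
    then show "\<bar>(G' (ps j x) - G' (w x)) * g i x\<bar> <= \<bar>g i x\<bar>" by (simp add: abs_mult mult_left_le_one_le)
   qed
  qed
  have le: "nsq (%x. G' (ps j x) * pd i (ps j) x - G' (w x) * g i x)
    <= 2 * pdist (ps j) (%i. pd i (ps j)) w g + 2 * nsq (%x. (G' (ps j x) - G' (w x)) * g i x)" for j
  proof -
   have dL: "L2l (%x. pd i (ps j) x - g i x)" by (intro L2_diff L)
   have "L2l (%x. G' (ps j x) * g i x - G' (w x) * g i x)" by (intro L2_diff G'L L)
   then have "L2l (%x. (G' (ps j x) - G' (w x)) * g i x)" by (simp add: algebra_simps)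
   from sqn_add_le[OF G'L(1)[OF L(1)[of j] dL] this]
   have "nsq (%x. G' (ps j x) * (pd i (ps j) x - g i x) + (G' (ps j x) - G' (w x)) * g i x)
    <= 2 * nsq (%x. G' (ps j x) * (pd i (ps j) x - g i x)) + 2 * nsq (%x. (G' (ps j x) - G' (w x)) * g i x)" .
   moreover have "(%x. G' (ps j x) * (pd i (ps j) x - g i x) + (G' (ps j x) - G' (w x)) * g i x) = (%x. G' (ps j x) * pd i (ps j) x - G' (w x) * g i x)"
    by (simp add: algebra_simps)
   moreover have "nsq (%x. pd i (ps j) x - g i x) <= pdist (ps j) (%i. pd i (ps j)) w g" by (rule pdist_ge(2)[where a = "%i. pd i (ps j)"])
   ultimately show ?thesis using G'L(2)[OF L(1)[of j] dL] by simp
  qed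
  have "(%j. 2 * pdist (ps j) (%i. pd i (ps j)) w g + 2 * nsq (%x. (G' (ps j x) - G' (w x)) * g i x)) \<longlonglongrightarrow> 2 * 0 + 2 * 0"
   by (intro tendsto_add tendsto_mult tendsto_const pslim a)
  then show ?thesis using squeeze_0[OF _ sqn_nonneg le] by simp
 qed
 have "(%j. pdist (%x. G (ps j x)) (%i. pd i (%x. G (ps j x))) (%x. G (w x)) (%i x. G' (w x) * g i x)) \<longlonglongrightarrow> 0 + (\<Sum>i\<in>(UNIV::'n set). 0)"
  unfolding pdist_def pdG
 proof (rule tendsto_add[OF 1])
  show "(%j. \<Sum>i\<in>UNIV. nsq (%x. G' (ps j x) * pd i (ps j) x - G' (w x) * g i x)) \<longlonglongrightarrow> (\<Sum>i\<in>(UNIV::'n set). 0)"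
   by (rule tendsto_sum) (rule 2)
 qed
 then have "\<exists>ph. (\<forall>j. ph j : Cci Om) & (%j. pdist (ph j) (%i. pd i (ph j)) (%x. G (w x)) (%i x. G' (w x) * g i x)) \<longlonglongrightarrow> 0"
  using Cc_infinity_compose[OF ps G(1,2)] by (intro exI[of _ "%j x. G (ps j x)"]) simp
 moreover have "L2l (%x. G (w x))" by (rule GL[OF L(3)])
 moreover have "L2l (%x. G' (w x) * g i x)" for i by (rule G'L(1)[OF L(3,4)])
 moreover have "G (w x) = 0" "G' (w x) * g i x = 0" if "x \<notin> Om" for x i using H0_outside[OF w that] H0_grad_outside[OF w that] G(2) by simp_all
 ultimately show ?thesis unfolding H0_def by simp
qed

text \<open>Both inequalities come from G'^2 <= G' <= 1. The middle term is the local form of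
  \<open>w\<close> tested with its truncation.\<close>

lemma gip_compose_le:
 assumes w: "H0 Om w g" and G: "continuous_on UNIV G'" "!!x. 0 <= G' x" "!!x. G' x <= (1::real)"
 shows "gip (%i x. G' (w x) * g i x) (%i x. G' (w x) * g i x) <= gip g (%i x. G' (w x) * g i x)"
  "gip g (%i x. G' (w x) * g i x) <= gip g g"
proof -
 have G'm: "(%x. G' (w x)) : borel_measurable lborel" using measurable_compose[OF L2_measurable[OF H0_L2[OF w]] borel_measurable_continuous_onI[OF G(1)]] .
 have L: "L2l (%x. G' (w x) * g i x)" for i
 proof (rule L2_bound[OF H0_grad_L2[OF w, of i]])
  show "(%x. G' (w x) * g i x) : borel_measurable lborel" using G'm L2_measurable[OF H0_grad_L2[OF w]] by auto
  show "AE x in lborel. \<bar>G' (w x) * g i x\<bar> <= \<bar>g i x\<bar>" using G(2,3) by (auto simp: abs_mult intro!: mult_left_le_one_le)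
 qed
 have sq: "0 <= G' (w x) * (g i x * g i x)" "G' (w x) * (g i x * g i x) <= g i x * g i x" for i x using G(2,3)[of "w x"] by (auto intro!: mult_left_le_one_le)
 show "gip (%i x. G' (w x) * g i x) (%i x. G' (w x) * g i x) <= gip g (%i x. G' (w x) * g i x)" unfolding gip_def ip_def
 proof (intro sum_mono integral_mono L2_integrable_mult L H0_grad_L2[OF w])
  fix i x
  have "G' (w x) * (G' (w x) * (g i x * g i x)) <= G' (w x) * (g i x * g i x)" using sq(1)[of x i] G(2,3)[of "w x"] by (intro mult_left_le_one_le) auto
  then show "G' (w x) * g i x * (G' (w x) * g i x) <= g i x * (G' (w x) * g i x)" by (simp add: mult_ac)
 qed
 show "gip g (%i x. G' (w x) * g i x) <= gip g g" unfolding gip_def ip_def by (intro sum_mono integral_mono L2_integrable_mult L H0_grad_L2[OF w])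
    (use sq(2) in \<open>simp add: mult_ac\<close>)
qed

section \<open>Borel representatives of Lebesgue measurable functions\<close>

lemma AE_lebesgue_on_iff:
 assumes "Om : sets borel"
 shows "(AE x in lebesgue_on Om. P x) \<longleftrightarrow> (AE x in lborel. x : Om --> P x)"
 using assms by (subst AE_restrict_space_iff) (auto simp: AE_completion_iff)

lemma borel_measurable_lebesgue_on:
 "f : bmb ==> f : borel_measurable (lebesgue_on Om)" by (intro measurable_restrict_space1 measurable_completion) simp

text \<open>The solutions are measurable for completed measures, whereas Fubini's theorem and
  translations are applied to \<open>lborel\<close>. Every datum is therefore exchanged for a Borel
  function that vanishes outside the domain.\<close>

lemma lebesgue_on_borel_version:
 fixes F :: "'a::euclidean_space => real"
 assumes Om: "Om : sets borel" and F: "F : borel_measurable (lebesgue_on Om)"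
 shows "\<exists>f. f : bmb & (\<forall>x. x \<notin> Om --> f x = 0) & (AE x in lebesgue_on Om. F x = f x)"
proof -
 have "(%x. chf Om x * F x) : borel_measurable lebesgue" using F Om by (subst (asm) borel_measurable_restrict_space_iff) auto
 from completion_ex_borel_measurable_real[OF this]
 obtain g where g: "g : borel_measurable lborel" "AE x in lborel. chf Om x * F x = g x" by blast
 show ?thesis
 proof (intro exI[of _ "%x. chf Om x * g x"] conjI)
  show "(%x. chf Om x * g x) : bmb" using g(1) Om by simp
  have "AE x in lborel. x : Om --> F x = chf Om x * g x" using g(2) by eventually_elim auto
  then show "AE x in lebesgue_on Om. F x = chf Om x * g x" using Om by (simp add: AE_lebesgue_on_iff)
 qed auto
qed

lemma lebesgue_on_clean:
 fixes f :: "'a::euclidean_space => 'b::{banach, second_countable_topology}"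
 assumes Om: "Om : sets borel" and f: "f : bmb" "!!x. x \<notin> Om ==> f x = 0"
  and F: "F : borel_measurable (lebesgue_on Om)" "AE x in lebesgue_on Om. F x = f x"
 shows "(LINT x|lebesgue_on Om. F x) = (LBINT x. f x)"
  and "integrable (lebesgue_on Om) F \<longleftrightarrow> integrable lborel f"
proof -
 have ind: "(%x. chf Om x *\<^sub>R f x) = f" using f(2) by (auto simp: indicator_def fun_eq_iff)
 have fl: "f : borel_measurable lborel" using f(1) by simp
 have "(LINT x|lebesgue_on Om. F x) = (LINT x|lebesgue_on Om. f x)" by (rule integral_cong_AE[OF F(1) borel_measurable_lebesgue_on[OF f(1)] F(2)])
 also have "\<dots> = (LINT x|lebesgue. f x)" using Om by (subst integral_restrict_space) (auto simp: ind)
 also have "\<dots> = (LBINT x. f x)" by (rule integral_completion[OF fl])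
 finally show "(LINT x|lebesgue_on Om. F x) = (LBINT x. f x)" .
 have "integrable (lebesgue_on Om) F \<longleftrightarrow> integrable (lebesgue_on Om) f"
  by (rule integrable_cong_AE[OF F(1) borel_measurable_lebesgue_on[OF f(1)] F(2)])
 also have "\<dots> \<longleftrightarrow> integrable lebesgue f" using Om by (subst integrable_restrict_space) (auto simp: ind)
 also have "\<dots> \<longleftrightarrow> integrable lborel f" by (rule integrable_completion[OF fl])
 finally show "integrable (lebesgue_on Om) F \<longleftrightarrow> integrable lborel f" .
qed

lemma Lspace_2_iff:
 fixes f :: "'a => 'b::{real_normed_vector,second_countable_topology}"
 shows "f : Lspace 2 M \<longleftrightarrow> f : borel_measurable M & integrable M (%x. (norm (f x))\<^sup>2)"
proof -
 have p: "norm (f x) powr enn2real 2 = (norm (f x))\<^sup>2" for x by (simp add: powr_numeral)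
 show ?thesis
 proof (cases "f : borel_measurable M")
  case True
  then have "integrable M (%x. (norm (f x))\<^sup>2) \<longleftrightarrow> (\<integral>\<^sup>+x. ennreal ((norm (f x))\<^sup>2) \<partial>M) < \<infinity>"
   by (subst integrable_iff_bounded) auto
  then show ?thesis using True unfolding Lspace_def Lnorm_def p Let_def by (auto simp: less_top)
 qed (simp add: Lspace_def)
qed

lemma Lnorm_2_eq:
 fixes f :: "'a => 'b::{real_normed_vector,second_countable_topology}"
 assumes "f : borel_measurable M" "integrable M (%x. (norm (f x))\<^sup>2)"
 shows "Lnorm 2 M f = ennreal (sqrt (LINT x|M. (norm (f x))\<^sup>2))"
proof -
 have p: "norm (f x) powr enn2real 2 = (norm (f x))\<^sup>2" for x by (simp add: powr_numeral)
 have "(\<integral>\<^sup>+x. ennreal ((norm (f x))\<^sup>2) \<partial>M) = ennreal (LINT x|M. (norm (f x))\<^sup>2)"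
  by (rule nn_integral_eq_integral[OF assms(2)]) simp
 then show ?thesis unfolding Lnorm_def p Let_def by (simp add: powr_half_sqrt)
qed

lemma Lspace_2_real_iff: "f : Lspace 2 M \<longleftrightarrow> L2 M f" for f :: "'a => real"
 by (simp add: Lspace_2_iff L2_def)

lemma Lnorm_2_real: "L2 M f ==> Lnorm 2 M f = ennreal (sqrt (sqn M f))" for f :: "'a => real"
 by (subst Lnorm_2_eq) (auto simp: L2_def sqn_def)

subsection \<open>Uniqueness of weak gradients\<close>

text \<open>The positive and the negative part, taken as densities, define measures that agree on
  the boxes, an intersection-stable generator; so the densities agree a.e.\<close>

lemma AE_zero_of_boxes:
 fixes h :: "'a::euclidean_space => real"
 assumes h: "integrable lborel h" and z: "!!c d. (LBINT x. h x * indicator (box c d) x) = 0"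
 shows "AE x in lborel. h x = 0"
proof -
 have hm: "h : bmb" using h by auto
 define p where "p = (%x. max 0 (h x))"
 define n where "n = (%x. max 0 (- h x))"
 have m: "p : bmb" "n : bmb" using hm by (auto simp: p_def n_def)
 have i: "integrable lborel p" "integrable lborel n" using h by (auto simp: p_def n_def)
 have nn: "0 <= p x" "0 <= n x" for x by (auto simp: p_def n_def)
 let ?M = "density lborel (%x. ennreal (p x))" and ?N = "density lborel (%x. ennreal (n x))"
 have em: "emeasure (density lborel (%x. ennreal (k x))) B = ennreal (LBINT x. k x * indicator B x)"
  if "k : bmb" "integrable lborel k" "!!x. 0 <= k x" "B : sets borel" for k :: "'a => real" and B
 proof -
  have "emeasure (density lborel (%x. ennreal (k x))) B = (\<integral>\<^sup>+x. ennreal (k x * indicator B x) \<partial>lborel)"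
   using that by (subst emeasure_density) (auto simp: ennreal_mult' ennreal_indicator)
  also have "\<dots> = ennreal (LBINT x. k x * indicator B x)" using that by (intro nn_integral_eq_integral integrable_real_mult_indicator) auto
  finally show ?thesis .
 qed
 have "?M = ?N"
 proof (rule measure_eqI_generator_eq)
  let ?E = "range (%(a, b). box a b::'a set)"
  show "Int_stable ?E" by (auto simp: Int_stable_def box_Int_box)
  show "?E \<subseteq> Pow UNIV" "sets ?M = sigma_sets UNIV ?E" "sets ?N = sigma_sets UNIV ?E" by (simp_all add: borel_eq_box)
  let ?A = "%n::nat. box (- (real n *\<^sub>R One)) (real n *\<^sub>R One) :: 'a set"
  show "range ?A \<subseteq> ?E" "(\<Union>i. ?A i) = UNIV" unfolding UN_box_eq_UNIV by auto
  show "emeasure ?M (?A k) ~= \<infinity>" for k using em[OF m(1) i(1) nn(1)] by simp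
  fix X assume "X : ?E"
  then obtain c d where X: "X = box c d" by auto
  have "(LBINT x. p x * indicator (box c d) x) - (LBINT x. n x * indicator (box c d) x)
    = (LBINT x. p x * indicator (box c d) x - n x * indicator (box c d) x)"
   using i by (intro Bochner_Integration.integral_diff[symmetric] integrable_real_mult_indicator) auto
  also have "\<dots> = (LBINT x. h x * indicator (box c d) x)" by (intro Bochner_Integration.integral_cong) (auto simp: p_def n_def indicator_def)
  finally show "emeasure ?M X = emeasure ?N X" unfolding X using z[of c d] em[OF m(1) i(1) nn(1)] em[OF m(2) i(2) nn(2)] by simp
 qed
 then have "AE x in lborel. ennreal (p x) = ennreal (n x)" by (subst (asm) finite_density_unique)
    (use m i nn nn_integral_eq_integral[OF i(1)] in auto)
 then show ?thesis by eventually_elim (auto simp: p_def n_def max_def split: if_splits)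
qed

text \<open>Test functions converge to the indicator of any box whose closure lies in
  \<open>Om\<close>, so \<open>g\<close> integrates to 0 over such boxes and vanishes a.e. on them.
  Boundaries of boxes are null, and countably many closed boxes cover \<open>Om\<close>.\<close>

lemma fundamental_lemma:
 fixes g :: "'a::euclidean_space => real"
 assumes Om: "open Om" and g: "L2l g" "!!x. x \<notin> Om ==> g x = 0"
  and z: "!!ph. ph : Cci Om ==> (LBINT x. g x * ph x) = 0"
 shows "AE x in lborel. g x = 0"
proof -
 have gm: "g : bmb" using L2_measurable[OF g(1)] by simp
 have box: "AE x in lborel. x : cbox a b --> g x = 0" if ab: "cbox a b \<subseteq> Om" for a b
 proof -
  have Lc: "L2l (chf (cbox a b))" by (rule compact_support_L2[of _ "cbox a b" 1]) (auto simp: indicator_def)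
  have int: "integrable lborel (%x. g x * chf (cbox a b) x)" by (rule L2_integrable_mult[OF g(1) Lc])
  then have "integrable lborel (%x. (g x * chf (cbox a b) x) * chf (box a b) x)" by (intro integrable_real_mult_indicator[OF _ int]) auto
  moreover have eq: "(g x * chf (cbox a b) x) * chf (box a b) x = g x * chf (box a b) x" for x using box_subset_cbox[of a b] by (auto simp: indicator_def)
  ultimately have hint: "integrable lborel (%x. g x * chf (box a b) x)" by simp
  have "AE x in lborel. g x * chf (box a b) x = 0"
  proof (rule AE_zero_of_boxes[OF hint])
   fix c d
   define a' where "a' = (\<Sum>i\<in>Basis. max (a\<bullet>i) (c\<bullet>i) *\<^sub>R i)"
   define b' where "b' = (\<Sum>i\<in>Basis. min (b\<bullet>i) (d\<bullet>i) *\<^sub>R i)"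
   have B: "box a b \<inter> box c d = box a' b'" by (simp add: box_Int_box a'_def b'_def)
   have ind: "g x * chf (box a b) x * chf (box c d) x = g x * chf (box a' b') x" for x unfolding B[symmetric] by (auto simp: indicator_def)
   show "(LBINT x. g x * chf (box a b) x * chf (box c d) x) = 0"
   proof (cases "box a' b' = {}")
    case True
    then show ?thesis unfolding ind by simp
   next
    case False
    then have le: "a' \<bullet> i <= b' \<bullet> i" if "i : Basis" for i using that by (auto simp: box_eq_empty not_le intro: less_imp_le)
    have sub: "cbox a' b' \<subseteq> cbox a b" using le by (auto simp: subset_box a'_def b'_def)
    have ph: "box_bump a' b' m : Cci Om" for m using sub ab le by (intro box_bump_Cc_infinity) auto
    have "(%m. LBINT x. g x * box_bump a' b' m x) \<longlonglongrightarrow> (LBINT x. g x * chf (box a' b') x)"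
    proof (rule integral_dominated_convergence)
     show "integrable lborel (%x. norm (g x * chf (cbox a b) x))" using int by (rule integrable_norm)
     show "AE x in lborel. (%m. g x * box_bump a' b' m x) \<longlonglongrightarrow> g x * chf (box a' b') x"
      using le by (intro AE_I2 tendsto_mult tendsto_const box_bump_tendsto) auto
     show "AE x in lborel. norm (g x * box_bump a' b' m x) <= norm (g x * chf (cbox a b) x)" for m
     proof (rule AE_I2)
      fix x
      show "norm (g x * box_bump a' b' m x) <= norm (g x * chf (cbox a b) x)"
      proof (cases "x : cbox a b")
       case True
       then show ?thesis using box_bump_bounds[of a' b' m x] by (simp add: abs_mult mult_left_le)
      next
       case False
       then have "x \<notin> cbox a' b'" using sub by blast
       moreover have "box_bump a' b' m : Cci (cbox a' b')" using le by (intro box_bump_Cc_infinity) auto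
       ultimately have "box_bump a' b' m x = 0" using closure_subset[of "{x. box_bump a' b' m x ~= 0}"] by (auto simp: Cc_infinity_iff)
       then show ?thesis by simp
      qed
     qed
     have "box_bump a' b' m : bmb" for m using ph[of m] by (intro borel_measurable_continuous_onI smooth_continuous_on) (simp add: Cc_infinity_iff)
     then show "(%x. g x * box_bump a' b' m x) : borel_measurable lborel" for m using gm by simp
    qed (use gm in simp)
    then show ?thesis using z[OF ph] by (simp add: ind LIMSEQ_const_iff)
   qed
  qed
  moreover have "AE x in lborel. x \<notin> cbox a b - box a b"
  proof (rule AE_not_in)
   have "emeasure lborel (cbox a b - box a b) = emeasure lborel (cbox a b) - emeasure lborel (box a b)"
    using emeasure_lborel_box_finite[of a b] box_subset_cbox[of a b] by (intro emeasure_Diff) auto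
   also have "\<dots> = 0" by (simp add: emeasure_lborel_cbox_eq emeasure_lborel_box_eq)
   finally show "cbox a b - box a b : null_sets lborel" by (simp add: null_sets_def)
  qed
  ultimately show ?thesis by eventually_elim (auto simp: indicator_def split: if_splits)
 qed
 obtain \<D> where \<D>: "countable \<D>" "\<D> \<subseteq> Pow Om" "!!X. X : \<D> ==> \<exists>a b. X = cbox a b" "\<Union>\<D> = Om"
  using open_countable_Union_open_cbox[OF Om] by metis
 have "AE x in lborel. \<forall>X\<in>\<D>. x : X --> g x = 0"
 proof (subst AE_ball_countable[OF \<D>(1)], intro ballI)
  fix X assume X: "X : \<D>"
  obtain a b where "X = cbox a b" using \<D>(3)[OF X] by blast
  moreover have "X \<subseteq> Om" using X \<D>(2) by blast
  ultimately show "AE x in lborel. x : X --> g x = 0" using box by blast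
 qed
 then show ?thesis
 proof eventually_elim
  fix x assume x: "\<forall>X\<in>\<D>. x : X --> g x = 0"
  show "g x = 0"
  proof (cases "x : Om")
   case True
   then have "x : \<Union>\<D>" using \<D>(4) by simp
   then show ?thesis using x by blast
  qed (rule g(2))
 qed
qed

subsection \<open>Closed balls of \<open>H0\<close> are closed in \<open>L\<^sup>2\<close>\<close>

theorem H0_weak_closed:
 fixes v :: "(real^'n::finite) => real"
 assumes Om: "Om : sets borel" and w: "!!j::nat. H0 Om (w j) (g j)" and lim: "(%j. nsq (%x. w j x - v x)) \<longlonglongrightarrow> 0"
  and v: "L2l v" "!!x. x \<notin> Om ==> v x = 0" and C: "!!j. gip (g j) (g j) <= C"
 shows "\<exists>h. H0 Om v h & gip h h <= C"
proof -
 \<comment> \<open>Minimise the gradient norm over shrinking \<open>L\<^sup>2\<close>-balls around \<open>v\<close>; by the parallelogram law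
  almost minimisers form a Cauchy sequence.\<close>
 define P where "P = (%m::nat. {(u, a). H0 Om u a & sqrt (nsq (%x. u x - v x)) <= 1 / real (Suc m)})"
 define V where "V = (%m. (%(u, a). gip a a) ` P m)"
 define d where "d = (%m. Inf (V m))"
 have bdd: "bdd_below (V m)" for m unfolding V_def by (rule bdd_belowI[of _ 0]) (auto simp: gip_self_nonneg)
 have ex: "\<exists>j. (w j, g j) : P m" for m
 proof -
  have "(%j. sqrt (nsq (%x. w j x - v x))) \<longlonglongrightarrow> sqrt 0" by (intro tendsto_real_sqrt lim)
  then have "eventually (%j. sqrt (nsq (%x. w j x - v x)) < 1 / real (Suc m)) sequentially" by (rule order_tendstoD(2)) simp
  then obtain j where "sqrt (nsq (%x. w j x - v x)) < 1 / real (Suc m)" by (rule eventually_happens'[OF sequentially_bot, THEN exE])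
  then show ?thesis using w by (intro exI[of _ j]) (auto simp: P_def)
 qed
 have ne: "V m ~= {}" for m using ex[of m] by (auto simp: V_def)
 have dC: "d m <= C" for m
 proof -
  obtain j where j: "(w j, g j) : P m" using ex by blast
  have "d m <= gip (g j) (g j)" unfolding d_def by (rule cInf_lower[OF _ bdd]) (use j in \<open>auto simp: V_def\<close>)
  then show ?thesis using C[of j] by linarith
 qed
 have d_le: "d m <= gip a a" if "(u, a) : P m" for u a m unfolding d_def by (rule cInf_lower[OF _ bdd]) (use that in \<open>auto simp: V_def\<close>)
 have Pmono: "P k \<subseteq> P m" if "m <= k" for m k
 proof -
  have "1 / real (Suc k) <= 1 / real (Suc m)" using that by (simp add: frac_le)
  then show ?thesis unfolding P_def by auto
 qed
 have dmono: "d m <= d k" if "m <= k" for m k unfolding d_def V_def by (rule cInf_superset_mono) (use ne bdd Pmono[OF that] in \<open>auto simp: V_def\<close>)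
 have "\<exists>u a. (u, a) : P m & gip a a < d m + 1 / real (Suc m)" for m
 proof -
  have "Inf (V m) < d m + 1 / real (Suc m)" by (simp add: d_def)
  from cInf_lessD[OF ne this] show ?thesis by (auto simp: V_def)
 qed
 then obtain u a where ua: "!!m. (u m, a m) : P m" "!!m. gip (a m) (a m) < d m + 1 / real (Suc m)" by metis
 have H: "H0 Om (u m) (a m)" and uv: "sqrt (nsq (%x. u m x - v x)) <= 1 / real (Suc m)" for m using ua(1)[of m] by (auto simp: P_def)
 note L = H0_L2[OF H] H0_grad_L2[OF H]
 have par: "gip (%i x. a m i x - a k i x) (%i x. a m i x - a k i x) <= 2 * (d k - d m) + 2 / real (Suc m) + 2 / real (Suc k)"
  if "m <= k" for m k
 proof -
  have "(u k, a k) : P m" using ua(1)[of k] Pmono[OF that] by blast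
  then have ukv: "sqrt (nsq (%x. u k x - v x)) <= 1 / real (Suc m)" by (simp add: P_def)
  have "sqrt (nsq (%x. (1/2) * (u m x - v x) + (1/2) * (u k x - v x)))
    <= sqrt (nsq (%x. (1/2) * (u m x - v x))) + sqrt (nsq (%x. (1/2) * (u k x - v x)))" by (intro sqrt_sqn_triangle L2_cmult L2_diff L v)
  also have "\<dots> = (1/2) * sqrt (nsq (%x. u m x - v x)) + (1/2) * sqrt (nsq (%x. u k x - v x))"
   unfolding sqn_cmult by (simp add: real_sqrt_mult real_sqrt_power power2_eq_square real_sqrt_divide)
  also have "\<dots> <= 1 / real (Suc m)" using uv[of m] ukv by linarith
  also have "(%x. (1/2) * (u m x - v x) + (1/2) * (u k x - v x)) = (%x. ((1/2) * u m x + (1/2) * u k x) - v x)" by (auto simp: fun_eq_iff field_simps)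
  finally have "(%x. (1/2) * u m x + (1/2) * u k x, %i x. (1/2) * a m i x + (1/2) * a k i x) : P m"
   unfolding P_def using H0_lincomb[OF H[of m] H[of k], of "1/2" "1/2"] by simp
  from d_le[OF this] have "4 * d m <= gip (a m) (a m) + 2 * gip (a m) (a k) + gip (a k) (a k)"
   by (subst (asm) gip_lincomb_self[OF L(2)[of m] L(2)[of k]]) (simp add: power2_eq_square)
  moreover have "gip (%i x. a m i x - a k i x) (%i x. a m i x - a k i x) = gip (a m) (a m) - 2 * gip (a m) (a k) + gip (a k) (a k)"
   using gip_lincomb_self[OF L(2)[of m] L(2)[of k], where s = 1 and t = "-1"] by simp
  moreover have "2 / real (Suc m) = 2 * (1 / real (Suc m))" "2 / real (Suc k) = 2 * (1 / real (Suc k))" by simp_all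
  ultimately show ?thesis using ua(2)[of m] ua(2)[of k] by argo
 qed
 \<comment> \<open>The infima increase as the balls shrink and are bounded by \<open>C\<close>;
   their convergence turns the parallelogram estimate \<open>par\<close> into the Cauchy property of
   the gradients.\<close>
 have "incseq d" using dmono by (simp add: incseq_def)
 then obtain l where "d \<longlonglongrightarrow> l" using incseq_convergent[of d C] dC by blast
 then have cd: "Cauchy d" by (rule LIMSEQ_imp_Cauchy)
 have cauchy: "\<exists>N. \<forall>m\<ge>N. \<forall>k\<ge>N. nsq (%x. a m i x - a k i x) <= e" if e: "e > 0" for e i
 proof -
  obtain N1 where N1: "!!m k. m >= N1 ==> k >= N1 ==> \<bar>d m - d k\<bar> < e / 6"
   using cd e unfolding Cauchy_def dist_real_def by (metis divide_pos_pos zero_less_numeral)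
  obtain N2 :: nat where N2: "6 / e < real N2" using reals_Archimedean2 by blast
  have N2': "2 / real (Suc m) <= e / 3" if "m >= N2" for m
  proof -
   have "6 / e < real (Suc m)" using N2 that by linarith
   then show ?thesis using e by (simp add: field_simps)
  qed
  have *: "nsq (%x. a m i x - a k i x) <= e" if "m >= max N1 N2" "k >= max N1 N2" "m <= k" for m k
  proof -
   have "nsq (%x. a m i x - a k i x) <= gip (%i x. a m i x - a k i x) (%i x. a m i x - a k i x)"
    unfolding gip_self by (rule member_le_sum[where f = "%i. nsq (%x. a m i x - a k i x)"]) (auto simp: sqn_nonneg)
   also have "\<dots> <= 2 * (d k - d m) + 2 / real (Suc m) + 2 / real (Suc k)" by (rule par[OF that(3)])
   also have "\<dots> <= e"
   proof -
    have "d k - d m <= \<bar>d m - d k\<bar>" "\<bar>d m - d k\<bar> < e / 6" "2 / real (Suc m) <= e / 3" "2 / real (Suc k) <= e / 3" using N1 N2' that by auto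
    moreover have "2 * x + p + q <= e" if "x <= z" "z < e / 6" "p <= e / 3" "q <= e / 3" for p q x z :: real using that by argo
    ultimately show ?thesis by blast
   qed
   finally show ?thesis .
  qed
  show ?thesis
  proof (intro exI[of _ "max N1 N2"] allI impI)
   fix m k assume mk: "m >= max N1 N2" "k >= max N1 N2"
   show "nsq (%x. a m i x - a k i x) <= e" using *[OF mk] *[OF mk(2,1)] by (cases "m <= k") (auto simp: sqn_commute[of lborel "a m i"])
  qed
 qed
 have "\<exists>h. L2l h & (%m. nsq (%x. a m i x - h x)) \<longlonglongrightarrow> 0" for i by (rule L2_complete[OF L(2) cauchy])
 then obtain h0 where h0: "!!i. L2l (h0 i)" "!!i. (%m. nsq (%x. a m i x - h0 i x)) \<longlonglongrightarrow> 0" by metis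
 \<comment> \<open>An L2 limit is fixed only a.e.; the cut-off restores the exact vanishing outside
   \<open>Om\<close> that \<open>H0\<close> demands.\<close>
 define h where "h = (%i x. chf Om x * h0 i x)"
 have hL: "L2l (h i)" for i by (rule L2_bound[OF h0(1)[of i]]) (use Om L2_measurable[OF h0(1)[of i]] in \<open>auto simp: h_def indicator_def\<close>)
 have hlim: "(%m. nsq (%x. a m i x - h i x)) \<longlonglongrightarrow> 0" for i
 proof (rule squeeze_0[OF h0(2) sqn_nonneg])
  fix m
  have "\<bar>a m i x - h i x\<bar> <= \<bar>a m i x - h0 i x\<bar>" for x using H0_grad_outside[OF H, of x m i] by (auto simp: h_def indicator_def)
  then show "nsq (%x. a m i x - h i x) <= nsq (%x. a m i x - h0 i x)" using L2_measurable[OF L2_diff[OF L(2) hL]] by (intro sqn_mono L2_diff L h0) auto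
 qed
 have ulim: "(%m. nsq (%x. u m x - v x)) \<longlonglongrightarrow> 0"
 proof -
  have "(%m. sqrt (nsq (%x. u m x - v x))) \<longlonglongrightarrow> 0" by (rule squeeze_0[OF LIMSEQ_Suc[OF lim_1_over_n] _ uv]) (simp add: sqn_nonneg)
  from tendsto_power[OF this, of 2] show ?thesis by (simp add: sqn_nonneg)
 qed
 have "(%m. pdist (u m) (a m) v h) \<longlonglongrightarrow> 0" unfolding pdist_def using tendsto_add[OF ulim tendsto_sum[of UNIV, OF hlim]] by simp
 then have "H0 Om v h"
 proof (rule H0_closed[OF H _ v hL])
  show "h i x = 0" if "x \<notin> Om" for i x using that unfolding h_def by (simp add: indicator_def)
 qed
 moreover have "gip h h <= C"
 proof (rule LIMSEQ_le)
  show "(%m. gip (a m) (a m)) \<longlonglongrightarrow> gip h h" unfolding gip_def by (intro tendsto_sum ip_tendsto L hL hlim)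
  show "(%m. C + 1 / real (Suc m)) \<longlonglongrightarrow> C" using tendsto_add[OF tendsto_const[of C] LIMSEQ_Suc[OF lim_1_over_n]] by simp
  show "\<exists>N. \<forall>m\<ge>N. gip (a m) (a m) <= C + 1 / real (Suc m)"
  proof (intro exI allI impI)
   fix m show "gip (a m) (a m) <= C + 1 / real (Suc m)" using ua(2)[of m] dC[of m] by linarith
  qed
 qed
 ultimately show ?thesis by blast
qed

section \<open>Normal forms, and the agreement of \<open>H0\<close> with \<open>H10\<close>\<close>

definition clean :: "(real^'n) set => ((real^'n::finite) => real) => bool" where
 "clean Om w \<longleftrightarrow> L2l w & (\<forall>x. x \<notin> Om --> w x = 0)"

text \<open>Links a Lebesgue measurable function on the domain to a representative on the whole
  space. It is used for scalar functions and for gradients alike, hence the general range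
  type.\<close>

definition rep :: "(real^'n) set => ((real^'n::finite) => 'b::{real_normed_vector,second_countable_topology}) => ((real^'n) => 'b) => bool" where
 "rep Om W w \<longleftrightarrow> W : borel_measurable (lebesgue_on Om) & (AE x in lebesgue_on Om. W x = w x)"

definition ibp :: "(real^'n) set => ((real^'n::finite) => real) => ('n => (real^'n) => real) => bool" where
 "ibp Om w g \<longleftrightarrow> (\<forall>ph\<in>Cci Om. \<forall>i. ipl w (pd i ph) = - ipl (g i) ph)"

lemma clean_L2: "clean Om w ==> L2l w"
 and clean_outside: "clean Om w ==> x \<notin> Om ==> w x = 0"
 and clean_borel: "clean Om w ==> w : bmb" using L2_measurable[of lborel w] by (auto simp: clean_def)

lemma clean_diff: "clean Om v ==> clean Om w ==> clean Om (%x. v x - w x)"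
 by (auto simp: clean_def intro: L2_diff)

lemma clean_Cc: "ps : Cci Om ==> clean Om ps"
 by (auto simp: clean_def Cc_infinity_L2 Cc_infinity_outside)

lemma H0_clean: "H0 Om w g ==> clean Om w" "H0 Om w g ==> clean Om (g i)"
 by (auto simp: clean_def H0_def)

lemma rep_refl: "w : bmb ==> rep Om w w"
 by (simp add: rep_def borel_measurable_lebesgue_on)

lemma rep_measurable: "rep Om W w ==> W : borel_measurable (lebesgue_on Om)"
 by (simp add: rep_def)

lemma rep_AE: "rep Om W w ==> AE x in lebesgue_on Om. W x = w x"
 by (simp add: rep_def)

lemma rep_diff: "rep Om V v ==> rep Om W w ==> rep Om (%x. V x - W x) (%x. v x - w x)"
 unfolding rep_def by auto

lemma rep_integral:
 fixes f :: "(real^'n::finite) => 'b::{banach, second_countable_topology}"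
 assumes "Om : sets borel" "f : bmb" "!!x. x \<notin> Om ==> f x = 0" "rep Om F f"
 shows "(LINT x|lebesgue_on Om. F x) = (LBINT x. f x)" "integrable (lebesgue_on Om) F \<longleftrightarrow> integrable lborel f"
 using lebesgue_on_clean[OF assms(1-3)] assms(4) by (auto simp: rep_def)

lemma rep_sqn:
 assumes "Om : sets borel" "clean Om w" "rep Om W w"
 shows "L2 (lebesgue_on Om) W" "sqn (lebesgue_on Om) W = nsq w"
proof -
 have r: "rep Om (%x. (W x)\<^sup>2) (%x. (w x)\<^sup>2)" using assms(3) by (auto simp: rep_def)
 have m: "(%x. (w x)\<^sup>2) : bmb" using clean_borel[OF assms(2)] by simp
 note * = rep_integral[OF assms(1) m _ r]
 show "sqn (lebesgue_on Om) W = nsq w" unfolding sqn_def by (rule *(1)) (simp add: clean_outside[OF assms(2)])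
 have "integrable (lebesgue_on Om) (%x. (W x)\<^sup>2)" by (subst *(2)) (use assms(2) in \<open>auto simp: clean_def L2_def\<close>)
 then show "L2 (lebesgue_on Om) W" using assms(3) by (simp add: L2_def rep_def)
qed

lemma ex_clean_rep:
 assumes Om: "Om : sets borel" and W: "L2 (lebesgue_on Om) W"
 shows "\<exists>w. clean Om w & rep Om W w"
proof -
 obtain w where w: "w : bmb" "!!x. x \<notin> Om ==> w x = 0" "AE x in lebesgue_on Om. W x = w x"
  using lebesgue_on_borel_version[OF Om L2_measurable[OF W]] by blast
 have r: "rep Om W w" using w(3) L2_measurable[OF W] by (simp add: rep_def)
 then have r2: "rep Om (%x. (W x)\<^sup>2) (%x. (w x)\<^sup>2)" by (auto simp: rep_def)
 have "integrable lborel (%x. (w x)\<^sup>2)" by (subst rep_integral(2)[OF Om _ _ r2, symmetric]) (use w W in \<open>auto simp: L2_def\<close>)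
 then have "clean Om w" using w by (simp add: clean_def L2_def)
 with r show ?thesis by blast
qed

lemma ex_clean_rep_vec:
 fixes G :: "(real^'n::finite) => real^'n"
 assumes Om: "Om : sets borel" and G: "G : Lspace 2 (lebesgue_on Om)"
 shows "\<exists>g. (\<forall>i. clean Om (g i)) & rep Om G (%x. \<chi> i. g i x)"
proof -
 have Gm: "G : borel_measurable (lebesgue_on Om)" and Gi: "integrable (lebesgue_on Om) (%x. (norm (G x))\<^sup>2)" using G by (auto simp: Lspace_2_iff)
 have Gim: "(%x. G x $ i) : borel_measurable (lebesgue_on Om)" for i using measurable_compose[OF Gm borel_measurable_nth[of i]] .
 have "L2 (lebesgue_on Om) (%x. G x $ i)" for i
 proof (rule L2_bound[of _ "%x. norm (G x)"])
  show "L2 (lebesgue_on Om) (%x. norm (G x))" using Gm Gi by (simp add: L2_def)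
  show "AE x in lebesgue_on Om. \<bar>G x $ i\<bar> <= \<bar>norm (G x)\<bar>" by (rule AE_I2) (simp add: component_le_norm_cart)
 qed (rule Gim)
 then have "\<forall>i. \<exists>w. clean Om w & rep Om (%x. G x $ i) w" using ex_clean_rep[OF Om] by blast
 then obtain g where g: "!!i. clean Om (g i)" "!!i. rep Om (%x. G x $ i) (g i)" by metis
 have "AE x in lebesgue_on Om. \<forall>i\<in>UNIV. G x $ i = g i x" by (rule AE_finite_allI) (use rep_AE[OF g(2)] in auto)
 then have "AE x in lebesgue_on Om. G x = (\<chi> i. g i x)" by eventually_elim (simp add: vec_eq_iff)
 with g(1) Gm show ?thesis by (auto simp: rep_def)
qed

lemma clean_vec_borel:
 fixes g :: "'n::finite => (real^'n) => real"
 assumes "!!i. clean Om (g i)"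
 shows "(%x. \<chi> i. g i x) : bmb"
proof -
 have [measurable]: "g i : bmb" for i by (rule clean_borel[OF assms])
 have "(%x. \<Sum>i\<in>UNIV. g i x *\<^sub>R (axis i 1 :: real^'n)) : bmb" by measurable
 moreover have "(%x. \<Sum>i\<in>UNIV. g i x *\<^sub>R (axis i 1 :: real^'n)) = (%x. \<chi> i. g i x)"
  by (auto simp: fun_eq_iff vec_eq_iff axis_def if_distrib[of "(*) _"] cong: if_cong)
 ultimately show ?thesis by simp
qed

lemma rep_gip:
 assumes Om: "Om : sets borel" and a: "!!i. clean Om (a i)" "rep Om A (%x. \<chi> i. a i x)"
  and b: "!!i. clean Om (b i)" "rep Om B (%x. \<chi> i. b i x)"
 shows "integrable (lebesgue_on Om) (%x. A x \<bullet> B x)" "(LINT x|lebesgue_on Om. A x \<bullet> B x) = gip a b"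
proof -
 have m: "(%x. \<Sum>i\<in>UNIV. a i x * b i x) : bmb"
  using clean_borel[OF a(1)] clean_borel[OF b(1)] by (intro borel_measurable_sum borel_measurable_times) auto
 have r: "rep Om (%x. A x \<bullet> B x) (%x. \<Sum>i\<in>UNIV. a i x * b i x)"
 proof -
  have "AE x in lebesgue_on Om. A x \<bullet> B x = (\<Sum>i\<in>UNIV. a i x * b i x)"
   using rep_AE[OF a(2)] rep_AE[OF b(2)] by eventually_elim (simp add: inner_vec_def)
  then show ?thesis using rep_measurable[OF a(2)] rep_measurable[OF b(2)] by (simp add: rep_def)
 qed
 have i: "integrable lborel (%x. a i x * b i x)" for i by (rule L2_integrable_mult[OF clean_L2[OF a(1)] clean_L2[OF b(1)]])
 note * = rep_integral[OF Om m _ r]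
 show "integrable (lebesgue_on Om) (%x. A x \<bullet> B x)" by (subst *(2)) (use i in \<open>auto simp: clean_outside[OF a(1)]\<close>)
 have "(LINT x|lebesgue_on Om. A x \<bullet> B x) = (LBINT x. (\<Sum>i\<in>UNIV. a i x * b i x))" by (rule *(1)) (simp add: clean_outside[OF a(1)])
 also have "\<dots> = gip a b" unfolding gip_def ip_def by (rule Bochner_Integration.integral_sum) (rule i)
 finally show "(LINT x|lebesgue_on Om. A x \<bullet> B x) = gip a b" .
qed

lemma rep_vec_Lspace:
 assumes Om: "Om : sets borel" and a: "!!i. clean Om (a i)" "rep Om A (%x. \<chi> i. a i x)"
 shows "A : Lspace 2 (lebesgue_on Om)" "(LINT x|lebesgue_on Om. (norm (A x))\<^sup>2) = gip a a" using rep_gip[OF assms assms(2,3)] rep_measurable[OF a(2)]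
 by (auto simp: Lspace_2_iff power2_norm_eq_inner)

lemma is_weak_gradient_iff:
 assumes Om: "Om : sets borel" and w: "clean Om w" "rep Om W w" and g: "!!i. clean Om (g i)" "rep Om G (%x. \<chi> i. g i x)"
 shows "is_weak_gradient Om W G \<longleftrightarrow> ibp Om w g"
proof -
 have 1: "(LINT x|lebesgue_on Om. W x * frd ph (at x) (axis i 1)) = ipl w (pd i ph)"
  if ph: "ph : Cci Om" for ph i unfolding ip_def
 proof (rule rep_integral(1)[OF Om])
  have m: "pd i ph : bmb" by (rule Cc_infinity_borel[OF pd_Cc_infinity[OF ph]])
  show "(%x. w x * pd i ph x) : bmb" using m clean_borel[OF w(1)] by simp
  have "AE x in lebesgue_on Om. W x * frd ph (at x) (axis i 1) = w x * pd i ph x" using rep_AE[OF w(2)] by eventually_elim (simp add: pd_def)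
  moreover have "(%x. W x * frd ph (at x) (axis i 1)) : borel_measurable (lebesgue_on Om)"
   using rep_measurable[OF w(2)] borel_measurable_lebesgue_on[OF m, of Om] by (simp add: pd_def[abs_def])
  ultimately show "rep Om (%x. W x * frd ph (at x) (axis i 1)) (%x. w x * pd i ph x)" by (simp add: rep_def)
 qed (simp add: clean_outside[OF w(1)])
 have 2: "(LINT x|lebesgue_on Om. G x $ i * ph x) = ipl (g i) ph"
  if ph: "ph : Cci Om" for ph i unfolding ip_def
 proof (rule rep_integral(1)[OF Om])
  have m: "ph : bmb" by (rule Cc_infinity_borel[OF ph])
  show "(%x. g i x * ph x) : bmb" using m clean_borel[OF g(1)] by simp
  have "AE x in lebesgue_on Om. G x $ i * ph x = g i x * ph x" using rep_AE[OF g(2)] by eventually_elim simp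
  moreover have "(%x. G x $ i * ph x) : borel_measurable (lebesgue_on Om)"
   using measurable_compose[OF rep_measurable[OF g(2)] borel_measurable_nth[of i]] borel_measurable_lebesgue_on[OF m, of Om] by simp
  ultimately show "rep Om (%x. G x $ i * ph x) (%x. g i x * ph x)" by (simp add: rep_def)
 qed (simp add: clean_outside[OF g(1)])
 show ?thesis unfolding is_weak_gradient_def ibp_def using 1 2 by auto
qed

lemma H0_ibp:
 fixes w :: "(real^'n::finite) => real"
 assumes w: "H0 Om w g"
 shows "ibp Om w g" unfolding ibp_def
proof (intro ballI allI)
 fix ph i assume ph: "ph : Cci Om"
 obtain ps :: "nat => _" where ps: "\<forall>j. ps j : Cci Om" "(%j. pdist (ps j) (%i. pd i (ps j)) w g) \<longlonglongrightarrow> 0" by (rule H0_approx[OF w])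
 note L = Cc_infinity_L2(2)[OF spec[OF ps(1)]] Cc_pd_L2[OF spec[OF ps(1)]] H0_L2[OF w] H0_grad_L2[OF w] Cc_infinity_L2(2)[OF ph] Cc_pd_L2[OF ph]
 have z: "(%j::nat. nsq (%x. f x - f x)) \<longlonglongrightarrow> 0" for f :: "(real^'n) => real" by (simp add: sqn_def)
 have "(%j. ipl (ps j) (pd i ph)) \<longlonglongrightarrow> ipl w (pd i ph)" by (intro ip_tendsto L z squeeze_0[OF ps(2) sqn_nonneg pdist_ge(1)])
 moreover have "(%j. - ipl (pd i (ps j)) ph) \<longlonglongrightarrow> - ipl (g i) ph"
  by (intro tendsto_minus ip_tendsto L z squeeze_0[OF ps(2) sqn_nonneg]) (rule pdist_ge(2)[where a = "%i. pd i (ps j)" for j])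
 moreover have "ipl (ps j) (pd i ph) = - ipl (pd i (ps j)) ph" for j by (rule Cc_by_parts[OF spec[OF ps(1)] ph])
 ultimately show "ipl w (pd i ph) = - ipl (g i) ph" using LIMSEQ_unique by simp
qed

text \<open>Since \<open>weak_gradient\<close> is an arbitrary choice, integrals containing it can
  be evaluated only because all candidates agree a.e.\<close>

lemma ibp_unique:
 assumes Om: "open Om" and g: "!!i. clean Om (g i)" "!!i. clean Om (g' i)" and i: "ibp Om w g" "ibp Om w g'"
 shows "AE x in lborel. (\<chi> i. g i x) = (\<chi> i. g' i x)"
proof -
 have "AE x in lborel. g i x - g' i x = 0" for i
 proof (rule fundamental_lemma[OF Om])
  show "L2l (%x. g i x - g' i x)" by (intro L2_diff clean_L2[OF g(1)] clean_L2[OF g(2)])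
  show "g i x - g' i x = 0" if "x \<notin> Om" for x using that by (simp add: clean_outside[OF g(1)] clean_outside[OF g(2)])
  fix ph assume ph: "ph : Cci Om"
  have "ipl (g i) ph = ipl (g' i) ph" using i ph unfolding ibp_def by (metis neg_equal_iff_equal)
  then show "(LBINT x. (g i x - g' i x) * ph x) = 0"
   using ip_diff_left[OF clean_L2[OF g(1)] clean_L2[OF g(2)] Cc_infinity_L2(2)[OF ph], of i i] by (simp add: ip_def)
 qed
 then have "AE x in lborel. \<forall>i\<in>UNIV. g i x - g' i x = 0" by (intro AE_finite_allI) auto
 then show ?thesis by eventually_elim (simp add: vec_eq_iff)
qed

lemma weak_gradient_rep:
 assumes Om: "open Om" and w: "clean Om w" "rep Om W w" and g: "!!i. clean Om (g i)" "ibp Om w g"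
 shows "W : H1 Om" "rep Om (weak_gradient Om W) (%x. \<chi> i. g i x)" "H1_norm Om W = sqrt (nsq w + gip g g)"
proof -
 have Omb: "Om : sets borel" using Om by simp
 let ?G = "%x. \<chi> i. g i x"
 have r: "rep Om ?G ?G" by (rule rep_refl[OF clean_vec_borel[OF g(1)]])
 have G: "?G : Lspace 2 (lebesgue_on Om)" by (rule rep_vec_Lspace(1)[OF Omb g(1) r])
 have wG: "is_weak_gradient Om W ?G" using is_weak_gradient_iff[OF Omb w g(1) r] g(2) by simp
 show "W : H1 Om" unfolding H1_def using G wG rep_sqn(1)[OF Omb w] by (auto simp: Lspace_2_real_iff)
 have *: "weak_gradient Om W : Lspace 2 (lebesgue_on Om) & is_weak_gradient Om W (weak_gradient Om W)"
  unfolding weak_gradient_def by (rule someI[of _ ?G]) (use G wG in blast)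
 obtain g' where g': "!!i. clean Om (g' i)" "rep Om (weak_gradient Om W) (%x. \<chi> i. g' i x)" using ex_clean_rep_vec[OF Omb conjunct1[OF *]] by blast
 have "ibp Om w g'" using is_weak_gradient_iff[OF Omb w g'] * by blast
 from ibp_unique[OF Om g'(1) g(1) this g(2)]
 have "AE x in lebesgue_on Om. (\<chi> i. g' i x) = ?G x" unfolding AE_lebesgue_on_iff[OF Omb] by eventually_elim simp
 with rep_AE[OF g'(2)] have "AE x in lebesgue_on Om. weak_gradient Om W x = ?G x" by eventually_elim simp
 then show rG: "rep Om (weak_gradient Om W) ?G" using rep_measurable[OF g'(2)] by (simp add: rep_def)
 show "H1_norm Om W = sqrt (nsq w + gip g g)" unfolding H1_norm_def rep_vec_Lspace(2)[OF Omb g(1) rG] using rep_sqn(2)[OF Omb w] by (simp add: sqn_def)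
qed

lemma ibp_diff:
 assumes "clean Om w" "clean Om w'" "!!i. clean Om (g i)" "!!i. clean Om (g' i)" "ibp Om w g" "ibp Om w' g'"
 shows "ibp Om (%x. w x - w' x) (%i x. g i x - g' i x)" unfolding ibp_def
proof (intro ballI allI)
 fix ph i assume ph: "ph : Cci Om"
 have "ipl (%x. w x - w' x) (pd i ph) = ipl w (pd i ph) - ipl w' (pd i ph)" by (intro ip_diff_left clean_L2[OF assms(1)] clean_L2[OF assms(2)] Cc_pd_L2[OF ph])
 also have "\<dots> = - (ipl (g i) ph - ipl (g' i) ph)" using assms(5,6) ph by (simp add: ibp_def)
 also have "ipl (g i) ph - ipl (g' i) ph = ipl (%x. g i x - g' i x) ph"
  by (intro ip_diff_left[symmetric] clean_L2[OF assms(3)] clean_L2[OF assms(4)] Cc_infinity_L2(2)[OF ph])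
 finally show "ipl (%x. w x - w' x) (pd i ph) = - ipl (%x. g i x - g' i x) ph" .
qed

text \<open>Both closures use the same test functions, and by uniqueness of weak gradients the
  \<open>H1_norm\<close> of a difference is the square root of \<open>pdist\<close>.\<close>

theorem H0_imp_H10:
 assumes Om: "open Om" and w: "H0 Om w g" and W: "rep Om W w"
 shows "W : H10 Om" "rep Om (weak_gradient Om W) (%x. \<chi> i. g i x)" "H1_norm Om W = sqrt (nsq w + gip g g)"
proof -
 note c = H0_clean[OF w]
 show "rep Om (weak_gradient Om W) (%x. \<chi> i. g i x)" "H1_norm Om W = sqrt (nsq w + gip g g)"
  using weak_gradient_rep[OF Om c(1) W c(2) H0_ibp[OF w]] by auto
 obtain ps :: "nat => _" where ps: "\<forall>j. ps j : Cci Om" "(%j. pdist (ps j) (%i. pd i (ps j)) w g) \<longlonglongrightarrow> 0" by (rule H0_approx[OF w])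
 have "H1_norm Om (%x. W x - ps j x) = sqrt (pdist (ps j) (%i. pd i (ps j)) w g)" for j
 proof -
  have cd: "clean Om (%x. w x - ps j x)" "!!i. clean Om (%x. g i x - pd i (ps j) x)"
   by (intro clean_diff c clean_Cc[OF spec[OF ps(1)]] clean_Cc[OF pd_Cc_infinity[OF spec[OF ps(1)]]])+
  have "H1_norm Om (%x. W x - ps j x) = sqrt (nsq (%x. w x - ps j x) + gip (%i x. g i x - pd i (ps j) x) (%i x. g i x - pd i (ps j) x))"
   by (rule weak_gradient_rep(3)[OF Om cd(1) rep_diff[OF W rep_refl[OF Cc_infinity_borel[OF spec[OF ps(1)]]]] cd(2)
     H0_ibp[OF H0_diff[OF w H0_Cc[OF spec[OF ps(1)]]]]])
  then show ?thesis by (simp add: gip_self pdist_def sqn_commute[of lborel w] sqn_commute[of lborel "g _"])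
 qed
 then have "(%j. H1_norm Om (%x. W x - ps j x)) \<longlonglongrightarrow> 0" using tendsto_real_sqrt[OF ps(2)] by simp
 then show "W : H10 Om" unfolding H10_def using weak_gradient_rep(1)[OF Om c(1) W c(2) H0_ibp[OF w]] ps(1) by blast
qed

text \<open>The gradient is taken from membership in \<open>H1\<close>; the approximating sequence
  of \<open>H10\<close> then converges to this pair, because \<open>H1_norm\<close> is again the
  square root of \<open>pdist\<close>.\<close>

theorem H10_imp_H0:
 assumes Om: "open Om" and W: "W : H10 Om" "rep Om W w" and w: "clean Om w"
 shows "\<exists>g. H0 Om w g"
proof -
 have Omb: "Om : sets borel" using Om by simp
 obtain G where G: "G : Lspace 2 (lebesgue_on Om)" "is_weak_gradient Om W G" using W(1) by (auto simp: H10_def H1_def)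
 obtain g where g: "!!i. clean Om (g i)" "rep Om G (%x. \<chi> i. g i x)" using ex_clean_rep_vec[OF Omb G(1)] by blast
 have i: "ibp Om w g" using is_weak_gradient_iff[OF Omb w W(2) g] G(2) by blast
 obtain ps where ps: "\<forall>j::nat. ps j : Cci Om" "(%j. H1_norm Om (%x. W x - ps j x)) \<longlonglongrightarrow> 0" using W(1) by (auto simp: H10_def)
 have "H1_norm Om (%x. W x - ps j x) = sqrt (pdist (ps j) (%i. pd i (ps j)) w g)" for j
 proof -
  have cd: "clean Om (%x. w x - ps j x)" "!!i. clean Om (%x. g i x - pd i (ps j) x)"
   by (intro clean_diff w g clean_Cc[OF spec[OF ps(1)]] clean_Cc[OF pd_Cc_infinity[OF spec[OF ps(1)]]])+
  have "ibp Om (%x. w x - ps j x) (%i x. g i x - pd i (ps j) x)"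
   by (intro ibp_diff w g i clean_Cc[OF spec[OF ps(1)]] clean_Cc[OF pd_Cc_infinity[OF spec[OF ps(1)]]] H0_ibp[OF H0_Cc[OF spec[OF ps(1)]]])
  then have "H1_norm Om (%x. W x - ps j x) = sqrt (nsq (%x. w x - ps j x) + gip (%i x. g i x - pd i (ps j) x) (%i x. g i x - pd i (ps j) x))"
   by (rule weak_gradient_rep(3)[OF Om cd(1) rep_diff[OF W(2) rep_refl[OF Cc_infinity_borel[OF spec[OF ps(1)]]]] cd(2)])
  then show ?thesis by (simp add: gip_self pdist_def sqn_commute[of lborel w] sqn_commute[of lborel "g _"])
 qed
 then have "(%j. (sqrt (pdist (ps j) (%i. pd i (ps j)) w g))\<^sup>2) \<longlonglongrightarrow> 0\<^sup>2" using ps(2) by (intro tendsto_power) simp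
 then have "(%j. pdist (ps j) (%i. pd i (ps j)) w g) \<longlonglongrightarrow> 0" by (simp add: pdist_nonneg)
 then have "H0 Om w g" unfolding H0_def using ps(1) w g(1) by (auto simp: clean_def)
 then show ?thesis by blast
qed

subsection \<open>A weak Sobolev inequality\<close>

lemma L1_of_L2_support:
 fixes f :: "'a::euclidean_space => real"
 assumes f: "L2l f" and A: "A : sets borel" "emeasure lborel A < \<infinity>" "!!x. x \<notin> A ==> f x = 0"
 shows "integrable lborel f" "(LBINT x. \<bar>f x\<bar>)\<^sup>2 <= measure lborel A * nsq f"
proof -
 have LA: "L2l (chf A)" using A(1,2) by (simp add: L2_def power2_eq_square flip: indicator_inter_arith)
 have La: "L2l (%x. \<bar>f x\<bar>)" using f by (auto simp: L2_def)
 have e: "\<bar>f x\<bar> * chf A x = \<bar>f x\<bar>" for x using A(3)[of x] by (auto simp: indicator_def)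
 have "integrable lborel (%x. \<bar>f x\<bar>)" using L2_integrable_mult[OF La LA] by (simp add: e)
 then show "integrable lborel f" using L2_measurable[OF f] by (simp add: integrable_abs_iff)
 have "nsq (chf A) = measure lborel A" using A(1,2) by (simp add: sqn_def power2_eq_square flip: indicator_inter_arith)
 moreover have "nsq (%x. \<bar>f x\<bar>) = nsq f" by (simp add: sqn_def)
 moreover have "ipl (%x. \<bar>f x\<bar>) (chf A) = (LBINT x. \<bar>f x\<bar>)" by (simp add: ip_def e)
 ultimately show "(LBINT x. \<bar>f x\<bar>)\<^sup>2 <= measure lborel A * nsq f" using ip_Cauchy_Schwarz[OF La LA] by (simp add: mult.commute)
qed

text \<open>Averaging \<open>2 \<parallel>f\<parallel>\<^sup>2 = \<parallel>f(\<sqdot> + h) - f\<parallel>\<^sup>2 + 2 \<langle>f(\<sqdot> + h), f\<rangle>\<close> over all \<open>h\<close> in a cube of volume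
 \<open>2 |A|\<close>: the average of the inner products is at most \<open>\<parallel>f\<parallel>\<^sub>1\<^sup>2 / (2 |A|) <= \<parallel>f\<parallel>\<^sup>2 / 2\<close>.\<close>

theorem Faber_Krahn:
 fixes f :: "(real^'n::finite) => real" and D :: real
 assumes f: "L2l f" and A: "A : sets borel" "emeasure lborel A < \<infinity>" "!!x. x \<notin> A ==> f x = 0"
  and D: "!!h. nsq (Inc h f) <= (norm h)\<^sup>2 * D"
 shows "nsq f <= CARD('n) * (2 * measure lborel A) powr (2 / CARD('n)) * D"
proof (cases "measure lborel A = 0")
 case True
 have "(LBINT x. \<bar>f x\<bar>)\<^sup>2 <= 0" using L1_of_L2_support(2)[OF f A] True by simp
 then have "(LBINT x. \<bar>f x\<bar>) = 0" by simp
 then have "AE x in lborel. \<bar>f x\<bar> = 0" using L1_of_L2_support(1)[OF f A] by (subst (asm) integral_nonneg_eq_0_iff_AE) auto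
 then have "AE x in lborel. (f x)\<^sup>2 = 0" by eventually_elim simp
 then have "nsq f = (LINT x|(lborel::(real^'n) measure). 0)" unfolding sqn_def using L2_measurable[OF f] by (intro integral_cong_AE) auto
 then show ?thesis using True by simp
next
 case False
 define a where "a = measure lborel A"
 have a: "a > 0" using False by (simp add: a_def zero_less_measure_iff)
 define l where "l = (2 * a) powr (1 / CARD('n))"
 have l: "l > 0" using a by (simp add: l_def)
 have ln: "l ^ CARD('n) = 2 * a" using a by (simp add: l_def powr_realpow[symmetric] powr_powr)
 have l2: "l\<^sup>2 = (2 * a) powr (2 / CARD('n))" using a by (simp add: l_def powr_realpow[symmetric] powr_powr)
 have D0: "0 <= D" using D[of "axis undefined 1"] sqn_nonneg[of lborel "Inc (axis undefined 1) f"] by simp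
 define Q where "Q = cbox (0::real^'n) (\<chi> i. l)"
 have Qb: "Q : sets borel" by (simp add: Q_def)
 have emQ: "emeasure lborel Q = ennreal (2 * a)"
 proof -
  have "emeasure lborel Q = ennreal (\<Prod>b\<in>Basis. ((\<chi> i. l) - 0 :: real^'n) \<bullet> b)"
   unfolding Q_def using l by (intro emeasure_lborel_cbox) (auto simp: Basis_vec_def inner_axis)
  also have "(\<Prod>b\<in>Basis. ((\<chi> i. l) - 0 :: real^'n) \<bullet> b) = (\<Prod>b\<in>(Basis::(real^'n) set). l)"
   by (intro prod.cong) (auto simp: Basis_vec_def inner_axis)
  also have "\<dots> = 2 * a" using ln by simp
  finally show ?thesis .
 qed
 have hQ: "(norm h)\<^sup>2 <= CARD('n) * l\<^sup>2" if "h : Q" for h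
 proof -
  have "0 <= h $ i & h $ i <= l" for i using that by (simp add: Q_def mem_box_cart)
  then have "(\<Sum>i\<in>UNIV. (h $ i)\<^sup>2) <= (\<Sum>i\<in>(UNIV::'n set). l\<^sup>2)" by (intro sum_mono power_mono) auto
  then show ?thesis by (simp add: norm_vec_def L2_set_def sum_nonneg)
 qed
 have fb: "f : bmb" using L2_measurable[OF f] by simp
 define F where "F = (%h. \<integral>\<^sup>+x. ennreal (\<bar>f (x + h)\<bar> * \<bar>f x\<bar>) \<partial>lborel)"
 have pm: "(%(h, x). ennreal (\<bar>f (x + h)\<bar> * \<bar>f x\<bar>)) : borel_measurable (lborel \<Otimes>\<^sub>M lborel)"
 proof -
  have "(%z::(real^'n) \<times> (real^'n). snd z + fst z) : borel_measurable (lborel \<Otimes>\<^sub>M lborel)"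
   "(%z::(real^'n) \<times> (real^'n). snd z) : borel_measurable (lborel \<Otimes>\<^sub>M lborel)" by measurable
  from measurable_compose[OF this(1) fb] measurable_compose[OF this(2) fb]
  show ?thesis by (simp add: case_prod_beta)
 qed
 have Fm: "F : bmb" unfolding F_def using lborel.borel_measurable_nn_integral[OF pm] by simp
 have Fint: "(\<integral>\<^sup>+h. F h \<partial>lborel) <= ennreal (a * nsq f)"
 proof -
  have "(\<integral>\<^sup>+h. F h \<partial>lborel) = (\<integral>\<^sup>+x. \<integral>\<^sup>+h. ennreal (\<bar>f (x + h)\<bar> * \<bar>f x\<bar>) \<partial>lborel \<partial>lborel)"
   unfolding F_def using lborel_pair.Fubini'[OF pm] by simp
  also have "\<dots> = (\<integral>\<^sup>+x. ennreal \<bar>f x\<bar> * ennreal (LBINT x. \<bar>f x\<bar>) \<partial>lborel)"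
  proof (rule nn_integral_cong)
   fix x
   have "(\<integral>\<^sup>+h. ennreal (\<bar>f (x + h)\<bar> * \<bar>f x\<bar>) \<partial>lborel) = (\<integral>\<^sup>+h. ennreal (\<bar>f (h + x)\<bar>) * ennreal \<bar>f x\<bar> \<partial>lborel)"
    by (simp add: ennreal_mult add.commute)
   also have "\<dots> = (\<integral>\<^sup>+h. ennreal (\<bar>f (h + x)\<bar>) \<partial>lborel) * ennreal \<bar>f x\<bar>"
    using measurable_compose[OF _ fb, of "%h. h + x" borel] by (intro nn_integral_multc) simp
   also have "(\<integral>\<^sup>+h. ennreal (\<bar>f (h + x)\<bar>) \<partial>lborel) = (\<integral>\<^sup>+h. ennreal (\<bar>f h\<bar>) \<partial>lborel)"
    using fb by (intro nn_integral_lborel_shift) simp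
   also have "\<dots> = ennreal (LBINT x. \<bar>f x\<bar>)" using L1_of_L2_support(1)[OF f A] by (intro nn_integral_eq_integral) auto
   finally show "(\<integral>\<^sup>+h. ennreal (\<bar>f (x + h)\<bar> * \<bar>f x\<bar>) \<partial>lborel) = ennreal \<bar>f x\<bar> * ennreal (LBINT x. \<bar>f x\<bar>)"
    by (simp add: mult.commute)
  qed
  also have "\<dots> = (\<integral>\<^sup>+x. ennreal \<bar>f x\<bar> \<partial>lborel) * ennreal (LBINT x. \<bar>f x\<bar>)"
   using fb by (intro nn_integral_multc) simp
  also have "(\<integral>\<^sup>+h. ennreal (\<bar>f h\<bar>) \<partial>lborel) = ennreal (LBINT x. \<bar>f x\<bar>)"
   using L1_of_L2_support(1)[OF f A] by (intro nn_integral_eq_integral) auto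
  also have "ennreal (LBINT x. \<bar>f x\<bar>) * ennreal (LBINT x. \<bar>f x\<bar>) = ennreal ((LBINT x. \<bar>f x\<bar>)\<^sup>2)"
   by (simp add: power2_eq_square ennreal_mult)
  also have "\<dots> <= ennreal (a * nsq f)" unfolding a_def by (intro ennreal_leI L1_of_L2_support(2)[OF f A])
  finally show ?thesis .
 qed
 let ?s = "nsq f"
 have pt: "ennreal (2 * ?s) <= ennreal (CARD('n) * l\<^sup>2 * D) + 2 * F h" if h: "h : Q" for h
 proof -
  have fh: "L2l (%x. f (x + h))" by (rule L2_shift(1)[OF f])
  have i: "integrable lborel (%x. \<bar>f (x + h)\<bar> * \<bar>f x\<bar>)" using integrable_abs[OF L2_integrable_mult[OF fh f]] by (simp add: abs_mult)
  have "nsq (Inc h f) = ?s - 2 * ipl (%x. f (x + h)) f + ?s" using sqn_lincomb[OF fh f, of 1 "-1"] L2_shift(2)[OF f, of h] by (simp add: Inc_def[abs_def])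
  then have "2 * ?s <= CARD('n) * l\<^sup>2 * D + 2 * ipl (%x. f (x + h)) f" using D[of h] mult_right_mono[OF hQ[OF h] D0] by linarith
  also have "ipl (%x. f (x + h)) f <= (LBINT x. \<bar>f (x + h)\<bar> * \<bar>f x\<bar>)" unfolding ip_def using i L2_integrable_mult[OF fh f]
   by (intro integral_mono) (auto simp: abs_mult[symmetric])
  finally have "2 * ?s <= CARD('n) * l\<^sup>2 * D + 2 * (LBINT x. \<bar>f (x + h)\<bar> * \<bar>f x\<bar>)" by simp
  then have "ennreal (2 * ?s) <= ennreal (CARD('n) * l\<^sup>2 * D + 2 * (LBINT x. \<bar>f (x + h)\<bar> * \<bar>f x\<bar>))" by (rule ennreal_leI)
  also have "\<dots> = ennreal (CARD('n) * l\<^sup>2 * D) + 2 * ennreal (LBINT x. \<bar>f (x + h)\<bar> * \<bar>f x\<bar>)"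
   using D0 by (subst ennreal_plus) (auto simp: ennreal_mult intro!: integral_nonneg_AE)
  also have "ennreal (LBINT x. \<bar>f (x + h)\<bar> * \<bar>f x\<bar>) = F h" unfolding F_def by (intro nn_integral_eq_integral[symmetric] i) auto
  finally show ?thesis .
 qed
 have "ennreal (2 * ?s) * emeasure lborel Q = (\<integral>\<^sup>+h. ennreal (2 * ?s) * indicator Q h \<partial>lborel)"
  using Qb by (simp add: nn_integral_cmult_indicator)
 also have "\<dots> <= (\<integral>\<^sup>+h. ennreal (CARD('n) * l\<^sup>2 * D) * indicator Q h + 2 * F h \<partial>lborel)"
  using pt by (intro nn_integral_mono) (auto simp: indicator_def)
 also have "\<dots> = ennreal (CARD('n) * l\<^sup>2 * D) * emeasure lborel Q + 2 * (\<integral>\<^sup>+h. F h \<partial>lborel)"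
  using Qb Fm by (subst nn_integral_add) (auto simp: nn_integral_cmult_indicator nn_integral_cmult)
 also have "\<dots> <= ennreal (CARD('n) * l\<^sup>2 * D) * emeasure lborel Q + 2 * ennreal (a * ?s)" by (intro add_left_mono mult_left_mono Fint) auto
 also have "\<dots> = ennreal (CARD('n) * l\<^sup>2 * D * (2 * a) + 2 * (a * ?s))"
  unfolding emQ using D0 a sqn_nonneg[of lborel f] by (subst ennreal_plus) (auto simp: ennreal_mult)
 also have "ennreal (2 * ?s) * emeasure lborel Q = ennreal (2 * ?s * (2 * a))"
  unfolding emQ using a sqn_nonneg[of lborel f] by (intro ennreal_mult[symmetric]) auto
 finally have "2 * ?s * (2 * a) <= CARD('n) * l\<^sup>2 * D * (2 * a) + 2 * (a * ?s)" using D0 a sqn_nonneg[of lborel f] by (subst (asm) ennreal_le_iff) auto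
 \<comment> \<open>The term \<open>2 * (a * ?s)\<close> is half of the left side and is
   absorbed.\<close>
 then have "?s * (2 * a) <= (CARD('n) * l\<^sup>2 * D) * (2 * a)" by (simp add: algebra_simps)
 then have "?s <= CARD('n) * l\<^sup>2 * D" using a by simp
 then show ?thesis by (simp add: l2 a_def)
qed

text \<open>Chebyshev's inequality and \<open>Faber_Krahn\<close>, applied to the part of
  \<open>f\<close> above l/2, bound the level set at l by the power 1 - th = 2/n of the level set at
  l/2. For N(l) = l^2 a(l)^th with supremum S this reads N(l) <= (K D)^th (4 S)^(1 - th), so S
  bounds itself. Boundedness of \<open>f\<close> makes S finite.\<close>

theorem weak_Sobolev:
 fixes f :: "(real^'n::finite) => real" and D :: real
 assumes n: "CARD('n) > 2" and f: "L2l f" "!!x. 0 <= f x" "!!x. f x <= M"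
  and A: "A : sets borel" "emeasure lborel A < \<infinity>" "!!x. x \<notin> A ==> f x = 0"
  and D: "!!h. nsq (Inc h f) <= (norm h)\<^sup>2 * D" and lam: "lam > 0"
 shows "lam\<^sup>2 * measure lborel {x. lam <= f x} powr (1 - 2 / CARD('n)) <= 64 * (16 * CARD('n)) * D"
proof -
 define th where "th = 1 - 2 / real CARD('n)"
 \<comment> \<open>A factor 4 stems from the square of l/2, another 4 bounds
   \<open>2 powr (2 / CARD('n))\<close>.\<close>
 define K where "K = 16 * real CARD('n)"
 define a where "a = (%l. measure lborel {x. l <= f x})"
 have th: "1/3 <= th" "th < 1" using n by (auto simp: th_def field_simps)
 have K: "K > 0" by (simp add: K_def)
 have D0: "0 <= D" using D[of "axis undefined 1"] sqn_nonneg[of lborel "Inc (axis undefined 1) f"] by simp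
 have fb: "f : bmb" using L2_measurable[OF f(1)] by simp
 have lev: "{x. l <= f x} : sets borel" for l using fb by simp
 have lev': "{x. l <= f x} : sets lborel" for l using fb by simp
 have levA: "{x. l <= f x} \<subseteq> A" if "l > 0" for l
 proof
  fix x assume "x : {x. l <= f x}"
  then show "x : A" using A(3)[of x] that by force
 qed
 have fin: "emeasure lborel {x. l <= f x} < \<infinity>" if "l > 0" for l using emeasure_mono[OF levA[OF that], of lborel] A by (simp add: le_less_trans)
 have aA: "a l <= measure lborel A" if "l > 0" for l unfolding a_def using levA[OF that] A lev by (intro measure_mono_fmeasurable fmeasurableI) auto
 have step: "l\<^sup>2 * a l <= K * a (l/2) powr (1 - th) * D" if l: "l > 0" for l
 proof -
  define g where "g = (%x. max 0 (f x - l/2))"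
  have gm: "g : borel_measurable lborel" using fb by (simp add: g_def)
  have g: "L2l g" by (rule L2_bound[OF f(1) gm]) (use f(2) l in \<open>auto simp: g_def\<close>)
  have Dg: "nsq (Inc h g) <= (norm h)\<^sup>2 * D" for h
  proof -
   have "nsq (Inc h g) <= nsq (Inc h f)" by (rule sqn_mono[OF L2_Inc[OF f(1)] L2_measurable[OF L2_Inc[OF g]]]) (auto simp: Inc_def g_def)
   then show ?thesis using D[of h] by linarith
  qed
  have "nsq g <= CARD('n) * (2 * measure lborel {x. l/2 <= f x}) powr (2 / CARD('n)) * D"
   by (rule Faber_Krahn[OF g lev fin _ Dg]) (use l in \<open>auto simp: g_def\<close>)
  also have "(2 * measure lborel {x. l/2 <= f x}) powr (2 / CARD('n)) = 2 powr (2 / CARD('n)) * a (l/2) powr (1 - th)" by (simp add: powr_mult a_def th_def)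
  also have "CARD('n) * (2 powr (2 / CARD('n)) * a (l/2) powr (1 - th)) * D <= CARD('n) * (4 * a (l/2) powr (1 - th)) * D"
  proof -
   have "2 powr (2 / real CARD('n)) <= 2 powr 2" using n by (intro powr_mono) (auto simp: field_simps)
   then have "2 powr (2 / real CARD('n)) <= 4" by simp
   then show ?thesis using D0 by (intro mult_right_mono mult_left_mono) auto
  qed
  finally have up: "nsq g <= CARD('n) * (4 * a (l/2) powr (1 - th)) * D" .
  have "(l/2)\<^sup>2 * a l = (LBINT x. (l/2)\<^sup>2 * chf {x. l <= f x} x)" by (simp add: a_def)
  also have "\<dots> <= nsq g" unfolding sqn_def
  proof (rule integral_mono)
   show "integrable lborel (%x. (l/2)\<^sup>2 * chf {x. l <= f x} x)" using fin[OF l] lev by (intro integrable_mult_right) auto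
   show "(l/2)\<^sup>2 * chf {x. l <= f x} x <= (g x)\<^sup>2" for x
   proof (cases "l <= f x")
    case True
    then have "(l/2)\<^sup>2 <= (g x)\<^sup>2" using l by (intro power_mono) (auto simp: g_def)
    then show ?thesis using True by simp
   qed simp
  qed (rule L2_integrable_sq[OF g])
  finally show ?thesis using up by (simp add: K_def power2_eq_square field_simps)
 qed
 define N where "N = (%l. l\<^sup>2 * a l powr th)"
 have N0: "0 <= N l" for l by (simp add: N_def)
 have M0: "0 <= M" using f(2)[of undefined] f(3)[of undefined] by linarith
 have bdd: "N l <= M\<^sup>2 * measure lborel A powr th" if "l > 0" for l
 proof (cases "l <= M")
  case True
  then show ?thesis unfolding N_def using that aA[OF that] th by (intro mult_mono power_mono powr_mono2) (auto simp: a_def)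
 next
  case False
  then have "{x. l <= f x} = {}" using f(3) by (auto intro: order_trans)
  then have "a l = 0" by (simp add: a_def)
  then show ?thesis by (simp add: N_def)
 qed
 define S where "S = (SUP l\<in>{0<..}. N l)"
 have bddS: "bdd_above (N ` {0<..})" using bdd by (intro bdd_aboveI2) auto
 have NS: "N l <= S" if "l > 0" for l unfolding S_def using that by (intro cSUP_upper bddS) auto
 have S0: "0 <= S" using N0[of 1] NS[of 1] by linarith
 have it: "N l <= (K * D) powr th * (4 * S) powr (1 - th)" if l: "l > 0" for l
 proof (cases "a l = 0")
  case True
  then show ?thesis by (simp add: N_def)
 next
  case False
  then have al: "a l > 0" by (simp add: a_def zero_less_measure_iff)
  have "a l <= a (l/2)" unfolding a_def by (rule measure_mono_fmeasurable[OF _ lev' fmeasurableI[OF lev' fin]]) (use l in auto)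
  then have al2: "a (l/2) > 0" using al by linarith
  have b: "a (l/2) powr th <= 4 * S / l\<^sup>2" using NS[of "l/2"] l by (simp add: N_def power2_eq_square field_simps)
  have Sp: "S > 0"
  proof -
   have "0 < a (l/2) powr th" using al2 by simp
   then have "0 < 4 * S / l\<^sup>2" using b by linarith
   then show ?thesis using l by (simp add: zero_less_divide_iff)
  qed
  have a1: "a l <= K * D / l\<^sup>2 * a (l/2) powr (1 - th)" using step[OF l] l by (simp add: field_simps)
  have KD: "K * D / l\<^sup>2 > 0"
  proof (rule ccontr)
   assume "\<not> K * D / l\<^sup>2 > 0"
   then have "K * D / l\<^sup>2 * a (l/2) powr (1 - th) <= 0" by (intro mult_nonpos_nonneg) auto
   then show False using a1 al by linarith
  qed
  have "a l powr th <= (K * D / l\<^sup>2 * a (l/2) powr (1 - th)) powr th" using a1 al th by (intro powr_mono2) auto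
  also have "\<dots> = (K * D / l\<^sup>2) powr th * (a (l/2) powr th) powr (1 - th)" using KD by (subst powr_mult) (auto simp: powr_powr mult.commute)
  also have "\<dots> <= (K * D / l\<^sup>2) powr th * (4 * S / l\<^sup>2) powr (1 - th)" using th b by (intro mult_left_mono powr_mono2) auto
  finally have "N l <= l\<^sup>2 * ((K * D / l\<^sup>2) powr th * (4 * S / l\<^sup>2) powr (1 - th))" unfolding N_def by (intro mult_left_mono) auto
  also have "\<dots> = (l\<^sup>2) powr th * (l\<^sup>2) powr (1 - th) * ((K * D / l\<^sup>2) powr th * (4 * S / l\<^sup>2) powr (1 - th))"
   using l by (simp add: powr_add[symmetric])
  also have "\<dots> = (l\<^sup>2 * (K * D / l\<^sup>2)) powr th * (l\<^sup>2 * (4 * S / l\<^sup>2)) powr (1 - th)"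
   using l KD Sp by (simp only: powr_mult) (simp add: mult_ac)
  also have "\<dots> = (K * D) powr th * (4 * S) powr (1 - th)" using l by simp
  finally show ?thesis .
 qed
 \<comment> \<open>If S > 64 K D, the self-bound gives S <= (1/64)^th 4^(1 - th) S, and th >= 1/3
   makes the right side at most (1/4) 4^(2/3) S < S.\<close>
 have "S <= 64 * (K * D)"
 proof (rule ccontr)
  assume *: "\<not> S <= 64 * (K * D)"
  have Sp: "S > 0" using * D0 K by (smt (verit) mult_nonneg_nonneg)
  have "S <= (K * D) powr th * (4 * S) powr (1 - th)" unfolding S_def using it by (intro cSUP_least) (auto simp: S_def)
  also have "\<dots> <= (S / 64) powr th * (4 * S) powr (1 - th)" using * D0 K th by (intro mult_right_mono powr_mono2) auto
  also have "\<dots> = (S powr th * S powr (1 - th)) * ((1 / 64) powr th * 4 powr (1 - th))" using Sp by (simp add: powr_mult powr_divide mult_ac)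
  also have "S powr th * S powr (1 - th) = S" using Sp by (simp add: powr_add[symmetric])
  also have "(1 / 64) powr th <= (1/64::real) powr (1/3)" using th by (intro powr_mono') auto
  also have "(1/64::real) powr (1/3) = ((1/4) powr 3) powr (1/3)" by (simp add: powr_numeral power3_eq_cube)
  also have "\<dots> = 1/4" by (simp only: powr_powr) simp
  also have "4 powr (1 - th) <= 4 powr (2/3::real)" using th by (intro powr_mono) auto
  also have "S * (1 / 4 * 4 powr (2/3)) < S"
  proof -
   have "4 powr (2/3::real) < 4 powr 1" by (intro powr_less_mono) auto
   then show ?thesis using Sp by simp
  qed
  finally show False using Sp by (simp add: mult_left_mono mult_right_mono)
 qed
 then show ?thesis using NS[OF lam] by (simp add: N_def K_def th_def a_def)
qed

subsection \<open>The Gagliardo seminorm\<close>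

text \<open>Square root of the Gagliardo integrand: the exponent is half of n + 2s. The nonlocal
  form thereby becomes an L2 inner product on the product space and inherits its inequalities. On
  the diagonal the value is 0/0 = 0.\<close>

definition Ef :: "real => ((real^'n::finite) => real) => (real^'n) \<times> (real^'n) => real" where
 "Ef s v z = (v (fst z) - v (snd z)) / norm (fst z - snd z) powr (real CARD('n) / 2 + s)"

text \<open>The numerator reflects the two bounds on squared increments: order |h|^2 through the
  gradient for small h, a constant through the norm for large h.\<close>

definition Gker :: "real => (real^'n::finite) => real" where
 "Gker s h = min ((norm h)\<^sup>2) 1 / norm h powr (real CARD('n) + 2 * s)"

lemma emeasure_ball_le:
 assumes "0 <= r"
 shows "emeasure lborel (ball (0::real^'n::finite) r) <= ennreal ((2 * r) ^ CARD('n))"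
proof -
 have "ball (0::real^'n) r \<subseteq> cbox (\<chi> i. - r) (\<chi> i. r)"
 proof
  fix x :: "real^'n" assume "x : ball 0 r"
  then have "\<bar>x $ i\<bar> <= r" for i using component_le_norm_cart[of x i] by simp
  then show "x : cbox (\<chi> i. - r) (\<chi> i. r)" by (auto simp: mem_box_cart abs_le_iff)
    (smt (verit, best))
 qed
 then have "emeasure lborel (ball (0::real^'n) r) <= emeasure lborel (cbox (\<chi> i. - r) (\<chi> i. r) :: (real^'n) set)" by (intro emeasure_mono) auto
 also have "\<dots> = ennreal (\<Prod>b\<in>Basis. ((\<chi> i. r) - (\<chi> i. - r) :: real^'n) \<bullet> b)"
  using assms by (intro emeasure_lborel_cbox) (auto simp: Basis_vec_def inner_axis)
 also have "(\<Prod>b\<in>Basis. ((\<chi> i. r) - (\<chi> i. - r) :: real^'n) \<bullet> b) = (\<Prod>b\<in>(Basis::(real^'n) set). 2 * r)"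
  by (intro prod.cong) (auto simp: Basis_vec_def inner_axis)
 finally show ?thesis by simp
qed

lemma ex_dyadic:
 fixes x :: real assumes "1 <= x" shows "\<exists>i. 2 ^ i <= x & x < 2 ^ Suc i"
proof -
 define i where "i = nat \<lfloor>log 2 x\<rfloor>"
 have l: "0 <= log 2 x" using assms by simp
 then have "real i <= log 2 x" "log 2 x < real i + 1" unfolding i_def by linarith+
 then have "2 powr real i <= x" "x < 2 powr (real i + 1)" using assms by (auto simp: le_log_iff log_less_iff)
 then show ?thesis by (intro exI[of _ i]) (auto simp: powr_add powr_realpow mult.commute)
qed

lemma Gker_nonneg: "0 <= Gker s h"
 by (simp add: Gker_def)

lemma Gker_borel: "Gker s : bmb"
 unfolding Gker_def[abs_def] by measurable

text \<open>Dyadic decomposition of \<open>\<real>\<^sup>n\<close> into annuli.\<close>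

lemma Gker_integrable:
 assumes n: "CARD('n) > 2" and s: "0 < s" "s < 1"
 shows "(\<integral>\<^sup>+h. ennreal (Gker s (h::real^'n::finite)) \<partial>lborel) < \<infinity>"
proof -
 define N where "N = real CARD('n)"
 define p where "p = N + 2 * s"
 \<comment> \<open>\<open>o1\<close> dominates the kernel on annuli outside the unit ball,
   \<open>o2\<close> inside. Their integrals are bounded by geometric series with ratios 2^(n-p) =
   2^(-2s) and 2^(p-2-n) = 2^(2s-2), where the two bounds on s enter. In \<open>o2\<close> the
   radius is 2 (1/2)^i, so that the open ball contains all h with |h| <= (1/2)^i.\<close>
 define o1 where "o1 = (%i (h::real^'n). ennreal ((1 / 2 powr p) ^ i) * indicator (ball 0 (2 ^ Suc i)) h)"
 define o2 where "o2 = (%i (h::real^'n). ennreal ((2 powr (p - 2)) ^ Suc i) * indicator (ball 0 (4 * (1/2) ^ Suc i)) h)"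
 have Npos: "N > 2" using n by (simp add: N_def)
 have le: "ennreal (Gker s h) <= (\<Sum>i. o1 i h) + (\<Sum>i. o2 i h)" for h :: "real^'n"
 proof (cases "h = 0")
  case True
  then show ?thesis by (simp add: Gker_def)
 next
  case False
  then have h: "norm h > 0" by simp
  show ?thesis
  proof (cases "1 <= norm h")
   case True
   then obtain i where i: "2 ^ i <= norm h" "norm h < 2 ^ Suc i" using ex_dyadic by blast
   have "Gker s h <= 1 / norm h powr p" unfolding Gker_def p_def N_def by (intro divide_right_mono) auto
   also have "\<dots> <= 1 / (2 ^ i) powr p" using i h s Npos by (intro divide_left_mono powr_mono2 mult_pos_pos) (auto simp: p_def)
   also have "\<dots> = (1 / 2 powr p) ^ i" by (simp add: power_one_over powr_realpow[symmetric] powr_powr mult.commute)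
   finally have "ennreal (Gker s h) <= ennreal ((1 / 2 powr p) ^ i)" by (rule ennreal_leI)
   also have "\<dots> = o1 i h" using i(2) by (simp add: o1_def)
   also have "\<dots> <= (\<Sum>i. o1 i h)" using sum_le_suminf[of "%i. o1 i h" "{i}"] by simp
   finally show ?thesis by (rule order_trans) simp
  next
   case False
   then have "1 <= 1 / norm h" using h by (simp add: field_simps)
   then obtain i where i: "2 ^ i <= 1 / norm h" "1 / norm h < 2 ^ Suc i" using ex_dyadic by blast
   have u: "norm h <= (1/2) ^ i" and l: "(1/2) ^ Suc i < norm h" using i h by (simp_all add: field_simps power_one_over)
   have "Gker s h <= (norm h)\<^sup>2 / norm h powr p" unfolding Gker_def p_def N_def by (intro divide_right_mono) auto
   also have "\<dots> = 1 / norm h powr (p - 2)" using h by (simp add: powr_diff powr_numeral)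
   also have "\<dots> <= 1 / ((1/2) ^ Suc i) powr (p - 2)" using l h s Npos by (intro divide_left_mono powr_mono2 mult_pos_pos) (auto simp: p_def)
   also have "\<dots> = (2 powr (p - 2)) ^ Suc i"
    by (simp only: powr_realpow[symmetric] powr_powr) (simp add: powr_divide powr_powr divide_simps powr_realpow[symmetric] powr_minus powr_add[symmetric] algebra_simps)
   finally have "ennreal (Gker s h) <= ennreal ((2 powr (p - 2)) ^ Suc i)" by (rule ennreal_leI)
   also have "\<dots> = o2 i h"
   proof -
    have "(1/2::real) ^ i < 2 * (1/2) ^ i" by simp
    with u have "norm h < 2 * (1/2) ^ i" by linarith
    then show ?thesis by (simp add: o2_def)
   qed
   also have "\<dots> <= (\<Sum>i. o2 i h)" using sum_le_suminf[of "%i. o2 i h" "{i}"] by simp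
   finally show ?thesis by (rule order_trans) simp
  qed
 qed
 have fin: "(\<integral>\<^sup>+h. (\<Sum>i. k i h) \<partial>lborel) < \<infinity>"
  if k: "!!i. k i = (%h::real^'n. ennreal (c i) * indicator (ball 0 (r i)) h)" "!!i. 0 <= r i" "!!i. 0 <= c i"
   and b: "!!i. c i * (2 * r i) ^ CARD('n) = C * q ^ i" "0 <= C" "0 <= q" "q < 1" for k c r C q
 proof -
  have [measurable]: "ball 0 (r i) : sets (borel :: (real^'n) measure)" for i by simp
  have "(\<integral>\<^sup>+h. (\<Sum>i. k i h) \<partial>lborel) = (\<Sum>i. \<integral>\<^sup>+h. k i h \<partial>lborel)"
   by (rule nn_integral_suminf) (unfold k(1), measurable)
  also have "\<dots> <= (\<Sum>i. ennreal (C * q ^ i))"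
  proof (intro suminf_le allI summableI)
   fix i
   have "(\<integral>\<^sup>+h. k i h \<partial>lborel) = ennreal (c i) * emeasure lborel (ball (0::real^'n) (r i))"
    by (simp add: k(1) nn_integral_cmult_indicator)
   also have "\<dots> <= ennreal (c i) * ennreal ((2 * r i) ^ CARD('n))" by (intro mult_left_mono emeasure_ball_le k(2)) simp
   also have "\<dots> = ennreal (C * q ^ i)" unfolding b(1)[of i, symmetric] using k(2)[of i] k(3)[of i] by (intro ennreal_mult[symmetric]) auto
   finally show "(\<integral>\<^sup>+h. k i h \<partial>lborel) <= ennreal (C * q ^ i)" .
  qed
  also have "\<dots> = ennreal (\<Sum>i. C * q ^ i)" using b by (intro suminf_ennreal2 summable_mult summable_geometric) auto
  finally show ?thesis by (simp add: le_less_trans)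
 qed
 have P: "2 ^ CARD('n) = (2::real) powr N" by (simp add: N_def powr_realpow)
 have f1: "(\<integral>\<^sup>+h. (\<Sum>i. o1 i h) \<partial>lborel) < \<infinity>"
 proof (rule fin)
  show "o1 i = (%h. ennreal ((1 / 2 powr p) ^ i) * indicator (ball 0 (2 ^ Suc i)) h)" for i by (simp add: o1_def)
  show "(1 / 2 powr p) ^ i * (2 * 2 ^ Suc i) ^ CARD('n) = 4 ^ CARD('n) * (2 ^ CARD('n) / 2 powr p) ^ i" for i
   by (simp add: power_mult_distrib power_divide power_mult[symmetric] mult.commute[of i])
  show "2 ^ CARD('n) / 2 powr p < (1::real)" unfolding P using s by (simp add: p_def)
 qed auto
 have f2: "(\<integral>\<^sup>+h. (\<Sum>i. o2 i h) \<partial>lborel) < \<infinity>"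
 proof (rule fin)
  show "o2 i = (%h. ennreal ((2 powr (p - 2)) ^ Suc i) * indicator (ball 0 (4 * (1/2) ^ Suc i)) h)" for i by (simp add: o2_def)
  have "(2 powr (p - 2)) ^ Suc i * (2 * (4 * (1/2) ^ Suc i)) ^ CARD('n) = 8 ^ CARD('n) * (2 powr (p - 2) * (1/2) ^ CARD('n)) ^ Suc i" for i
   by (simp only: power_mult_distrib power_mult[symmetric] mult.commute[of "Suc i"] mult.assoc[symmetric]) (simp add: power_mult_distrib[symmetric] mult_ac)
  then show "(2 powr (p - 2)) ^ Suc i * (2 * (4 * (1/2) ^ Suc i)) ^ CARD('n) = 8 ^ CARD('n) * (2 powr (p - 2) * (1/2) ^ CARD('n)) * (2 powr (p - 2) * (1/2) ^ CARD('n)) ^ i" for i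
   by simp
  have "2 powr (p - 2) * (1/2) ^ CARD('n) = 2 powr (p - 2) / 2 powr N" by (simp add: power_one_over P)
  also have "\<dots> = 2 powr (p - 2 - N)" by (simp add: powr_diff)
  also have "\<dots> < 2 powr 0" using s by (intro powr_less_mono) (auto simp: p_def)
  finally show "2 powr (p - 2) * (1/2) ^ CARD('n) < (1::real)" by simp
 qed auto
 have "(\<integral>\<^sup>+h. ennreal (Gker s (h::real^'n)) \<partial>lborel) <= (\<integral>\<^sup>+h. (\<Sum>i. o1 i h) + (\<Sum>i. o2 i h) \<partial>lborel)"
  by (intro nn_integral_mono le)
 also have "\<dots> = (\<integral>\<^sup>+h. (\<Sum>i. o1 i h) \<partial>lborel) + (\<integral>\<^sup>+h. (\<Sum>i. o2 i h) \<partial>lborel)"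
 proof (rule nn_integral_add)
  have [measurable]: "ball 0 r : sets (borel :: (real^'n) measure)" for r by simp
  show "(%h. \<Sum>i. o1 i h) : borel_measurable lborel" by (rule borel_measurable_suminf_order) (unfold o1_def, measurable)
  show "(%h. \<Sum>i. o2 i h) : borel_measurable lborel" by (rule borel_measurable_suminf_order) (unfold o2_def, measurable)
 qed
 also have "\<dots> < \<infinity>" using f1 f2 by simp
 finally show ?thesis .
qed

lemma Ef_borel:
 fixes v :: "(real^'n::finite) => real"
 assumes "v : bmb"
 shows "Ef s v : borel_measurable (lborel \<Otimes>\<^sub>M lborel)"
proof -
 have [measurable]: "v : borel_measurable lborel" using assms by simp
 show ?thesis unfolding Ef_def[abs_def] by measurable
qed

lemma Ef_lincomb: "Ef s (%x. a * v x + b * w x) = (%z. a * Ef s v z + b * Ef s w z)"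
 by (simp add: Ef_def fun_eq_iff add_divide_distrib[symmetric] algebra_simps)

text \<open>Substituting x = y + h and exchanging the integrals writes the squared seminorm as the
  integral over h of the squared increment norm times |h|^(-n-2s), which a multiple of
  \<open>Gker\<close> dominates.\<close>

theorem Gagliardo_bound:
 fixes v :: "(real^'n::finite) => real" and D :: real
 assumes n: "CARD('n) > 2" and s: "0 < s" "s < 1" and v: "L2l v" "!!h. nsq (Inc h v) <= (norm h)\<^sup>2 * D"
 shows "L2 (lborel \<Otimes>\<^sub>M lborel) (Ef s v)"
  "sqn (lborel \<Otimes>\<^sub>M lborel) (Ef s v) <= enn2real (\<integral>\<^sup>+h. ennreal (Gker s (h::real^'n)) \<partial>lborel) * (D + 4 * nsq v)"
proof -
 define I where "I = enn2real (\<integral>\<^sup>+h. ennreal (Gker s (h::real^'n)) \<partial>lborel)"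
 have I: "(\<integral>\<^sup>+h. ennreal (Gker s (h::real^'n)) \<partial>lborel) = ennreal I"
  unfolding I_def using Gker_integrable[OF n s] by (simp add: less_top)
 have D0: "0 <= D" using v(2)[of "axis undefined 1"] sqn_nonneg[of lborel "Inc (axis undefined 1) v"] by simp
 let ?C = "D + 4 * nsq v"
 have C0: "0 <= ?C" using D0 sqn_nonneg[of lborel v] by linarith
 define p where "p = real CARD('n) + 2 * s"
 have vb: "v : bmb" using L2_measurable[OF v(1)] by simp
 have [measurable]: "v : borel_measurable lborel" using vb by simp
 have Em: "Ef s v : borel_measurable (lborel \<Otimes>\<^sub>M lborel)" by (rule Ef_borel[OF vb])
 have sq: "(Ef s v (x, y))\<^sup>2 = (v x - v y)\<^sup>2 * (1 / norm (x - y) powr p)" for x y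
 proof -
  have "(norm (x - y) powr (real CARD('n) / 2 + s))\<^sup>2 = norm (x - y) powr p" by (simp add: p_def power2_eq_square powr_add[symmetric])
  then show ?thesis by (simp add: Ef_def power_divide)
 qed
 have m2: "(%(h, y). ennreal ((v (h + y) - v y)\<^sup>2 * (1 / norm h powr p))) : borel_measurable (lborel \<Otimes>\<^sub>M lborel)"
 proof -
  have "(%z::(real^'n) \<times> (real^'n). v (fst z + snd z)) : borel_measurable (lborel \<Otimes>\<^sub>M lborel)"
   by (rule measurable_compose[OF _ vb]) measurable
  then show ?thesis by (simp add: case_prod_beta)
 qed
 have "(\<integral>\<^sup>+z. ennreal ((Ef s v z)\<^sup>2) \<partial>(lborel \<Otimes>\<^sub>M lborel)) = (\<integral>\<^sup>+y. \<integral>\<^sup>+x. ennreal ((Ef s v (x, y))\<^sup>2) \<partial>lborel \<partial>lborel)"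
  using Em by (intro lborel_pair.nn_integral_snd[symmetric]) simp
 also have "\<dots> = (\<integral>\<^sup>+y. \<integral>\<^sup>+h. ennreal ((v (h + y) - v y)\<^sup>2 * (1 / norm h powr p)) \<partial>lborel \<partial>lborel)"
 proof (rule nn_integral_cong)
  fix y :: "real^'n"
  have "(%x. ennreal ((Ef s v (x, y))\<^sup>2)) : bmb" unfolding sq using vb by simp
  from nn_integral_lborel_shift[OF this, of y]
  show "(\<integral>\<^sup>+x. ennreal ((Ef s v (x, y))\<^sup>2) \<partial>lborel) = (\<integral>\<^sup>+h. ennreal ((v (h + y) - v y)\<^sup>2 * (1 / norm h powr p)) \<partial>lborel)"
   by (simp add: sq)
 qed
 also have "\<dots> = (\<integral>\<^sup>+h. \<integral>\<^sup>+y. ennreal ((v (h + y) - v y)\<^sup>2 * (1 / norm h powr p)) \<partial>lborel \<partial>lborel)"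
  by (rule lborel_pair.Fubini'[OF m2])
 also have "\<dots> <= (\<integral>\<^sup>+h. ennreal ?C * ennreal (Gker s (h::real^'n)) \<partial>lborel)"
 proof (rule nn_integral_mono)
  fix h :: "real^'n"
  have "(\<integral>\<^sup>+y. ennreal ((v (h + y) - v y)\<^sup>2 * (1 / norm h powr p)) \<partial>lborel) = (\<integral>\<^sup>+y. ennreal ((Inc h v y)\<^sup>2) * ennreal (1 / norm h powr p) \<partial>lborel)"
   by (intro nn_integral_cong, subst ennreal_mult[symmetric]) (auto simp: Inc_def add.commute)
  also have "\<dots> = ennreal (nsq (Inc h v)) * ennreal (1 / norm h powr p)"
   using L2_measurable[OF L2_Inc[OF v(1), of h]] by (subst nn_integral_multc) (auto simp: sqn_nn_integral[OF L2_Inc[OF v(1)]])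
  also have "\<dots> = ennreal (nsq (Inc h v) * (1 / norm h powr p))" by (intro ennreal_mult[symmetric] sqn_nonneg) simp
  also have "\<dots> <= ennreal (?C * Gker s h)"
  proof (rule ennreal_leI)
   have "nsq (Inc h v) <= ?C * min ((norm h)\<^sup>2) 1"
   proof (cases "(norm h)\<^sup>2 <= 1")
    case True
    have "(norm h)\<^sup>2 * D <= (norm h)\<^sup>2 * ?C" using sqn_nonneg[of lborel v] by (intro mult_left_mono) auto
    then show ?thesis using v(2)[of h] True by (simp add: mult.commute)
   next
    case False
    then show ?thesis using sqn_Inc_le[OF v(1), of h] D0 by simp
   qed
   then have "nsq (Inc h v) * (1 / norm h powr p) <= ?C * min ((norm h)\<^sup>2) 1 * (1 / norm h powr p)" by (intro mult_right_mono) auto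
   then show "nsq (Inc h v) * (1 / norm h powr p) <= ?C * Gker s h" by (simp add: Gker_def p_def)
  qed
  finally show "(\<integral>\<^sup>+y. ennreal ((v (h + y) - v y)\<^sup>2 * (1 / norm h powr p)) \<partial>lborel) <= ennreal ?C * ennreal (Gker s h)"
   using C0 by (simp add: ennreal_mult Gker_nonneg)
 qed
 also have "\<dots> = ennreal ?C * ennreal I"
 proof -
  have "Gker s : borel_measurable (borel :: (real^'n) measure)" by (rule Gker_borel)
  then show ?thesis by (subst nn_integral_cmult) (auto simp: I)
 qed
 also have "\<dots> = ennreal (I * ?C)" using C0 by (simp add: ennreal_mult[symmetric] I_def mult.commute)
 finally have le: "(\<integral>\<^sup>+z. ennreal ((Ef s v z)\<^sup>2) \<partial>(lborel \<Otimes>\<^sub>M lborel)) <= ennreal (I * ?C)" .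
 have "0 <= I * ?C" using C0 by (simp add: I_def)
 from L2_nn_leI[OF Em le this] show "L2 (lborel \<Otimes>\<^sub>M lborel) (Ef s v)"
  "sqn (lborel \<Otimes>\<^sub>M lborel) (Ef s v) <= enn2real (\<integral>\<^sup>+h. ennreal (Gker s (h::real^'n)) \<partial>lborel) * ?C"
  by (simp_all add: I_def)
qed

subsection \<open>The bilinear forms\<close>

text \<open>The Dirichlet form as a limit of difference quotient forms. It depends on the functions
  alone, so no gradient has to be chosen and measurability in time follows from joint measurability;
  on \<open>H0\<close> it equals \<open>gip\<close> of the gradients.\<close>

definition Bf :: "((real^'n::finite) => real) => ((real^'n) => real) => real" where
 "Bf u w = lim (%m. dqform m u w)"

definition NLf :: "real => ((real^'n::finite) => real) => ((real^'n) => real) => real" where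
 "NLf s u w = ip (lborel \<Otimes>\<^sub>M lborel) (Ef s u) (Ef s w)"

definition Af :: "real => ((real^'n::finite) => real) => ((real^'n) => real) => real" where
 "Af s u w = Bf u w + NLf s u w / 2"

lemma Bf_eq: "H0 Om u a ==> H0 Om w b ==> Bf u w = gip a b"
 unfolding Bf_def by (rule limI[OF dqform_tendsto])

lemma Bf_nonneg: "H0 Om u a ==> 0 <= Bf u u"
 by (simp add: Bf_eq gip_self_nonneg)

lemma sqn_Inc_Bf: "H0 Om u a ==> nsq (Inc h u) <= (norm h)\<^sup>2 * Bf u u"
 by (simp add: Bf_eq H0_sqn_Inc)

text \<open>The type argument fixes the dimension, on which this constant depends.\<close>

definition Gint :: "'n::finite itself => real => real" where
 "Gint _ s = enn2real (\<integral>\<^sup>+h. ennreal (Gker s (h::real^'n::finite)) \<partial>lborel)"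

lemma Gint_nonneg: "0 <= Gint TYPE('n::finite) s"
 by (simp add: Gint_def)

locale frac =
 fixes Om :: "(real^'n::finite) set" and s :: real
 assumes dim: "CARD('n) > 2" and s: "0 < s" "s < 1" and op: "open Om" and bd: "bounded Om"
begin

lemma Ef_L2: "H0 Om u a ==> L2 (lborel \<Otimes>\<^sub>M lborel) (Ef s u)"
 by (rule Gagliardo_bound(1)[OF dim s H0_L2 sqn_Inc_Bf])

lemma NLf_self_le: "H0 Om u a ==> NLf s u u <= Gint TYPE('n) s * (Bf u u + 4 * nsq u)"
 unfolding NLf_def ip_self Gint_def by (rule Gagliardo_bound(2)[OF dim s H0_L2 sqn_Inc_Bf])

lemma NLf_self_nonneg: "0 <= NLf s u u"
 by (simp add: NLf_def ip_self sqn_nonneg)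

text \<open>The 2 is half of the 4 in \<open>NLf_self_le\<close>, since the nonlocal form enters
  with factor 1/2.\<close>

definition CA :: real where "CA = 1 + 2 * Gint TYPE('n) s"

definition Qf :: "((real^'n) => real) => real" where "Qf u = nsq u + Bf u u"

lemma CA_pos: "1 <= CA"
 using Gint_nonneg[where ?'n='n, of s] by (simp add: CA_def)

lemma Qf_nonneg: "H0 Om u a ==> 0 <= Qf u"
 by (simp add: Qf_def sqn_nonneg Bf_nonneg)

lemma Af_self_le: assumes u: "H0 Om u a" shows "Af s u u <= CA * Qf u"
proof -
 have "Af s u u <= Bf u u + Gint TYPE('n) s * (Bf u u + 4 * nsq u) / 2" using NLf_self_le[OF u] by (simp add: Af_def)
 also have "\<dots> <= CA * Qf u"
 proof -
  have "0 <= Gint TYPE('n) s * Bf u u" using Gint_nonneg[where ?'n='n, of s] Bf_nonneg[OF u] by simp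
  moreover have "CA * Qf u - (Bf u u + Gint TYPE('n) s * (Bf u u + 4 * nsq u) / 2)
    = nsq u + 3/2 * (Gint TYPE('n) s * Bf u u)" by (simp add: CA_def Qf_def algebra_simps) (simp add: field_simps)
  ultimately show ?thesis using sqn_nonneg[of lborel u] by linarith
 qed
 finally show ?thesis .
qed

lemma Af_self_nonneg: "H0 Om u a ==> 0 <= Af s u u"
 using Bf_nonneg[of Om u a] NLf_self_nonneg[of u] by (simp add: Af_def)

lemma Bf_lincomb_left:
 assumes "H0 Om u a" "H0 Om v b" "H0 Om w c"
 shows "Bf (%x. k * u x + l * v x) w = k * Bf u w + l * Bf v w" using assms H0_lincomb[OF assms(1,2), of k l]
 by (simp add: Bf_eq[of Om _ _ w c] gip_lincomb_left H0_grad_L2)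

lemma NLf_lincomb_left:
 assumes "H0 Om u a" "H0 Om v b" "H0 Om w c"
 shows "NLf s (%x. k * u x + l * v x) w = k * NLf s u w + l * NLf s v w" unfolding NLf_def Ef_lincomb
 by (rule ip_lincomb_left[OF Ef_L2[OF assms(1)] Ef_L2[OF assms(2)] Ef_L2[OF assms(3)]])

lemma Af_lincomb_left:
 assumes "H0 Om u a" "H0 Om v b" "H0 Om w c"
 shows "Af s (%x. k * u x + l * v x) w = k * Af s u w + l * Af s v w"
 unfolding Af_def Bf_lincomb_left[OF assms] NLf_lincomb_left[OF assms] by (simp add: algebra_simps)

lemma Bf_sym: "Bf u w = Bf w u"
 by (simp add: Bf_def dqform_def gip_sym)

lemma Af_sym: "Af s u w = Af s w u"
 by (simp add: Af_def Bf_sym[of u] NLf_def ip_sym)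

lemma Af_lincomb_right:
 assumes "H0 Om u a" "H0 Om v b" "H0 Om w c"
 shows "Af s w (%x. k * u x + l * v x) = k * Af s w u + l * Af s w v" using Af_lincomb_left[OF assms] by (simp add: Af_sym)

lemma Bf_lincomb_self:
 assumes "H0 Om u a" "H0 Om v b"
 shows "Bf (%x. k * u x + l * v x) (%x. k * u x + l * v x) = k\<^sup>2 * Bf u u + 2 * k * l * Bf u v + l\<^sup>2 * Bf v v"
 using Bf_eq[OF H0_lincomb[OF assms] H0_lincomb[OF assms]] Bf_eq[OF assms] Bf_eq[OF assms(1,1)] Bf_eq[OF assms(2,2)]
  gip_lincomb_self[of a b, OF H0_grad_L2[OF assms(1)] H0_grad_L2[OF assms(2)]] by simp

lemma Qf_lincomb_le:
 assumes "H0 Om u a" "H0 Om v b"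
 shows "Qf (%x. u x - v x) <= 2 * Qf u + 2 * Qf v"
proof -
 have "Bf (%x. u x - v x) (%x. u x - v x) <= 2 * Bf u u + 2 * Bf v v" using Bf_lincomb_self[OF assms, of 1 "-1"] Bf_lincomb_self[OF assms, of 1 1]
   Bf_nonneg[OF H0_lincomb[OF assms, of 1 1]] by simp
 moreover have "nsq (%x. u x - v x) <= 2 * nsq u + 2 * nsq v"
  using sqn_add_le[OF H0_L2[OF assms(1)] L2_cmult[OF H0_L2[OF assms(2)], of "-1"]] sqn_cmult[of lborel "-1" v] by simp
 ultimately show ?thesis by (simp add: Qf_def)
qed

text \<open>Nonnegativity of the form at l u + w and l u - w. The weight l makes the energy of u
  cheap at the expense of w.\<close>

lemma Af_Young:
 assumes u: "H0 Om u a" and w: "H0 Om w b" and l: "l > 0"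
 shows "\<bar>Af s u w\<bar> <= CA * (l * Qf u + Qf w / l)"
proof -
 have e: "Af s (%x. k * u x + m * w x) (%x. k * u x + m * w x) = k\<^sup>2 * Af s u u + 2 * k * m * Af s u w + m\<^sup>2 * Af s w w" for k m
  using Af_lincomb_left[OF u w H0_lincomb[OF u w]] Af_lincomb_right[OF u w u] Af_lincomb_right[OF u w w]
  by (simp add: Af_sym[of w u] power2_eq_square algebra_simps)
 have "2 * l * \<bar>Af s u w\<bar> <= l\<^sup>2 * Af s u u + Af s w w"
  using e[of l 1] e[of l "-1"] Af_self_nonneg[OF H0_lincomb[OF u w, of l 1]] Af_self_nonneg[OF H0_lincomb[OF u w, of l "-1"]] by (simp add: abs_if)
 also have "\<dots> <= l\<^sup>2 * (CA * Qf u) + CA * Qf w" by (intro add_mono mult_left_mono Af_self_le[OF u] Af_self_le[OF w]) auto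
 finally have "2 * l * \<bar>Af s u w\<bar> <= l * (CA * (l * Qf u + Qf w / l))" using l by (simp add: power2_eq_square algebra_simps)
 then have "2 * \<bar>Af s u w\<bar> <= CA * (l * Qf u + Qf w / l)" using l by (simp add: mult.assoc mult.left_commute)
 then show ?thesis using abs_ge_zero[of "Af s u w"] by linarith
qed

end

subsection \<open>Measurability in time\<close>

definition tmeas :: "((real^'n::finite) => real => real) => bool" where
 "tmeas V \<longleftrightarrow> (%z. V (fst z) (snd z)) : bmb"

lemma tmeas_slice: "tmeas V ==> (%x. V x t) : bmb"
 unfolding tmeas_def using measurable_compose[of "%x. (x, t)" borel borel "%z. V (fst z) (snd z)"] by (simp add: borel_prod[symmetric])

lemma tmeas_compose:
 assumes "tmeas V" "f : N \<rightarrow>\<^sub>M borel" "g : N \<rightarrow>\<^sub>M borel"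
 shows "(%y. V (f y) (g y)) : borel_measurable N"
proof -
 have "(%y. (f y, g y)) : N \<rightarrow>\<^sub>M borel" unfolding borel_prod[symmetric] using assms(2,3) by simp
 from measurable_compose[OF this assms(1)[unfolded tmeas_def]] show ?thesis by simp
qed

lemma tmeas_ip:
 assumes V: "tmeas V" and W: "tmeas W"
 shows "(%t. ipl (%x. V x t) (%x. W x t)) : bmb"
proof -
 have "(%(t, x). V x t * W x t) : borel_measurable (borel \<Otimes>\<^sub>M lborel)" unfolding case_prod_beta
  by (intro borel_measurable_times tmeas_compose[OF V] tmeas_compose[OF W]) measurable
 then show ?thesis unfolding ip_def by (rule lborel.borel_measurable_lebesgue_integral)
qed

lemma tmeas_sqn: "tmeas V ==> (%t. nsq (%x. V x t)) : bmb"
 using tmeas_ip[of V V] by (simp add: ip_self)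

lemma tmeas_const: "w : bmb ==> tmeas (%x t. w x)"
 unfolding tmeas_def borel_prod[symmetric] by simp

lemma tmeas_DQ:
 fixes V :: "(real^'n::finite) => real => real"
 assumes V: "tmeas V" shows "tmeas (%x t. DQ m h (%x. V x t) x)"
proof -
 have "(%z::(real^'n)\<times>real. V (fst z + h /\<^sub>R real (Suc m)) (snd z)) : borel_measurable (borel \<Otimes>\<^sub>M borel)"
  "(%z::(real^'n)\<times>real. V (fst z) (snd z)) : borel_measurable (borel \<Otimes>\<^sub>M borel)" by (intro tmeas_compose[OF V]; measurable)+
 then show ?thesis unfolding tmeas_def DQ_def Inc_def borel_prod[symmetric] by simp
qed

lemma tmeas_Bf:
 assumes V: "tmeas V" and W: "tmeas W"
 shows "(%t. Bf (%x. V x t) (%x. W x t)) : bmb" unfolding Bf_def dqform_def gip_def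
 by (intro borel_measurable_lim_metric borel_measurable_sum tmeas_ip tmeas_DQ V W)

lemma tmeas_NLf:
 fixes V W :: "(real^'n::finite) => real => real"
 assumes V: "tmeas V" and W: "tmeas W"
 shows "(%t. NLf s (%x. V x t) (%x. W x t)) : bmb"
proof -
 have E: "(%(t, z). Ef s (%x. V x t) z) : borel_measurable (borel \<Otimes>\<^sub>M (lborel \<Otimes>\<^sub>M lborel))"
  if V: "tmeas V" for V :: "(real^'n) => real => real"
 proof -
  have [measurable]: "(%p::real \<times> (real^'n) \<times> (real^'n). V (fst (snd p)) (fst p)) : borel_measurable (borel \<Otimes>\<^sub>M (lborel \<Otimes>\<^sub>M lborel))"
   "(%p::real \<times> (real^'n) \<times> (real^'n). V (snd (snd p)) (fst p)) : borel_measurable (borel \<Otimes>\<^sub>M (lborel \<Otimes>\<^sub>M lborel))"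
   by (intro tmeas_compose[OF V]; measurable)+
  show ?thesis unfolding Ef_def case_prod_beta by measurable
 qed
 have "(%(t, z). Ef s (%x. V x t) z * Ef s (%x. W x t) z) : borel_measurable (borel \<Otimes>\<^sub>M (lborel \<Otimes>\<^sub>M lborel))"
  using borel_measurable_times[OF E[OF V] E[OF W]] by (simp add: case_prod_beta)
 then show ?thesis unfolding NLf_def ip_def by (rule lborel_pair.P.borel_measurable_lebesgue_integral)
qed

lemma tmeas_Af:
 assumes "tmeas V" "tmeas W"
 shows "(%t. Af s (%x. V x t) (%x. W x t)) : bmb" unfolding Af_def using tmeas_Bf[OF assms] tmeas_NLf[OF assms] by simp

subsection \<open>Almost everywhere slices and complete measures\<close>

lemma AE_slices:
 fixes P :: "'a::euclidean_space \<times> 'b::euclidean_space => bool"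
 assumes "AE z in lborel. P z"
 shows "AE t in lborel. AE x in lborel. P (x, t)"
proof -
 obtain N where N: "N : null_sets lborel" "{z. \<not> P z} \<subseteq> N" using assms by (auto simp: eventually_ae_filter)
 have Ns: "N : sets (lborel \<Otimes>\<^sub>M lborel)" and N0: "emeasure (lborel \<Otimes>\<^sub>M lborel) N = 0" using N(1) unfolding lborel_prod by auto
 have "(\<integral>\<^sup>+t. emeasure lborel ((%x. (x, t)) -` N) \<partial>lborel) = 0" using lborel_pair.emeasure_pair_measure_alt2[OF Ns] N0 by simp
 then have "AE t in lborel. emeasure lborel ((%x. (x, t)) -` N) = 0"
  using lborel_pair.measurable_emeasure_Pair2[OF Ns] by (subst (asm) nn_integral_0_iff_AE) auto
 then show ?thesis
 proof eventually_elim
  fix t assume "emeasure lborel ((%x. (x, t)) -` N) = 0"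
  moreover have "(%x. (x, t)) -` N : sets lborel" using sets_Pair2[OF Ns, of t] by simp
  ultimately have "(%x. (x, t)) -` N : null_sets lborel" by (simp add: null_sets_def)
  then show "AE x in lborel. P (x, t)" by (rule AE_I') (use N(2) in auto)
 qed
qed

text \<open>Completeness of the restricted Lebesgue measure. It yields measurability of expressions
  such as \<open>H1_norm\<close>, which rest on a choice of gradient, once their value is known
  a.e.\<close>

lemma measurable_AE_lebesgue_on:
 fixes f :: "'a::euclidean_space => 'b::{second_countable_topology, metric_space}"
 assumes A: "A : sets lebesgue" and g: "g : borel_measurable (lebesgue_on A)" and ae: "AE x in lebesgue_on A. f x = g x"
 shows "f : borel_measurable (lebesgue_on A)"
proof (rule borel_measurableI)
 fix S :: "'b set" assume "open S"
 obtain N where N: "N : null_sets (lebesgue_on A)" "{x : space (lebesgue_on A). f x ~= g x} \<subseteq> N" using ae by (auto simp: eventually_ae_filter)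
 have null: "X : sets (lebesgue_on A)" if "X \<subseteq> N" for X
 proof -
  have NA: "N \<subseteq> A" using sets.sets_into_space[of N "lebesgue_on A"] N(1) by (auto simp: null_sets_def)
  have "N : null_sets lebesgue" using N(1) A null_sets_restrict_space[of A lebesgue N] by simp
  then have "X : null_sets lebesgue" using that null_sets_completion_subset by blast
  then show ?thesis using that NA A by (subst sets_restrict_space_iff) auto
 qed
 have "f -` S \<inter> space (lebesgue_on A) = (g -` S \<inter> space (lebesgue_on A) - N) \<union> (f -` S \<inter> space (lebesgue_on A) \<inter> N)"
  using N(2) by auto
 also have "\<dots> : sets (lebesgue_on A)"
 proof (intro sets.Un sets.Diff)
  show "g -` S \<inter> space (lebesgue_on A) : sets (lebesgue_on A)" using g \<open>open S\<close> by (intro measurable_sets) auto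
 qed (auto intro: null)
 finally show "f -` S \<inter> space (lebesgue_on A) : sets (lebesgue_on A)" .
qed

lemma integral_AE_lebesgue_on:
 fixes f g :: "'a::euclidean_space => real"
 assumes A: "A : sets lebesgue" and g: "g : borel_measurable (lebesgue_on A)" and ae: "AE x in lebesgue_on A. f x = g x"
 shows "(LINT x|lebesgue_on A. f x) = (LINT x|lebesgue_on A. g x)" by (rule integral_cong_AE[OF measurable_AE_lebesgue_on[OF assms] g ae])

subsection \<open>Weak derivatives in time\<close>

text \<open>A test function rising just after a and falling just after b tends to the indicator of
  \<open>{a<..b}\<close>, while its derivative concentrates unit masses of opposite sign at a and b,
  where continuity of m evaluates it. Smoothing to the right only is what makes the interval
  half-open, so that increments add up.\<close>

lemma weak_deriv_increment:
 fixes m f :: "real => real"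
 assumes m: "continuous_on {0..T} m" and f: "integrable (lebesgue_on {0<..<T}) f"
  and wd: "!!ps. ps : Cci {0<..<T} ==>
   (LINT t|lebesgue_on {0<..<T}. f t * ps t) = - (LINT t|lebesgue_on {0<..<T}. m t * deriv ps t)"
  and ab: "0 < a" "a < b" "b < T"
 shows "m b - m a = (LINT t|lebesgue_on {0<..<T}. indicator {a<..b} t * f t)"
proof -
 define S' where "S' = (%x. frd smooth_step (at x) 1)"
 have Sd: "(smooth_step has_real_derivative S' x) (at x)" for x
 proof -
  have "(smooth_step has_derivative frd smooth_step (at x)) (at x)" by (rule smooth_has_derivative[OF smooth_step_smooth])
  moreover have "frd smooth_step (at x) = (*) (S' x)"
  proof
   fix y
   show "frd smooth_step (at x) y = S' x * y" using linear_scale[OF has_derivative_linear[OF smooth_has_derivative[OF smooth_step_smooth, of x]], of y 1]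
    by (simp add: S'_def)
  qed
  ultimately show ?thesis by (simp add: has_field_derivative_def)
 qed
 have S'c: "continuous_on UNIV S'" unfolding S'_def by (rule smooth_continuous_on[OF smooth_frechet_derivative[OF smooth_step_smooth]])
 have S'0: "S' x = 0" if "x < 0 \<or> x > 1" for x
 proof -
  have "(smooth_step has_real_derivative 0) (at x)"
  proof (cases "x < 0")
   case True
   show ?thesis by (rule DERIV_cong_ev[THEN iffD1, OF refl _ refl DERIV_const[of 0]])
     (use eventually_nhds_in_open[of "{..<0}" x] True in \<open>auto simp: smooth_step_0 elim!: eventually_mono\<close>)
  next
   case False
   then have "x > 1" using that by auto
   then show ?thesis by (intro DERIV_cong_ev[THEN iffD1, OF refl _ refl DERIV_const[of 1]])
     (use eventually_nhds_in_open[of "{1<..}" x] in \<open>auto simp: smooth_step_1 elim!: eventually_mono\<close>)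
  qed
  then show ?thesis using DERIV_unique[OF Sd] by blast
 qed
 obtain C where C: "!!x. \<bar>S' x\<bar> <= C" "0 <= C"
 proof -
  have "bounded (S' ` {0..1})" by (intro compact_imp_bounded compact_continuous_image continuous_on_subset[OF S'c]) auto
  then obtain C where "!!y. y : S' ` {0..1} ==> norm y <= C" unfolding bounded_iff by blast
  then have "\<bar>S' x\<bar> <= max C 0" for x using S'0[of x] by (cases "0 <= x & x <= 1") force+
  then show thesis by (intro that[of "max C 0"]) auto
 qed
 \<comment> \<open>The falling edge at b has width 1/k; the offset \<open>K\<close> keeps it inside
   (0,T).\<close>
 obtain K :: nat where K: "1 / (T - b) < real K" using reals_Archimedean2 by blast
 have Kp: "real K > 0" using K ab by (smt (verit) divide_nonneg_nonneg zero_less_divide_iff)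
 define k where "k = (%j::nat. real (K + j))"
 have kp: "k j > 0" "1 / k j < T - b" for j
 proof -
  show "k j > 0" using Kp by (simp add: k_def)
  have "1 < k j * (T - b)"
  proof -
   have "1 < real K * (T - b)" using K ab by (simp add: field_simps)
   also have "\<dots> <= k j * (T - b)" using ab by (intro mult_right_mono) (auto simp: k_def)
   finally show ?thesis .
  qed
  then show "1 / k j < T - b" using \<open>k j > 0\<close> by (simp add: field_simps)
 qed
 have kinf: "filterlim k at_top sequentially" by (rule filterlim_at_top_mono[OF filterlim_real_sequentially]) (simp add: k_def)
 define ps where "ps = (%j t. smooth_step (k j * (t - a)) - smooth_step (k j * (t - b)))"
 have psd: "(ps j has_real_derivative k j * S' (k j * (t - a)) - k j * S' (k j * (t - b))) (at t)" for j t
 proof -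
  have "((%t. smooth_step (k j * (t - c))) has_real_derivative k j * S' (k j * (t - c))) (at t)" for c
  proof -
   have "((%t. k j * (t - c)) has_real_derivative k j) (at t)" by (auto intro!: derivative_eq_intros)
   from DERIV_chain2[OF Sd this] show ?thesis by (simp add: mult.commute)
  qed
  then show ?thesis unfolding ps_def by (intro DERIV_diff)
 qed
 have psCc: "ps j : Cci {0<..<T}" for j
 proof (rule Cc_infinityI[of _ "{a..b + 1 / k j}"])
  have af: "smooth (%t::real. k j * (t - c))" for c using smooth_cmult[OF smooth_diff[OF smooth_inner[of "1::real"] smooth_const[of c]], of "k j"] by simp
  show "smooth (ps j)" unfolding ps_def by (rule smooth_diff[OF smooth_compose[OF smooth_step_smooth af] smooth_compose[OF smooth_step_smooth af]])
  show "{a..b + 1 / k j} \<subseteq> {0<..<T}" using ab kp(2)[of j] by auto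
  fix t assume "t \<notin> {a..b + 1 / k j}"
  then consider "t < a" | "t > b + 1 / k j" by fastforce
  then show "ps j t = 0"
  proof cases
   case 1
   then have "k j * (t - a) <= 0" "k j * (t - b) <= 0" using kp(1)[of j] ab by (auto simp: mult_le_0_iff)
   then show ?thesis by (simp add: ps_def smooth_step_0)
  next
   case 2
   then have "k j * (t - b) >= 1" using kp(1)[of j] by (simp add: field_simps)
   moreover from this have "k j * (t - a) >= 1" using kp(1)[of j] ab by (smt (verit) mult_left_mono)
   ultimately show ?thesis by (simp add: ps_def smooth_step_1)
  qed
 qed simp
 have pslim: "(%j. ps j t) \<longlonglongrightarrow> indicator {a<..b} t" for t
 proof -
  have "(%j. smooth_step (k j * (t - c))) \<longlonglongrightarrow> (if t > c then 1 else 0)" for c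
  proof (cases "t > c")
   case True
   have "eventually (%j. 1 / (t - c) <= k j) sequentially" using kinf by (simp add: filterlim_at_top)
   then have "eventually (%j. 1 = smooth_step (k j * (t - c))) sequentially"
   proof eventually_elim
    fix j assume "1 / (t - c) <= k j"
    then have "1 <= k j * (t - c)" using True by (simp add: field_simps)
    then show "1 = smooth_step (k j * (t - c))" by (simp add: smooth_step_1)
   qed
   from Lim_transform_eventually[OF tendsto_const this] show ?thesis using True by simp
  next
   case False
   then have "smooth_step (k j * (t - c)) = 0" for j using kp(1)[of j] by (intro smooth_step_0) (auto simp: mult_le_0_iff)
   then show ?thesis using False by simp
  qed
  from tendsto_diff[OF this[of a] this[of b]] show ?thesis using ab by (auto simp: ps_def indicator_def)
 qed
 have psb: "\<bar>ps j t\<bar> <= 1" for j t unfolding ps_def using smooth_step_bounds[of "k j * (t - a)"] smooth_step_bounds[of "k j * (t - b)"] by linarith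
 have fm: "f : borel_measurable (lebesgue_on {0<..<T})" using f by auto
 have psm: "ps j : borel_measurable (lebesgue_on {0<..<T})" for j by (rule borel_measurable_lebesgue_on[OF Cc_infinity_borel[OF psCc]])
 have L: "(%j. LINT t|lebesgue_on {0<..<T}. f t * ps j t) \<longlonglongrightarrow> (LINT t|lebesgue_on {0<..<T}. f t * indicator {a<..b} t)"
 proof (rule integral_dominated_convergence[where w = "%t. \<bar>f t\<bar>"])
  show "AE t in lebesgue_on {0<..<T}. norm (f t * ps j t) <= \<bar>f t\<bar>" for j using psb[of j] by (intro AE_I2) (simp add: abs_mult mult_left_le)
  show "AE t in lebesgue_on {0<..<T}. (%j. f t * ps j t) \<longlonglongrightarrow> f t * indicator {a<..b} t" by (intro AE_I2 tendsto_mult tendsto_const pslim)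
  have "(indicator {a<..b} :: real => real) : borel_measurable (lebesgue_on {0<..<T})" by (rule borel_measurable_lebesgue_on) simp
  then show "(%t. f t * indicator {a<..b} t) : borel_measurable (lebesgue_on {0<..<T})" using fm by (rule borel_measurable_times[rotated])
  show "(%t. f t * ps j t) : borel_measurable (lebesgue_on {0<..<T})" for j by (rule borel_measurable_times[OF fm psm])
  show "integrable (lebesgue_on {0<..<T}) (%t. \<bar>f t\<bar>)" using f by (rule integrable_abs)
 qed
 \<comment> \<open>The kernel multiplying m is supported on an interval of length 1/k to the right
   of c and has integral 1.\<close>
 have conc: "(%j. LINT t|lebesgue_on {0<..<T}. m t * (k j * S' (k j * (t - c)))) \<longlonglongrightarrow> m c"
  if c: "0 < c" "c <= b" for c
 proof (rule LIMSEQ_I)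
  fix e :: real assume e: "e > 0"
  define e' where "e' = e / (2 * (C + 1))"
  have e': "e' > 0" using e C by (simp add: e'_def)
  have "c : {0..T}" using c ab by auto
  from m[unfolded continuous_on_iff, rule_format, OF this e']
  obtain d where d: "d > 0" "!!t. t : {0..T} ==> \<bar>t - c\<bar> < d ==> \<bar>m t - m c\<bar> < e'" unfolding dist_real_def by blast
  have "eventually (%j. k j > 1 / d) sequentially" using kinf by (simp add: filterlim_at_top_dense)
  then obtain no where no: "!!j. j >= no ==> k j > 1 / d" unfolding eventually_sequentially by blast
  have "norm ((LINT t|lebesgue_on {0<..<T}. m t * (k j * S' (k j * (t - c)))) - m c) < e" if "j >= no" for j
  proof -
   define h where "h = 1 / k j"
   have h: "h > 0" "h < d" using kp[of j] no[OF that] d by (auto simp: h_def field_simps)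
   have hT: "c + h < T" using kp(2)[of j] c by (simp add: h_def)
   define G where "G = (%t. k j * S' (k j * (t - c)))"
   have Gc: "continuous_on A G" for A unfolding G_def by (intro continuous_intros continuous_on_compose2[OF S'c]) auto
   have G0: "G t = 0" if "t \<notin> {c..c + h}" for t
   proof -
    have "k j * (t - c) < 0 \<or> k j * (t - c) > 1" using that kp(1)[of j] by (auto simp: h_def field_simps mult_less_0_iff)
    then show ?thesis by (simp add: G_def S'0)
   qed
   have Gb: "\<bar>G t\<bar> <= k j * C" for t using C(1)[of "k j * (t - c)"] kp(1)[of j] by (simp add: G_def abs_mult)
   have sub: "{c..c + h} \<subseteq> {0<..<T}" using c h hT by auto
   have "(G has_integral (smooth_step (k j * (c + h - c)) - smooth_step (k j * (c - c)))) {c..c+h}"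
   proof (rule fundamental_theorem_of_calculus)
    show "c <= c + h" using h by simp
    fix t
    have "((%t. smooth_step (k j * (t - c))) has_real_derivative G t) (at t)"
    proof -
     have "((%t. k j * (t - c)) has_real_derivative k j) (at t)" by (auto intro!: derivative_eq_intros)
     from DERIV_chain2[OF Sd this] show ?thesis by (simp add: G_def mult.commute)
    qed
    then show "((%t. smooth_step (k j * (t - c))) has_vector_derivative G t) (at t within {c..c+h})"
     unfolding has_real_derivative_iff_has_vector_derivative by (rule has_vector_derivative_at_within)
   qed
   then have "(G has_integral 1) {c..c+h}" using kp(1)[of j] by (simp add: h_def smooth_step_0 smooth_step_1)
   moreover have Gi: "set_integrable lborel {c..c+h} G" by (rule borel_integrable_atLeastAtMost'[OF Gc])
   ultimately have G1: "(LINT t:{c..c+h}|lborel. G t) = 1" using set_borel_integral_eq_integral(2)[OF Gi] by (simp add: integral_unique)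
   have mi: "set_integrable lborel {c..c+h} (%t. m t * G t)"
   proof (rule borel_integrable_atLeastAtMost')
    have "continuous_on {c..c+h} m" by (rule continuous_on_subset[OF m]) (use c h hT in auto)
    then show "continuous_on {c..c+h} (%t. m t * G t)" by (rule continuous_on_mult[OF _ Gc])
   qed
   have "(LINT t|lebesgue_on {0<..<T}. m t * G t) = (LINT t:{c..c+h}|lborel. m t * G t)"
   proof -
    have "(LINT t|lebesgue_on {0<..<T}. m t * G t) = (LINT t|lebesgue. chf {0<..<T} t *\<^sub>R (m t * G t))" by (rule integral_restrict_space) simp
    also have "(%t. chf {0<..<T} t *\<^sub>R (m t * G t)) = (%t. chf {c..c+h} t *\<^sub>R (m t * G t))" using G0 sub by (auto simp: fun_eq_iff indicator_def)
    also have "(LINT t|lebesgue. chf {c..c+h} t *\<^sub>R (m t * G t)) = (LINT t:{c..c+h}|lborel. m t * G t)"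
     unfolding set_lebesgue_integral_def using mi by (intro integral_completion) (auto simp: set_integrable_def)
    finally show ?thesis .
   qed
   moreover have "m c = (LINT t:{c..c+h}|lborel. m c * G t)" using G1 by simp
   ultimately have "(LINT t|lebesgue_on {0<..<T}. m t * G t) - m c = (LINT t:{c..c+h}|lborel. m t * G t - m c * G t)"
    using set_integral_diff(2)[OF mi set_integrable_mult_right[of "m c", OF Gi]] by simp
   also have "norm \<dots> <= (LINT t:{c..c+h}|lborel. e' * (k j * C))"
   proof -
    have "norm (LINT t:{c..c+h}|lborel. m t * G t - m c * G t) <= (LBINT t. norm (chf {c..c+h} t *\<^sub>R (m t * G t - m c * G t)))"
     unfolding set_lebesgue_integral_def by (rule integral_norm_bound)
    also have "\<dots> <= (LINT t:{c..c+h}|lborel. e' * (k j * C))" unfolding set_lebesgue_integral_def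
    proof (rule integral_mono)
     show "integrable lborel (%t. norm (chf {c..c+h} t *\<^sub>R (m t * G t - m c * G t)))"
      using set_integral_diff(1)[OF mi set_integrable_mult_right[of "m c", OF Gi]] by (simp add: set_integrable_def)
     have "integrable lborel (chf {c..c+h})" by (rule integrable_real_indicator) (use h in auto)
     then show "integrable lborel (%t. chf {c..c+h} t *\<^sub>R (e' * (k j * C)))" by simp
     fix t
     show "norm (chf {c..c+h} t *\<^sub>R (m t * G t - m c * G t)) <= chf {c..c+h} t *\<^sub>R (e' * (k j * C))"
     proof (cases "t : {c..c+h}")
      case True
      then have "\<bar>m t - m c\<bar> <= e'" using h hT c by (intro less_imp_le d(2)) auto
      then have "\<bar>m t - m c\<bar> * \<bar>G t\<bar> <= e' * (k j * C)" using Gb[of t] e' by (intro mult_mono) auto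
      then show ?thesis using True by (simp add: abs_mult[symmetric] left_diff_distrib)
     qed simp
    qed
    finally show ?thesis .
   qed
   also have "\<dots> = h * (e' * (k j * C))" using h by (simp add: set_lebesgue_integral_def)
   also have "\<dots> = e' * C" using kp(1)[of j] by (simp add: h_def)
   also have "\<dots> < e"
   proof -
    have "e' * C <= e / 2" using e C by (simp add: e'_def field_simps)
    then show ?thesis using e by simp
   qed
   finally show ?thesis by (simp add: G_def)
  qed
  then show "\<exists>no. \<forall>n\<ge>no. norm ((LINT t|lebesgue_on {0<..<T}. m t * (k n * S' (k n * (t - c)))) - m c) < e" by blast
 qed
 have mm: "m : borel_measurable (lebesgue_on {0<..<T})" by (intro continuous_imp_measurable_on_sets_lebesgue continuous_on_subset[OF m]) auto
 obtain Mb where Mb: "!!t. t : {0..T} ==> \<bar>m t\<bar> <= Mb"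
 proof -
  have "bounded (m ` {0..T})" by (intro compact_imp_bounded compact_continuous_image m) auto
  then show thesis using that unfolding bounded_iff by (metis imageI real_norm_def)
 qed
 interpret fm: finite_measure "lebesgue_on {0<..<T}" by (rule finite_measure_lebesgue_on) simp
 have int: "integrable (lebesgue_on {0<..<T}) (%t. m t * (k j * S' (k j * (t - c))))" for j c
 proof (rule fm.integrable_const_bound[of _ "Mb * (k j * C)"])
  show "AE t in lebesgue_on {0<..<T}. norm (m t * (k j * S' (k j * (t - c)))) <= Mb * (k j * C)"
  proof (rule AE_I2)
   fix t assume "t : space (lebesgue_on {0<..<T})"
   then have "\<bar>m t\<bar> <= Mb" using Mb[of t] by simp
   moreover have "\<bar>k j * S' (k j * (t - c))\<bar> <= k j * C" using C(1)[of "k j * (t - c)"] kp(1)[of j] by (simp add: abs_mult)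
   ultimately show "norm (m t * (k j * S' (k j * (t - c)))) <= Mb * (k j * C)" unfolding real_norm_def abs_mult[of "m t"] by (intro mult_mono) auto
  qed
  have "(%t. k j * S' (k j * (t - c))) : bmb" by (intro borel_measurable_continuous_onI continuous_intros continuous_on_compose2[OF S'c]) auto
  then show "(%t. m t * (k j * S' (k j * (t - c)))) : borel_measurable (lebesgue_on {0<..<T})"
   by (intro borel_measurable_times[OF mm] borel_measurable_lebesgue_on)
 qed
 have "(LINT t|lebesgue_on {0<..<T}. f t * ps j t) =
   (LINT t|lebesgue_on {0<..<T}. m t * (k j * S' (k j * (t - b)))) - (LINT t|lebesgue_on {0<..<T}. m t * (k j * S' (k j * (t - a))))" for j
 proof -
  have "(LINT t|lebesgue_on {0<..<T}. f t * ps j t) = - (LINT t|lebesgue_on {0<..<T}. m t * (k j * S' (k j * (t - a))) - m t * (k j * S' (k j * (t - b))))"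
   using wd[OF psCc[of j]] by (simp add: DERIV_imp_deriv[OF psd] right_diff_distrib)
  then show ?thesis using Bochner_Integration.integral_diff[OF int[of j a] int[of j b]] by simp
 qed
 then have "(%j. LINT t|lebesgue_on {0<..<T}. f t * ps j t) \<longlonglongrightarrow> m b - m a" using tendsto_diff[OF conc[of b] conc[of a]] ab by simp
 from LIMSEQ_unique[OF this L] show ?thesis by (simp add: mult.commute)
qed

lemma rep_clean:
 assumes Om: "Om : sets borel" and W: "L2 (lebesgue_on Om) W" "rep Om W w" and w: "w : bmb" "!!x. x \<notin> Om ==> w x = 0"
 shows "clean Om w"
proof -
 have r2: "rep Om (%x. (W x)\<^sup>2) (%x. (w x)\<^sup>2)" using W(2) by (auto simp: rep_def)
 have "integrable lborel (%x. (w x)\<^sup>2)" by (subst rep_integral(2)[OF Om _ _ r2, symmetric]) (use w W in \<open>auto simp: L2_def\<close>)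
 then show ?thesis using w by (simp add: clean_def L2_def)
qed

lemma rep_ip:
 assumes Om: "Om : sets borel" and v: "clean Om v" "rep Om V v" and w: "w : bmb"
 shows "(LINT x|lebesgue_on Om. V x * w x) = ipl v w" unfolding ip_def
proof (rule rep_integral(1)[OF Om])
 show "rep Om (%x. V x * w x) (%x. v x * w x)" using v(2) borel_measurable_lebesgue_on[OF w, of Om] by (auto simp: rep_def)
qed (use w clean_borel[OF v(1)] in \<open>auto simp: clean_outside[OF v(1)]\<close>)

lemma integral_AE_lebesgue:
 fixes f g :: "'a::euclidean_space => real"
 assumes g: "g : bmb" and ae: "AE x in lebesgue. f x = g x"
 shows "(LINT x|lebesgue. f x) = (LBINT x. g x)"
proof -
 have "AE x in lebesgue_on UNIV. f x = g x" using ae by (simp add: AE_lebesgue_on_iff AE_completion_iff)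
 then have "(LINT x|lebesgue_on UNIV. f x) = (LINT x|lebesgue_on UNIV. g x)"
  by (rule integral_AE_lebesgue_on[OF _ borel_measurable_lebesgue_on[OF g], rotated]) simp
 moreover have "(LINT x|lebesgue_on UNIV. k x) = (LINT x|lebesgue. k x)" for k :: "'a => real" by (subst integral_restrict_space) simp_all
 moreover have "(LINT x|lebesgue. g x) = (LBINT x. g x)" using g by (intro integral_completion) simp
 ultimately show ?thesis by metis
qed

section \<open>The dual pairing and the formulation by time slices\<close>

context frac begin

lemma Om_borel: "Om : sets borel" using op by simp

lemma H0_H10: "H0 Om w c ==> w : H10 Om" and H0_H1_norm: "H0 Om w c ==> H1_norm Om w = sqrt (Qf w)"
 using H0_imp_H10[OF op _ rep_refl, of w c] clean_borel[OF H0_clean(1), of Om w c] by (auto simp: Qf_def Bf_eq[of Om w c w c])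

lemma Qf_cmult: "H0 Om w c ==> Qf (%x. k * w x) = k\<^sup>2 * Qf w"
 using Bf_lincomb_self[of w c w c k 0] by (simp add: Qf_def sqn_cmult algebra_simps)

text \<open>\<open>Hneg1_norm\<close> is a supremum over the unit ball, finite because
  \<open>F\<close> is bounded. Scaling settles the case of nonzero norm; at norm zero the bound on
  \<open>F\<close> forces the value 0.\<close>

lemma Hneg1_bound:
 assumes F: "F : Hneg1 Om" and w: "H0 Om w c"
 shows "\<bar>F w\<bar> <= Hneg1_norm Om F * H1_norm Om w"
proof -
 have lin: "F (%x. a * w1 x + b * w2 x) = a * F w1 + b * F w2" if "w1 : H10 Om" "w2 : H10 Om" for w1 w2 a b using F that unfolding Hneg1_def by blast
 obtain C where C: "!!u. u : H10 Om ==> \<bar>F u\<bar> <= C * H1_norm Om u" using F unfolding Hneg1_def by blast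
 have wH: "w : H10 Om" by (rule H0_H10[OF w])
 show ?thesis
 proof (cases "H1_norm Om w = 0")
  case True
  then show ?thesis using C[OF wH] by simp
 next
  case False
  define N where "N = H1_norm Om w"
  have N: "N > 0" using False Qf_nonneg[OF w] unfolding N_def H0_H1_norm[OF w] by (simp add: less_le)
  have kw: "H0 Om (%x. (1/N) * w x) (%i x. (1/N) * c i x)" using H0_lincomb[OF w H0_zero, of "1/N" 0] by simp
  have "H1_norm Om (%x. (1/N) * w x) = sqrt ((1/N)\<^sup>2 * Qf w)" unfolding H0_H1_norm[OF kw] Qf_cmult[OF w] ..
  also have "\<dots> = (1/N) * N" unfolding N_def H0_H1_norm[OF w] using Qf_nonneg[OF w] by (simp add: real_sqrt_mult real_sqrt_divide power_divide)
  finally have n1: "H1_norm Om (%x. (1/N) * w x) = 1" using N by simp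
  have "\<bar>F (%x. (1/N) * w x)\<bar> <= Hneg1_norm Om F" unfolding Hneg1_norm_def
  proof (rule cSUP_upper)
   show "(%x. (1/N) * w x) : {w : H10 Om. H1_norm Om w <= 1}" using H0_H10[OF kw] n1 by simp
   show "bdd_above ((%w. \<bar>F w\<bar>) ` {w : H10 Om. H1_norm Om w <= 1})"
   proof (rule bdd_aboveI2)
    fix u assume u: "u : {w : H10 Om. H1_norm Om w <= 1}"
    have "0 <= H1_norm Om u" by (simp add: H1_norm_def)
    then have "C * H1_norm Om u <= \<bar>C\<bar> * 1" using u by (intro mult_mono) auto
    then show "\<bar>F u\<bar> <= \<bar>C\<bar>" using C[of u] u by simp
   qed
  qed
  moreover have "F (%x. (1/N) * w x) = (1/N) * F w" using lin[OF wH wH, of "1/N" 0] by simp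
  ultimately show ?thesis using N by (simp add: abs_mult N_def field_simps)
 qed
qed

lemma Hneg1_diff:
 assumes "F : Hneg1 Om" "F' : Hneg1 Om" shows "(%w. F w - F' w) : Hneg1 Om"
proof -
 obtain C where C: "!!u. u : H10 Om ==> \<bar>F u\<bar> <= C * H1_norm Om u" using assms(1) unfolding Hneg1_def by blast
 obtain C' where C': "!!u. u : H10 Om ==> \<bar>F' u\<bar> <= C' * H1_norm Om u" using assms(2) unfolding Hneg1_def by blast
 have lin: "F (%x. a * w1 x + b * w2 x) = a * F w1 + b * F w2" "F' (%x. a * w1 x + b * w2 x) = a * F' w1 + b * F' w2"
  if "w1 : H10 Om" "w2 : H10 Om" for w1 w2 a b using assms that unfolding Hneg1_def by blast+
 have "\<bar>F u - F' u\<bar> <= (C + C') * H1_norm Om u" if "u : H10 Om" for u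
 proof -
  have "\<bar>F u - F' u\<bar> <= \<bar>F u\<bar> + \<bar>F' u\<bar>" by (rule abs_triangle_ineq4)
  then show ?thesis using C[OF that] C'[OF that] by (simp add: distrib_right)
 qed
 moreover have "F (%x. a * w1 x + b * w2 x) - F' (%x. a * w1 x + b * w2 x) = a * (F w1 - F' w1) + b * (F w2 - F' w2)"
  if "w1 : H10 Om" "w2 : H10 Om" for w1 w2 a b unfolding lin[OF that] by (simp add: algebra_simps)
 ultimately show ?thesis unfolding Hneg1_def by blast
qed

text \<open>Strong measurability provides simple approximants whose pairings with the fixed
  \<open>w\<close> are measurable in time. Integrability follows since square-integrable functions
  on a bounded interval are integrable.\<close>

lemma L2Hneg1_integrable:
 assumes F: "F : L2Hneg1 Om T" and w: "H0 Om w c"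
 shows "integrable (lebesgue_on {0<..<T}) (%t. F t w)"
proof -
 let ?M = "lebesgue_on {0<..<T}"
 have FH: "AE t in ?M. F t : Hneg1 Om" and FL: "(%t. Hneg1_norm Om (F t)) : Lspace 2 ?M" using F by (auto simp: L2Hneg1_def)
 obtain sg where sg: "!!j::nat. simple_function ?M (sg j)" "!!j t. t : {0<..<T} ==> sg j t : Hneg1 Om"
  "AE t in ?M. (%j. Hneg1_norm Om (%w. F t w - sg j t w)) \<longlonglongrightarrow> 0" using F unfolding L2Hneg1_def by blast
 interpret fm: finite_measure ?M by (rule finite_measure_lebesgue_on) simp
 have sgm: "(%t. sg j t w) : borel_measurable ?M" for j by (rule borel_measurable_simple_function, rule simple_function_compose1[OF sg(1)])
 have lim: "AE t in ?M. (%j. sg j t w) \<longlonglongrightarrow> F t w" using FH sg(3) AE_space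
 proof eventually_elim
  fix t assume t: "F t : Hneg1 Om" "(%j. Hneg1_norm Om (%w. F t w - sg j t w)) \<longlonglongrightarrow> 0" "t : space ?M"
  have b: "norm (sg j t w - F t w) <= Hneg1_norm Om (%w. F t w - sg j t w) * H1_norm Om w" for j
   using Hneg1_bound[OF Hneg1_diff[OF t(1) sg(2)] w, of t j] t(3) by (simp add: abs_minus_commute)
  have "(%j. Hneg1_norm Om (%w. F t w - sg j t w) * H1_norm Om w) \<longlonglongrightarrow> 0" by (rule tendsto_mult_left_zero[OF t(2)])
  then have "(%j. sg j t w - F t w) \<longlonglongrightarrow> 0" by (rule Lim_null_comparison[OF always_eventually[OF allI[OF b]]])
  then show "(%j. sg j t w) \<longlonglongrightarrow> F t w" by (simp add: LIM_zero_iff)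
 qed
 have lm: "(%t. lim (%j. sg j t w)) : borel_measurable ?M" by (rule borel_measurable_lim_metric[OF sgm])
 have lae: "AE t in ?M. F t w = lim (%j. sg j t w)" using lim by eventually_elim (simp add: limI)
 have Fm: "(%t. F t w) : borel_measurable ?M" by (rule measurable_AE_lebesgue_on[OF _ lm lae]) simp
 have L: "L2 ?M (%t. Hneg1_norm Om (F t))" using FL by (simp add: Lspace_2_real_iff)
 have one: "L2 ?M (%t. 1)" by (simp add: L2_def)
 have "integrable ?M (%t. Hneg1_norm Om (F t) * 1)" by (rule L2_integrable_mult[OF L one])
 then have "integrable ?M (%t. Hneg1_norm Om (F t) * H1_norm Om w)" by simp
 then show ?thesis
 proof (rule Bochner_Integration.integrable_bound[OF _ Fm])
  show "AE t in ?M. norm (F t w) <= norm (Hneg1_norm Om (F t) * H1_norm Om w)" using FH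
  proof eventually_elim
   fix t assume "F t : Hneg1 Om"
   from Hneg1_bound[OF this w] show "norm (F t w) <= norm (Hneg1_norm Om (F t) * H1_norm Om w)" by simp
  qed
 qed
qed

text \<open>An energy solution reduced to Borel slices at a set \<open>G\<close> of good times of
  full measure, with all slices 0 at other times. The equation is integrated over
  \<open>{a<..b}\<close> and tested with functions constant in time, so no time derivative is left.
  Uniform continuity and the initial value are stated in L2 along \<open>G\<close>.\<close>

definition wsol :: "real => ((real^'n) => real => real) => ((real^'n) => real) => ((real^'n) => real => real) => real set => bool" where
 "wsol T g v0 V G \<longleftrightarrow> tmeas V & tmeas g & clean Om v0 & G : sets borel & G \<subseteq> {0<..<T} &
   (AE t in lborel. t : {0<..<T} --> t : G) &
   (\<forall>t. t \<notin> G --> (\<forall>x. V x t = 0 & g x t = 0)) &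
   (\<forall>t. (\<exists>a. H0 Om (%x. V x t) a) & clean Om (%x. g x t)) &
   integrable lborel (%t. Qf (%x. V x t)) & integrable lborel (%t. nsq (%x. g x t)) &
   (\<forall>e>0. \<exists>d>0. \<forall>t\<in>G. \<forall>t'\<in>G. \<bar>t - t'\<bar> < d --> nsq (%x. V x t - V x t') < e) &
   (\<forall>e>0. \<exists>d>0. \<forall>t\<in>G. t < d --> nsq (%x. V x t - v0 x) < e) &
   (\<forall>a\<in>G. \<forall>b\<in>G. a < b --> (\<forall>w c. H0 Om w c -->
    ipl (%x. V x b - V x a) w = - (LBINT t. indicator {a<..b} t * (Af s (%x. V x t) w - ipl (%x. g x t) w))))"

lemma tmeas_Qf: "tmeas V ==> (%t. Qf (%x. V x t)) : bmb"
 unfolding Qf_def using tmeas_sqn[of V] tmeas_Bf[of V V] by simp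

text \<open>Both parts of the energy form are symmetric and nonnegative on the diagonal, so a single
  argument by \<open>discriminant_bound\<close> serves either value of \<open>B\<close>.\<close>

lemma integrable_form:
 assumes V: "tmeas V" "!!t. \<exists>a. H0 Om (%x. V x t) a" "integrable lborel (%t. Qf (%x. V x t))" and w: "H0 Om w c"
  and B: "B = Bf \<or> B = NLf s" and ab: "a <= b"
 shows "integrable lborel (%t. indicator {a<..b} t * B (%x. V x t) w)"
proof -
 have wm: "tmeas (%x t. w x)" using clean_borel[OF H0_clean(1)[OF w]] by (rule tmeas_const)
 have m: "(%t. B (%x. V x t) w) : bmb" using B tmeas_Bf[OF V(1) wm] tmeas_NLf[OF V(1) wm] by auto
 define K where "K = 2 * (1 + 4 * Gint TYPE('n) s)"
 have G0: "0 <= Gint TYPE('n) s" by (rule Gint_nonneg)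
 have b: "\<bar>B (%x. V x t) w\<bar> <= K * (Qf (%x. V x t) + Qf w)" for t
 proof -
  obtain a where a: "H0 Om (%x. V x t) a" using V(2) by blast
  let ?v = "%x. V x t"
  have q: "0 <= Qf ?v" "0 <= Qf w" using Qf_nonneg a w by blast+
  have self: "0 <= B u u & B u u <= (1 + 4 * Gint TYPE('n) s) * Qf u" if u: "H0 Om u e" for u e
  proof (rule disjE[OF B])
   assume "B = Bf"
   moreover have "Bf u u <= 1 * Qf u" using sqn_nonneg[of lborel u] by (simp add: Qf_def)
   moreover have "1 * Qf u <= (1 + 4 * Gint TYPE('n) s) * Qf u" using G0 Qf_nonneg[OF u] by (intro mult_right_mono) auto
   ultimately show ?thesis using Bf_nonneg[OF u] by simp
  next
   assume "B = NLf s"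
   moreover have "NLf s u u <= Gint TYPE('n) s * (4 * Qf u)" using NLf_self_le[OF u] mult_left_mono[OF _ G0, of "Bf u u + 4 * nsq u" "4 * Qf u"] Bf_nonneg[OF u]
    by (simp add: Qf_def)
   moreover have "Gint TYPE('n) s * (4 * Qf u) <= (1 + 4 * Gint TYPE('n) s) * Qf u" using Qf_nonneg[OF u] by (simp add: algebra_simps)
   ultimately show ?thesis using NLf_self_nonneg[of u] by simp
  qed
  have "(B ?v w)\<^sup>2 <= B ?v ?v * B w w"
  proof (rule discriminant_bound)
   fix k
   have "B (%x. 1 * ?v x + k * w x) (%x. 1 * ?v x + k * w x) = B ?v ?v + 2 * k * B ?v w + k\<^sup>2 * B w w"
    using B Bf_lincomb_self[OF a w, of 1 k] sqn_lincomb[OF Ef_L2[OF a] Ef_L2[OF w], of 1 k]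
    unfolding NLf_def Ef_lincomb[of s 1 ?v k w, symmetric] by (auto simp: ip_self Ef_lincomb)
   then show "0 <= B ?v ?v + 2 * k * B ?v w + k\<^sup>2 * B w w" using self[OF H0_lincomb[OF a w, of 1 k]] by simp
  qed (use self[OF w] in blast)
  also have "\<dots> <= ((1 + 4 * Gint TYPE('n) s) * Qf ?v) * ((1 + 4 * Gint TYPE('n) s) * Qf w)" using self[OF a] self[OF w] by (intro mult_mono) auto
  also have "\<dots> <= (K * (Qf ?v + Qf w))\<^sup>2"
  proof -
   have "Qf ?v * Qf w <= (Qf ?v + Qf w)\<^sup>2" using q by (simp add: power2_eq_square algebra_simps)
   then have "(1 + 4 * Gint TYPE('n) s)\<^sup>2 * (Qf ?v * Qf w) <= K\<^sup>2 * (Qf ?v + Qf w)\<^sup>2"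
    using G0 q by (intro mult_mono power_mono) (auto simp: K_def)
   then show ?thesis by (simp add: power2_eq_square mult_ac)
  qed
  finally have "\<bar>B ?v w\<bar>\<^sup>2 <= (K * (Qf ?v + Qf w))\<^sup>2" by simp
  then show ?thesis using G0 q by (intro power2_le_imp_le[of "\<bar>B ?v w\<bar>"]) (auto simp: K_def)
 qed
 show ?thesis
 proof (rule Bochner_Integration.integrable_bound)
  have "integrable lborel (%t. chf {a<..b} t * Qf w)" by (intro integrable_mult_left integrable_real_indicator) (use ab in auto)
  then show "integrable lborel (%t. K * (Qf (%x. V x t) + chf {a<..b} t * Qf w))" using V(3) by (intro integrable_mult_right Bochner_Integration.integrable_add)
  show "(%t. indicator {a<..b} t * B (%x. V x t) w) : borel_measurable lborel" using m by simp
  show "AE t in lborel. norm (chf {a<..b} t * B (%x. V x t) w) <= norm (K * (Qf (%x. V x t) + chf {a<..b} t * Qf w))"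
  proof (rule AE_I2)
   fix t
   have q: "0 <= Qf (%x. V x t)" "0 <= Qf w" using Qf_nonneg V(2) w by blast+
   then show "norm (chf {a<..b} t * B (%x. V x t) w) <= norm (K * (Qf (%x. V x t) + chf {a<..b} t * Qf w))"
    using b[of t] G0 by (cases "t : {a<..b}") (auto simp: K_def)
  qed
 qed
qed

lemma integrable_ip:
 assumes g: "tmeas g" "!!t. L2l (%x. g x t)" "integrable lborel (%t. nsq (%x. g x t))" and w: "L2l w" and ab: "a <= b"
 shows "integrable lborel (%t. indicator {a<..b} t * ipl (%x. g x t) w)"
proof (rule Bochner_Integration.integrable_bound)
 have wm: "tmeas (%x t. w x)" using L2_measurable[OF w] by (intro tmeas_const) simp
 have m: "(%t. ipl (%x. g x t) w) : bmb" by (rule tmeas_ip[OF g(1) wm])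
 then show "(%t. indicator {a<..b} t * ipl (%x. g x t) w) : borel_measurable lborel" by simp
 have "integrable lborel (%t. chf {a<..b} t * nsq w)" by (intro integrable_mult_left integrable_real_indicator) (use ab in auto)
 then show "integrable lborel (%t. nsq (%x. g x t) + chf {a<..b} t * nsq w)" using g(3) by (rule Bochner_Integration.integrable_add[rotated])
 show "AE t in lborel. norm (chf {a<..b} t * ipl (%x. g x t) w) <= norm (nsq (%x. g x t) + chf {a<..b} t * nsq w)"
 proof (rule AE_I2)
  fix t
  have "0 <= nsq (%x. 1 * g x t + k * w x)" for k by (rule sqn_nonneg)
  from this[of 1] this[of "-1"] have "2 * \<bar>ipl (%x. g x t) w\<bar> <= nsq (%x. g x t) + nsq w" unfolding sqn_lincomb[OF g(2) w] by (simp add: abs_if)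
  then show "norm (chf {a<..b} t * ipl (%x. g x t) w) <= norm (nsq (%x. g x t) + chf {a<..b} t * nsq w)"
   using sqn_nonneg[of lborel w] sqn_nonneg[of lborel "%x. g x t"] by (cases "t : {a<..b}") auto
 qed
qed

text \<open>The energy formulation contains an iterated Lebesgue integral. Its inner integral can be
  replaced at those \<open>y\<close> with \<open>v y = V y\<close>, which are almost all; Fubini's
  theorem for the product of two square-integrable \<open>Ef\<close> gives the rest.\<close>

lemma nonlocal_eq:
 assumes V: "H0 Om V a" and w: "H0 Om w c" and v: "AE x in lebesgue. v x = V x"
 shows "(LINT y|lebesgue. LINT x|lebesgue. (v x - v y) * (w x - w y) / norm (x - y) powr (real CARD('n) + 2 * s)) = NLf s V w"
proof -
 have Vb: "V : bmb" and wb: "w : bmb" using clean_borel[OF H0_clean(1)[OF V]] clean_borel[OF H0_clean(1)[OF w]] by auto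
 let ?p = "real CARD('n) + 2 * s"
 let ?k = "%v x y. (v x - v y) * (w x - w y) / norm (x - y) powr ?p"
 have kE: "?k V x y = Ef s V (x, y) * Ef s w (x, y)" for x y
 proof -
  have "norm (x - y) powr ?p = norm (x - y) powr (real CARD('n) / 2 + s) * norm (x - y) powr (real CARD('n) / 2 + s)" by (simp add: powr_add[symmetric])
  then show ?thesis by (simp add: Ef_def)
 qed
 have inner: "(LINT x|lebesgue. ?k v x y) = (LBINT x. ?k V x y)" if y: "v y = V y" for y
 proof -
  have m: "(%x. ?k V x y) : bmb" using Vb wb by simp
  show ?thesis by (rule integral_AE_lebesgue[OF m AE_mp[OF v AE_I2]]) (simp add: y)
 qed
 define K where "K = (%z. Ef s V z * Ef s w z)"
 have Keq: "case_prod (%x y. K (x, y)) = K" by (auto simp: fun_eq_iff)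
 have E: "integrable (lborel \<Otimes>\<^sub>M lborel) (case_prod (%x y. K (x, y)))"
 proof -
  have "integrable (lborel \<Otimes>\<^sub>M lborel) K" unfolding K_def by (rule L2_integrable_mult[OF Ef_L2[OF V] Ef_L2[OF w]])
  then show ?thesis by (simp only: Keq)
 qed
 have om: "(%y. LBINT x. ?k V x y) : bmb"
 proof -
  have "(%(y, x). ?k V x y) : borel_measurable (lborel \<Otimes>\<^sub>M lborel)" unfolding kE case_prod_beta
   using measurable_compose[OF measurable_pair_swap' Ef_borel[OF Vb, of s]] measurable_compose[OF measurable_pair_swap' Ef_borel[OF wb, of s]]
   by (simp add: case_prod_beta)
  from lborel.borel_measurable_lebesgue_integral[OF this] show ?thesis by simp
 qed
 have "(LINT y|lebesgue. LINT x|lebesgue. ?k v x y) = (LBINT y. LBINT x. ?k V x y)" by (rule integral_AE_lebesgue[OF om AE_mp[OF v AE_I2]]) (intro impI inner)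
 also have "\<dots> = NLf s V w"
 proof -
  have "(LBINT y. LBINT x. K (x, y)) = integral\<^sup>L (lborel \<Otimes>\<^sub>M lborel) K" using lborel_pair.integral_snd[OF E] unfolding Keq .
  then show ?thesis by (simp only: NLf_def ip_def kE K_def)
 qed
 finally show ?thesis .
qed

end

lemma AE_lborel_prod_cylinder:
 fixes A :: "(real^'n::finite) set"
 assumes "A : sets borel" "AE z in cylinder A T. P z"
 shows "AE t in lborel. AE x in lborel. x : A --> t : {0<..<T} --> P (x, t)"
proof -
 have "A \<times> {0<..<T} : sets borel" unfolding borel_prod[symmetric] using assms(1) by auto
 then have "AE z in lborel. z : A \<times> {0<..<T} --> P z" using assms(2) by (simp only: AE_lebesgue_on_iff)
 from AE_slices[OF this] show ?thesis
 proof eventually_elim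
  fix t assume "AE x in lborel. (x, t) : A \<times> {0<..<T} --> P (x, t)"
  then show "AE x in lborel. x : A --> t : {0<..<T} --> P (x, t)" by eventually_elim auto
 qed
qed

text \<open>Continuity at each time becomes uniform through a Lebesgue number of the cover of [0,T]
  by intervals of continuity.\<close>

lemma uniform_L2_continuity:
 assumes ct: "cont_L2 Om T v" and e: "e > 0"
 shows "\<exists>d>0. \<forall>t\<in>{0..T}. \<forall>t'\<in>{0..T}. \<bar>t - t'\<bar> < d --> sqrt (sqn (lebesgue_on Om) (%x. v x t - v x t')) < e"
proof -
 let ?M = "lebesgue_on Om"
 have L: "L2 ?M (%x. v x t)" if "t : {0..T}" for t using ct that by (auto simp: cont_L2_def Lspace_2_real_iff)
 have "\<exists>d>0. \<forall>ta\<in>{0..T}. dist ta t < d --> sqrt (sqn ?M (%x. v x ta - v x t)) < e / 2" if t: "t : {0..T}" for t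
 proof -
  have "((%ta. Lnorm 2 ?M (%x. v x ta - v x t)) \<longlongrightarrow> 0) (at t within {0..T})" using ct t by (auto simp: cont_L2_def)
  from order_tendstoD(2)[OF this, of "ennreal (e/2)"] e
  have "eventually (%ta. Lnorm 2 ?M (%x. v x ta - v x t) < ennreal (e/2)) (at t within {0..T})" by simp
  then obtain d where d: "d > 0" "!!ta. ta : {0..T} ==> ta ~= t ==> dist ta t < d ==> Lnorm 2 ?M (%x. v x ta - v x t) < ennreal (e/2)"
   unfolding eventually_at by blast
  have "sqrt (sqn ?M (%x. v x ta - v x t)) < e / 2" if ta: "ta : {0..T}" "dist ta t < d" for ta
  proof (cases "ta = t")
   case True
   then show ?thesis using e by (simp add: sqn_def)
  next
   case False
   from d(2)[OF ta(1) False ta(2)] show ?thesis by (simp add: Lnorm_2_real[OF L2_diff[OF L[OF ta(1)] L[OF t]]] ennreal_less_iff sqn_nonneg)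
  qed
  with d(1) show ?thesis by blast
 qed
 then obtain d where d: "!!t. t : {0..T} ==> d t > 0"
  "!!t ta. t : {0..T} ==> ta : {0..T} ==> dist ta t < d t ==> sqrt (sqn ?M (%x. v x ta - v x t)) < e / 2" by metis
 have "{0..T} \<subseteq> \<Union>((%t. ball t (d t)) ` {0..T})" using d(1) by force
 then obtain r where r: "r > 0" "!!t. t : {0..T} ==> \<exists>B\<in>(%t. ball t (d t)) ` {0..T}. ball t r \<subseteq> B"
  using Heine_Borel_lemma[of "{0..T}" "(%t. ball t (d t)) ` {0..T}"] compact_Icc by (metis (no_types, lifting) imageE open_ball)
 show ?thesis
 proof (intro exI[of _ r] conjI ballI impI)
  fix t t' assume t: "t : {0..T}" "t' : {0..T}" "\<bar>t - t'\<bar> < r"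
  obtain t0 where t0: "t0 : {0..T}" "ball t r \<subseteq> ball t0 (d t0)" using r(2)[OF t(1)] by blast
  have "t : ball t r" "t' : ball t r" using r(1) t(3) by (auto simp: dist_real_def)
  then have "t : ball t0 (d t0)" "t' : ball t0 (d t0)" using t0(2) by blast+
  then have "dist t t0 < d t0" "dist t' t0 < d t0" by (simp_all add: dist_commute)
  then have "sqrt (sqn ?M (%x. v x t - v x t0)) < e / 2" "sqrt (sqn ?M (%x. v x t0 - v x t')) < e / 2"
   using d(2)[OF t0(1)] t sqn_commute[of ?M "%x. v x t0"] by auto
  then show "sqrt (sqn ?M (%x. v x t - v x t')) < e" using sqrt_sqn_triangle_diff[OF L[OF t(1)] L[OF t0(1)] L[OF t(2)]] by linarith
 qed (rule r(1))
qed

context frac begin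

text \<open>The test function is the indicator of \<open>{a<..b}\<close> in time multiplied by a
  fixed \<open>w\<close>. The four integrals of the energy identity are computed from the Borel
  slices, the one with the time derivative through \<open>weak_deriv_increment\<close>.\<close>

theorem energy_solution_wsol:
 assumes T: "0 < T" and es: "energy_solution Om T s g v0 v"
 shows "\<exists>V h w0 G. wsol T h w0 V G & rep Om v0 w0 &
  (\<forall>t\<in>G. rep Om (%x. v x t) (%x. V x t)) &
  (\<forall>t\<in>G. AE x in lborel. x : Om --> g x t = h x t)"
proof -
 let ?I = "{0<..<T}"
 let ?MI = "lebesgue_on ?I"
 have gL: "(%(x, t). g x t) : Lspace 2 (cylinder Om T)" and v0L: "v0 : Lspace 2 (lebesgue_on Om)"
  and vL: "v : L2H10 Om T" and ct: "cont_L2 Om T v" and out: "AE (x, t) in cylinder (- Om) T. v x t = 0"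
  and ini: "((%t. Lnorm 2 (lebesgue_on Om) (%x. v x t - v0 x)) \<longlongrightarrow> 0) (at_right 0)" using es by (auto simp: energy_solution_def)
 obtain vt where vt: "vt : L2Hneg1 Om T" "is_weak_time_deriv Om T v vt"
  and eqn: "!!ph. ph : L2H10 Om T ==>
      (LINT t|?MI. vt t (%x. ph x t))
      + (LINT t|?MI. LINT x|lebesgue_on Om. weak_gradient Om (%x. v x t) x \<bullet> weak_gradient Om (%x. ph x t) x)
      + 1 / 2 * (LINT t|?MI. LINT y|lebesgue. LINT x|lebesgue.
        (v x t - v y t) * (zero_ext Om ph x t - zero_ext Om ph y t) / norm (x - y) powr (real CARD('n) + 2 * s))
      = (LINT t|?MI. LINT x|lebesgue_on Om. g x t * ph x t)" using es unfolding energy_solution_def by blast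
 have C: "Om \<times> ?I : sets borel" unfolding borel_prod[symmetric] using Om_borel by auto
 have vm: "(%(x, t). v x t) : borel_measurable (cylinder Om T)" and vH: "AE t in ?MI. (%x. v x t) : H10 Om"
  and vN: "(%t. H1_norm Om (%x. v x t)) : Lspace 2 ?MI" using vL by (auto simp: L2H10_def Lspace_time_def)
 obtain f where f: "f : bmb" "!!z. z \<notin> Om \<times> ?I ==> f z = 0" "AE z in cylinder Om T. (%(x, t). v x t) z = f z"
  using lebesgue_on_borel_version[OF C vm] by blast
 have gL2: "L2 (cylinder Om T) (%(x, t). g x t)" using gL by (simp add: Lspace_2_real_iff)
 obtain gb where gb: "gb : bmb" "!!z. z \<notin> Om \<times> ?I ==> gb z = 0" "AE z in cylinder Om T. (%(x, t). g x t) z = gb z"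
  using lebesgue_on_borel_version[OF C L2_measurable[OF gL2]] by blast
 have gi: "integrable lborel (%z. (gb z)\<^sup>2)"
 proof -
  have "integrable (cylinder Om T) (%z. ((%(x, t). g x t) z)\<^sup>2) \<longleftrightarrow> integrable lborel (%z. (gb z)\<^sup>2)"
  proof (rule lebesgue_on_clean(2)[OF C])
   show "AE z in cylinder Om T. ((%(x, t). g x t) z)\<^sup>2 = (gb z)\<^sup>2" using gb(3) by eventually_elim simp
  qed (use gb L2_measurable[OF gL2] in auto)
  then show ?thesis using gL2 by (simp add: L2_def)
 qed
 have gi': "integrable (lborel \<Otimes>\<^sub>M lborel) (%(x, t). (gb (x, t))\<^sup>2)"
 proof -
  have "(%(x, t). (gb (x, t))\<^sup>2) = (%z. (gb z)\<^sup>2)" by (auto simp: fun_eq_iff)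
  then show ?thesis using gi by (simp only: lborel_prod)
 qed
 have gslice: "AE t in lborel. integrable lborel (%x. (gb (x, t))\<^sup>2)" and gint: "integrable lborel (%t. LBINT x. (gb (x, t))\<^sup>2)"
  using lborel_pair.AE_integrable_snd[OF gi'] lborel_pair.integrable_snd[OF gi'] by auto
 \<comment> \<open>Everything required of a single time slice. It fails on a null set only, whose
   removal defines \<open>G\<close>.\<close>
 define Pg where "Pg = (%t. (AE x in lborel. x : Om --> v x t = f (x, t)) & (AE x in lborel. x : Om --> g x t = gb (x, t)) &
  (AE x in lborel. x \<notin> Om --> v x t = 0) & (%x. v x t) : H10 Om & vt t : Hneg1 Om & integrable lborel (%x. (gb (x, t))\<^sup>2))"
 have "AE t in lborel. t : ?I --> Pg t"
 proof -
  have "AE t in lborel. AE x in lborel. x : Om --> t : ?I --> (%(x, t). v x t) (x, t) = f (x, t)" by (rule AE_lborel_prod_cylinder[OF Om_borel f(3)])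
  moreover have "AE t in lborel. AE x in lborel. x : Om --> t : ?I --> (%(x, t). g x t) (x, t) = gb (x, t)" by (rule AE_lborel_prod_cylinder[OF Om_borel gb(3)])
  moreover have "AE t in lborel. AE x in lborel. x : - Om --> t : ?I --> (case (x, t) of (x, t) => v x t = 0)"
   by (rule AE_lborel_prod_cylinder[OF _ out]) (use Om_borel in auto)
  moreover have "AE t in lborel. t : ?I --> (%x. v x t) : H10 Om" using vH by (simp add: AE_lebesgue_on_iff)
  moreover have "AE t in lborel. t : ?I --> vt t : Hneg1 Om" using vt(1) by (simp add: L2Hneg1_def AE_lebesgue_on_iff)
  moreover note gslice
  ultimately show ?thesis unfolding Pg_def by eventually_elim auto
 qed
 then obtain N where N: "N : null_sets lborel" "{t. \<not> (t : ?I --> Pg t)} \<subseteq> N" by (auto simp: eventually_ae_filter)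
 define G where "G = ?I - N"
 have Gb: "G : sets borel" "G \<subseteq> ?I" using N(1) by (auto simp: G_def)
 have GAE: "AE t in lborel. t : ?I --> t : G" using AE_not_in[OF N(1)] by eventually_elim (auto simp: G_def)
 have PG: "Pg t" if "t : G" for t using that N(2) by (auto simp: G_def)
 \<comment> \<open>Slices at bad times are set to 0, so that every slice is admissible and later
   statements hold for all times.\<close>
 define V where "V = (%x t. if t : G then f (x, t) else 0)"
 define h where "h = (%x t. if t : G then gb (x, t) else 0)"
 have sndG: "{z::(real^'n) \<times> real. snd z : G} : sets borel"
 proof -
  have "UNIV \<times> G : sets (borel \<Otimes>\<^sub>M borel :: ((real^'n) \<times> real) measure)" using Gb(1) by auto
  moreover have "UNIV \<times> G = {z::(real^'n) \<times> real. snd z : G}" by auto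
  ultimately show ?thesis unfolding borel_prod[symmetric] by simp
 qed
 have If: "(%z. if snd z : G then p z else 0) : bmb" if p: "p : bmb"
  for p :: "(real^'n) \<times> real => real"
 proof -
  have "(%z. if z : {z. snd z : G} then p z else 0) : bmb" by (rule measurable_If_set) (use p sndG in simp_all)
  then show ?thesis unfolding mem_Collect_eq .
 qed
 have tV: "tmeas V" unfolding tmeas_def V_def prod.collapse by (rule If[OF f(1)])
 have th: "tmeas h" unfolding tmeas_def h_def prod.collapse by (rule If[OF gb(1)])
 have hcl: "clean Om (%x. h x t)" for t
 proof (cases "t : G")
  case True
  then show ?thesis using PG[OF True] tmeas_slice[OF th, of t] gb(2) by (auto simp: clean_def L2_def h_def Pg_def)
 qed (simp add: h_def clean_def L2_zero)
 have Vrep: "rep Om (%x. v x t) (%x. V x t)" and VH: "\<exists>a. H0 Om (%x. V x t) a" and VAE: "AE x in lebesgue. v x t = V x t"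
  if t: "t : G" for t
 proof -
  have P: "AE x in lborel. x : Om --> v x t = f (x, t)" "AE x in lborel. x \<notin> Om --> v x t = 0" "(%x. v x t) : H10 Om"
   using PG[OF t] by (auto simp: Pg_def)
  have L: "L2 (lebesgue_on Om) (%x. v x t)" using P(3) by (auto simp: H10_def H1_def Lspace_2_real_iff)
  have "AE x in lborel. v x t = V x t" using P(1,2) by eventually_elim (use t f(2) in \<open>auto simp: V_def\<close>)
  then show "AE x in lebesgue. v x t = V x t" by (rule AE_completion)
  show r: "rep Om (%x. v x t) (%x. V x t)" unfolding rep_def AE_lebesgue_on_iff[OF Om_borel] using L2_measurable[OF L] P(1) t by (auto simp: V_def)
  have "clean Om (%x. V x t)" by (rule rep_clean[OF Om_borel L r tmeas_slice[OF tV]]) (use f(2) in \<open>auto simp: V_def\<close>)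
  then show "\<exists>a. H0 Om (%x. V x t) a" by (rule H10_imp_H0[OF op P(3) r])
 qed
 have V0: "V x t = 0" "h x t = 0" if "t \<notin> G" for x t using that by (auto simp: V_def h_def)
 have VH': "\<exists>a. H0 Om (%x. V x t) a" for t using VH[of t] H0_zero[of Om] V0(1)[of t] by (cases "t : G") auto
 have MIs: "?I : sets lebesgue" by simp
 have AEG: "AE t in ?MI. t : G" unfolding AE_lebesgue_on_iff[of ?I, simplified] using GAE by simp
 have Qi: "integrable lborel (%t. Qf (%x. V x t))"
 proof -
  have e: "(H1_norm Om (%x. v x t))\<^sup>2 = Qf (%x. V x t)" if t: "t : G" for t
  proof -
   obtain a where a: "H0 Om (%x. V x t) a" using VH[OF t] by blast
   show ?thesis unfolding H0_imp_H10(3)[OF op a Vrep[OF t]] using Qf_nonneg[OF a] Bf_eq[OF a a] by (simp add: Qf_def)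
  qed
  have "integrable ?MI (%t. (H1_norm Om (%x. v x t))\<^sup>2) \<longleftrightarrow> integrable lborel (%t. Qf (%x. V x t))"
  proof (rule lebesgue_on_clean(2))
   show "(%t. Qf (%x. V x t)) : bmb" by (rule tmeas_Qf[OF tV])
   show "Qf (%x. V x t) = 0" if "t \<notin> ?I" for t
   proof -
    have "t \<notin> G" using that Gb(2) by blast
    then have "(%x. V x t) = (%x. 0)" using V0 by auto
    then show ?thesis using Bf_eq[OF H0_zero[of Om] H0_zero[of Om]] by (simp add: Qf_def sqn_def gip_self)
   qed
   show "(%t. (H1_norm Om (%x. v x t))\<^sup>2) : borel_measurable ?MI" using vN by (auto simp: Lspace_2_real_iff L2_def)
   show "AE t in ?MI. (H1_norm Om (%x. v x t))\<^sup>2 = Qf (%x. V x t)" using AEG by eventually_elim (rule e)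
  qed simp
  then show ?thesis using vN by (simp add: Lspace_2_real_iff L2_def)
 qed
 have hi: "integrable lborel (%t. nsq (%x. h x t))"
 proof (rule Bochner_Integration.integrable_bound[OF gint])
  show "(%t. nsq (%x. h x t)) : borel_measurable lborel" using tmeas_sqn[OF th] by simp
  show "AE t in lborel. norm (nsq (%x. h x t)) <= norm (LBINT x. (gb (x, t))\<^sup>2)"
  proof (rule AE_I2)
   fix t show "norm (nsq (%x. h x t)) <= norm (LBINT x. (gb (x, t))\<^sup>2)" by (cases "t : G") (simp_all add: h_def sqn_def)
  qed
 qed
 have vLt: "L2 (lebesgue_on Om) (%x. v x t)" if "t : {0..T}" for t using ct that by (auto simp: cont_L2_def Lspace_2_real_iff)
 have GI: "t : {0..T}" if "t : G" for t using that Gb(2) by auto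
 have Vcl: "clean Om (%x. V x t)" for t using VH'[of t] H0_clean(1) by blast
 have cont: "\<exists>d>0. \<forall>t\<in>G. \<forall>t'\<in>G. \<bar>t - t'\<bar> < d --> nsq (%x. V x t - V x t') < e" if e: "e > 0" for e
 proof -
  obtain d where d: "d > 0" "!!t t'. t : {0..T} ==> t' : {0..T} ==> \<bar>t - t'\<bar> < d ==> sqrt (sqn (lebesgue_on Om) (%x. v x t - v x t')) < sqrt e"
   using uniform_L2_continuity[OF ct, of "sqrt e"] e by auto
  have "nsq (%x. V x t - V x t') < e" if "t : G" "t' : G" "\<bar>t - t'\<bar> < d" for t t'
  proof -
   have r: "sqn (lebesgue_on Om) (%x. v x t - v x t') = nsq (%x. V x t - V x t')"
    by (rule rep_sqn(2)[OF Om_borel clean_diff[OF Vcl Vcl] rep_diff[OF Vrep[OF that(1)] Vrep[OF that(2)]]])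
   show ?thesis using d(2)[OF GI[OF that(1)] GI[OF that(2)] that(3)] unfolding r real_sqrt_less_iff .
  qed
  with d(1) show ?thesis by blast
 qed
 have v0L2: "L2 (lebesgue_on Om) v0" using v0L by (simp add: Lspace_2_real_iff)
 obtain w0 where w0: "clean Om w0" "rep Om v0 w0" using ex_clean_rep[OF Om_borel v0L2] by blast
 have init: "\<exists>d>0. \<forall>t\<in>G. t < d --> nsq (%x. V x t - w0 x) < e" if e: "e > 0" for e
 proof -
  have "eventually (%t. Lnorm 2 (lebesgue_on Om) (%x. v x t - v0 x) < ennreal (sqrt e)) (at_right 0)" by (rule order_tendstoD(2)[OF ini]) (use e in simp)
  then obtain d where d: "d > 0" "!!t. 0 < t ==> t < d ==> Lnorm 2 (lebesgue_on Om) (%x. v x t - v0 x) < ennreal (sqrt e)"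
   unfolding eventually_at_right_field by blast
  have "nsq (%x. V x t - w0 x) < e" if t: "t : G" "t < d" for t
  proof -
   have "0 < t" using t(1) Gb(2) by auto
   from d(2)[OF this t(2)] have "sqrt (sqn (lebesgue_on Om) (%x. v x t - v0 x)) < sqrt e" unfolding Lnorm_2_real[OF L2_diff[OF vLt[OF GI[OF t(1)]] v0L2]]
    by (subst (asm) ennreal_less_iff) (auto intro: sqn_nonneg)
   then have "sqn (lebesgue_on Om) (%x. v x t - v0 x) < e" unfolding real_sqrt_less_iff .
   then show ?thesis unfolding rep_sqn(2)[OF Om_borel clean_diff[OF Vcl w0(1)] rep_diff[OF Vrep[OF t(1)] w0(2)]] .
  qed
  with d(1) show ?thesis by blast
 qed
 have weak: "ipl (%x. V x b - V x a) w = - (LBINT t. indicator {a<..b} t * (Af s (%x. V x t) w - ipl (%x. h x t) w))"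
  if ab: "a : G" "b : G" "a < b" and w: "H0 Om w c" for a b w c
 proof -
  have wcl: "clean Om w" by (rule H0_clean(1)[OF w])
  have wb: "w : bmb" by (rule clean_borel[OF wcl])
  have "0 < a" "b < T" using ab Gb(2) by auto
  then have abI: "0 < a" "b < T" "{a<..b} \<subseteq> ?I" by auto
  let ?ind = "%t. chf {a<..b} t"
  define ph where "ph = (%x t. ?ind t * w x)"
  have phin: "(%x. ph x t) = w" if "t : {a<..b}" for t using that by (simp add: ph_def)
  have phout: "(%x. ph x t) = (%x. 0)" if "t \<notin> {a<..b}" for t using that by (simp add: ph_def)
  have n0: "H1_norm Om (%x. 0) = 0" using H0_H1_norm[OF H0_zero] Bf_eq[OF H0_zero[of Om] H0_zero[of Om]] by (simp add: Qf_def sqn_def gip_self)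
  have ibm: "?ind : borel_measurable ?MI" by (rule borel_measurable_lebesgue_on) simp
  interpret fm: finite_measure ?MI by (rule finite_measure_lebesgue_on) simp
  have phL: "ph : L2H10 Om T" unfolding L2H10_def Lspace_time_def
  proof (intro CollectI conjI)
   have "(%z::(real^'n) \<times> real. ?ind (snd z) * w (fst z)) : borel_measurable (borel \<Otimes>\<^sub>M borel)" using wb by measurable
   then have "(%(x, t). ph x t) : bmb" unfolding ph_def case_prod_beta borel_prod[symmetric] by simp
   then show "(%(x, t). ph x t) : borel_measurable (cylinder Om T)" by (rule borel_measurable_lebesgue_on)
   show "AE t in ?MI. (%x. ph x t) : H10 Om"
   proof (rule AE_I2)
    fix t show "(%x. ph x t) : H10 Om" using H0_H10[OF w] H0_H10[OF H0_zero] phin[of t] phout[of t] by (cases "t : {a<..b}") auto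
   qed
   have e: "H1_norm Om (%x. ph x t) = ?ind t * H1_norm Om w" for t using phin[of t] phout[of t] n0 by (cases "t : {a<..b}") auto
   have "integrable ?MI (%t. (?ind t * H1_norm Om w)\<^sup>2)"
   proof (rule fm.integrable_const_bound[of _ "(H1_norm Om w)\<^sup>2"])
    show "AE t in ?MI. norm ((?ind t * H1_norm Om w)\<^sup>2) <= (H1_norm Om w)\<^sup>2" by (intro AE_I2) (auto simp: indicator_def)
   qed (use ibm in measurable)
   then show "(%t. H1_norm Om (%x. ph x t)) : Lspace 2 ?MI" unfolding e Lspace_2_real_iff L2_def using ibm by auto
  qed
  \<comment> \<open>Common reduction of the three integrals without time derivative: equality at
    good times suffices.\<close>
  have clean_t: "(LINT t|?MI. F t) = (LBINT t. ?ind t * B t)"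
   if m: "B : bmb" and F: "!!t. t : G ==> F t = ?ind t * B t" for F B
  proof -
   have mb: "(%t. ?ind t * B t) : bmb" using m by simp
   have ae: "AE t in ?MI. F t = ?ind t * B t" using AEG by eventually_elim (rule F)
   have "(LINT t|?MI. F t) = (LINT t|?MI. ?ind t * B t)" by (rule integral_AE_lebesgue_on[OF MIs borel_measurable_lebesgue_on[OF mb] ae])
   also have "\<dots> = (LBINT t. ?ind t * B t)"
    by (rule lebesgue_on_clean(1)[OF _ mb _ borel_measurable_lebesgue_on[OF mb]]) (use abI(3) in \<open>auto simp: indicator_def\<close>)
   finally show ?thesis .
  qed
  have wt: "tmeas (%x t. w x)" by (rule tmeas_const[OF wb])
  have fI: "integrable ?MI (%t. vt t w)" by (rule L2Hneg1_integrable[OF vt(1) w])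
  define m where "m = (%t. LINT x|lebesgue_on Om. v x t * w x)"
  have wL: "L2 (lebesgue_on Om) w" by (rule rep_sqn(1)[OF Om_borel wcl rep_refl[OF wb]])
  have mc: "continuous_on {0..T} m" unfolding continuous_on_iff
  proof (intro ballI allI impI)
   fix t and e :: real assume t: "t : {0..T}" and e: "e > 0"
   define K where "K = sqrt (sqn (lebesgue_on Om) w) + 1"
   have K: "K > 0" by (simp add: K_def sqn_nonneg add_nonneg_pos)
   obtain d where d: "d > 0" "!!t t'. t : {0..T} ==> t' : {0..T} ==> \<bar>t - t'\<bar> < d ==> sqrt (sqn (lebesgue_on Om) (%x. v x t - v x t')) < e / K"
    using uniform_L2_continuity[OF ct, of "e / K"] e K by auto
   have "dist (m t') (m t) < e" if t': "t' : {0..T}" "dist t' t < d" for t'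
   proof -
    have "m t' - m t = ip (lebesgue_on Om) (%x. v x t' - v x t) w" using ip_diff_left[OF vLt[OF t'(1)] vLt[OF t] wL] by (simp add: m_def ip_def)
    also have "\<bar>\<dots>\<bar> <= sqrt (sqn (lebesgue_on Om) (%x. v x t' - v x t)) * sqrt (sqn (lebesgue_on Om) w)"
     by (rule ip_Cauchy_Schwarz_sqrt[OF L2_diff[OF vLt[OF t'(1)] vLt[OF t]] wL])
    also have "\<dots> <= sqrt (sqn (lebesgue_on Om) (%x. v x t' - v x t)) * K" by (intro mult_left_mono) (auto simp: K_def sqn_nonneg)
    also have "\<dots> < e / K * K" using d(2)[OF t'(1) t] t'(2) K by (intro mult_strict_right_mono) (auto simp: dist_real_def)
    finally show ?thesis using K by (simp add: dist_real_def)
   qed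
   with d(1) show "\<exists>d>0. \<forall>x'\<in>{0..T}. dist x' t < d --> dist (m x') (m t) < e" by blast
  qed
  have wd: "(LINT t|?MI. vt t w * ps t) = - (LINT t|?MI. m t * deriv ps t)" if "ps : Cci ?I" for ps
   using vt(2) H0_H10[OF w] that unfolding is_weak_time_deriv_def m_def by blast
  have inc: "m b - m a = (LINT t|?MI. ?ind t * vt t w)" by (rule weak_deriv_increment[OF mc fI wd abI(1) ab(3) abI(2)])
  have mG: "m t = ipl (%x. V x t) w" if "t : G" for t unfolding m_def by (rule rep_ip[OF Om_borel Vcl Vrep[OF that] wb])
  have T1: "(LINT t|?MI. vt t (%x. ph x t)) = ipl (%x. V x b - V x a) w"
  proof -
   have "(LINT t|?MI. vt t (%x. ph x t)) = (LINT t|?MI. ?ind t * vt t w)"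
   proof (rule integral_AE_lebesgue_on[OF MIs])
    show "(%t. ?ind t * vt t w) : borel_measurable ?MI" using ibm fI by auto
    show "AE t in ?MI. vt t (%x. ph x t) = ?ind t * vt t w" using AEG
    proof eventually_elim
     fix t assume "t : G"
     then have F: "vt t : Hneg1 Om" using PG by (simp add: Pg_def)
     have "vt t (%x. 0 * w x + 0 * w x) = 0 * vt t w + 0 * vt t w" using F H0_H10[OF w] unfolding Hneg1_def by blast
     then have z: "vt t (%x. 0) = 0" by simp
     show "vt t (%x. ph x t) = ?ind t * vt t w" using phin[of t] phout[of t] z by (cases "t : {a<..b}") auto
    qed
   qed
   also have "\<dots> = ipl (%x. V x b) w - ipl (%x. V x a) w" using inc mG ab by simp
   also have "\<dots> = ipl (%x. V x b - V x a) w" by (rule ip_diff_left[symmetric, OF clean_L2[OF Vcl] clean_L2[OF Vcl] clean_L2[OF wcl]])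
   finally show ?thesis .
  qed
  have T2: "(LINT t|?MI. LINT x|lebesgue_on Om. weak_gradient Om (%x. v x t) x \<bullet> weak_gradient Om (%x. ph x t) x)
    = (LBINT t. ?ind t * Bf (%x. V x t) w)"
  proof (rule clean_t[OF tmeas_Bf[OF tV wt]])
   fix t assume t: "t : G"
   obtain k where k: "H0 Om (%x. V x t) k" using VH[OF t] by blast
   have r: "rep Om (weak_gradient Om (%x. v x t)) (%x. \<chi> i. k i x)" by (rule H0_imp_H10(2)[OF op k Vrep[OF t]])
   have *: "(LINT x|lebesgue_on Om. weak_gradient Om (%x. v x t) x \<bullet> weak_gradient Om u x) = Bf (%x. V x t) u" if u: "H0 Om u l" for u l
   proof -
    have "rep Om (weak_gradient Om u) (%x. \<chi> i. l i x)" by (rule H0_imp_H10(2)[OF op u rep_refl[OF clean_borel[OF H0_clean(1)[OF u]]]])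
    from rep_gip(2)[OF Om_borel H0_clean(2)[OF k] r H0_clean(2)[OF u] this] show ?thesis by (simp add: Bf_eq[OF k u])
   qed
   have z: "Bf (%x. V x t) (%x. 0) = 0" using Bf_eq[OF k H0_zero] by (simp add: gip_def ip_def)
   show "(LINT x|lebesgue_on Om. weak_gradient Om (%x. v x t) x \<bullet> weak_gradient Om (%x. ph x t) x) = ?ind t * Bf (%x. V x t) w"
    using phin[of t] phout[of t] *[OF w] *[OF H0_zero] z by (cases "t : {a<..b}") auto
  qed
  have T3: "(LINT t|?MI. LINT y|lebesgue. LINT x|lebesgue.
     (v x t - v y t) * (zero_ext Om ph x t - zero_ext Om ph y t) / norm (x - y) powr (real CARD('n) + 2 * s))
    = (LBINT t. ?ind t * NLf s (%x. V x t) w)"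
  proof (rule clean_t[OF tmeas_NLf[OF tV wt]])
   fix t assume t: "t : G"
   obtain k where k: "H0 Om (%x. V x t) k" using VH[OF t] by blast
   \<comment> \<open>\<open>w\<close> vanishes off the domain, so its extension by zero is
     \<open>w\<close> itself.\<close>
   have z: "zero_ext Om ph x t = ?ind t * w x" for x using clean_outside[OF wcl, of x] by (simp add: zero_ext_def ph_def)
   show "(LINT y|lebesgue. LINT x|lebesgue.
     (v x t - v y t) * (zero_ext Om ph x t - zero_ext Om ph y t) / norm (x - y) powr (real CARD('n) + 2 * s)) = ?ind t * NLf s (%x. V x t) w"
    unfolding z using nonlocal_eq[OF k w VAE[OF t]] by (cases "t : {a<..b}") auto
  qed
  have T4: "(LINT t|?MI. LINT x|lebesgue_on Om. g x t * ph x t) = (LBINT t. ?ind t * ipl (%x. h x t) w)"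
  proof (rule clean_t[OF tmeas_ip[OF th wt]])
   fix t assume t: "t : G"
   have hb: "(%x. h x t * w x) : bmb" using clean_borel[OF hcl[of t]] wb by simp
   have "AE x in lebesgue_on Om. g x t = h x t" unfolding AE_lebesgue_on_iff[OF Om_borel] using PG[OF t] t by (simp add: Pg_def h_def)
   then have "AE x in lebesgue_on Om. g x t * w x = h x t * w x" by eventually_elim simp
   then have "(LINT x|lebesgue_on Om. g x t * w x) = (LINT x|lebesgue_on Om. h x t * w x)"
    using Om_borel by (intro integral_AE_lebesgue_on[OF _ borel_measurable_lebesgue_on[OF hb]]) simp_all
   also have "\<dots> = ipl (%x. h x t) w" by (rule rep_ip[OF Om_borel hcl rep_refl[OF clean_borel[OF hcl]] wb])
   finally show "(LINT x|lebesgue_on Om. g x t * ph x t) = ?ind t * ipl (%x. h x t) w" by (cases "t : {a<..b}") (auto simp: ph_def)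
  qed
  have i: "integrable lborel (%t. ?ind t * Bf (%x. V x t) w)" "integrable lborel (%t. ?ind t * NLf s (%x. V x t) w)"
   by (rule integrable_form[where B = Bf, OF tV VH' Qi w disjI1[OF refl] less_imp_le[OF ab(3)]],
     rule integrable_form[where B = "NLf s", OF tV VH' Qi w disjI2[OF refl] less_imp_le[OF ab(3)]])
  have ig: "integrable lborel (%t. ?ind t * ipl (%x. h x t) w)" by (rule integrable_ip[OF th clean_L2[OF hcl] hi clean_L2[OF wcl] less_imp_le[OF ab(3)]])
  have "(LBINT t. ?ind t * (Af s (%x. V x t) w - ipl (%x. h x t) w))
    = (LBINT t. (?ind t * Bf (%x. V x t) w + (1/2) * (?ind t * NLf s (%x. V x t) w)) - ?ind t * ipl (%x. h x t) w)"
   by (intro Bochner_Integration.integral_cong) (auto simp: Af_def algebra_simps)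
  also have "\<dots> = (LBINT t. ?ind t * Bf (%x. V x t) w) + (1/2) * (LBINT t. ?ind t * NLf s (%x. V x t) w)
    - (LBINT t. ?ind t * ipl (%x. h x t) w)" using i ig by (simp add: Bochner_Integration.integral_diff Bochner_Integration.integral_add)
  finally show ?thesis using eqn[OF phL] unfolding T1 T2 T3 T4 by linarith
 qed
 have "wsol T h w0 V G" unfolding wsol_def
 proof (intro conjI)
  show "\<forall>t. t \<notin> G --> (\<forall>x. V x t = 0 & h x t = 0)" by (simp add: V_def h_def)
  show "\<forall>t. (\<exists>a. H0 Om (%x. V x t) a) & clean Om (%x. h x t)" using VH' hcl by simp
  show "\<forall>e>0. \<exists>d>0. \<forall>t\<in>G. \<forall>t'\<in>G. \<bar>t - t'\<bar> < d --> nsq (%x. V x t - V x t') < e" using cont by simp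
  show "\<forall>e>0. \<exists>d>0. \<forall>t\<in>G. t < d --> nsq (%x. V x t - w0 x) < e" using init by simp
  show "\<forall>a\<in>G. \<forall>b\<in>G. a < b --> (\<forall>w c. H0 Om w c -->
    ipl (%x. V x b - V x a) w = - (LBINT t. indicator {a<..b} t * (Af s (%x. V x t) w - ipl (%x. h x t) w)))" by (intro ballI allI impI weak)
 qed (fact tV th w0(1) Gb GAE Qi hi)+
 moreover have "\<forall>t\<in>G. AE x in lborel. x : Om --> g x t = h x t" using PG by (simp add: Pg_def h_def)
 ultimately show ?thesis using w0(2) Vrep by blast
qed

end

section \<open>Increments averaged in time\<close>

lemma isCont_indefinite_integral:
 fixes f :: "real => real"
 assumes f: "integrable lborel f"
 shows "isCont (%t. LBINT ta. indicator {c<..t} ta * f ta) t0" unfolding continuous_at_sequentially o_def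
proof (intro allI impI)
 fix u assume u: "u \<longlonglongrightarrow> t0"
 show "(%n. LBINT ta. indicator {c<..u n} ta * f ta) \<longlonglongrightarrow> (LBINT ta. indicator {c<..t0} ta * f ta)"
 proof (rule integral_dominated_convergence[where w = "%ta. \<bar>f ta\<bar>"])
  have "AE ta in lborel. ta ~= t0" by (rule AE_lborel_singleton)
  then show "AE ta in lborel. (%n. indicator {c<..u n} ta * f ta) \<longlonglongrightarrow> indicator {c<..t0} ta * f ta"
  proof eventually_elim
   fix ta assume "ta ~= t0"
   then consider "ta < t0" | "t0 < ta" by linarith
   then have "eventually (%n. indicator {c<..t0} ta * f ta = indicator {c<..u n} ta * f ta) sequentially"
   proof cases
    case 1
    show ?thesis using order_tendstoD(1)[OF u 1] by eventually_elim (use 1 in \<open>auto simp: indicator_def\<close>)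
   next
    case 2
    show ?thesis using order_tendstoD(2)[OF u 2] by eventually_elim (use 2 in \<open>auto simp: indicator_def\<close>)
   qed
   then show "(%n. indicator {c<..u n} ta * f ta) \<longlonglongrightarrow> indicator {c<..t0} ta * f ta" by (rule Lim_transform_eventually[OF tendsto_const])
  qed
  show "AE ta in lborel. norm (indicator {c<..u n} ta * f ta) <= \<bar>f ta\<bar>" for n by (intro AE_I2) (auto simp: indicator_def)
 qed (use f in auto)
qed

lemma set_int_split:
 fixes f :: "real => real"
 assumes f: "integrable lborel f" and "c <= a" "a <= b"
 shows "(LBINT ta. indicator {c<..b} ta * f ta) - (LBINT ta. indicator {c<..a} ta * f ta) = (LBINT ta. indicator {a<..b} ta * f ta)"
proof -
 have i: "integrable lborel (%ta. chf {p<..q} ta * f ta)" for p q using integrable_real_mult_indicator[OF _ f, of "{p<..q}"] by (simp add: mult.commute)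
 have "(LBINT ta. indicator {c<..b} ta * f ta) - (LBINT ta. indicator {c<..a} ta * f ta)
   = (LBINT ta. chf {c<..b} ta * f ta - chf {c<..a} ta * f ta)" by (rule Bochner_Integration.integral_diff[symmetric, OF i i])
 also have "\<dots> = (LBINT ta. indicator {a<..b} ta * f ta)" using assms by (intro Bochner_Integration.integral_cong) (auto simp: indicator_def)
 finally show ?thesis .
qed

text \<open>Averaging the increment bound over \<open>b\<close> with \<open>b - a = h\<close> fixed, and letting \<open>h \<rightarrow> 0\<close>.\<close>

lemma averaged_increments:
 fixes F r :: "real => real"
 assumes GAE: "AE t in lborel. t : {0<..<T} --> t : G" and F: "integrable lborel F"
  and r: "integrable lborel r" "!!t. 0 <= r t"
  and inc: "h0 > 0" "!!a b. a : G ==> b : G ==> a < b ==> b - a <= h0 ==> F b - F a <= (b - a) * r b"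
  and t01: "t0 : {0<..<T}" "t1 : {0<..<T}" "t0 < t1"
  and c0: "!!e. e > 0 ==> \<exists>d>0. \<forall>t\<in>G. \<bar>t - t0\<bar> < d --> \<bar>F t - F t0\<bar> <= e"
  and c1: "!!e. e > 0 ==> \<exists>d>0. \<forall>t\<in>G. \<bar>t - t1\<bar> < d --> \<bar>F t - F t1\<bar> <= e"
 shows "F t1 - F t0 <= (LBINT t. r t)"
proof (rule field_le_epsilon)
 fix e :: real assume e: "e > 0"
 obtain d0 where d0: "d0 > 0" "!!t. t : G ==> \<bar>t - t0\<bar> < d0 ==> \<bar>F t - F t0\<bar> <= e / 2" using c0[of "e/2"] e by auto
 obtain d1 where d1: "d1 > 0" "!!t. t : G ==> \<bar>t - t1\<bar> < d1 ==> \<bar>F t - F t1\<bar> <= e / 2" using c1[of "e/2"] e by auto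
 define h where "h = Min {h0, d0 / 2, d1 / 2, (t1 - t0) / 2}"
 have "h > 0" unfolding h_def using inc(1) d0(1) d1(1) t01 by (subst Min_gr_iff) auto
 moreover have hle: "h <= y" if "y : {h0, d0 / 2, d1 / 2, (t1 - t0) / 2}" for y unfolding h_def by (rule Min_le) (use that in auto)
 moreover have "h <= h0" "h <= d0 / 2" "h <= d1 / 2" "h <= (t1 - t0) / 2" by (rule hle, simp)+
 ultimately have h: "h > 0" "h <= h0" "h < d0" "h < d1" "h < t1 - t0" using d0(1) d1(1) t01 by auto
 let ?ind = "%p q t. chf {p<..q} t"
 have i: "integrable lborel (%t. ?ind p q t * f t)" if "integrable lborel f" for p q and f :: "real => real"
  using integrable_real_mult_indicator[OF _ that, of "{p<..q}"] by (simp add: mult.commute)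
 have ii: "integrable lborel (%t. ?ind p q t * c)" "(LBINT t. ?ind p q t * c) = (q - p) * c" if "p <= q" for p q and c :: real
 proof -
  have "integrable lborel (chf {p<..q})" by (rule integrable_real_indicator) (use that in auto)
  then show "integrable lborel (%t. ?ind p q t * c)" by simp
  show "(LBINT t. ?ind p q t * c) = (q - p) * c" using that by simp
 qed
 have Fh: "integrable lborel (%t. F (t - h))" using lborel_shift(2)[of F "- h"] F by auto
 \<comment> \<open>Both \<open>t\<close> and \<open>t - h\<close> have to be good times; null sets
   are invariant under translation.\<close>
 have GAEh: "AE t in lborel. t - h : {0<..<T} --> t - h : G"
 proof -
  obtain N where N: "N : null_sets lborel" "{t. \<not> (t : {0<..<T} --> t : G)} \<subseteq> N" using GAE by (auto simp: eventually_ae_filter)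
  have "(\<integral>\<^sup>+t. indicator N (t + (- h)) \<partial>lborel) = (\<integral>\<^sup>+t. indicator N t \<partial>lborel)"
   by (rule nn_integral_lborel_shift) (use N(1) in auto)
  also have "\<dots> = 0" using N(1) by (simp add: null_sets_def)
  finally have "AE t in lborel. (indicator N (t + (- h)) :: ennreal) = 0"
   using N(1) measurable_compose[of "%t. t + (- h)" lborel borel "indicator N :: real => ennreal" borel]
   by (subst (asm) nn_integral_0_iff_AE) (auto simp: null_sets_def)
  then show ?thesis
  proof eventually_elim
   fix t assume "(indicator N (t + (- h)) :: ennreal) = 0"
   then have "t - h \<notin> N" by (simp add: indicator_eq_0_iff)
   then show "t - h : {0<..<T} --> t - h : G" using N(2) by blast
  qed
 qed
 have "(LBINT t. ?ind (t0 + h) t1 t * F t) - (LBINT t. ?ind (t0 + h) t1 t * F (t - h))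
   = (LBINT t. ?ind (t0 + h) t1 t * F t - ?ind (t0 + h) t1 t * F (t - h))" by (rule Bochner_Integration.integral_diff[symmetric, OF i[OF F] i[OF Fh]])
 also have "\<dots> <= (LBINT t. h * r t)"
 proof (rule integral_mono_AE)
  show "AE t in lborel. ?ind (t0 + h) t1 t * F t - ?ind (t0 + h) t1 t * F (t - h) <= h * r t" using GAE GAEh
  proof eventually_elim
   fix t assume t: "t : {0<..<T} --> t : G" "t - h : {0<..<T} --> t - h : G"
   show "?ind (t0 + h) t1 t * F t - ?ind (t0 + h) t1 t * F (t - h) <= h * r t"
   proof (cases "t : {t0 + h<..t1}")
    case True
    then have "t : G" "t - h : G" using t t01 h by auto
    then show ?thesis using inc(2)[of "t - h" t] h True by simp
   qed (use r(2) h in auto)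
  qed
  show "integrable lborel (%t. ?ind (t0 + h) t1 t * F t - ?ind (t0 + h) t1 t * F (t - h))" by (rule Bochner_Integration.integrable_diff[OF i[OF F] i[OF Fh]])
 qed (use r in simp)
 finally have A: "(LBINT t. ?ind (t0 + h) t1 t * F t) - (LBINT t. ?ind (t0 + h) t1 t * F (t - h)) <= h * (LBINT t. r t)" by simp
 have "(LBINT t. ?ind (t0 + h) t1 t * F (t - h)) = (LBINT t. ?ind t0 (t1 - h) (t + (- h)) * F (t + (- h)))"
  by (intro Bochner_Integration.integral_cong) (auto simp: indicator_def)
 also have "\<dots> = (LBINT t. ?ind t0 (t1 - h) t * F t)" by (rule lborel_shift(1))
 finally have B: "(LBINT t. ?ind (t0 + h) t1 t * F (t - h)) = (LBINT t. ?ind t0 (t1 - h) t * F t)" .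
 \<comment> \<open>Telescoping: only the integrals of \<open>F\<close> over windows of length h
   after \<open>t0\<close> and before \<open>t1\<close> survive, and there \<open>F\<close> is close
   to \<open>F t0\<close> and \<open>F t1\<close>.\<close>
 have C: "(LBINT t. ?ind (t0 + h) t1 t * F t) - (LBINT t. ?ind t0 (t1 - h) t * F t)
   = (LBINT t. ?ind (t1 - h) t1 t * F t) - (LBINT t. ?ind t0 (t0 + h) t * F t)"
  using set_int_split[OF F, of t0 "t0 + h" t1] set_int_split[OF F, of t0 "t1 - h" t1] h by simp
 have D: "h * (F t1 - e / 2) <= (LBINT t. ?ind (t1 - h) t1 t * F t)"
 proof -
  have "(LBINT t. ?ind (t1 - h) t1 t * (F t1 - e / 2)) <= (LBINT t. ?ind (t1 - h) t1 t * F t)"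
  proof (rule integral_mono_AE)
   show "AE t in lborel. ?ind (t1 - h) t1 t * (F t1 - e / 2) <= ?ind (t1 - h) t1 t * F t" using GAE
   proof eventually_elim
    fix t assume t: "t : {0<..<T} --> t : G"
    show "?ind (t1 - h) t1 t * (F t1 - e / 2) <= ?ind (t1 - h) t1 t * F t"
    proof (cases "t : {t1 - h<..t1}")
     case True
     then have "t : G" "\<bar>t - t1\<bar> < d1" using t t01 h by auto
     then have "\<bar>F t - F t1\<bar> <= e / 2" by (rule d1(2))
     then have "F t1 - e / 2 <= F t" by argo
     then show ?thesis using True by simp
    qed simp
   qed
  qed (use ii(1)[of "t1 - h" t1 "F t1 - e / 2"] i[OF F] h in auto)
  then show ?thesis using ii(2)[of "t1 - h" t1 "F t1 - e / 2"] h by simp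
 qed
 have E: "(LBINT t. ?ind t0 (t0 + h) t * F t) <= h * (F t0 + e / 2)"
 proof -
  have "(LBINT t. ?ind t0 (t0 + h) t * F t) <= (LBINT t. ?ind t0 (t0 + h) t * (F t0 + e / 2))"
  proof (rule integral_mono_AE)
   show "AE t in lborel. ?ind t0 (t0 + h) t * F t <= ?ind t0 (t0 + h) t * (F t0 + e / 2)" using GAE
   proof eventually_elim
    fix t assume t: "t : {0<..<T} --> t : G"
    show "?ind t0 (t0 + h) t * F t <= ?ind t0 (t0 + h) t * (F t0 + e / 2)"
    proof (cases "t : {t0<..t0 + h}")
     case True
     then have "t : G" "\<bar>t - t0\<bar> < d0" using t t01 h by auto
     then have "\<bar>F t - F t0\<bar> <= e / 2" by (rule d0(2))
     then have "F t <= F t0 + e / 2" by argo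
     then show ?thesis using True by simp
    qed simp
   qed
  qed (use ii(1)[of t0 "t0 + h" "F t0 + e / 2"] i[OF F] h in auto)
  then show ?thesis using ii(2)[of t0 "t0 + h" "F t0 + e / 2"] h by simp
 qed
 have "h * (F t1 - e / 2) - h * (F t0 + e / 2) <= (LBINT t. ?ind (t1 - h) t1 t * F t) - (LBINT t. ?ind t0 (t0 + h) t * F t)" by (rule diff_mono[OF D E])
 also have "\<dots> <= h * (LBINT t. r t)" unfolding C[symmetric] B[symmetric] by (rule A)
 finally have "h * (F t1 - e / 2) - h * (F t0 + e / 2) <= h * (LBINT t. r t)" .
 then have "h * (F t1 - F t0 - e) <= h * (LBINT t. r t)" by (simp add: algebra_simps)
 then show "F t1 - F t0 <= (LBINT t. r t) + e" using h by simp
qed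

subsection \<open>Truncation functions and their primitives\<close>

text \<open>\<open>gf\<close> is a smooth nondecreasing contraction with value 0 at 0: composition
  with it preserves \<open>H0\<close> and does not raise the gradient energy. Its primitive
  \<open>Ph\<close> is the convex density whose integral is controlled when the equation is tested
  with \<open>gf\<close> of the solution.\<close>

locale trunc_fun =
 fixes gf gf' Ph :: "real => real"
 assumes sm: "smooth gf" and g0: "gf 0 = 0" and gd: "!!x. (gf has_real_derivative gf' x) (at x)"
  and gb: "!!x. 0 <= gf' x" "!!x. gf' x <= 1" and gc: "continuous_on UNIV gf'"
  and Phd: "!!x. (Ph has_real_derivative gf x) (at x)" and Ph0: "Ph 0 = 0"
begin

lemma gf_diff: "x <= y ==> 0 <= gf y - gf x & gf y - gf x <= y - x"
 by (rule mono_lip_of_deriv) (use gd gb in blast)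

lemma gf_lip: "\<bar>gf x - gf y\<bar> <= \<bar>x - y\<bar>"
 using gf_diff[of x y] gf_diff[of y x] by (cases "x <= y") auto

lemma gf_abs: "\<bar>gf x\<bar> <= \<bar>x\<bar>"
 using gf_lip[of x 0] g0 by simp

text \<open>The tangent inequality of a convex function, by the mean value theorem. It does the work
  of a chain rule in time.\<close>

lemma Ph_convex: "Ph b - Ph a <= gf b * (b - a)"
proof -
 consider "a < b" | "a = b" | "b < a" by linarith
 then show ?thesis
 proof cases
  case 1
  obtain z where z: "a < z" "z < b" "Ph b - Ph a = (b - a) * gf z" using MVT2[OF 1, of Ph gf] Phd by blast
  have "gf z <= gf b" using gf_diff[of z b] z by auto
  then have "(b - a) * gf z <= (b - a) * gf b" using 1 by (intro mult_left_mono) auto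
  then show ?thesis using z by (simp add: mult.commute)
 next
  case 3
  obtain z where z: "b < z" "z < a" "Ph a - Ph b = (a - b) * gf z" using MVT2[OF 3, of Ph gf] Phd by blast
  have "gf b <= gf z" using gf_diff[of b z] z by auto
  then have "(a - b) * gf b <= (a - b) * gf z" using 3 by (intro mult_left_mono) auto
  then show ?thesis using z by (simp add: algebra_simps)
 qed simp
qed

lemma Ph_nonneg: "0 <= Ph x"
 using Ph_convex[of 0 x] g0 Ph0 by simp

lemma Ph_le_sq: "Ph x <= x\<^sup>2"
proof -
 have "Ph x <= gf x * x" using Ph_convex[of x 0] Ph0 by simp
 also have "\<dots> <= \<bar>gf x\<bar> * \<bar>x\<bar>" by (simp add: abs_mult[symmetric])
 also have "\<dots> <= \<bar>x\<bar> * \<bar>x\<bar>" by (intro mult_right_mono gf_abs) simp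
 finally show ?thesis by (simp add: power2_eq_square)
qed

lemma Ph_diff_le: "\<bar>Ph a - Ph b\<bar> <= 2 * (\<bar>b\<bar> * \<bar>a - b\<bar>) + (a - b)\<^sup>2"
proof -
 have *: "gf x * (x - y) <= (\<bar>b\<bar> + \<bar>a - b\<bar>) * \<bar>a - b\<bar>" if "x : {a, b}" "y : {a, b}" "x ~= y" for x y
 proof -
  have "gf x * (x - y) <= \<bar>gf x\<bar> * \<bar>x - y\<bar>" by (simp add: abs_mult[symmetric])
  also have "\<dots> <= (\<bar>b\<bar> + \<bar>a - b\<bar>) * \<bar>x - y\<bar>" using gf_abs[of x] that by (intro mult_right_mono) auto
  also have "\<bar>x - y\<bar> = \<bar>a - b\<bar>" using that by auto
  finally show ?thesis .
 qed
 have "\<bar>Ph a - Ph b\<bar> <= (\<bar>b\<bar> + \<bar>a - b\<bar>) * \<bar>a - b\<bar>"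
 proof (cases "a = b")
  case False
  then show ?thesis using Ph_convex[of a b] Ph_convex[of b a] *[of a b] *[of b a] by (auto simp: abs_le_iff)
 qed simp
 also have "\<dots> = \<bar>b\<bar> * \<bar>a - b\<bar> + (a - b)\<^sup>2" by (simp add: distrib_right power2_eq_square abs_mult[symmetric])
 also have "\<dots> <= 2 * (\<bar>b\<bar> * \<bar>a - b\<bar>) + (a - b)\<^sup>2" by simp
 finally show ?thesis .
qed

lemma gf_borel: "gf : bmb"
 by (rule borel_measurable_continuous_onI[OF smooth_continuous_on[OF sm]])

lemma Ph_borel: "Ph : bmb"
 by (rule borel_measurable_continuous_onI) (use Phd in \<open>blast intro: continuous_at_imp_continuous_on DERIV_isCont\<close>)

lemma Ph_integrable:
 assumes "L2l u" shows "integrable lborel (%x. Ph (u x))"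
proof (rule Bochner_Integration.integrable_bound[OF L2_integrable_sq[OF assms]])
 show "(%x. Ph (u x)) : borel_measurable lborel" using measurable_compose[OF L2_measurable[OF assms] Ph_borel] .
 show "AE x in lborel. norm (Ph (u x)) <= norm ((u x)\<^sup>2)" using Ph_nonneg Ph_le_sq by (intro AE_I2) auto
qed

text \<open>Since \<open>gf\<close> grows at most linearly, the integral of \<open>Ph\<close> is
  continuous in L2 with an explicit modulus at \<open>w\<close>. This transfers the L2 continuity of
  solutions, and the initial value, to energies.\<close>

lemma Ph_integral_diff:
 fixes u w :: "'a::euclidean_space => real"
 assumes u: "L2l u" and w: "L2l w"
 shows "\<bar>(LBINT x. Ph (u x)) - (LBINT x. Ph (w x))\<bar>
  <= 2 * (sqrt (nsq w) * sqrt (nsq (%x. u x - w x))) + nsq (%x. u x - w x)"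
proof -
 have d: "L2l (%x. u x - w x)" by (rule L2_diff[OF u w])
 have a: "L2l (%x. \<bar>u x - w x\<bar>)" "L2l (%x. \<bar>w x\<bar>)" using d w by (auto simp: L2_def)
 have "\<bar>(LBINT x. Ph (u x)) - (LBINT x. Ph (w x))\<bar> = \<bar>LBINT x. Ph (u x) - Ph (w x)\<bar>"
  by (simp add: Bochner_Integration.integral_diff[OF Ph_integrable[OF u] Ph_integrable[OF w]])
 also have "\<dots> <= (LBINT x. \<bar>Ph (u x) - Ph (w x)\<bar>)" using integral_norm_bound[of lborel "%x. Ph (u x) - Ph (w x)"] by simp
 also have "\<dots> <= (LBINT x. 2 * (\<bar>w x\<bar> * \<bar>u x - w x\<bar>) + (u x - w x)\<^sup>2)"
 proof (rule integral_mono)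
  show "integrable lborel (%x. 2 * (\<bar>w x\<bar> * \<bar>u x - w x\<bar>) + (u x - w x)\<^sup>2)"
   using L2_integrable_mult[OF a(2,1)] L2_integrable_sq[OF d] by simp
  show "integrable lborel (%x. \<bar>Ph (u x) - Ph (w x)\<bar>)" using Ph_integrable[OF u] Ph_integrable[OF w] by simp
 qed (rule Ph_diff_le)
 also have "\<dots> = 2 * ipl (%x. \<bar>w x\<bar>) (%x. \<bar>u x - w x\<bar>) + nsq (%x. u x - w x)"
  using L2_integrable_mult[OF a(2,1)] L2_integrable_sq[OF d] by (simp add: ip_def sqn_def)
 also have "ipl (%x. \<bar>w x\<bar>) (%x. \<bar>u x - w x\<bar>) <= sqrt (nsq w) * sqrt (nsq (%x. u x - w x))"
  using ip_Cauchy_Schwarz_sqrt[OF a(2,1)] by (simp add: sqn_def)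
 finally show ?thesis by simp
qed

lemma Ph_convex_integral:
 assumes u: "L2l u" and w: "L2l w"
 shows "(LBINT x. Ph (u x)) - (LBINT x. Ph (w x)) <= ipl (%x. u x - w x) (%x. gf (u x))"
proof -
 have gu: "L2l (%x. gf (u x))" by (rule L2_bound[OF u measurable_compose[OF L2_measurable[OF u] gf_borel]]) (use gf_abs in auto)
 have "(LBINT x. Ph (u x)) - (LBINT x. Ph (w x)) = (LBINT x. Ph (u x) - Ph (w x))"
  by (simp add: Bochner_Integration.integral_diff[OF Ph_integrable[OF u] Ph_integrable[OF w]])
 also have "\<dots> <= (LBINT x. (u x - w x) * gf (u x))" using Ph_integrable[OF u] Ph_integrable[OF w] L2_integrable_mult[OF L2_diff[OF u w] gu] Ph_convex
  by (intro integral_mono) (auto simp: mult.commute)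
 finally show ?thesis by (simp add: ip_def)
qed

end

section \<open>The energy inequality for truncations\<close>

definition Rj :: "nat => ((real^'n::finite) => real) => real" where
 "Rj j u = lim (%k. \<Sum>i\<in>UNIV. nsq (%x. DQ j (axis i 1) u x - DQ k (axis i 1) u x))"

text \<open>Identifies \<open>Rj\<close> as the squared error of the j-th difference quotients
  against the gradient. Its definition through finer quotients in place of the gradient keeps it
  measurable in time.\<close>

lemma Rj_eq:
 assumes u: "H0 Om u a" shows "Rj j u = (\<Sum>i\<in>UNIV. nsq (%x. DQ j (axis i 1) u x - a i x))" unfolding Rj_def
proof (rule limI, rule tendsto_sum, rule sqn_tendsto)
 fix i
 show "L2l (%x. DQ j (axis i 1) u x - DQ k (axis i 1) u x)" for k by (intro L2_diff L2_DQ H0_L2[OF u])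
 show "L2l (%x. DQ j (axis i 1) u x - a i x)" by (intro L2_diff L2_DQ H0_L2[OF u] H0_grad_L2[OF u])
 have "(%x. DQ j (axis i 1) u x - DQ k (axis i 1) u x - (DQ j (axis i 1) u x - a i x)) = (%x. a i x - DQ k (axis i 1) u x)" for k by (simp add: fun_eq_iff)
 then show "(%k. nsq (%x. DQ j (axis i 1) u x - DQ k (axis i 1) u x - (DQ j (axis i 1) u x - a i x))) \<longlonglongrightarrow> 0"
  using H0_DQ_tendsto[OF u, of i] by (simp add: sqn_commute[of lborel "a i"])
qed

lemma tmeas_Rj:
 fixes V :: "(real^'n::finite) => real => real"
 shows "tmeas V ==> (%t. Rj j (%x. V x t)) : bmb" unfolding Rj_def
proof (intro borel_measurable_lim_metric borel_measurable_sum)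
 fix k and i :: 'n assume V: "tmeas V"
 have "tmeas (%x t. DQ j (axis i 1) (%x. V x t) x - DQ k (axis i 1) (%x. V x t) x)"
  using tmeas_DQ[OF V, of j "axis i 1"] tmeas_DQ[OF V, of k "axis i 1"] unfolding tmeas_def by simp
 from tmeas_sqn[OF this] show "(%t. nsq (%x. DQ j (axis i 1) (%x. V x t) x - DQ k (axis i 1) (%x. V x t) x)) : bmb" .
qed

lemma sqn_diff_le: "L2 M f ==> L2 M g ==> sqn M (%x. f x - g x) <= 2 * sqn M f + 2 * sqn M g"
 using sqn_add_le[of M f "%x. - 1 * g x"] L2_cmult[of M g "-1"] sqn_cmult[of M "-1" g] by simp

lemma Rj_props:
 fixes u :: "(real^'n::finite) => real"
 assumes u: "H0 Om u a"
 shows "0 <= Rj j u" "Rj j u <= (2 * CARD('n) + 2) * Bf u u" "(%j. Rj j u) \<longlonglongrightarrow> 0"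
proof -
 show "0 <= Rj j u" unfolding Rj_eq[OF u] by (intro sum_nonneg sqn_nonneg)
 have "Rj j u <= (\<Sum>i\<in>UNIV. 2 * nsq (DQ j (axis i 1) u) + 2 * nsq (a i))"
  unfolding Rj_eq[OF u] by (intro sum_mono sqn_diff_le L2_DQ H0_L2[OF u] H0_grad_L2[OF u])
 also have "\<dots> <= (\<Sum>i\<in>(UNIV::'n set). 2 * gip a a + 2 * nsq (a i))" by (intro sum_mono add_right_mono mult_left_mono H0_sqn_DQ[OF u]) auto
 also have "\<dots> = (2 * CARD('n) + 2) * gip a a" by (simp add: sum.distrib gip_self sum_distrib_left[symmetric] algebra_simps)
 finally show "Rj j u <= (2 * CARD('n) + 2) * Bf u u" by (simp add: Bf_eq[OF u u])
 have "(%j. \<Sum>i\<in>UNIV. nsq (%x. DQ j (axis i 1) u x - a i x)) \<longlonglongrightarrow> (\<Sum>i\<in>(UNIV::'n set). 0)"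
  by (rule tendsto_sum) (rule H0_DQ_tendsto[OF u])
 then show "(%j. Rj j u) \<longlonglongrightarrow> 0" by (simp add: Rj_eq[OF u])
qed

text \<open>At a fixed scale j the difference quotient of u - w is bounded by the L2 norm of u - w,
  with a factor j + 1. Gradients are thus close whenever the functions are close in L2 and both
  errors \<open>Rj\<close> are small; this stands in for continuity of gradients in time.\<close>

lemma Bf_diff_le_Rj:
 fixes u w :: "(real^'n::finite) => real"
 assumes u: "H0 Om u a" and w: "H0 Om w b"
 shows "Bf (%x. u x - w x) (%x. u x - w x)
  <= 8 * CARD('n) * (real (Suc j))\<^sup>2 * nsq (%x. u x - w x) + 4 * Rj j u + 4 * Rj j w"
proof -
 let ?d = "%x. u x - w x"
 let ?D = "%i. DQ j (axis i (1::real))"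
 have d: "H0 Om ?d (%i x. a i x - b i x)" by (rule H0_diff[OF u w])
 have *: "nsq (%x. a i x - b i x) <= 8 * (real (Suc j))\<^sup>2 * nsq ?d
   + 4 * nsq (%x. ?D i u x - a i x) + 4 * nsq (%x. ?D i w x - b i x)" for i
 proof -
  have L: "L2l (%x. ?D i u x - a i x)" "L2l (%x. ?D i w x - b i x)" "L2l (?D i ?d)"
   by (intro L2_diff L2_DQ H0_L2[OF u] H0_grad_L2[OF u] H0_L2[OF w] H0_grad_L2[OF w])+
  have "(%x. a i x - b i x) = (%x. ?D i ?d x - ((?D i u x - a i x) - (?D i w x - b i x)))" by (simp add: fun_eq_iff DQ_def Inc_def algebra_simps)
  then have "nsq (%x. a i x - b i x) <= 2 * nsq (?D i ?d) + 2 * nsq (%x. (?D i u x - a i x) - (?D i w x - b i x))"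
   using sqn_diff_le[OF L(3) L2_diff[OF L(1,2)]] by simp
  moreover have "nsq (%x. (?D i u x - a i x) - (?D i w x - b i x)) <= 2 * nsq (%x. ?D i u x - a i x) + 2 * nsq (%x. ?D i w x - b i x)"
   by (rule sqn_diff_le[OF L(1,2)])
  moreover have "nsq (?D i ?d) <= (real (Suc j))\<^sup>2 * (4 * nsq ?d)"
   unfolding DQ_def[abs_def] sqn_cmult by (intro mult_left_mono sqn_Inc_le H0_L2[OF d]) simp
  ultimately show ?thesis by linarith
 qed
 have "Bf ?d ?d = (\<Sum>i\<in>UNIV. nsq (%x. a i x - b i x))" by (simp add: Bf_eq[OF d d] gip_self)
 also have "\<dots> <= (\<Sum>i\<in>(UNIV::'n set). 8 * (real (Suc j))\<^sup>2 * nsq ?d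
   + 4 * nsq (%x. ?D i u x - a i x) + 4 * nsq (%x. ?D i w x - b i x))" by (intro sum_mono *)
 also have "\<dots> = 8 * CARD('n) * (real (Suc j))\<^sup>2 * nsq ?d + 4 * Rj j u + 4 * Rj j w"
  by (simp add: sum.distrib Rj_eq[OF u] Rj_eq[OF w] sum_distrib_left)
 finally show ?thesis .
qed

lemma AE_real_ex_small:
 assumes ae: "AE t in lborel. t : {0<..<T} --> t : G" and m: "0 < m" "m <= (T::real)"
 shows "\<exists>t\<in>G. 0 < t & t < m"
proof (rule ccontr)
 assume n: "\<not> ?thesis"
 have "AE t in lborel. t \<notin> {0<..<m}" using ae by eventually_elim (use n m in auto)
 then have "emeasure lborel {0<..<m} = 0" by (subst (asm) AE_iff_measurable[of "{0<..<m}"]) auto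
 then show False using m by simp
qed

context frac begin

text \<open>A small weight l falls on the solution and the source, while the test function pays
  1/l.\<close>

lemma form_Young:
 assumes u: "H0 Om u a" and w: "H0 Om w b" and g: "L2l g" and l: "l > 0"
 shows "\<bar>Af s u w - ipl g w\<bar> <= l * (CA * Qf u + nsq g) + (CA + 1) / l * Qf w"
proof -
 have "0 <= nsq (%x. l * g x + k * w x)" for k by (rule sqn_nonneg)
 from this[of 1] this[of "-1"] have "2 * (l * \<bar>ipl g w\<bar>) <= l\<^sup>2 * nsq g + nsq w"
  unfolding sqn_lincomb[OF g H0_L2[OF w]] using l by (simp add: abs_if)
 also have "\<dots> <= 2 * (l\<^sup>2 * nsq g + nsq w)" using sqn_nonneg[of lborel g] sqn_nonneg[of lborel w] by simp
 finally have "l * \<bar>ipl g w\<bar> <= l * (l * nsq g + nsq w / l)" using l by (simp add: power2_eq_square algebra_simps)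
 then have "\<bar>ipl g w\<bar> <= l * nsq g + nsq w / l" using l by simp
 moreover have "nsq w / l <= Qf w / l" using Bf_nonneg[OF w] l by (intro divide_right_mono) (auto simp: Qf_def)
 moreover have "\<bar>Af s u w\<bar> <= CA * (l * Qf u + Qf w / l)" by (rule Af_Young[OF u w l])
 moreover have "CA * (l * Qf u + Qf w / l) + l * nsq g + Qf w / l = l * (CA * Qf u + nsq g) + (CA + 1) / l * Qf w"
  by (simp add: algebra_simps add_divide_distrib)
 moreover have "\<bar>Af s u w - ipl g w\<bar> <= \<bar>Af s u w\<bar> + \<bar>ipl g w\<bar>" by (rule abs_triangle_ineq4)
 ultimately show ?thesis by linarith
qed

text \<open>Testing the increment over \<open>{a'<..b}\<close> with the truncation frozen at b,
  \<open>Ph_convex\<close> gives an inequality whose test function belongs to the wrong time. The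
  correction is the form against \<open>ph b - ph ta\<close>, estimated by \<open>form_Young\<close>
  and \<open>Bf_diff_le_Rj\<close>. What depends on \<open>ta\<close> is collected in
  \<open>k\<close>, what depends on b alone in \<open>r\<close>; averaging over b turns
  \<open>r\<close> into a small integral.\<close>

theorem energy_inequality:
 assumes ws: "wsol T g v0 V G" and tf: "trunc_fun gf gf' Ph" and t1: "t1 : G"
 shows "integrable lborel (%ta. Af s (%x. V x ta) (%x. gf (V x ta)) - ipl (%x. g x ta) (%x. gf (V x ta)))" (is "integrable lborel ?al")
  and "(LBINT x. Ph (V x t1)) + (LBINT ta. indicator {0<..t1} ta * (Af s (%x. V x ta) (%x. gf (V x ta)) - ipl (%x. g x ta) (%x. gf (V x ta))))
   <= (LBINT x. Ph (v0 x))"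
proof -
 interpret trunc_fun gf gf' Ph by (rule tf)
 have tV: "tmeas V" and tg: "tmeas g" and v0c: "clean Om v0" and Gb: "G : sets borel" "G \<subseteq> {0<..<T}"
  and GAE: "AE t in lborel. t : {0<..<T} --> t : G"
  and VH: "!!t. \<exists>a. H0 Om (%x. V x t) a" and gcl: "!!t. clean Om (%x. g x t)"
  and Qi: "integrable lborel (%t. Qf (%x. V x t))" and gi: "integrable lborel (%t. nsq (%x. g x t))"
  and cont: "!!e. e > 0 ==> \<exists>d>0. \<forall>t\<in>G. \<forall>t'\<in>G. \<bar>t - t'\<bar> < d --> nsq (%x. V x t - V x t') < e"
  and init: "!!e. e > 0 ==> \<exists>d>0. \<forall>t\<in>G. t < d --> nsq (%x. V x t - v0 x) < e"
  and weak: "!!a b w c. a : G ==> b : G ==> a < b ==> H0 Om w c ==>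
    ipl (%x. V x b - V x a) w = - (LBINT t. indicator {a<..b} t * (Af s (%x. V x t) w - ipl (%x. g x t) w))" using ws unfolding wsol_def by blast+
 obtain a where a: "!!t. H0 Om (%x. V x t) (a t)" using VH by metis
 define ph where "ph = (%x t. gf (V x t))"
 have Hph: "H0 Om (%x. ph x t) (%i x. gf' (V x t) * a t i x)" for t unfolding ph_def by (rule H0_compose[OF a sm g0 gd gb gc])
 have tph: "tmeas ph" using measurable_compose[OF tV[unfolded tmeas_def] gf_borel] by (simp add: tmeas_def ph_def)
 have VL: "L2l (%x. V x t)" for t by (rule H0_L2[OF a])
 have phL: "L2l (%x. ph x t)" for t by (rule H0_L2[OF Hph])
 have gL: "L2l (%x. g x t)" for t by (rule clean_L2[OF gcl])
 define Q where "Q = (%t. Qf (%x. V x t))"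
 define S where "S = (%t. nsq (%x. g x t))"
 have Q0: "0 <= Q t" and S0: "0 <= S t" for t unfolding Q_def S_def by (rule Qf_nonneg[OF a], rule sqn_nonneg)
 have Bfph: "Bf (%x. ph x t) (%x. ph x t) <= Bf (%x. V x t) (%x. V x t)" for t unfolding Bf_eq[OF Hph Hph] Bf_eq[OF a a]
  by (rule order_trans[OF gip_compose_le(1)[OF a gc gb] gip_compose_le(2)[OF a gc gb]])
 have sqph: "nsq (%x. ph x t) <= nsq (%x. V x t)" for t by (rule sqn_mono[OF VL L2_measurable[OF phL]]) (simp add: ph_def gf_abs)
 have Qph: "Qf (%x. ph x t) <= Q t" for t unfolding Q_def Qf_def using Bfph[of t] sqph[of t] by linarith
 have sqQ: "nsq (%x. V x t) <= Q t" for t unfolding Q_def Qf_def using Bf_nonneg[OF a, of t] by linarith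
 define al where "al = (%ta. Af s (%x. V x ta) (%x. ph x ta) - ipl (%x. g x ta) (%x. ph x ta))"
 have alm: "al : bmb" unfolding al_def using tmeas_Af[OF tV tph] tmeas_ip[OF tg tph] by simp
 have ali: "integrable lborel al"
 proof (rule Bochner_Integration.integrable_bound)
  show "integrable lborel (%t. (CA * Q t + S t) + (CA + 1) * Q t)" using Qi gi unfolding Q_def S_def by simp
  show "AE t in lborel. norm (al t) <= norm ((CA * Q t + S t) + (CA + 1) * Q t)"
  proof (rule AE_I2)
   fix t
   have "\<bar>al t\<bar> <= 1 * (CA * Q t + S t) + (CA + 1) / 1 * Qf (%x. ph x t)" unfolding al_def Q_def S_def by (rule form_Young[OF a Hph gL]) simp
   also have "\<dots> <= (CA * Q t + S t) + (CA + 1) * Q t" using CA_pos Qph[of t] by (simp add: mult_left_mono)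
   finally show "norm (al t) <= norm ((CA * Q t + S t) + (CA + 1) * Q t)" by simp
  qed
 qed (use alm in simp)
 then show "integrable lborel ?al" by (simp add: al_def ph_def)
 define E where "E = (%t. LBINT x. Ph (V x t))"
 have Em: "E : bmb"
 proof -
  have "(%z. V (snd z) (fst z)) : borel_measurable (borel \<Otimes>\<^sub>M lborel)" by (rule tmeas_compose[OF tV]) measurable
  from measurable_compose[OF this Ph_borel]
  have "(%(t, x). Ph (V x t)) : borel_measurable (borel \<Otimes>\<^sub>M lborel)" by (simp add: case_prod_beta)
  then show ?thesis unfolding E_def by (rule lborel.borel_measurable_lebesgue_integral)
 qed
 have E0: "0 <= E t" for t unfolding E_def by (intro integral_nonneg_AE AE_I2 Ph_nonneg)
 have Ei: "integrable lborel E"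
 proof (rule Bochner_Integration.integrable_bound[OF Qi])
  show "AE t in lborel. norm (E t) <= norm (Qf (%x. V x t))"
  proof (rule AE_I2)
   fix t
   have "E t <= nsq (%x. V x t)" unfolding E_def sqn_def by (rule integral_mono[OF Ph_integrable[OF VL] L2_integrable_sq[OF VL] Ph_le_sq])
   then show "norm (E t) <= norm (Qf (%x. V x t))" using E0[of t] sqQ[of t] Q0[of t] by (simp add: Q_def)
  qed
 qed (use Em in simp)
 have near: "\<exists>p>0. \<forall>u. L2l u --> nsq (%x. u x - w x) < p --> \<bar>(LBINT x. Ph (u x)) - (LBINT x. Ph (w x))\<bar> <= e"
  if w: "L2l w" and e: "e > 0" for w :: "(real^'n) => real" and e
 proof -
  define N where "N = sqrt (nsq w)"
  define q where "q = min 1 (e / (2 * N + 1))"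
  have N: "0 <= N" by (simp add: N_def sqn_nonneg)
  have q: "0 < q" "q <= 1" "q <= e / (2 * N + 1)" using N e by (auto simp: q_def)
  have "\<bar>(LBINT x. Ph (u x)) - (LBINT x. Ph (w x))\<bar> <= e" if u: "L2l u" "nsq (%x. u x - w x) < q\<^sup>2" for u
  proof -
   let ?d = "nsq (%x. u x - w x)"
   have sd: "sqrt ?d <= q" using real_sqrt_le_mono[OF less_imp_le[OF u(2)]] q by simp
   have "q\<^sup>2 <= q" using q by (simp add: power2_eq_square mult_left_le)
   then have "?d <= q" using u(2) by linarith
   have "\<bar>(LBINT x. Ph (u x)) - (LBINT x. Ph (w x))\<bar> <= 2 * (N * sqrt ?d) + ?d" unfolding N_def by (rule Ph_integral_diff[OF u(1) w])
   also have "\<dots> <= 2 * (N * q) + q" using mult_left_mono[OF sd N] \<open>?d <= q\<close> by linarith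
   also have "\<dots> = (2 * N + 1) * q" by (simp add: algebra_simps)
   also have "\<dots> <= (2 * N + 1) * (e / (2 * N + 1))" using q N by (intro mult_left_mono) auto
   also have "\<dots> = e" using N by simp
   finally show ?thesis .
  qed
  then show ?thesis using q by (intro exI[of _ "q\<^sup>2"]) auto
 qed
 have Econt: "\<exists>d>0. \<forall>t\<in>G. \<bar>t - t'\<bar> < d --> \<bar>E t - E t'\<bar> <= e" if t': "t' : G" and e: "e > 0" for t' e
 proof -
  obtain p where p: "p > 0" "!!u. L2l u ==> nsq (%x. u x - V x t') < p ==> \<bar>(LBINT x. Ph (u x)) - E t'\<bar> <= e"
   using near[OF VL[of t'] e] unfolding E_def by blast
  obtain d where d: "d > 0" "\<forall>t\<in>G. \<forall>t'\<in>G. \<bar>t - t'\<bar> < d --> nsq (%x. V x t - V x t') < p" using cont[OF p(1)] by blast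
  have "\<bar>E t - E t'\<bar> <= e" if "t : G" "\<bar>t - t'\<bar> < d" for t using p(2)[OF VL[of t]] d(2) that t' unfolding E_def by blast
  with d(1) show ?thesis by blast
 qed
 define R where "R = (%j t. Rj j (%x. ph x t))"
 have Rm: "R j : bmb" for j unfolding R_def by (rule tmeas_Rj[OF tph])
 have R0: "0 <= R j t" for j t unfolding R_def by (rule Rj_props(1)[OF Hph])
 have RQ: "R j t <= (2 * CARD('n) + 2) * Q t" for j t
 proof -
  have "R j t <= (2 * CARD('n) + 2) * Bf (%x. ph x t) (%x. ph x t)" unfolding R_def by (rule Rj_props(2)[OF Hph])
  also have "\<dots> <= (2 * CARD('n) + 2) * Q t" using Qph[of t] sqn_nonneg[of lborel "%x. ph x t"] by (intro mult_left_mono) (auto simp: Qf_def)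
  finally show ?thesis .
 qed
 have QRi: "integrable lborel (%t. (2 * CARD('n) + 2) * Q t)" using Qi unfolding Q_def by simp
 have Ri: "integrable lborel (R j)" for j
 proof (rule Bochner_Integration.integrable_bound[OF QRi])
  show "AE t in lborel. norm (R j t) <= norm ((2 * CARD('n) + 2) * Q t)"
  proof (rule AE_I2)
   fix t show "norm (R j t) <= norm ((2 * CARD('n) + 2) * Q t)" using RQ[of j t] R0[of j t] by simp
  qed
 qed (use Rm in simp)
 have Rlim: "(%j. LBINT t. R j t) \<longlonglongrightarrow> 0"
 proof -
  have "(%j. LBINT t. R j t) \<longlonglongrightarrow> (LINT t|(lborel::real measure). 0)"
  proof (rule integral_dominated_convergence[OF _ _ QRi])
   show "AE t in lborel. (%j. R j t) \<longlonglongrightarrow> 0" unfolding R_def by (intro AE_I2 Rj_props(3)[OF Hph])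
   show "AE t in lborel. norm (R j t) <= (2 * CARD('n) + 2) * Q t" for j
   proof (rule AE_I2)
    fix t show "norm (R j t) <= (2 * CARD('n) + 2) * Q t" using RQ[of j t] R0[of j t] by simp
   qed
  qed (use Rm in auto)
  then show ?thesis by simp
 qed
 have ind_i: "integrable lborel (%ta. chf {p<..q} ta * f ta)" if "integrable lborel f" for p q and f :: "real => real"
  using integrable_real_mult_indicator[OF _ that, of "{p<..q}"] by (simp add: mult.commute)
 have T: "0 < T" using t1 Gb by auto
 have main: "E t1 - E t0 + (LBINT ta. indicator {t0<..t1} ta * al ta) <= 0" if t0: "t0 : G" "t0 < t1" for t0
 proof (rule field_le_epsilon)
  fix e :: real assume e: "e > 0"
  define KQ where "KQ = (LBINT t. CA * Q t + S t)"
  have Ki: "integrable lborel (%t. CA * Q t + S t)" using Qi gi unfolding Q_def S_def by simp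
  have K0: "0 <= CA * Q t + S t" for t using CA_pos Q0[of t] S0[of t] by simp
  have KQ0: "0 <= KQ" unfolding KQ_def by (intro integral_nonneg_AE AE_I2 K0)
  \<comment> \<open>Order of choices: \<open>l\<close> limits the contribution of solution and
    source to e/3 and fixes \<open>C\<close>; \<open>j\<close> limits that of the integrals of
    \<open>R j\<close> to e/3; \<open>e1\<close> limits that of the L2 oscillation, weighted with
    \<open>M\<close>, to e/3; \<open>d\<close> is the matching time step.\<close>
  define l where "l = e / (3 * (KQ + 1))"
  have l: "l > 0" using e KQ0 by (simp add: l_def)
  have lK: "l * KQ <= e / 3"
  proof -
   have "l * KQ <= l * (KQ + 1)" using l by simp
   also have "\<dots> = e / 3" using KQ0 by (simp add: l_def divide_simps)
   finally show ?thesis .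
  qed
  define C where "C = (CA + 1) / l"
  have C: "C > 0" using l CA_pos by (simp add: C_def)
  \<comment> \<open>24 is 3 times 8: the error occurs with factor 4 in \<open>k\<close> and once
    more with factor 4 in \<open>r\<close>.\<close>
  obtain j where j: "(LBINT t. R j t) < e / (24 * C)"
   by (rule eventually_happens'[OF sequentially_bot order_tendstoD(2)[OF Rlim], of "e / (24 * C)", THEN exE]) (use e C in auto)
  define M where "M = 1 + 8 * CARD('n) * (real (Suc j))\<^sup>2"
  have M: "M >= 1" by (simp add: M_def)
  define e1 where "e1 = e / (3 * C * M * T)"
  have e1: "e1 > 0" using e C M T by (simp add: e1_def)
  obtain d where d: "d > 0" "!!t t'. t : G ==> t' : G ==> \<bar>t - t'\<bar> < d ==> nsq (%x. V x t - V x t') < e1" using cont[OF e1] by blast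
  define k where "k = (%ta. l * (CA * Q ta + S ta) + C * (M * e1 * chf {0<..T} ta + 4 * R j ta))"
  define r where "r = (%b. 4 * C * R j b)"
  have indT: "integrable lborel (chf {0<..T})" by (rule integrable_real_indicator) (use T in auto)
  have ki: "integrable lborel k" unfolding k_def by (rule Bochner_Integration.integrable_add[OF integrable_mult_right[OF Ki]
      integrable_mult_right[OF Bochner_Integration.integrable_add[OF integrable_mult_right[OF indT] integrable_mult_right[OF Ri]]]])
  have k0: "0 <= k ta" for ta
  proof -
   have "0 <= l * (CA * Q ta + S ta)" using l K0[of ta] by (intro mult_nonneg_nonneg) auto
   moreover have "0 <= C * (M * e1 * chf {0<..T} ta + 4 * R j ta)" using C M e1 R0[of j ta] by (intro mult_nonneg_nonneg add_nonneg_nonneg) auto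
   ultimately show ?thesis unfolding k_def by (rule add_nonneg_nonneg)
  qed
  have ri: "integrable lborel r" unfolding r_def using Ri[of j] by simp
  have r0: "0 <= r b" for b unfolding r_def using C R0[of j b] by simp
  define I where "I = (%t. LBINT ta. indicator {0<..t} ta * (al ta - k ta))"
  have aki: "integrable lborel (%ta. al ta - k ta)" using ali ki by simp
  have Ic: "isCont I t" for t unfolding I_def by (rule isCont_indefinite_integral[OF aki])
  \<comment> \<open>The energy plus the accumulated integral of \<open>al - k\<close>; the cut-off
    to \<open>{0<..<T}\<close> makes it integrable over the line.\<close>
  define F where "F = (%t. E t + chf {0<..<T} t * I t)"
  have FG: "F t = E t + I t" if "t : G" for t using that Gb(2) by (auto simp: F_def indicator_def)
  have Fi: "integrable lborel F"
  proof -
   have "continuous_on {0..T} I" using Ic by (intro continuous_at_imp_continuous_on) auto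
   then have "set_integrable lborel {0..T} I" by (rule borel_integrable_atLeastAtMost')
   then have "set_integrable lborel {0<..<T} I" by (rule set_integrable_subset) auto
   then show ?thesis unfolding F_def using Ei by (simp add: set_integrable_def)
  qed
  have Fc: "\<exists>d>0. \<forall>t\<in>G. \<bar>t - t'\<bar> < d --> \<bar>F t - F t'\<bar> <= e" if t': "t' : G" and e: "e > 0" for t' e
  proof -
   obtain d1 where d1: "d1 > 0" "!!t. t : G ==> \<bar>t - t'\<bar> < d1 ==> \<bar>E t - E t'\<bar> <= e / 2" using Econt[OF t', of "e/2"] e by auto
   obtain d2 where d2: "d2 > 0" "!!t. \<bar>t - t'\<bar> < d2 ==> \<bar>I t - I t'\<bar> < e / 2"
    using Ic[of t', unfolded continuous_at_eps_delta dist_real_def] e half_gt_zero by metis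
   have "\<bar>F t - F t'\<bar> <= e" if "t : G" "\<bar>t - t'\<bar> < min d1 d2" for t
   proof -
    have "\<bar>E t - E t'\<bar> <= e / 2" "\<bar>I t - I t'\<bar> < e / 2" using d1(2)[of t] d2(2)[of t] that by auto
    then show ?thesis unfolding FG[OF that(1)] FG[OF t'] by argo
   qed
   then show ?thesis using d1(1) d2(1) by (intro exI[of _ "min d1 d2"]) auto
  qed
  have inc: "F b - F a' <= (b - a') * r b" if ab: "a' : G" "b : G" "a' < b" "b - a' <= d / 2" for a' b
  proof -
   have ab': "0 <= a'" "a' <= b" using ab Gb(2) by auto
   let ?ind = "chf {a'<..b}"
   have 1: "E b - E a' <= ipl (%x. V x b - V x a') (%x. ph x b)" unfolding E_def ph_def by (rule Ph_convex_integral[OF VL VL])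
   have fi: "integrable lborel (%t. ?ind t * (Af s (%x. V x t) (%x. ph x b) - ipl (%x. g x t) (%x. ph x b)))"
   proof -
    have i: "integrable lborel (%t. ?ind t * Bf (%x. V x t) (%x. ph x b))" "integrable lborel (%t. ?ind t * NLf s (%x. V x t) (%x. ph x b))"
     by (rule integrable_form[where B = Bf, OF tV VH Qi Hph disjI1[OF refl] ab'(2)],
       rule integrable_form[where B = "NLf s", OF tV VH Qi Hph disjI2[OF refl] ab'(2)])
    have ig: "integrable lborel (%t. ?ind t * ipl (%x. g x t) (%x. ph x b))" by (rule integrable_ip[OF tg gL gi phL ab'(2)])
    have "integrable lborel (%t. (?ind t * Bf (%x. V x t) (%x. ph x b) + (1/2) * (?ind t * NLf s (%x. V x t) (%x. ph x b))) - ?ind t * ipl (%x. g x t) (%x. ph x b))"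
     by (intro Bochner_Integration.integrable_diff Bochner_Integration.integrable_add integrable_mult_right i ig)
    then show ?thesis by (simp add: Af_def algebra_simps)
   qed
   have pt: "- (Af s (%x. V x ta) (%x. ph x b) - ipl (%x. g x ta) (%x. ph x b)) <= k ta - al ta + r b"
    if ta: "ta : G" "ta : {a'<..b}" for ta
   proof -
    let ?w = "%x. ph x b - ph x ta"
    have w: "H0 Om ?w (%i x. gf' (V x b) * a b i x - gf' (V x ta) * a ta i x)" by (rule H0_diff[OF Hph Hph])
    have "Af s (%x. V x ta) (%x. 1 * ph x b + (-1) * ph x ta) = 1 * Af s (%x. V x ta) (%x. ph x b) + (-1) * Af s (%x. V x ta) (%x. ph x ta)"
     by (rule Af_lincomb_right[OF Hph Hph a])
    then have "Af s (%x. V x ta) (%x. ph x b) = Af s (%x. V x ta) (%x. ph x ta) + Af s (%x. V x ta) ?w" by simp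
    moreover have "ipl (%x. g x ta) (%x. ph x b) = ipl (%x. g x ta) (%x. ph x ta) + ipl (%x. g x ta) ?w" using ip_diff_right[OF phL phL gL, of ta b ta] by simp
    moreover have "\<bar>Af s (%x. V x ta) ?w - ipl (%x. g x ta) ?w\<bar> <= l * (CA * Q ta + S ta) + C * Qf ?w"
     unfolding Q_def S_def C_def by (rule form_Young[OF a w gL l])
    moreover have "Qf ?w <= M * e1 + 4 * R j b + 4 * R j ta"
    proof -
     have "nsq ?w <= nsq (%x. V x b - V x ta)" by (rule sqn_mono[OF L2_diff[OF VL VL] L2_measurable[OF L2_diff[OF phL phL]]]) (simp add: ph_def gf_lip)
     also have "\<dots> <= e1" using ta ab d(1) by (intro less_imp_le d(2)) auto
     finally have s1: "nsq ?w <= e1" .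
     have "Qf ?w <= nsq ?w + (8 * CARD('n) * (real (Suc j))\<^sup>2 * nsq ?w + 4 * R j b + 4 * R j ta)"
      unfolding Qf_def R_def by (intro add_left_mono Bf_diff_le_Rj[OF Hph Hph])
     also have "\<dots> = M * nsq ?w + 4 * R j b + 4 * R j ta" by (simp add: M_def algebra_simps)
     also have "\<dots> <= M * e1 + 4 * R j b + 4 * R j ta" using s1 M by (simp add: mult_left_mono)
     finally show ?thesis .
    qed
    then have "C * Qf ?w <= C * (M * e1 + 4 * R j b + 4 * R j ta)" using C by (intro mult_left_mono) auto
    moreover have "k ta + r b = l * (CA * Q ta + S ta) + C * (M * e1 + 4 * R j b + 4 * R j ta)"
     using ta Gb(2) by (auto simp: k_def r_def algebra_simps indicator_def)
    ultimately show ?thesis unfolding al_def by linarith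
   qed
   have indab: "integrable lborel (%ta. ?ind ta * r b)" "(LBINT ta. ?ind ta * r b) = (b - a') * r b"
   proof -
    have "integrable lborel ?ind" by (rule integrable_real_indicator) (use ab in auto)
    then show "integrable lborel (%ta. ?ind ta * r b)" by simp
    show "(LBINT ta. ?ind ta * r b) = (b - a') * r b" using ab by simp
   qed
   have "E b - E a' <= (LBINT ta. - (?ind ta * (Af s (%x. V x ta) (%x. ph x b) - ipl (%x. g x ta) (%x. ph x b))))"
    using 1 unfolding weak[OF ab(1-3) Hph] by simp
   also have "\<dots> <= (LBINT ta. ?ind ta * r b - ?ind ta * (al ta - k ta))"
   proof (rule integral_mono_AE)
    show "AE ta in lborel. - (?ind ta * (Af s (%x. V x ta) (%x. ph x b) - ipl (%x. g x ta) (%x. ph x b))) <= ?ind ta * r b - ?ind ta * (al ta - k ta)" using GAE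
    proof eventually_elim
     fix ta assume G: "ta : {0<..<T} --> ta : G"
     show "- (?ind ta * (Af s (%x. V x ta) (%x. ph x b) - ipl (%x. g x ta) (%x. ph x b))) <= ?ind ta * r b - ?ind ta * (al ta - k ta)"
     proof (cases "ta : {a'<..b}")
      case True
      then have "ta : G" using G ab Gb(2) by force
      from pt[OF this True] show ?thesis using True by simp
     qed simp
    qed
   qed (use fi indab(1) ind_i[OF aki] in auto)
   also have "\<dots> = (b - a') * r b - (LBINT ta. ?ind ta * (al ta - k ta))"
    using indab ind_i[OF aki, of a' b] by (simp add: Bochner_Integration.integral_diff)
   also have "(LBINT ta. ?ind ta * (al ta - k ta)) = I b - I a'" unfolding I_def by (rule set_int_split[OF aki ab', symmetric])
   finally show ?thesis using FG[OF ab(1)] FG[OF ab(2)] by linarith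
  qed
  have tI: "t0 : {0<..<T}" "t1 : {0<..<T}" using t0 t1 Gb(2) by auto
  have "d / 2 > 0" using d(1) by simp
  from averaged_increments[OF GAE Fi ri r0 this inc tI t0(2) Fc[OF t0(1)] Fc[OF t1]]
  have "F t1 - F t0 <= (LBINT t. r t)" .
  moreover have "I t1 - I t0 = (LBINT ta. indicator {t0<..t1} ta * (al ta - k ta))" unfolding I_def by (rule set_int_split[OF aki]) (use tI t0 in auto)
  moreover have "\<dots> = (LBINT ta. indicator {t0<..t1} ta * al ta) - (LBINT ta. indicator {t0<..t1} ta * k ta)"
   using ind_i[OF ali, of t0 t1] ind_i[OF ki, of t0 t1] by (simp add: right_diff_distrib Bochner_Integration.integral_diff)
  moreover have "(LBINT ta. indicator {t0<..t1} ta * k ta) <= (LBINT ta. k ta)"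
   using ind_i[OF ki, of t0 t1] ki k0 by (intro integral_mono) (auto simp: indicator_def)
  moreover have "(LBINT ta. k ta) = l * KQ + C * (M * e1 * T + 4 * (LBINT t. R j t))" unfolding k_def KQ_def using Ki indT Ri[of j] T by simp
  moreover have "(LBINT t. r t) = 4 * C * (LBINT t. R j t)" by (simp add: r_def)
  moreover have "C * (M * e1 * T) = e / 3" using C M T by (simp add: e1_def)
  moreover have "8 * (C * (LBINT t. R j t)) <= e / 3"
  proof -
   have "C * (LBINT t. R j t) <= C * (e / (24 * C))" using C j by (intro mult_left_mono) auto
   also have "\<dots> = e / 24" using C by simp
   finally show ?thesis by simp
  qed
  moreover have "C * (M * e1 * T + 4 * (LBINT t. R j t)) + 4 * C * (LBINT t. R j t) = C * (M * e1 * T) + 8 * (C * (LBINT t. R j t))"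
   by (simp add: algebra_simps)
  ultimately have "E t1 - E t0 + (LBINT ta. indicator {t0<..t1} ta * al ta) <= l * KQ + (e / 3 + e / 3)" using FG[OF t0(1)] FG[OF t1] by linarith
  then show "E t1 - E t0 + (LBINT ta. indicator {t0<..t1} ta * al ta) <= 0 + e" using lK by argo
 qed
 \<comment> \<open>The lower time is moved to 0 along \<open>G\<close>, where the initial value
   takes over.\<close>
 have "E t1 + (LBINT ta. indicator {0<..t1} ta * al ta) <= (LBINT x. Ph (v0 x))"
 proof (rule field_le_epsilon)
  fix e :: real assume e: "e > 0"
  obtain p where p: "p > 0" "!!u. L2l u ==> nsq (%x. u x - v0 x) < p ==> \<bar>(LBINT x. Ph (u x)) - (LBINT x. Ph (v0 x))\<bar> <= e / 2"
   using near[OF clean_L2[OF v0c], of "e/2"] e by auto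
  obtain d1 where d1: "d1 > 0" "\<forall>t\<in>G. t < d1 --> nsq (%x. V x t - v0 x) < p" using init[OF p(1)] by blast
  have "isCont (%t. LBINT ta. indicator {0<..t} ta * al ta) 0" by (rule isCont_indefinite_integral[OF ali])
  then obtain d2 where d2: "d2 > 0" "!!t. \<bar>t\<bar> < d2 ==> \<bar>LBINT ta. indicator {0<..t} ta * al ta\<bar> < e / 2"
  proof -
   assume "isCont (%t. LBINT ta. indicator {0<..t} ta * al ta) 0"
    and that: "!!d2. 0 < d2 ==> (!!t. \<bar>t\<bar> < d2 ==> \<bar>LBINT ta. indicator {0<..t} ta * al ta\<bar> < e / 2) ==> thesis"
   then obtain d where d: "d > 0" "\<forall>t. dist t 0 < d --> dist (LBINT ta. indicator {0<..t} ta * al ta) (LBINT ta. indicator {0<..0::real} ta * al ta) < e / 2"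
    unfolding continuous_at_eps_delta using half_gt_zero[OF e] by blast
   show thesis by (rule that[OF d(1)]) (use d(2) in simp)
  qed
  define m where "m = min t1 (min d1 d2)"
  have "0 < t1" "t1 < T" using t1 Gb(2) by auto
  then have "0 < m" "m <= T" using d1(1) d2(1) by (auto simp: m_def)
  then obtain t0 where t0: "t0 : G" "0 < t0" "t0 < m" using AE_real_ex_small[OF GAE] by blast
  have "\<bar>E t0 - (LBINT x. Ph (v0 x))\<bar> <= e / 2" unfolding E_def using t0 d1(2) by (intro p(2)[OF VL]) (auto simp: m_def)
  moreover have "\<bar>LBINT ta. indicator {0<..t0} ta * al ta\<bar> < e / 2" using t0 by (intro d2(2)) (auto simp: m_def)
  moreover have "(LBINT ta. indicator {0<..t1} ta * al ta) - (LBINT ta. indicator {0<..t0} ta * al ta) = (LBINT ta. indicator {t0<..t1} ta * al ta)"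
   by (rule set_int_split[OF ali]) (use t0 in \<open>auto simp: m_def\<close>)
  moreover have "E t1 - E t0 + (LBINT ta. indicator {t0<..t1} ta * al ta) <= 0" by (rule main[OF t0(1)]) (use t0 in \<open>auto simp: m_def\<close>)
  ultimately show "E t1 + (LBINT ta. indicator {0<..t1} ta * al ta) <= (LBINT x. Ph (v0 x)) + e" by linarith
 qed
 then show "(LBINT x. Ph (V x t1)) + (LBINT ta. indicator {0<..t1} ta * (Af s (%x. V x ta) (%x. gf (V x ta)) - ipl (%x. g x ta) (%x. gf (V x ta))))
   <= (LBINT x. Ph (v0 x))" by (simp add: E_def al_def ph_def)
qed

end

subsection \<open>Particular truncations\<close>

definition eta_int :: "real => real" where "eta_int x = integral {0..x} eta"

definition eta' :: "real => real" where "eta' x = frd eta (at x) 1"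

lemma eta_has_derivative: "(eta has_real_derivative eta' x) (at x)"
proof -
 have d: "(eta has_derivative frd eta (at x)) (at x)" by (rule smooth_has_derivative[OF eta_smooth])
 have "frd eta (at x) = (*) (eta' x)"
 proof
  fix y
  show "frd eta (at x) y = eta' x * y" using linear_scale[OF has_derivative_linear[OF d], of y 1] by (simp add: eta'_def)
 qed
 with d show ?thesis by (simp add: has_field_derivative_def)
qed

lemma eta'_bounds: "0 <= eta' x" "eta' x <= 1"
 using eta_deriv_bounds[of x] DERIV_unique[OF eta_has_derivative] by blast+

lemma eta'_continuous: "continuous_on UNIV eta'"
 unfolding eta'_def by (rule smooth_continuous_on[OF smooth_frechet_derivative[OF eta_smooth]])

lemma eta_int_has_derivative: "(eta_int has_real_derivative eta x) (at x)"
proof -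
 define a b where "a = - \<bar>x\<bar> - 1" and "b = \<bar>x\<bar> + 1"
 have c: "continuous_on S eta" for S by (rule smooth_continuous_on[OF eta_smooth])
 have z: "integral {u..v} eta = 0" if "v <= 0" for u v
 proof -
  have "integral {u..v} eta = integral {u..v} (%_. 0)"
   by (rule Henstock_Kurzweil_Integration.integral_cong) (use that in \<open>auto intro!: eta_nonpos\<close>)
  then show ?thesis by simp
 qed
 have e: "integral {a..y} eta = eta_int y" for y
 proof (cases "0 <= y")
  case True
  have "integral {a..0} eta + integral {0..y} eta = integral {a..y} eta"
   by (rule Henstock_Kurzweil_Integration.integral_combine) (use True integrable_continuous_interval[OF c] in \<open>auto simp: a_def\<close>)
  then show ?thesis by (simp add: z eta_int_def)
 next
  case False
  then show ?thesis by (simp add: z eta_int_def)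
 qed
 have "((%y. integral {a..y} eta) has_real_derivative eta x) (at x within {a..b})" by (rule integral_has_real_derivative[OF c]) (auto simp: a_def b_def)
 then have "(eta_int has_real_derivative eta x) (at x within {a..b})" by (simp add: e)
 moreover have "a < x" "x < b" unfolding a_def b_def by arith+
 ultimately show ?thesis using at_within_Icc_at[of a x b] by simp
qed

text \<open>The truncation vanishes up to level k and stays below the height h. The height bound
  makes the source term at most h times the mass of the datum above k.\<close>

lemma trunc_fun_eta:
 assumes k: "0 <= k" and h: "h > 0"
 shows "trunc_fun (%x. h * eta ((x - k) / h)) (%x. eta' ((x - k) / h)) (%x. h\<^sup>2 * eta_int ((x - k) / h))"
proof
 have "smooth (%x::real. (x \<bullet> 1) * (1 / h) - k / h)" by (rule smooth_diff[OF smooth_mult[OF smooth_inner smooth_const] smooth_const])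
 moreover have "(%x::real. (x \<bullet> 1) * (1 / h) - k / h) = (%x. (x - k) / h)" by (simp add: fun_eq_iff diff_divide_distrib)
 ultimately have "smooth (%x. (x - k) / h)" by simp
 from smooth_cmult[OF smooth_compose[OF eta_smooth this], of h]
 show "smooth (%x. h * eta ((x - k) / h))" .
 have n: "(0 - k) / h <= 0" using k h by (simp add: divide_nonpos_pos)
 show "h * eta ((0 - k) / h) = 0" using eta_nonpos[OF n] by simp
 have l: "((%x. (x - k) / h) has_real_derivative 1 / h) (at x)" for x using DERIV_cdivide[OF DERIV_diff[OF DERIV_ident DERIV_const], of k h x] by simp
 show "((%x. h * eta ((x - k) / h)) has_real_derivative eta' ((x - k) / h)) (at x)" for x
  using DERIV_cmult[OF DERIV_chain2[OF eta_has_derivative l], of h] h by simp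
 show "((%x. h\<^sup>2 * eta_int ((x - k) / h)) has_real_derivative h * eta ((x - k) / h)) (at x)" for x
  using DERIV_cmult[OF DERIV_chain2[OF eta_int_has_derivative l], of "h\<^sup>2"] h by (simp add: power2_eq_square)
 show "continuous_on UNIV (%x. eta' ((x - k) / h))"
  by (rule continuous_on_compose2[OF eta'_continuous]) (auto intro!: continuous_intros simp: h[THEN less_imp_neq, symmetric])
 have "integral {0..(0 - k) / h} eta = integral {0..(0 - k) / h} (%_. 0)"
  by (rule Henstock_Kurzweil_Integration.integral_cong) (use n in \<open>auto intro!: eta_nonpos\<close>)
 then show "h\<^sup>2 * eta_int ((0 - k) / h) = 0" by (simp add: eta_int_def)
qed (rule eta'_bounds)+

lemma trunc_fun_id: "trunc_fun (%x. x) (%x. 1) (%x. x\<^sup>2 / 2)"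
proof
 show "smooth (%x::real. x)" using smooth_inner[of "1::real"] by simp
 show "((%x::real. x\<^sup>2 / 2) has_real_derivative x) (at x)" for x by (auto intro!: derivative_eq_intros)
qed (auto intro!: derivative_eq_intros)

interpretation eta_tf: trunc_fun eta eta' eta_int using trunc_fun_eta[of 0 1] by simp

lemma eta_int_nonpos: "x <= 0 ==> eta_int x = 0"
 using eta_tf.Ph_convex[of x 0] eta_tf.Ph_nonneg[of x] eta_tf.Ph0 eta_nonpos[of x] by simp

lemma eta_int_pos: "0 < x ==> 0 < eta_int x"
proof -
 assume x: "0 < x"
 have "eta_int (x / 2) - eta_int x <= eta (x / 2) * (x / 2 - x)" by (rule eta_tf.Ph_convex)
 moreover have "0 < eta (x / 2) * (x / 2)" using x eta_pos_iff[of "x/2"] by simp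
 moreover have "eta (x / 2) * (x / 2 - x) = - (eta (x / 2) * (x / 2))" by (simp add: algebra_simps)
 ultimately show ?thesis using eta_tf.Ph_nonneg[of "x/2"] by linarith
qed

text \<open>The tangent inequality at 1, where the slope is \<open>eta 1 = exp (-1)\<close>, used
  over the unit distance from 1 to 2. This is the origin of the step 2h in the recursion.\<close>

lemma eta_int_ge: "2 <= x ==> exp (-1) <= eta_int x"
proof -
 assume x: "2 <= x"
 have "eta_int 1 - eta_int x <= eta 1 * (1 - x)" by (rule eta_tf.Ph_convex)
 also have "\<dots> <= eta 1 * (- 1)" using x eta_nonneg[of 1] by (intro mult_left_mono) auto
 finally show ?thesis using eta_tf.Ph_nonneg[of 1] by (simp add: eta_def)
qed

lemma AE_real_ex_between:
 assumes ae: "AE t in lborel. t : {0<..<T} --> t : G" and m: "0 <= a" "a < b" "b <= (T::real)"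
 shows "\<exists>t\<in>G. a < t & t < b"
proof (rule ccontr)
 assume n: "\<not> ?thesis"
 have "AE t in lborel. t \<notin> {a<..<b}" using ae by eventually_elim (use n m in auto)
 then have "emeasure lborel {a<..<b} = 0" by (subst (asm) AE_iff_measurable[of "{a<..<b}"]) auto
 then show False using m by simp
qed

context frac begin

text \<open>Increments of v and of gf(v) have equal signs, so the nonlocal part is nonnegative and
  the local energy alone drives the estimates.\<close>

lemma form_compose_ge:
 assumes v: "H0 Om v a" and tf: "trunc_fun gf gf' Ph"
 shows "H0 Om (%x. gf (v x)) (%i x. gf' (v x) * a i x)"
  and "0 <= Bf (%x. gf (v x)) (%x. gf (v x))"
  and "Bf (%x. gf (v x)) (%x. gf (v x)) <= Af s v (%x. gf (v x))"
  and "Bf (%x. gf (v x)) (%x. gf (v x)) <= Bf v v"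
proof -
 interpret trunc_fun gf gf' Ph by (rule tf)
 show H: "H0 Om (%x. gf (v x)) (%i x. gf' (v x) * a i x)" by (rule H0_compose[OF v sm g0 gd gb gc])
 show "0 <= Bf (%x. gf (v x)) (%x. gf (v x))" by (rule Bf_nonneg[OF H])
 have 1: "Bf (%x. gf (v x)) (%x. gf (v x)) <= Bf v (%x. gf (v x))" unfolding Bf_eq[OF H H] Bf_eq[OF v H] by (rule gip_compose_le(1)[OF v gc gb])
 have 2: "0 <= NLf s v (%x. gf (v x))" unfolding NLf_def ip_def
 proof (rule integral_nonneg_AE, rule AE_I2)
  fix z
  have "0 <= (v (fst z) - v (snd z)) * (gf (v (fst z)) - gf (v (snd z)))" using gf_diff[of "v (fst z)" "v (snd z)"] gf_diff[of "v (snd z)" "v (fst z)"]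
   by (cases "v (fst z) <= v (snd z)") (auto intro: mult_nonpos_nonpos mult_nonneg_nonneg)
  then show "0 <= Ef s v z * Ef s (%x. gf (v x)) z" unfolding Ef_def times_divide_times_eq by (rule divide_nonneg_nonneg) simp
 qed
 show "Bf (%x. gf (v x)) (%x. gf (v x)) <= Af s v (%x. gf (v x))" using 1 2 by (simp add: Af_def)
 have "Bf v (%x. gf (v x)) <= Bf v v" unfolding Bf_eq[OF v H] Bf_eq[OF v v] by (rule gip_compose_le(2)[OF v gc gb])
 with 1 show "Bf (%x. gf (v x)) (%x. gf (v x)) <= Bf v v" by simp
qed

lemma wsolD:
 assumes "wsol T g v0 V G"
 shows "tmeas V" "tmeas g" "clean Om v0" "G : sets borel" "G \<subseteq> {0<..<T}"
  "AE t in lborel. t : {0<..<T} --> t : G"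
  "!!t x. t \<notin> G ==> V x t = 0" "!!t x. t \<notin> G ==> g x t = 0"
  "!!t. \<exists>a. H0 Om (%x. V x t) a" "!!t. clean Om (%x. g x t)"
  "integrable lborel (%t. Qf (%x. V x t))" "integrable lborel (%t. nsq (%x. g x t))"
  "!!e. e > 0 ==> \<exists>d>0. \<forall>t\<in>G. \<forall>t'\<in>G. \<bar>t - t'\<bar> < d --> nsq (%x. V x t - V x t') < e"
  "!!e. e > 0 ==> \<exists>d>0. \<forall>t\<in>G. t < d --> nsq (%x. V x t - v0 x) < e"
  "!!a b w c. a : G ==> b : G ==> a < b ==> H0 Om w c ==>
    ipl (%x. V x b - V x a) w = - (LBINT t. indicator {a<..b} t * (Af s (%x. V x t) w - ipl (%x. g x t) w))" using assms unfolding wsol_def by blast+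

lemma sqn_diff4: "L2 M a ==> L2 M b ==> L2 M c ==> L2 M d ==>
 sqn M (%x. (a x - b x) - (c x - d x)) <= 2 * sqn M (%x. a x - c x) + 2 * sqn M (%x. b x - d x)"
proof -
 assume L: "L2 M a" "L2 M b" "L2 M c" "L2 M d"
 have "(%x. (a x - b x) - (c x - d x)) = (%x. (a x - c x) - (b x - d x))" by (simp add: fun_eq_iff)
 then show ?thesis using sqn_diff_le[OF L2_diff[OF L(1,3)] L2_diff[OF L(2,4)]] by simp
qed

text \<open>The formulation is linear in the triple of solution, source and initial value, although
  the singular sources depend on the solutions. The difference lives on the common good
  times.\<close>

lemma wsol_diff:
 assumes 1: "wsol T g v0 V G" and 2: "wsol T g' v0' V' G'"
 shows "wsol T (%x t. if t : G \<inter> G' then g x t - g' x t else 0) (%x. v0 x - v0' x)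
  (%x t. if t : G \<inter> G' then V x t - V' x t else 0) (G \<inter> G')"
proof -
 note d1 = wsolD[OF 1] and d2 = wsolD[OF 2]
 define D where "D = G \<inter> G'"
 define W where "W = (%x t. if t : D then V x t - V' x t else 0)"
 define p where "p = (%x t. if t : D then g x t - g' x t else 0)"
 have Db: "D : sets borel" and DT: "D \<subseteq> {0<..<T}" and DAE: "AE t in lborel. t : {0<..<T} --> t : D"
  using d1(4,5) d2(4) unfolding D_def by (auto intro: AE_mp[OF d1(6) AE_mp[OF d2(6)]])
 have GD: "t : G" "t : G'" if "t : D" for t using that by (auto simp: D_def)
 have sndD: "{z::(real^'n) \<times> real. snd z : D} : sets borel"
 proof -
  have "UNIV \<times> D : sets (borel \<Otimes>\<^sub>M borel :: ((real^'n) \<times> real) measure)" using Db by auto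
  moreover have "UNIV \<times> D = {z::(real^'n) \<times> real. snd z : D}" by auto
  ultimately show ?thesis unfolding borel_prod[symmetric] by simp
 qed
 have If: "tmeas (%x t. if t : D then a x t - b x t else 0)" if "tmeas a" "tmeas b"
  for a b :: "(real^'n) => real => real"
 proof -
  have "(%z. if z : {z. snd z : D} then a (fst z) (snd z) - b (fst z) (snd z) else 0) : bmb"
   by (rule measurable_If_set) (use that sndD in \<open>simp_all add: tmeas_def\<close>)
  then show ?thesis unfolding tmeas_def mem_Collect_eq .
 qed
 have tW: "tmeas W" and tp: "tmeas p" unfolding W_def p_def using d1(1,2) d2(1,2) by (auto intro: If)
 obtain a a' where a: "!!t. H0 Om (%x. V x t) (a t)" "!!t. H0 Om (%x. V' x t) (a' t)" using d1(9) d2(9) by metis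
 have Win: "(%x. W x t) = (%x. V x t - V' x t)" "(%x. p x t) = (%x. g x t - g' x t)" if "t : D" for t using that by (auto simp: W_def p_def)
 have Wout: "(%x. W x t) = (%x. 0)" "(%x. p x t) = (%x. 0)" if "t \<notin> D" for t using that by (auto simp: W_def p_def)
 have HW: "\<exists>b. H0 Om (%x. W x t) b" for t using Win[of t] Wout[of t] H0_diff[OF a(1)[of t] a(2)[of t]] H0_zero by (cases "t : D") auto
 have clz: "clean Om (%x. 0)" by (rule H0_clean(1)[OF H0_zero])
 have cp: "clean Om (%x. p x t)" for t using Win[of t] Wout[of t] clean_diff[OF d1(10) d2(10), of t t] clz by (cases "t : D") auto
 have VL: "L2l (%x. V x t)" "L2l (%x. V' x t)" for t by (rule H0_L2[OF a(1)], rule H0_L2[OF a(2)])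
 have gL: "L2l (%x. g x t)" "L2l (%x. g' x t)" for t by (rule clean_L2[OF d1(10)], rule clean_L2[OF d2(10)])
 have q0: "0 <= Qf (%x. V x t)" "0 <= Qf (%x. V' x t)" for t by (rule Qf_nonneg[OF a(1)], rule Qf_nonneg[OF a(2)])
 have QW: "integrable lborel (%t. Qf (%x. W x t))"
 proof (rule Bochner_Integration.integrable_bound)
  show "integrable lborel (%t. 2 * Qf (%x. V x t) + 2 * Qf (%x. V' x t))" using d1(11) d2(11) by simp
  show "(%t. Qf (%x. W x t)) : borel_measurable lborel" using tmeas_Qf[OF tW] by simp
  show "AE t in lborel. norm (Qf (%x. W x t)) <= norm (2 * Qf (%x. V x t) + 2 * Qf (%x. V' x t))"
  proof (rule AE_I2)
   fix t
   have "0 <= Qf (%x. W x t)" using HW[of t] Qf_nonneg by blast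
   moreover have "Qf (%x. W x t) <= 2 * Qf (%x. V x t) + 2 * Qf (%x. V' x t)"
   proof (cases "t : D")
    case True
    show ?thesis unfolding Win(1)[OF True] by (rule Qf_lincomb_le[OF a(1) a(2)])
   next
    case False
    have "Qf (%x. 0) = 0" by (simp add: Qf_def sqn_def Bf_eq[OF H0_zero H0_zero] gip_self)
    then show ?thesis unfolding Wout(1)[OF False] using q0[of t] by simp
   qed
   ultimately show "norm (Qf (%x. W x t)) <= norm (2 * Qf (%x. V x t) + 2 * Qf (%x. V' x t))" by simp
  qed
 qed
 have Sp: "integrable lborel (%t. nsq (%x. p x t))"
 proof (rule Bochner_Integration.integrable_bound)
  show "integrable lborel (%t. 2 * nsq (%x. g x t) + 2 * nsq (%x. g' x t))" using d1(12) d2(12) by simp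
  show "(%t. nsq (%x. p x t)) : borel_measurable lborel" using tmeas_sqn[OF tp] by simp
  show "AE t in lborel. norm (nsq (%x. p x t)) <= norm (2 * nsq (%x. g x t) + 2 * nsq (%x. g' x t))"
  proof (rule AE_I2)
   fix t
   have n: "0 <= nsq (%x. g x t)" "0 <= nsq (%x. g' x t)" "0 <= nsq (%x. p x t)" by (rule sqn_nonneg)+
   have "nsq (%x. p x t) <= 2 * nsq (%x. g x t) + 2 * nsq (%x. g' x t)"
   proof (cases "t : D")
    case True
    show ?thesis unfolding Win(2)[OF True] by (rule sqn_diff_le[OF gL])
   next
    case False
    have "nsq (%x::real^'n. 0) = 0" by (simp add: sqn_def)
    then show ?thesis unfolding Wout(2)[OF False] using n by simp
   qed
   with n show "norm (nsq (%x. p x t)) <= norm (2 * nsq (%x. g x t) + 2 * nsq (%x. g' x t))" by simp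
  qed
 qed
 have "wsol T p (%x. v0 x - v0' x) W D" unfolding wsol_def
 proof (intro conjI)
  show "clean Om (%x. v0 x - v0' x)" by (rule clean_diff[OF d1(3) d2(3)])
  show "\<forall>t. t \<notin> D --> (\<forall>x. W x t = 0 & p x t = 0)" by (simp add: W_def p_def)
  show "\<forall>t. (\<exists>a. H0 Om (%x. W x t) a) & clean Om (%x. p x t)" using HW cp by simp
  show "\<forall>e>0. \<exists>d>0. \<forall>t\<in>D. \<forall>t'\<in>D. \<bar>t - t'\<bar> < d --> nsq (%x. W x t - W x t') < e"
  proof (intro allI impI)
   fix e :: real assume "e > 0"
   then have e4: "e / 4 > 0" by simp
   obtain r where r: "r > 0" "\<forall>t\<in>G. \<forall>t'\<in>G. \<bar>t - t'\<bar> < r --> nsq (%x. V x t - V x t') < e / 4" using d1(13)[OF e4] by blast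
   obtain r' where r': "r' > 0" "\<forall>t\<in>G'. \<forall>t'\<in>G'. \<bar>t - t'\<bar> < r' --> nsq (%x. V' x t - V' x t') < e / 4" using d2(13)[OF e4] by blast
   have "nsq (%x. W x t - W x t') < e" if t: "t : D" "t' : D" "\<bar>t - t'\<bar> < min r r'" for t t'
   proof -
    have "(%x. W x t - W x t') = (%x. (V x t - V' x t) - (V x t' - V' x t'))" using t by (simp add: W_def)
    then have "nsq (%x. W x t - W x t') <= 2 * nsq (%x. V x t - V x t') + 2 * nsq (%x. V' x t - V' x t')"
     using sqn_diff4[OF VL(1) VL(2) VL(1) VL(2), of t t t' t'] by simp
    moreover have "nsq (%x. V x t - V x t') < e / 4" "nsq (%x. V' x t - V' x t') < e / 4" using r(2) r'(2) t GD by auto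
    ultimately show ?thesis by argo
   qed
   then show "\<exists>d>0. \<forall>t\<in>D. \<forall>t'\<in>D. \<bar>t - t'\<bar> < d --> nsq (%x. W x t - W x t') < e"
    using r(1) r'(1) by (intro exI[of _ "min r r'"]) auto
  qed
  show "\<forall>e>0. \<exists>d>0. \<forall>t\<in>D. t < d --> nsq (%x. W x t - (v0 x - v0' x)) < e"
  proof (intro allI impI)
   fix e :: real assume "e > 0"
   then have e4: "e / 4 > 0" by simp
   obtain r where r: "r > 0" "\<forall>t\<in>G. t < r --> nsq (%x. V x t - v0 x) < e / 4" using d1(14)[OF e4] by blast
   obtain r' where r': "r' > 0" "\<forall>t\<in>G'. t < r' --> nsq (%x. V' x t - v0' x) < e / 4" using d2(14)[OF e4] by blast
   have "nsq (%x. W x t - (v0 x - v0' x)) < e" if t: "t : D" "t < min r r'" for t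
   proof -
    have "(%x. W x t - (v0 x - v0' x)) = (%x. (V x t - V' x t) - (v0 x - v0' x))" using t by (simp add: W_def)
    then have "nsq (%x. W x t - (v0 x - v0' x)) <= 2 * nsq (%x. V x t - v0 x) + 2 * nsq (%x. V' x t - v0' x)"
     using sqn_diff4[OF VL(1) VL(2) clean_L2[OF d1(3)] clean_L2[OF d2(3)], of t t] by simp
    moreover have "nsq (%x. V x t - v0 x) < e / 4" "nsq (%x. V' x t - v0' x) < e / 4" using r(2) r'(2) t GD by auto
    ultimately show ?thesis by argo
   qed
   then show "\<exists>d>0. \<forall>t\<in>D. t < d --> nsq (%x. W x t - (v0 x - v0' x)) < e" using r(1) r'(1) by (intro exI[of _ "min r r'"]) auto
  qed
  show "\<forall>b\<in>D. \<forall>e\<in>D. b < e --> (\<forall>w c. H0 Om w c -->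
    ipl (%x. W x e - W x b) w = - (LBINT t. indicator {b<..e} t * (Af s (%x. W x t) w - ipl (%x. p x t) w)))"
  proof (intro ballI allI impI)
   fix b e w c assume be: "b : D" "e : D" "b < e" and w: "H0 Om w c"
   have wL: "L2l w" by (rule H0_L2[OF w])
   have be': "b <= e" using be by simp
   let ?i = "%t. chf {b<..e} t"
   have int: "integrable lborel (%t. ?i t * (Af s (%x. V x t) w - ipl (%x. g x t) w))"
    if ws: "wsol T g v0 V G" for g v0 V G
   proof -
    note ds = wsolD[OF ws]
    have i1: "integrable lborel (%t. ?i t * Bf (%x. V x t) w)" by (rule integrable_form[where B = Bf, OF ds(1) ds(9) ds(11) w disjI1[OF refl] be'])
    have i2: "integrable lborel (%t. ?i t * NLf s (%x. V x t) w)" by (rule integrable_form[where B = "NLf s", OF ds(1) ds(9) ds(11) w disjI2[OF refl] be'])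
    have i3: "integrable lborel (%t. ?i t * ipl (%x. g x t) w)" by (rule integrable_ip[OF ds(2) clean_L2[OF ds(10)] ds(12) wL be'])
    have "integrable lborel (%t. (?i t * Bf (%x. V x t) w + (1/2) * (?i t * NLf s (%x. V x t) w)) - ?i t * ipl (%x. g x t) w)"
     by (rule Bochner_Integration.integrable_diff[OF Bochner_Integration.integrable_add[OF i1 integrable_mult_right[OF i2]] i3])
    then show ?thesis by (simp add: Af_def algebra_simps)
   qed
   have "ipl (%x. W x e - W x b) w = ipl (%x. (V x e - V x b) - (V' x e - V' x b)) w"
    by (rule arg_cong[of _ _ "%u. ipl u w"]) (use be in \<open>simp add: W_def fun_eq_iff\<close>)
   also have "\<dots> = ipl (%x. V x e - V x b) w - ipl (%x. V' x e - V' x b) w" by (rule ip_diff_left[OF L2_diff[OF VL(1) VL(1)] L2_diff[OF VL(2) VL(2)] wL])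
   also have "\<dots> = - ((LBINT t. ?i t * (Af s (%x. V x t) w - ipl (%x. g x t) w))
     - (LBINT t. ?i t * (Af s (%x. V' x t) w - ipl (%x. g' x t) w)))"
    unfolding d1(15)[OF GD(1)[OF be(1)] GD(1)[OF be(2)] be(3) w] d2(15)[OF GD(2)[OF be(1)] GD(2)[OF be(2)] be(3) w] by simp
   also have "\<dots> = - (LBINT t. ?i t * (Af s (%x. V x t) w - ipl (%x. g x t) w)
     - ?i t * (Af s (%x. V' x t) w - ipl (%x. g' x t) w))" by (subst Bochner_Integration.integral_diff[OF int[OF 1] int[OF 2]]) simp
   also have "(LBINT t. ?i t * (Af s (%x. V x t) w - ipl (%x. g x t) w)
     - ?i t * (Af s (%x. V' x t) w - ipl (%x. g' x t) w))
    = (LBINT t. ?i t * (Af s (%x. W x t) w - ipl (%x. p x t) w))"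
   proof (rule integral_cong_AE)
    show "(%t. ?i t * (Af s (%x. V x t) w - ipl (%x. g x t) w)
     - ?i t * (Af s (%x. V' x t) w - ipl (%x. g' x t) w)) : borel_measurable lborel"
     by (rule borel_measurable_integrable[OF Bochner_Integration.integrable_diff[OF int[OF 1] int[OF 2]]])
    have wt: "tmeas (%x t. w x)" using L2_measurable[OF wL] by (intro tmeas_const) simp
    show "(%t. ?i t * (Af s (%x. W x t) w - ipl (%x. p x t) w)) : borel_measurable lborel" using tmeas_Af[OF tW wt] tmeas_ip[OF tp wt] by simp
    show "AE t in lborel. ?i t * (Af s (%x. V x t) w - ipl (%x. g x t) w)
     - ?i t * (Af s (%x. V' x t) w - ipl (%x. g' x t) w) = ?i t * (Af s (%x. W x t) w - ipl (%x. p x t) w)" using DAE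
    proof eventually_elim
     fix t assume t: "t : {0<..<T} --> t : D"
     show "?i t * (Af s (%x. V x t) w - ipl (%x. g x t) w)
     - ?i t * (Af s (%x. V' x t) w - ipl (%x. g' x t) w) = ?i t * (Af s (%x. W x t) w - ipl (%x. p x t) w)"
     proof (cases "t : {b<..e}")
      case True
      have "0 < b" "e < T" using be DT by auto
      with True t have tD: "t : D" by simp
      have "Af s (%x. 1 * V x t + (-1) * V' x t) w = 1 * Af s (%x. V x t) w + (-1) * Af s (%x. V' x t) w" by (rule Af_lincomb_left[OF a(1) a(2) w])
      then have "Af s (%x. W x t) w = Af s (%x. V x t) w - Af s (%x. V' x t) w" unfolding Win(1)[OF tD] by simp
      moreover have "ipl (%x. p x t) w = ipl (%x. g x t) w - ipl (%x. g' x t) w" unfolding Win(2)[OF tD] by (rule ip_diff_left[OF gL wL])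
      ultimately show ?thesis using True by simp
     qed simp
    qed
   qed
   finally show "ipl (%x. W x e - W x b) w = - (LBINT t. ?i t * (Af s (%x. W x t) w - ipl (%x. p x t) w))" .
  qed
 qed (fact tW tp Db DT DAE QW Sp)+
 then show ?thesis unfolding W_def p_def D_def .
qed

end

subsection \<open>Fast geometric decay\<close>

text \<open>Stampacchia's iteration on the levels K0 + d (1 - 2^-j): the steps halve, M decays like
  m^j, and the exponent e > 1 closes the induction. The distance d is fixed before M, which is what
  makes the final bound uniform along the sequence.\<close>

lemma fast_decay:
 fixes K0 M0 C e :: real
 assumes e: "e > 1" and C: "0 <= C" and M0: "M0 > 0"
 shows "\<exists>d>0. \<forall>M :: real => real. (\<forall>k\<ge>K0. 0 <= M k) --> (\<forall>k\<ge>K0. \<forall>k'\<ge>k. M k' <= M k) --> M K0 <= M0 -->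
  (\<forall>k\<ge>K0. \<forall>h>0. M (k + 2 * h) <= C * (M k / h) powr e) --> M (K0 + d) = 0"
proof -
 \<comment> \<open>The solution of (2 m)^e = m; per step, the bound on M/h is multiplied by 2
   m.\<close>
 define m where "m = 2 powr (- (e / (e - 1)))"
 have m: "0 < m" "m < 1"
 proof -
  show "0 < m" by (simp add: m_def)
  have "e / (e - 1) > 0" using e by simp
  then show "m < 1" unfolding m_def using powr_less_cancel_iff[of 2 "- (e / (e - 1))" 0] by simp
 qed
 have m2: "(m * 2) powr e = m"
 proof -
  have "m * 2 = 2 powr (- (e / (e - 1)) + 1)" unfolding m_def by (subst powr_add) simp
  also have "- (e / (e - 1)) + 1 = - (1 / (e - 1))" using e by (simp add: field_simps)
  finally have "(m * 2) powr e = 2 powr (- (1 / (e - 1)) * e)" by (simp add: powr_powr)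
  then show ?thesis by (simp add: m_def)
 qed
 \<comment> \<open>Chosen so that C (1/y)^e <= M0 m, the factor one induction step needs; y >= 1
   permits (1/y)^e <= 1/y.\<close>
 define y where "y = max 1 (C / (M0 * m))"
 have y: "y >= 1" "C <= M0 * m * y"
 proof -
  show "y >= 1" by (simp add: y_def)
  have "C / (M0 * m) <= y" by (simp add: y_def)
  then show "C <= M0 * m * y" using M0 m by (simp add: divide_le_eq mult.commute)
 qed
 \<comment> \<open>The first step has h = d/4, so that M0/h = 1/y.\<close>
 define d where "d = 4 * M0 * y"
 have d: "d > 0" using M0 y by (simp add: d_def)
 have Cy: "C * (1 / y) powr e <= M0 * m"
 proof -
  have "(1 / y) powr e <= (1 / y) powr 1" using y e by (intro powr_mono') auto
  then have "C * (1 / y) powr e <= C * (1 / y)" using C y by (intro mult_left_mono) auto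
  also have "\<dots> <= M0 * m" using y by (simp add: divide_le_eq)
  finally show ?thesis .
 qed
 show ?thesis
 proof (intro exI[of _ d] conjI d allI impI)
  fix M :: "real => real"
  assume nn: "\<forall>k\<ge>K0. 0 <= M k" and anti: "\<forall>k\<ge>K0. \<forall>k'\<ge>k. M k' <= M k" and init: "M K0 <= M0"
   and st: "\<forall>k\<ge>K0. \<forall>h>0. M (k + 2 * h) <= C * (M k / h) powr e"
  define k where "k = (%j::nat. K0 + d * (1 - (1/2)^j))"
  have kK: "K0 <= k j" "k j <= K0 + d" for j
  proof -
   have "(1/2::real)^j <= 1" "0 <= (1/2::real)^j" by (simp_all add: power_le_one)
   then show "K0 <= k j" "k j <= K0 + d" using d by (simp_all add: k_def mult_left_le)
  qed
  have B: "M (k j) <= M0 * m ^ j" for j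
  proof (induction j)
   case 0 then show ?case using init by (simp add: k_def)
  next
   case (Suc j)
   \<comment> \<open>A quarter of the remaining gap d 2^-j, so that \<open>k (Suc j) - k j\<close>
     is 2h.\<close>
   define h where "h = d * (1/2)^j / 4"
   have h: "h > 0" using d by (simp add: h_def)
   have "k (Suc j) = k j + 2 * h" by (simp add: k_def h_def algebra_simps)
   then have "M (k (Suc j)) <= C * (M (k j) / h) powr e" using st kK(1)[of j] h by simp
   also have "\<dots> <= C * ((1 / y) * (m * 2) ^ j) powr e"
   proof (intro mult_left_mono powr_mono2)
    have "M (k j) / h <= M0 * m ^ j / h" using Suc h by (intro divide_right_mono) auto
    also have "\<dots> = (1 / y) * (m * 2) ^ j" using M0 y by (simp add: h_def d_def power_mult_distrib power_one_over field_simps)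
    finally show "M (k j) / h <= (1 / y) * (m * 2) ^ j" .
    show "0 <= M (k j) / h" using nn kK(1)[of j] h by simp
   qed (use e C in auto)
   also have "((1 / y) * (m * 2) ^ j) powr e = (1 / y) powr e * ((m * 2) ^ j) powr e" using y m by (intro powr_mult)
   also have "((m * 2) ^ j) powr e = m ^ j"
   proof -
    have p: "0 < m * 2" using m by simp
    have "((m * 2) ^ j) powr e = (m * 2) powr (real j * e)" by (simp only: powr_realpow[OF p, symmetric] powr_powr)
    also have "\<dots> = ((m * 2) powr e) powr (real j)" by (simp add: powr_powr mult.commute)
    also have "\<dots> = m ^ j" unfolding m2 by (rule powr_realpow[OF m(1)])
    finally show ?thesis .
   qed
   also have "C * ((1 / y) powr e * m ^ j) <= M0 * m * m ^ j" using mult_right_mono[OF Cy, of "m ^ j"] m by (simp add: mult_ac)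
   finally show ?case by (simp add: mult_ac)
  qed
  have "(%j. M0 * m ^ j) \<longlonglongrightarrow> M0 * 0" by (intro tendsto_mult tendsto_const LIMSEQ_realpow_zero) (use m in auto)
  moreover have "M (K0 + d) <= M0 * m ^ j" for j using anti kK[of j] B[of j] order_trans by blast
  ultimately have "M (K0 + d) <= M0 * 0" by (intro LIMSEQ_le_const) auto
  moreover have "0 <= M (K0 + d)" using nn d by simp
  ultimately show "M (K0 + d) = 0" by simp
 qed
qed

subsection \<open>The uniform bound\<close>

context frac begin

text \<open>The estimate packages Hoelder's inequality in space and in time, with \<open>B\<close> to be chosen
 as the time integral of \<open>|A|\<close> to the power \<open>1 - 2/n\<close>.\<close>

abbreviation slice_bound where
 "slice_bound F H dl sg C t \<equiv> \<forall>A\<in>sets borel. A \<subseteq> Om -->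
  integrable lborel (%x. F x t * chf A x) &
  (\<forall>B>0. (LBINT x. F x t * chf A x)
    <= measure lborel A powr dl * B powr sg * (H t + C * (measure lborel A powr (1 - 2 / real CARD('n)) / B)))"

text \<open>\<open>F\<close> is the datum and \<open>H\<close> an integrable function of time that
  carries its spatial norm; \<open>1 < dl + sg\<close> is the superlinearity fed to
  \<open>fast_decay\<close>.\<close>

definition datum :: "real => ((real^'n) => real => real) => (real => real) => real => real => real => bool" where
 "datum T F H dl sg C \<longleftrightarrow> tmeas F & (\<forall>x t. 0 <= F x t) & 0 < dl & 0 < sg & 1 < dl + sg & 0 <= C &
   integrable lborel H & (\<forall>t. 0 <= H t) &
   (AE t in lborel. t : {0<..<T} --> slice_bound F H dl sg C t)"

text \<open>The recursion runs on the time integral of this quantity, the datum integrated over the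
  level set, and not on the size of the level set itself.\<close>

definition mass :: "((real^'n) => real => real) => ((real^'n) => real => real) => real => real => real" where
 "mass F V k t = ipl (%x. F x t) (chf {x. k < V x t})"

lemma Om_fin: "emeasure lborel Om < \<infinity>"
 using emeasure_bounded_finite[OF bd] by simp

lemma level_sets:
 assumes V: "tmeas V" "!!t. \<exists>a. H0 Om (%x. V x t) a" and k: "0 <= k"
 shows "{x. k < V x t} : sets borel" "{x. k < V x t} \<subseteq> Om" "emeasure lborel {x. k < V x t} < \<infinity>"
  "measure lborel {x. k < V x t} <= measure lborel Om"
  "tmeas (%x t. chf {x. k < V x t} x)"
  "(%t. measure lborel {x. k < V x t}) : bmb"
proof -
 have b: "(%x. V x t) : bmb" for t by (rule tmeas_slice[OF V(1)])
 have s: "{x. k < V x t} : sets borel" for t using borel_measurable_less[OF borel_measurable_const b, of k t] by simp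
 then show "{x. k < V x t} : sets borel" .
 have sub: "{x. k < V x t} \<subseteq> Om" for t
 proof
  fix x assume x: "x : {x. k < V x t}"
  obtain a where "H0 Om (%x. V x t) a" using V(2) by blast
  from H0_outside[OF this, of x] show "x : Om" using x k by auto
 qed
 then show "{x. k < V x t} \<subseteq> Om" .
 have "emeasure lborel {x. k < V x t} <= emeasure lborel Om" for t by (rule emeasure_mono[OF sub]) (use Om_borel in simp)
 then have fin: "emeasure lborel {x. k < V x t} < \<infinity>" for t using Om_fin le_less_trans by blast
 then show "emeasure lborel {x. k < V x t} < \<infinity>" .
 show "measure lborel {x. k < V x t} <= measure lborel Om"
  by (rule measure_mono_fmeasurable[OF sub]) (use s Om_borel Om_fin in \<open>auto simp: fmeasurable_def\<close>)
 have "(%z. V (fst z) (snd z)) : bmb" using V(1) by (simp add: tmeas_def)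
 then have "{z. k < V (fst z) (snd z)} : sets borel" using borel_measurable_less[OF borel_measurable_const, of "%z. V (fst z) (snd z)" borel k] by simp
 then have "chf {z. k < V (fst z) (snd z)} : bmb" by simp
 moreover have "chf {z. k < V (fst z) (snd z)} = (%z. chf {x. k < V x (snd z)} (fst z))" by (auto simp: indicator_def fun_eq_iff)
 ultimately show tm: "tmeas (%x t. chf {x. k < V x t} x)" by (simp add: tmeas_def)
 \<comment> \<open>The measure of a level set is the squared norm of its indicator, which reduces
   its measurability in time to \<open>tmeas_sqn\<close>.\<close>
 have "nsq (%x. chf {x. k < V x t} x) = measure lborel {x. k < V x t}" for t
 proof -
  have "(%x. (chf {x. k < V x t} x)\<^sup>2) = chf {x. k < V x t}" by (auto simp: indicator_def fun_eq_iff)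
  then show ?thesis using s[of t] fin[of t] by (simp add: sqn_def)
 qed
 with tmeas_sqn[OF tm] show "(%t. measure lborel {x. k < V x t}) : bmb" by simp
qed

lemma mass_props:
 assumes dt: "datum T F H dl sg C" and V: "tmeas V" "!!t. \<exists>a. H0 Om (%x. V x t) a" "\<forall>t x. t \<notin> {0<..<T} --> V x t = 0"
  and T: "0 < T" and k: "0 <= k"
 shows "integrable lborel (mass F V k)" "0 <= mass F V k t"
  "(LBINT t. mass F V k t) <= measure lborel Om powr dl * ((LBINT t. H t) + C * (measure lborel Om powr (1 - 2 / real CARD('n)) * T))"
  "k <= k' ==> (LBINT t. mass F V k' t) <= (LBINT t. mass F V k t)"
proof -
 let ?th = "1 - 2 / real CARD('n)"
 define w where "w = measure lborel Om"
 have w: "0 <= w" by (simp add: w_def)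
 have th: "0 <= ?th" using dim by simp
 have F: "tmeas F" "!!x t. 0 <= F x t" and d: "0 < dl" "0 < sg" "0 <= C" and H: "integrable lborel H" "!!t. 0 <= H t" using dt by (simp_all add: datum_def)
 have D: "AE t in lborel. t : {0<..<T} --> slice_bound F H dl sg C t" using dt by (simp add: datum_def)
 have nn: "0 <= mass F V k t" for k t unfolding mass_def ip_def by (intro integral_nonneg_AE AE_I2) (simp add: F)
 then show "0 <= mass F V k t" .
 have m: "mass F V k : bmb" if "0 <= k" for k using tmeas_ip[OF F(1) level_sets(5)[OF V(1,2) that]] by (simp add: mass_def[abs_def])
 have z: "mass F V k t = 0" if "t \<notin> {0<..<T}" "0 <= k" for k t using V(3)[rule_format, OF that(1)] that(2) by (simp add: mass_def ip_def)
 define b where "b = (%t. w powr dl * (H t + C * (w powr ?th * chf {0..T} t)))"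
 have indT: "integrable lborel (chf {0..T})" "(LBINT t. chf {0..T} t) = T" using T by auto
 have bi: "integrable lborel b" unfolding b_def using H(1) indT(1) by simp
 have bl: "(LBINT t. b t) = w powr dl * ((LBINT t. H t) + C * (w powr ?th * T))" unfolding b_def using H(1) indT by simp
 have le: "AE t in lborel. mass F V k t <= b t" if k: "0 <= k" for k using D
 proof eventually_elim
  fix t assume D: "t : {0<..<T} --> slice_bound F H dl sg C t"
  show "mass F V k t <= b t"
  proof (cases "t : {0<..<T}")
   case True
   let ?A = "{x. k < V x t}"
   note l = level_sets(1-4)[OF V(1,2) k, of t]
   \<comment> \<open>\<open>slice_bound\<close> with B = 1; a crude bound is enough here.\<close>
   have "mass F V k t <= measure lborel ?A powr dl * 1 powr sg * (H t + C * (measure lborel ?A powr ?th / 1))"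
   proof -
    have "\<forall>A\<in>sets borel. A \<subseteq> Om --> (\<forall>B>0. (LBINT x. F x t * chf A x)
      <= measure lborel A powr dl * B powr sg * (H t + C * (measure lborel A powr ?th / B)))" using D True by blast
    from this[rule_format, OF l(1,2) zero_less_one] show ?thesis unfolding mass_def ip_def .
   qed
   also have "\<dots> = measure lborel ?A powr dl * (H t + C * measure lborel ?A powr ?th)" by simp
   also have "\<dots> <= w powr dl * (H t + C * w powr ?th)"
   proof (rule mult_mono)
    show "measure lborel ?A powr dl <= w powr dl" unfolding w_def by (rule powr_mono2) (use d l(4) in simp_all)
    have "measure lborel ?A powr ?th <= w powr ?th" unfolding w_def by (rule powr_mono2) (use th l(4) in simp_all)
    then show "H t + C * measure lborel ?A powr ?th <= H t + C * w powr ?th" by (intro add_left_mono mult_left_mono d(3))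
    show "0 <= H t + C * measure lborel ?A powr ?th" using H(2)[of t] d(3) by simp
   qed simp
   also have "\<dots> = b t" using True by (simp add: b_def)
   finally show ?thesis .
  next
   case False
   then show ?thesis using z[OF False k] H(2)[of t] d by (simp add: b_def)
  qed
 qed
 have int: "integrable lborel (mass F V k)" if k: "0 <= k" for k
 proof (rule Bochner_Integration.integrable_bound[OF bi])
  show "mass F V k : borel_measurable lborel" using m[OF k] by simp
  show "AE t in lborel. norm (mass F V k t) <= norm (b t)" using le[OF k] by eventually_elim (use nn in \<open>simp add: order_trans[OF nn]\<close>)
 qed
 then show "integrable lborel (mass F V k)" using k .
 show "(LBINT t. mass F V k t) <= measure lborel Om powr dl * ((LBINT t. H t) + C * (measure lborel Om powr ?th * T))"
  using integral_mono_AE[OF int[OF k] bi le[OF k]] unfolding bl w_def .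
 show "(LBINT t. mass F V k' t) <= (LBINT t. mass F V k t)" if kk: "k <= k'"
 proof (rule integral_mono_AE[OF int int[OF k]])
  show k': "0 <= k'" using k kk by simp
  show "AE t in lborel. mass F V k' t <= mass F V k t" using D
  proof eventually_elim
   fix t assume D: "t : {0<..<T} --> slice_bound F H dl sg C t"
   show "mass F V k' t <= mass F V k t"
   proof (cases "t : {0<..<T}")
    case True
    have i: "integrable lborel (%x. F x t * chf {x. k < V x t} x)" if "0 <= k" for k using D True level_sets(1,2)[OF V(1,2) that, of t] by blast
    show ?thesis unfolding mass_def ip_def by (rule integral_mono[OF i[OF k'] i[OF k]]) (use kk F in \<open>auto simp: indicator_def\<close>)
   qed (simp add: z k k')
  qed
 qed
qed

text \<open>Let M be the integrated mass above k. The energy inequality for the truncation of height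
  h above k has right side at most h M. Its energy term bounds the level sets at k + 2h uniformly in
  time, its gradient term together with \<open>weak_Sobolev\<close> the time integral of their
  measures to the power 1 - 2/n. Both bounds are of order M/h and enter \<open>slice_bound\<close>
  with the exponents dl and sg.\<close>

lemma decay_step:
 assumes dt: "datum T F H dl sg C" and T: "0 < T" and ws: "wsol T g w0 V G"
  and w0: "AE x in lborel. w0 x <= k" and k: "1 <= k" and h: "0 < h"
  and gF: "AE t in lborel. t : {0<..<T} --> (AE x in lborel. 1 < V x t --> g x t <= F x t)"
 shows "\<forall>t\<in>G. measure lborel {x. k + 2 * h < V x t} <= (LBINT t. mass F V k t) / (exp (-1) * h)"
  and "(LBINT t. mass F V (k + 2 * h) t) <= ((1 / exp (-1)) powr dl * (64 * (16 * real CARD('n)) / (exp (-1))\<^sup>2) powr sg * ((LBINT t. H t) + C))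
    * ((LBINT t. mass F V k t) / h) powr (dl + sg)"
proof -
 let ?th = "1 - 2 / real CARD('n)"
 define \<kappa> :: real where "\<kappa> = exp (-1)"
 define Cs where "Cs = 64 * (16 * real CARD('n))"
 have \<kappa>: "\<kappa> > 0" and Cs: "Cs > 0" by (simp_all add: \<kappa>_def Cs_def)
 note d = wsolD[OF ws]
 have F: "tmeas F" "!!x t. 0 <= F x t" and dd: "0 < dl" "0 < sg" "0 <= C" and H: "integrable lborel H" "!!t. 0 <= H t" using dt by (simp_all add: datum_def)
 have D: "AE t in lborel. t : {0<..<T} --> slice_bound F H dl sg C t" using dt by (simp add: datum_def)
 have Vz: "V x t = 0" if "t \<notin> {0<..<T}" for x t using d(5,7) that by blast
 have k0: "0 <= k" and k2: "0 <= k + 2 * h" using k h by auto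
 have Vz': "\<forall>t x. t \<notin> {0<..<T} --> V x t = 0" using Vz by blast
 note mp = mass_props[OF dt d(1) d(9) Vz' T]
 define M where "M = (LBINT t. mass F V k t)"
 have M0: "0 <= M" unfolding M_def by (intro integral_nonneg_AE AE_I2 mp(2)[OF k0])
 note tf = trunc_fun_eta[OF k0 h]
 interpret tf: trunc_fun "%x. h * eta ((x - k) / h)" "%x. eta' ((x - k) / h)" "%x. h\<^sup>2 * eta_int ((x - k) / h)" by (rule tf)
 define ph where "ph = (%x t. h * eta ((V x t - k) / h))"
 define DD where "DD = (%t. Bf (%x. ph x t) (%x. ph x t))"
 obtain a where a: "!!t. H0 Om (%x. V x t) (a t)" using d(9) by metis
 have Hph: "H0 Om (%x. ph x t) (%i x. eta' ((V x t - k) / h) * a t i x)"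
  and DD0: "0 <= DD t" and DDA: "DD t <= Af s (%x. V x t) (%x. ph x t)"
  and DDB: "DD t <= Bf (%x. V x t) (%x. V x t)" for t unfolding ph_def DD_def using form_compose_ge[OF a tf, of t] by auto
 have tph: "tmeas ph" using measurable_compose[OF d(1)[unfolded tmeas_def] tf.gf_borel] by (simp add: tmeas_def ph_def)
 have DDi: "integrable lborel DD"
 proof (rule Bochner_Integration.integrable_bound[OF d(11)])
  show "DD : borel_measurable lborel" using tmeas_Bf[OF tph tph] by (simp add: DD_def)
  show "AE t in lborel. norm (DD t) <= norm (Qf (%x. V x t))"
  proof (rule AE_I2)
   fix t
   have "DD t <= Qf (%x. V x t)" using DDB[of t] sqn_nonneg[of lborel "%x. V x t"] by (simp add: Qf_def)
   then show "norm (DD t) <= norm (Qf (%x. V x t))" using DD0[of t] by simp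
  qed
 qed
 have phb: "0 <= ph x t" "ph x t <= h" "V x t <= k ==> ph x t = 0" for x t
  using h eta_nonneg eta_le_1[of "(V x t - k) / h"] by (auto simp: ph_def eta_nonpos divide_nonpos_pos)
 have VL: "L2l (%x. V x t)" for t by (rule H0_L2[OF a])
 \<comment> \<open>Where the truncation is nonzero the solution exceeds k >= 1, so the source is at
   most \<open>F\<close> there; the truncation itself is at most h.\<close>
 have ipm: "AE t in lborel. t : {0<..<T} --> ipl (%x. g x t) (%x. ph x t) <= h * mass F V k t" using gF D
 proof eventually_elim
  fix t assume A: "t : {0<..<T} --> (AE x in lborel. 1 < V x t --> g x t <= F x t)"
   "t : {0<..<T} --> slice_bound F H dl sg C t"
  show "t : {0<..<T} --> ipl (%x. g x t) (%x. ph x t) <= h * mass F V k t"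
  proof
   assume t: "t : {0<..<T}"
   have i: "integrable lborel (%x. F x t * chf {x. k < V x t} x)" using A(2) t level_sets(1,2)[OF d(1) d(9) k0, of t] by blast
   have "ipl (%x. g x t) (%x. ph x t) <= (LBINT x. h * (F x t * chf {x. k < V x t} x))" unfolding ip_def
   proof (rule integral_mono_AE)
    show "integrable lborel (%x. g x t * ph x t)" by (rule L2_integrable_mult[OF clean_L2[OF d(10)] H0_L2[OF Hph]])
    show "integrable lborel (%x. h * (F x t * chf {x. k < V x t} x))" using i by simp
    have "AE x in lborel. 1 < V x t --> g x t <= F x t" using A(1) t by simp
    then show "AE x in lborel. g x t * ph x t <= h * (F x t * chf {x. k < V x t} x)"
    proof eventually_elim
     fix x assume g: "1 < V x t --> g x t <= F x t"
     show "g x t * ph x t <= h * (F x t * chf {x. k < V x t} x)"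
     proof (cases "k < V x t")
      case True
      have "g x t * ph x t <= F x t * ph x t" using g True k phb(1) by (intro mult_right_mono) auto
      also have "\<dots> <= F x t * h" using phb(2) F by (intro mult_left_mono) auto
      finally show ?thesis using True by (simp add: mult.commute)
     qed (simp add: phb(3))
    qed
   qed
   also have "\<dots> = h * mass F V k t" by (simp add: mass_def ip_def)
   finally show "ipl (%x. g x t) (%x. ph x t) <= h * mass F V k t" .
  qed
 qed
 have ind_i: "integrable lborel (%ta. chf {p<..q} ta * f ta)" if "integrable lborel f" for p q and f :: "real => real"
  using integrable_real_mult_indicator[OF _ that, of "{p<..q}"] by (simp add: mult.commute)
 have en: "(LBINT x. h\<^sup>2 * eta_int ((V x t1 - k) / h)) + (LBINT ta. chf {0<..t1} ta * DD ta) <= h * M"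
  if t1: "t1 : G" for t1
 proof -
  let ?al = "%ta. Af s (%x. V x ta) (%x. ph x ta) - ipl (%x. g x ta) (%x. ph x ta)"
  have e1: "integrable lborel ?al" unfolding ph_def by (rule energy_inequality(1)[OF ws tf t1])
  have e2: "(LBINT x. h\<^sup>2 * eta_int ((V x t1 - k) / h)) + (LBINT ta. chf {0<..t1} ta * ?al ta)
    <= (LBINT x. h\<^sup>2 * eta_int ((w0 x - k) / h))" unfolding ph_def by (rule energy_inequality(2)[OF ws tf t1])
  have t1T: "0 < t1" "t1 < T" using t1 d(5) by auto
  have mi: "integrable lborel (mass F V k)" by (rule mp(1)[OF k0])
  have z: "(LBINT x. h\<^sup>2 * eta_int ((w0 x - k) / h)) = 0"
  proof (rule integral_eq_zero_AE)
   show "AE x in lborel. h\<^sup>2 * eta_int ((w0 x - k) / h) = 0"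
    using w0 by eventually_elim (use h in \<open>simp add: eta_int_nonpos divide_nonpos_pos\<close>)
  qed
  have "(LBINT ta. chf {0<..t1} ta * DD ta - h * mass F V k ta) <= (LBINT ta. chf {0<..t1} ta * ?al ta)"
  proof (rule integral_mono_AE)
   show "integrable lborel (%ta. chf {0<..t1} ta * DD ta - h * mass F V k ta)" using ind_i[OF DDi] mi by simp
   show "integrable lborel (%ta. chf {0<..t1} ta * ?al ta)" by (rule ind_i[OF e1])
   show "AE ta in lborel. chf {0<..t1} ta * DD ta - h * mass F V k ta <= chf {0<..t1} ta * ?al ta" using ipm
   proof eventually_elim
    fix ta assume i: "ta : {0<..<T} --> ipl (%x. g x ta) (%x. ph x ta) <= h * mass F V k ta"
    have m0: "0 <= h * mass F V k ta" using h mp(2)[OF k0, of ta] by simp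
    show "chf {0<..t1} ta * DD ta - h * mass F V k ta <= chf {0<..t1} ta * ?al ta"
    proof (cases "ta : {0<..t1}")
     case True
     then have "ipl (%x. g x ta) (%x. ph x ta) <= h * mass F V k ta" using i t1T by simp
     then show ?thesis using True DDA[of ta] by simp
    qed (use m0 in simp)
   qed
  qed
  also have "(LBINT ta. chf {0<..t1} ta * DD ta - h * mass F V k ta) = (LBINT ta. chf {0<..t1} ta * DD ta) - h * M"
   unfolding M_def using ind_i[OF DDi, of 0 t1] mi by (simp add: Bochner_Integration.integral_diff)
  finally show ?thesis using e2 unfolding z by linarith
 qed
 define A where "A = (%t. measure lborel {x. k + 2 * h < V x t})"
 note lv = level_sets[OF d(1) d(9) k2]
 have deep: "2 <= (V x t - k) / h" if "k + 2 * h < V x t" for x t using that h by (simp add: le_divide_eq)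
 have sup: "A t1 <= M / (\<kappa> * h)" if t1: "t1 : G" for t1
 proof -
  have "(h\<^sup>2 * \<kappa>) * A t1 = (LBINT x. (h\<^sup>2 * \<kappa>) * chf {x. k + 2 * h < V x t1} x)" using lv(1,3)[of t1] by (simp add: A_def)
  also have "\<dots> <= (LBINT x. h\<^sup>2 * eta_int ((V x t1 - k) / h))"
  proof (rule integral_mono)
   show "integrable lborel (%x. (h\<^sup>2 * \<kappa>) * chf {x. k + 2 * h < V x t1} x)" using lv(1,3)[of t1] by simp
   show "integrable lborel (%x. h\<^sup>2 * eta_int ((V x t1 - k) / h))" by (rule tf.Ph_integrable[OF VL])
   show "(h\<^sup>2 * \<kappa>) * chf {x. k + 2 * h < V x t1} x <= h\<^sup>2 * eta_int ((V x t1 - k) / h)" for x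
   proof (cases "k + 2 * h < V x t1")
    case True
    have "\<kappa> <= eta_int ((V x t1 - k) / h)" unfolding \<kappa>_def by (rule eta_int_ge[OF deep[OF True]])
    then show ?thesis using True by (simp add: mult_left_mono)
   qed (use tf.Ph_nonneg in simp)
  qed
  also have "\<dots> <= h * M"
  proof -
   have "0 <= (LBINT ta. chf {0<..t1} ta * DD ta)" by (intro integral_nonneg_AE AE_I2) (simp add: DD0)
   then show ?thesis using en[OF t1] by linarith
  qed
  finally have "h * ((\<kappa> * h) * A t1) <= h * M" by (simp add: power2_eq_square mult_ac)
  then have "(\<kappa> * h) * A t1 <= M" using h by simp
  then show ?thesis using h \<kappa> by (simp add: le_divide_eq mult.commute)
 qed
 then show "\<forall>t\<in>G. measure lborel {x. k + 2 * h < V x t} <= (LBINT t. mass F V k t) / (exp (-1) * h)" by (simp add: A_def M_def \<kappa>_def)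
 \<comment> \<open>The energy inequality is available at good times, and these approach T.\<close>
 have DDM: "(LBINT t. DD t) <= h * M"
 proof (rule field_le_epsilon)
  fix e :: real assume e: "e > 0"
  have "isCont (%t. LBINT ta. chf {0<..t} ta * DD ta) T" by (rule isCont_indefinite_integral[OF DDi])
  then obtain r where r: "r > 0" "\<forall>t. dist t T < r --> dist (LBINT ta. chf {0<..t} ta * DD ta) (LBINT ta. chf {0<..T} ta * DD ta) < e"
   unfolding continuous_at_eps_delta using e by blast
  obtain t1 where t1: "t1 : G" "max 0 (T - r) < t1" "t1 < T" using AE_real_ex_between[OF d(6), of "max 0 (T - r)" T] T r(1) by auto
  have "(LBINT ta. chf {0<..T} ta * DD ta) - (LBINT ta. chf {0<..t1} ta * DD ta) <= e" using r(2)[rule_format, of t1] t1 by (simp add: dist_real_def)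
  moreover have "(LBINT ta. chf {0<..t1} ta * DD ta) <= h * M"
  proof -
   have "0 <= (LBINT x. h\<^sup>2 * eta_int ((V x t1 - k) / h))" by (intro integral_nonneg_AE AE_I2 tf.Ph_nonneg)
   then show ?thesis using en[OF t1(1)] by linarith
  qed
  moreover have "(LBINT ta. chf {0<..T} ta * DD ta) = (LBINT t. DD t)"
  proof (rule Bochner_Integration.integral_cong[OF refl])
   fix t
   have "DD t = 0" if "t \<notin> {0<..T}"
   proof -
    have z: "(%x. V x t) = (%x. 0)"
    proof -
     have "t \<notin> {0<..<T}" using that by auto
     then show ?thesis using Vz[of t] by blast
    qed
    have "Bf (%x. V x t) (%x. V x t) = 0" unfolding z Bf_eq[OF H0_zero[of Om] H0_zero[of Om]] by (simp add: gip_def ip_def)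
    then show ?thesis using DD0[of t] DDB[of t] by simp
   qed
   then show "chf {0<..T} t * DD t = DD t" by (cases "t : {0<..T}") auto
  qed
  ultimately show "(LBINT t. DD t) <= h * M + e" by linarith
 qed
 \<comment> \<open>Where the solution exceeds k + 2h, the truncation is at least h eta(1), that is
   \<open>\<kappa> * h\<close>, the level at which the weak inequality is applied.\<close>
 have sob: "(\<kappa> * h)\<^sup>2 * A t powr ?th <= Cs * DD t" for t
 proof -
  have "(\<kappa> * h)\<^sup>2 * measure lborel {x. \<kappa> * h <= ph x t} powr (1 - 2 / CARD('n)) <= 64 * (16 * CARD('n)) * DD t"
  proof (rule weak_Sobolev[where f = "%x. ph x t" and M = h and A = Om and D = "DD t", OF dim])
   show "L2l (%x. ph x t)" by (rule H0_L2[OF Hph])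
   show "0 <= ph x t" "ph x t <= h" for x by (rule phb)+
   show "Om : sets borel" "emeasure lborel Om < \<infinity>" by (rule Om_borel, rule Om_fin)
   show "ph x t = 0" if "x \<notin> Om" for x by (rule H0_outside[OF Hph that])
   show "nsq (Inc v (%x. ph x t)) <= (norm v)\<^sup>2 * DD t" for v unfolding DD_def by (rule sqn_Inc_Bf[OF Hph])
   show "0 < \<kappa> * h" using \<kappa> h by simp
  qed
  then have "(\<kappa> * h)\<^sup>2 * measure lborel {x. \<kappa> * h <= ph x t} powr ?th <= Cs * DD t" by (simp add: Cs_def)
  moreover have "A t <= measure lborel {x. \<kappa> * h <= ph x t}" unfolding A_def
  proof (rule measure_mono_fmeasurable)
   show "{x. k + 2 * h < V x t} \<subseteq> {x. \<kappa> * h <= ph x t}"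
   proof (intro subsetI CollectI)
    fix x assume "x : {x. k + 2 * h < V x t}"
    then have "eta 1 <= eta ((V x t - k) / h)" using deep[of x t] by (intro eta_mono) auto
    then show "\<kappa> * h <= ph x t" using h by (simp add: ph_def \<kappa>_def eta_def mult.commute mult_left_mono)
   qed
   show "{x. k + 2 * h < V x t} : sets lborel" using lv(1) by simp
   have s: "{x. \<kappa> * h <= ph x t} : sets lborel" using borel_measurable_le[OF borel_measurable_const tmeas_slice[OF tph], of "\<kappa> * h" t] by simp
   have "{x. \<kappa> * h <= ph x t} \<subseteq> Om"
   proof
    fix x assume "x : {x. \<kappa> * h <= ph x t}"
    moreover have "0 < \<kappa> * h" using \<kappa> h by simp
    ultimately show "x : Om" using H0_outside[OF Hph, of x t] by auto
   qed
   then have "emeasure lborel {x. \<kappa> * h <= ph x t} <= emeasure lborel Om" by (rule emeasure_mono) (use Om_borel in simp)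
   then show "{x. \<kappa> * h <= ph x t} : fmeasurable lborel" using s Om_fin by (auto simp: fmeasurable_def intro: le_less_trans)
  qed
  then have "A t powr ?th <= measure lborel {x. \<kappa> * h <= ph x t} powr ?th" using dim by (intro powr_mono2) (auto simp: A_def)
  then have "(\<kappa> * h)\<^sup>2 * A t powr ?th <= (\<kappa> * h)\<^sup>2 * measure lborel {x. \<kappa> * h <= ph x t} powr ?th"
   by (rule mult_left_mono) simp
  ultimately show ?thesis by linarith
 qed
 have Am: "A : bmb" unfolding A_def by (rule lv(6))
 have sob': "A t powr ?th <= Cs / (\<kappa> * h)\<^sup>2 * DD t" for t
 proof -
  have "0 < (\<kappa> * h)\<^sup>2" using \<kappa> h by simp
  then show ?thesis using sob[of t] by (simp add: field_simps)
 qed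
 have Ai: "integrable lborel (%t. A t powr ?th)"
 proof (rule Bochner_Integration.integrable_bound)
  show "integrable lborel (%t. Cs / (\<kappa> * h)\<^sup>2 * DD t)" using DDi by (rule integrable_mult_right)
  show "(%t. A t powr ?th) : borel_measurable lborel" using Am by simp
  show "AE t in lborel. norm (A t powr ?th) <= norm (Cs / (\<kappa> * h)\<^sup>2 * DD t)"
  proof (rule AE_I2)
   fix t have "0 <= A t powr ?th" by simp
   then show "norm (A t powr ?th) <= norm (Cs / (\<kappa> * h)\<^sup>2 * DD t)" using sob'[of t] unfolding real_norm_def by linarith
  qed
 qed
 \<comment> \<open>A bound for the time integral of \<open>A t powr ?th\<close>. As the free
   parameter of \<open>slice_bound\<close> it makes the last factor integrate to at most the
   integral of \<open>H\<close> plus \<open>C\<close>.\<close>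
 define B where "B = Cs * M / (\<kappa>\<^sup>2 * h)"
 have AB: "(LBINT t. A t powr ?th) <= B"
 proof -
  have "(LBINT t. A t powr ?th) <= (LBINT t. Cs / (\<kappa> * h)\<^sup>2 * DD t)" by (rule integral_mono[OF Ai _ sob']) (use DDi in simp)
  also have "\<dots> = Cs / (\<kappa> * h)\<^sup>2 * (LBINT t. DD t)" by simp
  also have "\<dots> <= Cs / (\<kappa> * h)\<^sup>2 * (h * M)" using Cs by (intro mult_left_mono DDM) auto
  also have "\<dots> = B" using h \<kappa> by (simp add: B_def power2_eq_square)
  finally show ?thesis .
 qed
 have "(LBINT t. mass F V (k + 2 * h) t) <= ((1 / \<kappa>) powr dl * (Cs / \<kappa>\<^sup>2) powr sg * ((LBINT t. H t) + C)) * (M / h) powr (dl + sg)"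
 proof (cases "M = 0")
  \<comment> \<open>For M = 0 the parameter \<open>B\<close> would be 0, which
    \<open>slice_bound\<close> does not admit.\<close>
  case True
  have "(LBINT t. mass F V (k + 2 * h) t) <= M" unfolding M_def by (rule mp(4)[OF k0]) (use h in simp)
  then show ?thesis using True by simp
 next
  case False
  then have M: "M > 0" using M0 by simp
  have B: "B > 0" using M Cs \<kappa> h by (simp add: B_def)
  define P where "P = (M / (\<kappa> * h)) powr dl * B powr sg"
  have P0: "0 <= P" by (simp add: P_def)
  have "(LBINT t. mass F V (k + 2 * h) t) <= (LBINT t. P * (H t + C * (A t powr ?th / B)))"
  proof (rule integral_mono_AE)
   show "integrable lborel (mass F V (k + 2 * h))" by (rule mp(1)[OF k2])
   show "integrable lborel (%t. P * (H t + C * (A t powr ?th / B)))" using H(1) Ai by simp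
   show "AE t in lborel. mass F V (k + 2 * h) t <= P * (H t + C * (A t powr ?th / B))" using D d(6)
   proof eventually_elim
    fix t assume D: "t : {0<..<T} --> slice_bound F H dl sg C t"
     and G: "t : {0<..<T} --> t : G"
    have n: "0 <= H t + C * (A t powr ?th / B)" using H(2)[of t] dd B by simp
    show "mass F V (k + 2 * h) t <= P * (H t + C * (A t powr ?th / B))"
    proof (cases "t : {0<..<T}")
     case True
     then have tG: "t : G" using G by simp
     have "\<forall>A\<in>sets borel. A \<subseteq> Om --> (\<forall>B>0. (LBINT x. F x t * chf A x)
       <= measure lborel A powr dl * B powr sg * (H t + C * (measure lborel A powr ?th / B)))" using D True by blast
     from this[rule_format, OF lv(1)[of t] lv(2)[of t] B]
     have "mass F V (k + 2 * h) t <= A t powr dl * B powr sg * (H t + C * (A t powr ?th / B))" unfolding mass_def ip_def A_def .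
     also have "\<dots> <= P * (H t + C * (A t powr ?th / B))" unfolding P_def using sup[OF tG] dd n by (intro mult_right_mono powr_mono2) (auto simp: A_def)
     finally show ?thesis .
    next
     case False
     then have "mass F V (k + 2 * h) t = 0" using Vz[OF False] k2 by (simp add: mass_def ip_def)
     then show ?thesis using P0 n by simp
    qed
   qed
  qed
  also have "\<dots> = P * ((LBINT t. H t) + C * ((LBINT t. A t powr ?th) / B))" using H(1) Ai by simp
  also have "\<dots> <= P * ((LBINT t. H t) + C * 1)" using AB B dd P0 by (intro mult_left_mono add_left_mono) auto
  also have "P = ((1 / \<kappa>) powr dl * (Cs / \<kappa>\<^sup>2) powr sg) * (M / h) powr (dl + sg)"
  proof -
   have "M / (\<kappa> * h) = (1 / \<kappa>) * (M / h)" "B = (Cs / \<kappa>\<^sup>2) * (M / h)" by (simp_all add: B_def)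
   then have "P = ((1 / \<kappa>) powr dl * (M / h) powr dl) * ((Cs / \<kappa>\<^sup>2) powr sg * (M / h) powr sg)"
    unfolding P_def using \<kappa> Cs M h by (simp only: powr_mult)
   then show ?thesis by (simp add: powr_add mult_ac)
  qed
  finally show ?thesis by (simp add: mult_ac)
 qed
 then show "(LBINT t. mass F V (k + 2 * h) t) <= ((1 / exp (-1)) powr dl * (64 * (16 * real CARD('n)) / (exp (-1))\<^sup>2) powr sg * ((LBINT t. H t) + C))
    * ((LBINT t. mass F V k t) / h) powr (dl + sg)" unfolding \<kappa>_def Cs_def M_def .
qed

theorem uniform_sup_bound:
 assumes dt: "datum T F H dl sg C" and T: "0 < T" and K0: "1 <= K0"
 shows "\<exists>c\<ge>1. \<forall>g w0 V G. wsol T g w0 V G --> (AE x in lborel. w0 x <= K0) -->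
  (AE t in lborel. t : {0<..<T} --> (AE x in lborel. 1 < V x t --> g x t <= F x t)) -->
  (\<forall>t\<in>G. AE x in lborel. V x t <= c)"
proof -
 let ?th = "1 - 2 / real CARD('n)"
 have dd: "1 < dl + sg" "0 <= C" and H: "integrable lborel H" "!!t. 0 <= H t" using dt by (simp_all add: datum_def)
 define C2 where "C2 = (1 / exp (-1)) powr dl * (64 * (16 * real CARD('n)) / (exp (-1))\<^sup>2) powr sg * ((LBINT t. H t) + C)"
 have H0': "0 <= (LBINT t. H t)" by (intro integral_nonneg_AE AE_I2 H(2))
 have C2: "0 <= C2" unfolding C2_def using H0' dd by (intro mult_nonneg_nonneg add_nonneg_nonneg) auto
 \<comment> \<open>The added 1 makes the bound strictly positive, as \<open>fast_decay\<close>
   requires.\<close>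
 define M0 where "M0 = measure lborel Om powr dl * ((LBINT t. H t) + C * (measure lborel Om powr ?th * T)) + 1"
 have M0: "0 < M0"
 proof -
  have "0 <= measure lborel Om powr dl * ((LBINT t. H t) + C * (measure lborel Om powr ?th * T))"
   using H0' dd T by (intro mult_nonneg_nonneg add_nonneg_nonneg) auto
  then show ?thesis by (simp add: M0_def)
 qed
 obtain d where d: "d > 0" "!!M :: real => real. (\<forall>k\<ge>K0. 0 <= M k) ==> (\<forall>k\<ge>K0. \<forall>k'\<ge>k. M k' <= M k) ==> M K0 <= M0 ==>
  (\<forall>k\<ge>K0. \<forall>h>0. M (k + 2 * h) <= C2 * (M k / h) powr (dl + sg)) ==> M (K0 + d) = 0" using fast_decay[OF dd(1) C2 M0, of K0] by blast
 \<comment> \<open>At K0 + d the mass vanishes; one further step with h = 1 turns this into a null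
   level set and accounts for the 2.\<close>
 show ?thesis
 proof (intro exI[of _ "K0 + d + 2"] conjI allI impI ballI)
  show "1 <= K0 + d + 2" using K0 d(1) by simp
  fix g w0 V G t assume ws: "wsol T g w0 V G" and w0: "AE x in lborel. w0 x <= K0"
   and gF: "AE t in lborel. t : {0<..<T} --> (AE x in lborel. 1 < V x t --> g x t <= F x t)" and t: "t : G"
  note w = wsolD[OF ws]
  have Vz: "V x t = 0" if "t \<notin> {0<..<T}" for x t using w(5,7) that by blast
  have Vz': "\<forall>t x. t \<notin> {0<..<T} --> V x t = 0" using Vz by blast
  note mp = mass_props[OF dt w(1) w(9) Vz' T]
  have w0k: "AE x in lborel. w0 x <= k" if "K0 <= k" for k using w0 by eventually_elim (use that in simp)
  define M where "M = (%k. LBINT t. mass F V k t)"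
  have "M (K0 + d) = 0"
  proof (rule d(2))
   show "\<forall>k\<ge>K0. 0 <= M k" unfolding M_def using K0 by (intro allI impI integral_nonneg_AE AE_I2 mp(2)) simp
   show "\<forall>k\<ge>K0. \<forall>k'\<ge>k. M k' <= M k" unfolding M_def using K0 by (intro allI impI mp(4)) auto
   show "M K0 <= M0" unfolding M_def M0_def using mp(3)[of K0] K0 by simp
   show "\<forall>k\<ge>K0. \<forall>h>0. M (k + 2 * h) <= C2 * (M k / h) powr (dl + sg)" unfolding M_def C2_def
   proof (intro allI impI)
    fix k h :: real assume "K0 <= k" "0 < h"
    then show "(LBINT t. mass F V (k + 2 * h) t) <= (1 / exp (-1)) powr dl * (64 * (16 * real CARD('n)) / (exp (-1))\<^sup>2) powr sg * ((LBINT t. H t) + C)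
     * ((LBINT t. mass F V k t) / h) powr (dl + sg)" by (intro decay_step(2)[OF dt T ws w0k _ _ gF]) (use K0 in auto)
   qed
  qed
  moreover have "\<forall>t\<in>G. measure lborel {x. (K0 + d) + 2 * 1 < V x t} <= (LBINT t. mass F V (K0 + d) t) / (exp (-1) * 1)"
   by (rule decay_step(1)[OF dt T ws w0k _ _ gF]) (use K0 d in auto)
  ultimately have "measure lborel {x. (K0 + d) + 2 * 1 < V x t} <= 0" using t by (simp add: M_def)
  then have m: "measure lborel {x. K0 + d + 2 < V x t} = 0" using measure_nonneg[of lborel "{x. K0 + d + 2 < V x t}"] by simp
  have l: "{x. K0 + d + 2 < V x t} : sets borel" "emeasure lborel {x. K0 + d + 2 < V x t} < \<infinity>"
   using level_sets(1,3)[OF w(1) w(9), of "K0 + d + 2" t] K0 d(1) by auto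
  have "emeasure lborel {x. K0 + d + 2 < V x t} = 0" using m l(2) by (simp add: emeasure_eq_ennreal_measure)
  then have "{x. K0 + d + 2 < V x t} : null_sets lborel" using l(1) by (simp add: null_sets_def)
  from AE_not_in[OF this] show "AE x in lborel. V x t <= K0 + d + 2" by eventually_elim simp
 qed
qed

end

subsection \<open>Hoelder's inequality for the data\<close>

lemma Lspace_real_exponent:
 fixes W :: "'a => real"
 assumes W: "W : Lspace (ennreal p) M" and p: "0 < p"
 shows "integrable M (%x. \<bar>W x\<bar> powr p)"
  and "enn2real (Lnorm (ennreal p) M W) = (LINT x|M. \<bar>W x\<bar> powr p) powr (1 / p)"
proof -
 let ?I = "\<integral>\<^sup>+x. ennreal (norm (W x) powr p) \<partial>M"
 have m: "W : borel_measurable M" using W by (simp add: Lspace_def)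
 have e: "Lnorm (ennreal p) M W = (if ?I = \<infinity> then \<infinity> else ennreal (enn2real ?I powr (1 / p)))" using p by (simp add: Lnorm_def Let_def)
 have "Lnorm (ennreal p) M W < \<infinity>" using W by (simp add: Lspace_def)
 then have fin: "?I ~= \<infinity>" unfolding e by (auto split: if_splits)
 show int: "integrable M (%x. \<bar>W x\<bar> powr p)" by (rule integrableI_nonneg) (use m fin in \<open>auto simp: top.not_eq_extremum\<close>)
 have "?I = ennreal (LINT x|M. \<bar>W x\<bar> powr p)" using nn_integral_eq_integral[OF int] by simp
 moreover have "0 <= (LINT x|M. \<bar>W x\<bar> powr p)" by (intro integral_nonneg_AE) simp
 ultimately show "enn2real (Lnorm (ennreal p) M W) = (LINT x|M. \<bar>W x\<bar> powr p) powr (1 / p)" unfolding e by simp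
qed

lemma Lspace_infinity_AE:
 fixes W :: "'a => real"
 assumes "W : Lspace \<infinity> M"
 shows "AE x in M. \<bar>W x\<bar> <= enn2real (Lnorm \<infinity> M W)"
proof -
 have f: "Lnorm \<infinity> M W < \<infinity>" using assms by (simp add: Lspace_def)
 then have e: "Lnorm \<infinity> M W = ennreal (enn2real (Lnorm \<infinity> M W))" by (simp add: less_top)
 have "AE x in M. ennreal (norm (W x)) <= Lnorm \<infinity> M W" unfolding Lnorm_def if_P[OF refl] by (rule esssup_AE)
 then show ?thesis
 proof eventually_elim
  fix x assume "ennreal (norm (W x)) <= Lnorm \<infinity> M W"
  then have "ennreal (norm (W x)) <= ennreal (enn2real (Lnorm \<infinity> M W))" using e by simp
  then show "\<bar>W x\<bar> <= enn2real (Lnorm \<infinity> M W)" by (simp add: ennreal_le_iff)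
 qed
qed

text \<open>Hoelder's inequality against an indicator, from Young's inequality with both factors
  normalised. The infinite exponent is a separate case, in which \<open>enn2real (1 / q)\<close> is
  0.\<close>

lemma slice_Holder:
 fixes W w :: "'a::euclidean_space => real"
 assumes Om: "Om : sets borel" "emeasure lborel Om < \<infinity>" and q: "1 < q" and W: "W : Lspace q (lebesgue_on Om)"
  and ae: "AE x in lebesgue_on Om. W x = w x"
  and w: "w : bmb" "!!x. 0 <= w x" "!!x. x \<notin> Om ==> w x = 0" and A: "A : sets borel" "A \<subseteq> Om"
 shows "integrable lborel (%x. w x * chf A x) &
  (LBINT x. w x * chf A x) <= enn2real (Lnorm q (lebesgue_on Om) W) * measure lborel A powr (1 - enn2real (1 / q))"
proof -
 define N where "N = enn2real (Lnorm q (lebesgue_on Om) W)"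
 define a where "a = measure lborel A"
 have "emeasure lborel A <= emeasure lborel Om" by (rule emeasure_mono) (use A Om in auto)
 then have Afin: "emeasure lborel A < \<infinity>" using Om(2) by (rule le_less_trans)
 have iA: "integrable lborel (chf A)" by (rule integrable_real_indicator) (use A Afin in auto)
 have LA: "(LBINT x. chf A x) = a" using A Afin by (simp add: a_def)
 have a0: "0 <= a" and N0: "0 <= N" by (simp_all add: a_def N_def)
 have m: "(%x. w x * chf A x) : borel_measurable lborel" using w(1) A by simp
 show ?thesis
 proof (cases q)
  case top
  have "AE x in lebesgue_on Om. \<bar>W x\<bar> <= N" unfolding N_def using Lspace_infinity_AE[of W "lebesgue_on Om"] W top by simp
  with ae have "AE x in lebesgue_on Om. w x <= N" by eventually_elim simp
  then have le: "AE x in lborel. w x * chf A x <= N * chf A x"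
   unfolding AE_lebesgue_on_iff[OF Om(1)] by eventually_elim (use A in \<open>auto simp: indicator_def\<close>)
  have int: "integrable lborel (%x. w x * chf A x)"
  proof (rule Bochner_Integration.integrable_bound[OF _ m])
   show "integrable lborel (%x. N * chf A x)" using iA by simp
   show "AE x in lborel. norm (w x * chf A x) <= norm (N * chf A x)" using le by eventually_elim (use w(2) N0 in simp)
  qed
  have "(LBINT x. w x * chf A x) <= (LBINT x. N * chf A x)" by (rule integral_mono_AE[OF int _ le]) (use iA in simp)
  also have "\<dots> = N * a" using LA by simp
  also have "\<dots> = N * a powr (1 - enn2real (1 / q))" using top a0 by simp
  finally show ?thesis using int unfolding N_def a_def by blast
 next
  case (real p)
  have p: "1 < p" using q real by (simp add: ennreal_less_iff flip: ennreal_1)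
  define J where "J = (LBINT x. w x powr p)"
  have W': "W : Lspace (ennreal p) (lebesgue_on Om)" using W real by simp
  note Wi = Lspace_real_exponent[OF W' order.strict_trans[OF zero_less_one p]]
  have wpm: "(%x. w x powr p) : bmb" using w(1) by simp
  have aep: "AE x in lebesgue_on Om. \<bar>W x\<bar> powr p = w x powr p" using ae by eventually_elim (use w(2) in simp)
  have Wm: "(%x. \<bar>W x\<bar> powr p) : borel_measurable (lebesgue_on Om)" using Wi(1) by simp
  have z: "w x powr p = 0" if "x \<notin> Om" for x using w(3)[OF that] by simp
  note cl = lebesgue_on_clean[OF Om(1) wpm z Wm aep]
  have wi: "integrable lborel (%x. w x powr p)" using Wi(1) cl(2) by simp
  have N: "N = J powr (1 / p)" unfolding N_def J_def using Wi(2) cl(1) real by simp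
  have J0: "0 <= J" unfolding J_def by (intro integral_nonneg_AE) simp
  have q': "1 - enn2real (1 / q) = 1 - 1 / p"
  proof -
   have "1 / q = ennreal (1 / p)" using real p by (simp add: divide_ennreal flip: ennreal_1)
   then show ?thesis using p by simp
  qed
  have int: "integrable lborel (%x. w x * chf A x)"
  proof (rule Bochner_Integration.integrable_bound[OF _ m])
   show "integrable lborel (%x. chf A x + w x powr p)" using iA wi by simp
   show "AE x in lborel. norm (w x * chf A x) <= norm (chf A x + w x powr p)"
   proof (rule AE_I2)
    fix x
    have "w x <= 1 + w x powr p"
    proof (cases "w x <= 1")
     case True
     have "0 <= w x powr p" by simp
     with True show ?thesis by linarith
    next
     case False
     then have "w x powr 1 <= w x powr p" using p by (intro powr_mono) auto
     then show ?thesis using False by simp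
    qed
    then show "norm (w x * chf A x) <= norm (chf A x + w x powr p)" using w(2)[of x] by (cases "x : A") auto
   qed
  qed
  have zero: ?thesis if "AE x in lborel. w x * chf A x = 0"
  proof -
   have "(LBINT x. w x * chf A x) = 0" by (rule integral_eq_zero_AE[OF that])
   then show ?thesis using int by simp
  qed
  consider "J = 0" | "a = 0" | "J > 0" "a > 0" using J0 a0 by linarith
  then show ?thesis
  proof cases
   case 1
   have "AE x in lborel. w x powr p = 0" using integral_nonneg_eq_0_iff_AE[OF wi] 1 unfolding J_def by simp
   then have "AE x in lborel. w x * chf A x = 0" by eventually_elim simp
   then show ?thesis by (rule zero)
  next
   case 2
   have "emeasure lborel A = 0" using 2 Afin unfolding a_def by (simp add: emeasure_eq_ennreal_measure)
   then have "A : null_sets lborel" using A by (simp add: null_sets_def)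
   from AE_not_in[OF this] have "AE x in lborel. w x * chf A x = 0" by eventually_elim simp
   then show ?thesis by (rule zero)
  next
   case 3
   define p' where "p' = p / (p - 1)"
   have p': "1 < p'" "1 / p + 1 / p' = 1" "1 / p' = 1 - 1 / p" using p by (simp_all add: p'_def field_simps)
   have Np: "N powr p = J" unfolding N using 3 p by (simp add: powr_powr)
   have Npos: "N > 0" unfolding N using 3 by simp
   define c where "c = N * a powr (1 - 1 / p)"
   have c: "c > 0" using Npos 3 by (simp add: c_def)
   \<comment> \<open>A pointwise majorant from Young's inequality. Its integral is \<open>c\<close>
     times \<open>1 / p + 1 / p'\<close>, that is, the Hoelder bound.\<close>
   define R where "R = (%x. c * (w x powr p / (J * p) + chf A x / (a * p')))"
   have le: "w x * chf A x <= R x" for x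
   proof (cases "x : A")
    case True
    have "(w x / N) * (a powr (- (1 / p'))) <= (w x / N) powr p / p + (a powr (- (1 / p'))) powr p' / p'"
     by (rule Youngs_inequality[OF p p'(1,2)]) (use w(2)[of x] Npos in auto)
    also have "(w x / N) powr p = w x powr p / J" using w(2)[of x] Npos by (simp add: powr_divide Np)
    also have "(a powr (- (1 / p'))) powr p' = 1 / a"
    proof -
     have "(a powr (- (1 / p'))) powr p' = a powr (- (1 / p') * p')" by (rule powr_powr)
     also have "- (1 / p') * p' = - 1" using p'(1) by simp
     also have "a powr (- 1) = 1 / a" by (rule powr_neg_one[OF 3(2)])
     finally show ?thesis .
    qed
    finally have Y: "(w x / N) * (a powr (- (1 / p'))) <= w x powr p / J / p + 1 / a / p'" .
    have "a powr (1 - 1 / p) * a powr (- (1 / p')) = 1" using 3 p'(3) by (simp flip: powr_add)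
    then have "w x = c * ((w x / N) * (a powr (- (1 / p'))))" using Npos by (simp add: c_def mult_ac)
    also have "\<dots> <= c * (w x powr p / J / p + 1 / a / p')" using Y c by (intro mult_left_mono) auto
    finally show ?thesis using True by (simp add: R_def)
   next
    case False
    then show ?thesis using c 3 p by (simp add: R_def)
   qed
   have Ri: "integrable lborel R" unfolding R_def using wi iA by simp
   have "(LBINT x. w x * chf A x) <= (LBINT x. R x)" by (rule integral_mono[OF int Ri le])
   also have "\<dots> = c * (J / (J * p) + a / (a * p'))" unfolding R_def using wi iA LA by (simp add: J_def)
   also have "\<dots> = c * (1 / p + 1 / p')" using 3 by simp
   finally show ?thesis using int unfolding p'(2) c_def q' N_def a_def by simp
  qed
 qed
qed

text \<open>Young's inequality keeps the estimate pointwise in t, with y still free: the p-th power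
  of \<open>N\<close> becomes the integrable \<open>H\<close>, and y enters linearly. For the
  infinite exponent the essential bound of \<open>N\<close> becomes \<open>C\<close>.\<close>

lemma time_Young:
 fixes N :: "real => real"
 assumes N: "N : Lspace r (lebesgue_on {0<..<T})" "!!t. 0 <= N t" and r: "1 < r"
 shows "\<exists>H C. integrable lborel H & (\<forall>t. 0 <= H t) & 0 <= C &
  (AE t in lborel. t : {0<..<T} --> (\<forall>y\<ge>0. N t * y powr (1 - enn2real (1 / r)) <= H t + C * y))"
proof (cases r)
 case top
 have "AE t in lebesgue_on {0<..<T}. \<bar>N t\<bar> <= enn2real (Lnorm \<infinity> (lebesgue_on {0<..<T}) N)"
  using Lspace_infinity_AE[of N "lebesgue_on {0<..<T}"] N top by simp
 then have "AE t in lborel. t : {0<..<T} --> \<bar>N t\<bar> <= enn2real (Lnorm \<infinity> (lebesgue_on {0<..<T}) N)" by (subst (asm) AE_lebesgue_on_iff) simp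
 then have "AE t in lborel. t : {0<..<T} --> (\<forall>y\<ge>0. N t * y powr (1 - enn2real (1 / r)) <= 0 + enn2real (Lnorm \<infinity> (lebesgue_on {0<..<T}) N) * y)"
  by eventually_elim (use top in \<open>auto intro!: mult_right_mono\<close>)
 then show ?thesis by (intro exI[of _ "%t. 0"] exI[of _ "enn2real (Lnorm \<infinity> (lebesgue_on {0<..<T}) N)"]) simp
next
 case (real p)
 have p: "1 < p" using r real by (simp add: ennreal_less_iff flip: ennreal_1)
 have N': "N : Lspace (ennreal p) (lebesgue_on {0<..<T})" using N real by simp
 note Ni = Lspace_real_exponent(1)[OF N' order.strict_trans[OF zero_less_one p]]
 have Is: "{0<..<T} : sets borel" by simp
 have Nm: "N : borel_measurable (lebesgue_on {0<..<T})" using N by (simp add: Lspace_def)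
 obtain b where b: "b : bmb" "!!t. t \<notin> {0<..<T} ==> b t = 0" "AE t in lebesgue_on {0<..<T}. N t = b t" using lebesgue_on_borel_version[OF Is Nm] by blast
 have bm: "(%t. \<bar>b t\<bar> powr p) : bmb" using b(1) by simp
 have aep: "AE t in lebesgue_on {0<..<T}. \<bar>N t\<bar> powr p = \<bar>b t\<bar> powr p" using b(3) by eventually_elim simp
 have z: "\<bar>b t\<bar> powr p = 0" if "t \<notin> {0<..<T}" for t using b(2)[OF that] by simp
 have Hm: "(%t. \<bar>N t\<bar> powr p) : borel_measurable (lebesgue_on {0<..<T})" using Ni by simp
 have Hi: "integrable lborel (%t. \<bar>b t\<bar> powr p)" using lebesgue_on_clean(2)[OF Is bm z Hm aep] Ni by simp
 have q': "1 - enn2real (1 / r) = 1 - 1 / p"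
 proof -
  have "1 / r = ennreal (1 / p)" using real p by (simp add: divide_ennreal flip: ennreal_1)
  then show ?thesis using p by simp
 qed
 define p' where "p' = p / (p - 1)"
 have p': "1 < p'" "1 / p + 1 / p' = 1" "(1 - 1 / p) * p' = 1" using p by (simp_all add: p'_def field_simps)
 have "AE t in lborel. t : {0<..<T} --> N t = b t" using b(3) by (subst (asm) AE_lebesgue_on_iff) simp
 then have "AE t in lborel. t : {0<..<T} --> (\<forall>y\<ge>0. N t * y powr (1 - enn2real (1 / r)) <= \<bar>b t\<bar> powr p + 1 * y)"
 proof eventually_elim
  fix t assume t: "t : {0<..<T} --> N t = b t"
  show "t : {0<..<T} --> (\<forall>y\<ge>0. N t * y powr (1 - enn2real (1 / r)) <= \<bar>b t\<bar> powr p + 1 * y)"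
  proof (intro impI allI)
   fix y :: real assume tI: "t : {0<..<T}" and y: "0 <= y"
   have "N t * y powr (1 - 1 / p) <= N t powr p / p + (y powr (1 - 1 / p)) powr p' / p'" by (rule Youngs_inequality[OF p p'(1,2)]) (use N(2) in auto)
   also have "(y powr (1 - 1 / p)) powr p' = y" using y p'(3) by (simp add: powr_powr)
   also have "N t powr p / p <= N t powr p" using p by (simp add: divide_le_eq mult_left_le_one_le mult_le_cancel_left1)
   also have "y / p' <= y" using p'(1) y by (simp add: divide_le_eq mult_le_cancel_left1)
   finally have "N t * y powr (1 - 1 / p) <= N t powr p + y" by simp
   moreover have "N t powr p = \<bar>b t\<bar> powr p" using t tI N(2)[of t] by simp
   ultimately show "N t * y powr (1 - enn2real (1 / r)) <= \<bar>b t\<bar> powr p + 1 * y" unfolding q' by simp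
  qed
 qed
 then show ?thesis using Hi by (intro exI[of _ "%t. \<bar>b t\<bar> powr p"] exI[of _ 1]) simp
qed

text \<open>In extended arithmetic division by 0 gives infinity, so the hypothesis excludes
  exponents 0. Then n/(2q) < 1 and n > 2 force q > 1, and 1/r < 1 gives r > 1.\<close>

lemma exponent_condition:
 fixes r q :: ennreal and n :: nat
 assumes n: "2 < n" and ex: "1 / r + of_nat n / (2 * q) < 1"
 shows "1 < r" "1 < q" "enn2real (1 / r) < 1" "enn2real (1 / r) + real n * enn2real (1 / q) / 2 < 1"
proof -
 define x where "x = enn2real (1 / r)"
 define k where "k = enn2real (of_nat n / (2 * q))"
 have "1 / r <= 1 / r + of_nat n / (2 * q)" "of_nat n / (2 * q) <= 1 / r + of_nat n / (2 * q)" by auto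
 from this(1)[THEN le_less_trans, OF ex] this(2)[THEN le_less_trans, OF ex]
 have t: "1 / r < top" "of_nat n / (2 * q) < top" using less_trans[OF _ ennreal_one_less_top] by blast+
 have xe: "1 / r = ennreal x" and ke: "of_nat n / (2 * q) = ennreal k" unfolding x_def k_def using t by simp_all
 have x0: "0 <= x" and k0: "0 <= k" by (simp_all add: x_def k_def)
 have l: "ennreal (x + k) < ennreal 1" using ex unfolding xe ke ennreal_plus[OF x0 k0] by simp
 have "0 <= x + k" using x0 k0 by simp
 have xk: "x + k < 1" by (rule iffD1[OF ennreal_less_iff[OF \<open>0 <= x + k\<close>] l])
 show "enn2real (1 / r) < 1" using xk k0 by (simp add: x_def)
 have qq: "1 < q & real n * enn2real (1 / q) / 2 = k"
 proof (cases q)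
  case top
  then show ?thesis by (simp add: k_def ennreal_mult_top)
 next
  case (real p)
  have p: "p > 0"
  proof (rule ccontr)
   assume "\<not> p > 0"
   then have "q = 0" using real by simp
   then have "of_nat n / (2 * q) = top" using n by (simp add: ennreal_divide_zero)
   then show False using t(2) by simp
  qed
  have "2 * q = ennreal (2 * p)" using real by (simp add: ennreal_mult flip: ennreal_numeral)
  then have "of_nat n / (2 * q) = ennreal (real n / (2 * p))" using p by (simp add: divide_ennreal ennreal_of_nat_eq_real_of_nat)
  then have kk: "k = real n / (2 * p)" using p by (simp add: k_def)
  have "1 / q = ennreal (1 / p)" using real p by (simp add: divide_ennreal flip: ennreal_1)
  then have q1: "enn2real (1 / q) = 1 / p" using p by simp
  have "real n / (2 * p) < 1" using xk x0 kk by simp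
  then have "real n < 2 * p" using p by simp
  then have "1 < p" using n by simp
  then have "1 < q" using real by (simp add: ennreal_less_iff flip: ennreal_1)
  then show ?thesis using kk q1 by simp
 qed
 then show "1 < q" "enn2real (1 / r) + real n * enn2real (1 / q) / 2 < 1" using xk by (simp_all add: x_def)
 show "1 < r"
 proof (cases r)
  case top then show ?thesis by simp
 next
  case (real p)
  have p: "p > 0"
  proof (rule ccontr)
   assume "\<not> p > 0"
   then have "r = 0" using real by simp
   then have "1 / r = top" by (simp add: ennreal_divide_zero)
   then show False using t(1) by simp
  qed
  have "1 / r = ennreal (1 / p)" using real p by (simp add: divide_ennreal flip: ennreal_1)
  then have "x = 1 / p" using p by (simp add: x_def)
  then have "1 / p < 1" using xk k0 by linarith
  then have "1 < p" using p by simp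
  then show ?thesis using real by (simp add: ennreal_less_iff flip: ennreal_1)
 qed
qed

text \<open>The converse of slicing, by Fubini's theorem for null sets; measurability of the
  exceptional set is what makes it applicable.\<close>

lemma AE_cylinder_of_slices:
 fixes P :: "(real^'n::finite) \<times> real => bool"
 assumes Om: "Om : sets borel" and P: "{z. P z} : sets borel"
  and ae: "AE t in lborel. t : {0<..<T} --> (AE x in lborel. x : Om --> P (x, t))"
 shows "AE z in cylinder Om T. P z"
proof -
 let ?Q = "%x t. x : Om & t : {0<..<T} --> P (x, t)"
 have C: "Om \<times> {0<..<T} : sets borel" unfolding borel_prod[symmetric] using Om by auto
 have eq: "{z. ?Q (fst z) (snd z)} = - (Om \<times> {0<..<T}) \<union> {z. P z}" by auto
 have "{z. ?Q (fst z) (snd z)} : sets borel" unfolding eq using C P by auto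
 moreover have s: "sets (lborel \<Otimes>\<^sub>M lborel) = sets (borel :: ((real^'n) \<times> real) measure)" unfolding lborel_prod by simp
 moreover have sp: "space (lborel \<Otimes>\<^sub>M lborel :: ((real^'n) \<times> real) measure) = UNIV" by (simp add: space_pair_measure)
 ultimately have m: "{z : space (lborel \<Otimes>\<^sub>M lborel). ?Q (fst z) (snd z)} : sets (lborel \<Otimes>\<^sub>M lborel)" unfolding s sp by simp
 have "AE t in lborel. AE x in lborel. ?Q x t" using ae
 proof eventually_elim
  fix t assume t: "t : {0<..<T} --> (AE x in lborel. x : Om --> P (x, t))"
  show "AE x in lborel. ?Q x t"
  proof (cases "t : {0<..<T}")
   case True
   then have "AE x in lborel. x : Om --> P (x, t)" using t by blast
   then show ?thesis by eventually_elim blast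
  next
   case False
   show ?thesis by (rule AE_I2) (use False in blast)
  qed
 qed
 then have "AE x in lborel. AE t in lborel. ?Q x t" by (subst lborel_pair.AE_commute[OF m])
 then have "AE z in lborel \<Otimes>\<^sub>M lborel. ?Q (fst z) (snd z)" by (subst lborel_pair.AE_pair_iff[OF m, symmetric])
 then have "AE z in lborel. z : Om \<times> {0<..<T} --> P z" unfolding lborel_prod by eventually_elim (auto simp: mem_Times_iff)
 then show ?thesis unfolding AE_lebesgue_on_iff[OF C] .
qed

context frac begin

lemma data_bound:
 assumes f: "f : LrLq r q Om T" and nn: "AE (x, t) in cylinder Om T. 0 <= f x t"
  and ex: "1 / r + of_nat CARD('n) / (2 * q) < 1"
 shows "\<exists>F H dl sg C. datum T F H dl sg C &
  (AE t in lborel. t : {0<..<T} --> (AE x in lborel. x : Om --> f x t = F x t))"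
proof -
 let ?I = "{0<..<T}"
 let ?th = "1 - 2 / real CARD('n)"
 let ?n = "real CARD('n)"
 have n: "2 < ?n" using dim by simp
 note ec = exponent_condition[OF dim ex]
 define x where "x = enn2real (1 / r)"
 define y where "y = enn2real (1 / q)"
 have xy: "x < 1" "x + ?n * y / 2 < 1" "0 <= x" "0 <= y" using ec by (simp_all add: x_def y_def)
 \<comment> \<open>Writing |A|^th = B (|A|^th / B) splits |A|^(1 - y) into |A|^dl B^sg (|A|^th /
   B)^sg, which dictates both exponents. The hypothesis on r and q says y < (2/n) sg, whence 1 < dl
   + sg.\<close>
 define sg where "sg = 1 - x"
 define dl where "dl = 1 - y - ?th * sg"
 have y2: "y < 2 / ?n * sg"
 proof -
  have "?n * y / 2 < sg" using xy by (simp add: sg_def)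
  then show ?thesis using n by (simp add: field_simps)
 qed
 have sg: "0 < sg" "sg <= 1" using xy by (simp_all add: sg_def)
 have dl: "0 < dl" "1 < dl + sg"
 proof -
  have e: "?th * sg = sg - 2 / ?n * sg" by (simp add: algebra_simps)
  show "0 < dl" unfolding dl_def e using y2 sg by argo
  show "1 < dl + sg" unfolding dl_def e using y2 by argo
 qed
 have C: "Om \<times> ?I : sets borel" unfolding borel_prod[symmetric] using Om_borel by auto
 have fm: "(%(x, t). f x t) : borel_measurable (cylinder Om T)"
  and fq: "AE t in lebesgue_on ?I. (%x. f x t) : Lspace q (lebesgue_on Om)"
  and fr: "(%t. enn2real (Lnorm q (lebesgue_on Om) (%x. f x t))) : Lspace r (lebesgue_on ?I)" using f by (simp_all add: LrLq_def Lspace_time_def)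
 obtain fb where fb: "fb : bmb" "!!z. z \<notin> Om \<times> ?I ==> fb z = 0"
  "AE z in cylinder Om T. (%(x, t). f x t) z = fb z" using lebesgue_on_borel_version[OF C fm] by blast
 define F where "F = (%x t. max 0 (fb (x, t)))"
 have tF: "tmeas F" using fb(1) by (simp add: tmeas_def F_def)
 have F0: "0 <= F x t" for x t by (simp add: F_def)
 have Fout: "F x t = 0" if "x \<notin> Om" for x t using fb(2)[of "(x, t)"] that by (simp add: F_def)
 have "AE z in cylinder Om T. (%(x, t). f x t = F x t) z" using fb(3) nn by eventually_elim (auto simp: F_def)
 from AE_lborel_prod_cylinder[OF Om_borel this]
 have fF: "AE t in lborel. t : ?I --> (AE x in lborel. x : Om --> f x t = F x t)"
 proof eventually_elim
  fix t assume A: "AE x in lborel. x : Om --> t : ?I --> (case (x, t) of (x, t) => f x t = F x t)"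
  show "t : ?I --> (AE x in lborel. x : Om --> f x t = F x t)"
  proof
   assume t: "t : ?I"
   from A show "AE x in lborel. x : Om --> f x t = F x t" by eventually_elim (use t in simp)
  qed
 qed
 define N where "N = (%t. enn2real (Lnorm q (lebesgue_on Om) (%x. f x t)))"
 obtain H C1 where HC: "integrable lborel H" "\<forall>t. 0 <= H t" "0 <= C1"
  "AE t in lborel. t : ?I --> (\<forall>y\<ge>0. N t * y powr sg <= H t + C1 * y)" using time_Young[OF fr _ ec(1)] unfolding N_def sg_def x_def by auto
 have fq': "AE t in lborel. t : ?I --> (%x. f x t) : Lspace q (lebesgue_on Om)" using fq by (subst (asm) AE_lebesgue_on_iff) simp
 have "AE t in lborel. t : ?I --> slice_bound F H dl sg C1 t" using fF HC(4) fq'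
 proof (eventually_elim, intro impI ballI)
  fix t A assume A: "t : ?I --> (AE x in lborel. x : Om --> f x t = F x t)"
   "t : ?I --> (\<forall>y\<ge>0. N t * y powr sg <= H t + C1 * y)" "t : ?I --> (%x. f x t) : Lspace q (lebesgue_on Om)"
   and t: "t : ?I" and As: "A : sets borel" "A \<subseteq> Om"
  have ae: "AE x in lebesgue_on Om. f x t = F x t" unfolding AE_lebesgue_on_iff[OF Om_borel] using A(1) t by blast
  have Lq: "(%x. f x t) : Lspace q (lebesgue_on Om)" using A(3) t by blast
  have Y: "N t * y powr sg <= H t + C1 * y" if "0 <= y" for y using A(2) t that by blast
  have sl: "integrable lborel (%x. F x t * chf A x) &
   (LBINT x. F x t * chf A x) <= N t * measure lborel A powr (1 - y)" unfolding N_def y_def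
   by (rule slice_Holder[OF Om_borel Om_fin ec(2) Lq ae tmeas_slice[OF tF] F0 Fout As])
  define a where "a = measure lborel A"
  have "(LBINT x. F x t * chf A x) <= a powr dl * B powr sg * (H t + C1 * (a powr ?th / B))" if B: "B > 0" for B
  proof -
   have "a powr (1 - y) = a powr dl * (a powr ?th) powr sg" by (simp add: dl_def powr_powr powr_add[symmetric])
   also have "(a powr ?th) powr sg = (B * (a powr ?th / B)) powr sg" using B by simp
   also have "\<dots> = B powr sg * (a powr ?th / B) powr sg" by (rule powr_mult)
   finally have e: "N t * a powr (1 - y) = a powr dl * B powr sg * (N t * (a powr ?th / B) powr sg)" by (simp add: mult_ac)
   have "a powr dl * B powr sg * (N t * (a powr ?th / B) powr sg) <= a powr dl * B powr sg * (H t + C1 * (a powr ?th / B))"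
    using B by (intro mult_left_mono Y) auto
   then show ?thesis using sl e unfolding a_def by linarith
  qed
  then show "integrable lborel (%x. F x t * chf A x) &
    (\<forall>B>0. (LBINT x. F x t * chf A x)
      <= measure lborel A powr dl * B powr sg * (H t + C1 * (measure lborel A powr ?th / B)))" using sl unfolding a_def by blast
 qed
 then have "datum T F H dl sg C1" unfolding datum_def using tF F0 dl sg(1) HC(1-3) by blast
 with fF show ?thesis by blast
qed

text \<open>The equation for the difference is tested with \<open>eta\<close>, which lives where V >
  V'. There \<open>g\<close> makes the difference of the sources nonpositive, so the energy of the
  positive part cannot grow from its initial value 0.\<close>

lemma comparison:
 assumes 1: "wsol T g w V G" and 2: "wsol T g' w' V' G'" and w: "AE x in lborel. w x <= w' x"
  and g: "AE t in lborel. t : {0<..<T} --> (AE x in lborel. V' x t < V x t --> g x t <= g' x t)"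
  and t1: "t1 : G" "t1 : G'"
 shows "AE x in lborel. V x t1 <= V' x t1"
proof -
 define z where "z = (%x t. if t : G \<inter> G' then V x t - V' x t else 0)"
 define p where "p = (%x t. if t : G \<inter> G' then g x t - g' x t else 0)"
 have ws: "wsol T p (%x. w x - w' x) z (G \<inter> G')" unfolding z_def p_def by (rule wsol_diff[OF 1 2])
 note d = wsolD[OF ws]
 have tf: "trunc_fun eta eta' eta_int" using trunc_fun_eta[of 0 1] by simp
 have t: "t1 : G \<inter> G'" using t1 by simp
 note e = energy_inequality[OF ws tf t]
 have "(LBINT x. eta_int (w x - w' x)) = 0" by (rule integral_eq_zero_AE) (use w in \<open>eventually_elim, simp add: eta_int_nonpos\<close>)
 moreover have "0 <= (LBINT ta. chf {0<..t1} ta * (Af s (%x. z x ta) (%x. eta (z x ta)) - ipl (%x. p x ta) (%x. eta (z x ta))))"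
 proof (rule integral_nonneg_AE)
  show "AE ta in lborel. 0 <= chf {0<..t1} ta * (Af s (%x. z x ta) (%x. eta (z x ta)) - ipl (%x. p x ta) (%x. eta (z x ta)))" using g
  proof eventually_elim
   fix ta assume g: "ta : {0<..<T} --> (AE x in lborel. V' x ta < V x ta --> g x ta <= g' x ta)"
   obtain a where a: "H0 Om (%x. z x ta) a" using d(9) by blast
   have "0 <= Af s (%x. z x ta) (%x. eta (z x ta))" using form_compose_ge(2,3)[OF a tf] by linarith
   moreover have "ipl (%x. p x ta) (%x. eta (z x ta)) <= 0"
   proof (cases "ta : G \<inter> G'")
    case True
    then have "ta : {0<..<T}" using d(5) by blast
    then have "AE x in lborel. V' x ta < V x ta --> g x ta <= g' x ta" using g by blast
    then have "AE x in lborel. 0 <= - (p x ta * eta (z x ta))"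
    proof eventually_elim
     fix x assume "V' x ta < V x ta --> g x ta <= g' x ta"
     then show "0 <= - (p x ta * eta (z x ta))" using True eta_nonneg[of "z x ta"] eta_nonpos[of "z x ta"]
      by (cases "V' x ta < V x ta") (auto simp: p_def z_def mult_le_0_iff)
    qed
    then have "0 <= (LBINT x. - (p x ta * eta (z x ta)))" by (rule integral_nonneg_AE)
    then show ?thesis by (simp add: ip_def)
   next
    case False
    then have z: "(%x. p x ta) = (%x. 0)" by (auto simp: p_def)
    show ?thesis unfolding z by (simp add: ip_def)
   qed
   ultimately show "0 <= chf {0<..t1} ta * (Af s (%x. z x ta) (%x. eta (z x ta)) - ipl (%x. p x ta) (%x. eta (z x ta)))" by (intro mult_nonneg_nonneg) auto
  qed
 qed
 ultimately have le: "(LBINT x. eta_int (z x t1)) <= 0" using e(2) by linarith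
 obtain a where a: "H0 Om (%x. z x t1) a" using d(9) by blast
 have i: "integrable lborel (%x. eta_int (z x t1))" by (rule trunc_fun.Ph_integrable[OF tf H0_L2[OF a]])
 have nn: "0 <= eta_int (z x t1)" for x by (rule trunc_fun.Ph_nonneg[OF tf])
 have "0 <= (LBINT x. eta_int (z x t1))" by (intro integral_nonneg_AE AE_I2 nn)
 with le have "(LBINT x. eta_int (z x t1)) = 0" by simp
 then have "AE x in lborel. eta_int (z x t1) = 0" using integral_nonneg_eq_0_iff_AE[OF i] nn by simp
 then show ?thesis
 proof eventually_elim
  fix x assume "eta_int (z x t1) = 0"
  then have "\<not> 0 < z x t1" using eta_int_pos[of "z x t1"] by auto
  then show "V x t1 <= V' x t1" using t by (simp add: z_def)
 qed
qed

text \<open>The solution itself is the test function (\<open>trunc_fun_id\<close>), and the nonlocal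
  part is nonnegative. The bound extends to the whole interval through good times approaching
  T.\<close>

lemma gradient_bound:
 assumes ws: "wsol T g w V G" and T: "0 < T"
  and R: "integrable lborel R" "!!t. 0 <= R t" "AE t in lborel. t : {0<..<T} --> ipl (%x. g x t) (%x. V x t) <= R t"
 shows "(LBINT t. Bf (%x. V x t) (%x. V x t)) <= nsq w / 2 + (LBINT t. R t)"
  and "integrable lborel (%t. Bf (%x. V x t) (%x. V x t))"
proof -
 note d = wsolD[OF ws]
 obtain a where a: "!!t. H0 Om (%x. V x t) (a t)" using d(9) by metis
 define DD where "DD = (%t. Bf (%x. V x t) (%x. V x t))"
 have DD0: "0 <= DD t" for t unfolding DD_def by (rule Bf_nonneg[OF a])
 have DDA: "DD t <= Af s (%x. V x t) (%x. V x t)" for t unfolding DD_def Af_def using NLf_self_nonneg[of "%x. V x t"] by simp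
 have DDi: "integrable lborel DD"
 proof (rule Bochner_Integration.integrable_bound[OF d(11)])
  show "DD : borel_measurable lborel" using tmeas_Bf[OF d(1) d(1)] by (simp add: DD_def)
  show "AE t in lborel. norm (DD t) <= norm (Qf (%x. V x t))"
  proof (rule AE_I2)
   fix t
   have "DD t <= Qf (%x. V x t)" using sqn_nonneg[of lborel "%x. V x t"] by (simp add: Qf_def DD_def)
   then show "norm (DD t) <= norm (Qf (%x. V x t))" using DD0[of t] by simp
  qed
 qed
 then show "integrable lborel (%t. Bf (%x. V x t) (%x. V x t))" by (simp add: DD_def)
 have ind_i: "integrable lborel (%ta. chf {p<..q} ta * f ta)" if "integrable lborel f" for p q and f :: "real => real"
  using integrable_real_mult_indicator[OF _ that, of "{p<..q}"] by (simp add: mult.commute)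
 define M where "M = nsq w / 2 + (LBINT t. R t)"
 have en: "(LBINT ta. chf {0<..t1} ta * DD ta) <= M" if t1: "t1 : G" for t1
 proof -
  let ?al = "%ta. Af s (%x. V x ta) (%x. V x ta) - ipl (%x. g x ta) (%x. V x ta)"
  note e = energy_inequality[OF ws trunc_fun_id t1]
  have t1T: "0 < t1" "t1 < T" using t1 d(5) by auto
  have "(LBINT ta. chf {0<..t1} ta * DD ta - R ta) <= (LBINT ta. chf {0<..t1} ta * ?al ta)"
  proof (rule integral_mono_AE)
   show "integrable lborel (%ta. chf {0<..t1} ta * DD ta - R ta)" using ind_i[OF DDi] R(1) by simp
   show "integrable lborel (%ta. chf {0<..t1} ta * ?al ta)" by (rule ind_i[OF e(1)])
   show "AE ta in lborel. chf {0<..t1} ta * DD ta - R ta <= chf {0<..t1} ta * ?al ta" using R(3)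
   proof eventually_elim
    fix ta assume i: "ta : {0<..<T} --> ipl (%x. g x ta) (%x. V x ta) <= R ta"
    show "chf {0<..t1} ta * DD ta - R ta <= chf {0<..t1} ta * ?al ta"
    proof (cases "ta : {0<..t1}")
     case True
     then have "ipl (%x. g x ta) (%x. V x ta) <= R ta" using i t1T by simp
     then show ?thesis using True DDA[of ta] by simp
    qed (use R(2) in simp)
   qed
  qed
  also have "(LBINT ta. chf {0<..t1} ta * DD ta - R ta) = (LBINT ta. chf {0<..t1} ta * DD ta) - (LBINT t. R t)"
   using ind_i[OF DDi, of 0 t1] R(1) by (simp add: Bochner_Integration.integral_diff)
  finally have "(LBINT ta. chf {0<..t1} ta * DD ta) - (LBINT t. R t) <= (LBINT ta. chf {0<..t1} ta * ?al ta)" .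
  moreover have "0 <= (LBINT x. (V x t1)\<^sup>2 / 2)" by (intro integral_nonneg_AE AE_I2) simp
  moreover have "(LBINT x. (w x)\<^sup>2 / 2) = nsq w / 2" by (simp add: sqn_def)
  ultimately show ?thesis using e(2) unfolding M_def by linarith
 qed
 show "(LBINT t. Bf (%x. V x t) (%x. V x t)) <= nsq w / 2 + (LBINT t. R t)" unfolding M_def[symmetric]
 proof (rule field_le_epsilon)
  fix e :: real assume e: "e > 0"
  have "isCont (%t. LBINT ta. chf {0<..t} ta * DD ta) T" by (rule isCont_indefinite_integral[OF DDi])
  then obtain r where r: "r > 0" "\<forall>t. dist t T < r --> dist (LBINT ta. chf {0<..t} ta * DD ta) (LBINT ta. chf {0<..T} ta * DD ta) < e"
   unfolding continuous_at_eps_delta using e by blast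
  obtain t1 where t1: "t1 : G" "max 0 (T - r) < t1" "t1 < T" using AE_real_ex_between[OF d(6), of "max 0 (T - r)" T] T r(1) by auto
  have "(LBINT ta. chf {0<..T} ta * DD ta) - (LBINT ta. chf {0<..t1} ta * DD ta) <= e" using r(2)[rule_format, of t1] t1 by (simp add: dist_real_def)
  moreover have "(LBINT ta. chf {0<..T} ta * DD ta) = (LBINT t. DD t)"
  proof (rule Bochner_Integration.integral_cong[OF refl])
   fix t
   have "DD t = 0" if "t \<notin> {0<..T}"
   proof -
    have "t \<notin> G" using d(5) that by auto
    then have z: "(%x. V x t) = (%x. 0)" using d(7) by (simp add: fun_eq_iff)
    show ?thesis unfolding DD_def z Bf_eq[OF H0_zero[of Om] H0_zero[of Om]] by (simp add: gip_def ip_def)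
   qed
   then show "chf {0<..T} t * DD t = DD t" by (cases "t : {0<..T}") auto
  qed
  ultimately show "(LBINT t. Bf (%x. V x t) (%x. V x t)) <= M + e" using en[OF t1(1)] by (simp add: DD_def)
 qed
qed

end

section \<open>Passage to the limit\<close>

lemma Lnorm_infinity_le:
 fixes W :: "'a => real"
 assumes W: "W : borel_measurable M" and le: "AE x in M. \<bar>W x\<bar> <= c"
 shows "Lnorm \<infinity> M W <= ennreal c" unfolding Lnorm_def if_P[OF refl]
proof (rule esssup_I)
 show "(%x. ennreal (norm (W x))) : borel_measurable M" using W by simp
 show "AE x in M. ennreal (norm (W x)) <= ennreal c" using le by eventually_elim (simp add: ennreal_leI)
qed

lemma trunc_nonneg_eq: "0 <= y ==> 0 <= k ==> trunc k y = min k y"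
 by (simp add: trunc_def)

context frac begin

text \<open>Fatou's lemma in time makes the lower limit of the energies finite at almost every t. A
  subsequence depending on t then has bounded energy, and \<open>H0_weak_closed\<close> applies to
  that slice; weak limits in space-time are avoided.\<close>

lemma liminf_energy:
 fixes V :: "nat => (real^'n) => real => real"
 assumes V: "!!j. tmeas (V j)" "!!j t. \<exists>a. H0 Om (%x. V j x t) a"
  and v: "tmeas v" "!!x t. x \<notin> Om ==> v x t = 0" "!!t. L2l (%x. v x t)"
  and lim: "AE t in lborel. (%j. nsq (%x. V j x t - v x t)) \<longlonglongrightarrow> 0"
  and bd: "!!j. integrable lborel (%t. Bf (%x. V j x t) (%x. V j x t))"
   "!!j. (LBINT t. Bf (%x. V j x t) (%x. V j x t)) <= K"
 shows "AE t in lborel. \<exists>b. H0 Om (%x. v x t) b" and "integrable lborel (%t. Bf (%x. v x t) (%x. v x t))"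
proof -
 obtain a where a: "!!j t. H0 Om (%x. V j x t) (a j t)" using V(2) by metis
 define X where "X = (%j t. ennreal (Bf (%x. V j x t) (%x. V j x t)))"
 define L where "L = (%t. liminf (%j. X j t))"
 have Xm: "X j : borel_measurable lborel" for j unfolding X_def using tmeas_Bf[OF V(1) V(1), of j j] by simp
 have Lm: "L : borel_measurable lborel" unfolding L_def using Xm by (intro borel_measurable_liminf)
 have "(\<integral>\<^sup>+t. L t \<partial>lborel) <= liminf (%j. \<integral>\<^sup>+t. X j t \<partial>lborel)"
  unfolding L_def by (rule nn_integral_liminf[OF Xm])
 also have "\<dots> <= liminf (%j::nat. ennreal K)"
 proof (rule Liminf_mono, rule always_eventually, rule allI)
  fix j
  have "(\<integral>\<^sup>+t. X j t \<partial>lborel) = ennreal (LBINT t. Bf (%x. V j x t) (%x. V j x t))"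
   unfolding X_def by (rule nn_integral_eq_integral[OF bd(1)]) (intro AE_I2 Bf_nonneg[OF a])
  then show "(\<integral>\<^sup>+t. X j t \<partial>lborel) <= ennreal K" using bd(2)[of j] by (simp add: ennreal_leI)
 qed
 also have "\<dots> = ennreal K" by (simp add: Liminf_const)
 finally have LK: "(\<integral>\<^sup>+t. L t \<partial>lborel) <= ennreal K" .
 have "(\<integral>\<^sup>+t. L t \<partial>lborel) ~= \<infinity>" using le_less_trans[OF LK ennreal_less_top] by simp
 then have Lfin: "AE t in lborel. L t ~= \<infinity>" by (rule nn_integral_PInf_AE[OF Lm])
 have key: "\<exists>b. H0 Om (%x. v x t) b & gip b b <= M"
  if lim: "(%j. nsq (%x. V j x t - v x t)) \<longlonglongrightarrow> 0" and M: "L t < ennreal M" for t M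
 proof -
  have "\<not> eventually (%j. ennreal M <= X j t) sequentially"
  proof
   assume "eventually (%j. ennreal M <= X j t) sequentially"
   then have "ennreal M <= L t" unfolding L_def by (rule Liminf_bounded)
   with M show False by simp
  qed
  then have "\<forall>N. \<exists>j\<ge>N. X j t < ennreal M" unfolding eventually_sequentially by (auto simp: not_le)
  then obtain r where r: "!!N. r N >= N" "!!N. X (r N) t < ennreal M" by metis
  have "filterlim r sequentially sequentially" by (rule filterlim_at_top_mono[OF filterlim_ident]) (simp add: r(1))
  then have lr: "(%N. nsq (%x. V (r N) x t - v x t)) \<longlonglongrightarrow> 0" by (rule filterlim_compose[OF lim])
  have "gip (a (r N) t) (a (r N) t) <= M" for N
  proof -
   have "gip (a (r N) t) (a (r N) t) = Bf (%x. V (r N) x t) (%x. V (r N) x t)" by (rule Bf_eq[OF a a, symmetric])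
   moreover have "Bf (%x. V (r N) x t) (%x. V (r N) x t) < M" using r(2)[of N] unfolding X_def by (simp add: ennreal_less_iff Bf_nonneg[OF a])
   ultimately show ?thesis by simp
  qed
  from H0_weak_closed[OF Om_borel a lr v(3) v(2) this] show ?thesis by blast
 qed
 show "AE t in lborel. \<exists>b. H0 Om (%x. v x t) b" using lim Lfin
 proof eventually_elim
  fix t assume l: "(%j. nsq (%x. V j x t - v x t)) \<longlonglongrightarrow> 0" and f: "L t ~= \<infinity>"
  then obtain y where y: "L t = ennreal y" "0 <= y" by (cases "L t") auto
  have "L t < ennreal (y + 1)" unfolding y(1) using y(2) by (simp add: ennreal_less_iff del: ennreal_plus)
  from key[OF l this] show "\<exists>b. H0 Om (%x. v x t) b" by blast
 qed
 have le: "AE t in lborel. 0 <= Bf (%x. v x t) (%x. v x t) & ennreal (Bf (%x. v x t) (%x. v x t)) <= L t" using lim Lfin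
 proof eventually_elim
  fix t assume l: "(%j. nsq (%x. V j x t - v x t)) \<longlonglongrightarrow> 0" and f: "L t ~= \<infinity>"
  then obtain y where y: "L t = ennreal y" "0 <= y" by (cases "L t") auto
  have k: "0 <= Bf (%x. v x t) (%x. v x t) & Bf (%x. v x t) (%x. v x t) <= y + e" if e: "e > 0" for e
  proof -
   have "L t < ennreal (y + e)" unfolding y(1) using y(2) e by (simp add: ennreal_less_iff del: ennreal_plus)
   from key[OF l this] obtain b where b: "H0 Om (%x. v x t) b" "gip b b <= y + e" by blast
   show ?thesis using Bf_nonneg[OF b(1)] b(2) unfolding Bf_eq[OF b(1) b(1)] by simp
  qed
  have "Bf (%x. v x t) (%x. v x t) <= y" by (rule field_le_epsilon) (use k in blast)
  then show "0 <= Bf (%x. v x t) (%x. v x t) & ennreal (Bf (%x. v x t) (%x. v x t)) <= L t" using k[of 1] unfolding y(1) by (simp add: ennreal_leI)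
 qed
 show "integrable lborel (%t. Bf (%x. v x t) (%x. v x t))"
 proof (rule integrableI_nonneg)
  show "(%t. Bf (%x. v x t) (%x. v x t)) : borel_measurable lborel" using tmeas_Bf[OF v(1) v(1)] by simp
  show "AE t in lborel. 0 <= Bf (%x. v x t) (%x. v x t)" using le by eventually_elim blast
  have "(\<integral>\<^sup>+t. ennreal (Bf (%x. v x t) (%x. v x t)) \<partial>lborel) <= (\<integral>\<^sup>+t. L t \<partial>lborel)"
   by (rule nn_integral_mono_AE) (use le in \<open>eventually_elim, blast\<close>)
  from le_less_trans[OF order_trans[OF this LK] ennreal_less_top]
  show "(\<integral>\<^sup>+t. ennreal (Bf (%x. v x t) (%x. v x t)) \<partial>lborel) < \<infinity>" by simp
 qed
qed

lemma L2H10_I: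
 assumes u: "(%(x, t). u x t) : borel_measurable (cylinder Om T)"
  and v: "tmeas v" "!!x t. t \<notin> {0<..<T} ==> v x t = 0"
  and uv: "AE t in lborel. t : {0<..<T} --> (AE x in lborel. x : Om --> u x t = v x t)"
  and H: "AE t in lborel. \<exists>b. H0 Om (%x. v x t) b" and Q: "integrable lborel (%t. Qf (%x. v x t))"
 shows "u : L2H10 Om T"
proof -
 let ?I = "{0<..<T}"
 let ?MI = "lebesgue_on ?I"
 have "AE t in lborel. t : ?I --> (%x. u x t) : H10 Om & H1_norm Om (%x. u x t) = sqrt (Qf (%x. v x t)) & 0 <= Qf (%x. v x t)" using uv H
 proof (eventually_elim, intro impI)
  fix t assume ae: "t : ?I --> (AE x in lborel. x : Om --> u x t = v x t)" and ex: "\<exists>b. H0 Om (%x. v x t) b" and t: "t : ?I"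
  obtain b where b: "H0 Om (%x. v x t) b" using ex by blast
  have ae': "AE x in lebesgue_on Om. u x t = v x t" unfolding AE_lebesgue_on_iff[OF Om_borel] using ae t by blast
  have vm: "(%x. v x t) : borel_measurable (lebesgue_on Om)" by (rule borel_measurable_lebesgue_on[OF tmeas_slice[OF v(1)]])
  have um: "(%x. u x t) : borel_measurable (lebesgue_on Om)" by (rule measurable_AE_lebesgue_on[OF _ vm ae']) (use Om_borel in simp)
  have r: "rep Om (%x. u x t) (%x. v x t)" unfolding rep_def using um ae' by blast
  show "(%x. u x t) : H10 Om & H1_norm Om (%x. u x t) = sqrt (Qf (%x. v x t)) & 0 <= Qf (%x. v x t)"
   using H0_imp_H10(1,3)[OF op b r] Qf_nonneg[OF b] by (simp add: Qf_def Bf_eq[OF b b])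
 qed
 then have ae: "AE t in ?MI. (%x. u x t) : H10 Om & H1_norm Om (%x. u x t) = sqrt (Qf (%x. v x t)) & 0 <= Qf (%x. v x t)" by (subst AE_lebesgue_on_iff) simp_all
 have Qm: "(%t. Qf (%x. v x t)) : bmb" by (rule tmeas_Qf[OF v(1)])
 have sm: "(%t. sqrt (Qf (%x. v x t))) : borel_measurable ?MI" by (rule borel_measurable_lebesgue_on) (use Qm in simp)
 have ae1: "AE t in ?MI. H1_norm Om (%x. u x t) = sqrt (Qf (%x. v x t))" using ae by eventually_elim blast
 have nm: "(%t. H1_norm Om (%x. u x t)) : borel_measurable ?MI" by (rule measurable_AE_lebesgue_on[OF _ sm ae1]) simp
 have nm2: "(%t. (H1_norm Om (%x. u x t))\<^sup>2) : borel_measurable ?MI" using nm by simp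
 have ae2: "AE t in ?MI. (H1_norm Om (%x. u x t))\<^sup>2 = Qf (%x. v x t)" using ae by eventually_elim simp
 have z: "Qf (%x. v x t) = 0" if "t \<notin> ?I" for t
 proof -
  have e: "(%x. v x t) = (%x. 0)" using v(2)[OF that] by (simp add: fun_eq_iff)
  show ?thesis unfolding e Qf_def Bf_eq[OF H0_zero[of Om] H0_zero[of Om]] by (simp add: gip_def ip_def sqn_def)
 qed
 have "integrable ?MI (%t. (H1_norm Om (%x. u x t))\<^sup>2)" using lebesgue_on_clean(2)[OF _ Qm z nm2 ae2] Q by simp
 then have "L2 ?MI (%t. H1_norm Om (%x. u x t))" using nm by (simp add: L2_def)
 moreover have "AE t in ?MI. (%x. u x t) : H10 Om" using ae by eventually_elim blast
 ultimately show ?thesis unfolding L2H10_def Lspace_time_def Lspace_2_real_iff using u by simp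
qed

end

text \<open>The three uses of the singular source. Above level 1 the denominator is at least 1, for
  the uniform bound. Multiplied by the solution and for \<open>\<gamma> <= 1\<close>, only the power
  1 - \<gamma> of a bounded quantity remains, for the gradient bound. The quotient decreases in the
  solution and increases with the index, for the comparison.\<close>

lemma singular_quotient_bounds:
 fixes F V c \<gamma> k :: real
 assumes F: "0 <= F" and V: "0 <= V" and k: "1 <= k" and \<gamma>: "0 < \<gamma>"
 shows "1 < V ==> min k F / (V + 1 / k) powr \<gamma> <= F"
  and "V <= c ==> \<gamma> <= 1 ==> min k F / (V + 1 / k) powr \<gamma> * V <= (c + 1) * F"
  and "0 <= V' ==> V' < V ==> k <= k' ==> min k F / (V + 1 / k) powr \<gamma> <= min k' F / (V' + 1 / k') powr \<gamma>"
proof -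
 have p: "0 < V + 1 / k" using V k by (simp add: add_nonneg_pos)
 have m: "0 <= min k F" "min k F <= F" using F k by auto
 show "min k F / (V + 1 / k) powr \<gamma> <= F" if "1 < V"
 proof -
  have "1 <= V + 1 / k" using that k by (simp add: add_increasing2)
  then have "1 <= (V + 1 / k) powr \<gamma>" using \<gamma> by (intro ge_one_powr_ge_zero) auto
  then have "min k F / (V + 1 / k) powr \<gamma> <= min k F / 1" using m(1) by (intro divide_left_mono) auto
  then show ?thesis using m(2) by simp
 qed
 show "min k F / (V + 1 / k) powr \<gamma> * V <= (c + 1) * F" if c: "V <= c" and g1: "\<gamma> <= 1"
 proof -
  let ?a = "V + 1 / k"
  have "1 / k <= 1" using k by simp
  then have a: "?a <= c + 1" using c by linarith
  have c1: "1 <= c + 1" using V c by simp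
  have "?a = ?a powr \<gamma> * ?a powr (1 - \<gamma>)" using p by (simp flip: powr_add)
  then have "?a / ?a powr \<gamma> = ?a powr (1 - \<gamma>)" using p by (metis less_irrefl nonzero_mult_div_cancel_left powr_eq_0_iff)
  moreover have "?a powr (1 - \<gamma>) <= (c + 1) powr (1 - \<gamma>)" using p a g1 by (intro powr_mono2) auto
  moreover have "(c + 1) powr (1 - \<gamma>) <= (c + 1) powr 1" using c1 \<gamma> by (intro powr_mono) auto
  moreover have "V / ?a powr \<gamma> <= ?a / ?a powr \<gamma>" using k by (intro divide_right_mono) auto
  ultimately have q: "V / ?a powr \<gamma> <= c + 1" using c1 by simp
  have "min k F / ?a powr \<gamma> * V = min k F * (V / ?a powr \<gamma>)" by simp
  also have "\<dots> <= F * (c + 1)" using m q V F by (intro mult_mono) auto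
  finally show ?thesis by (simp add: mult.commute)
 qed
 show "min k F / (V + 1 / k) powr \<gamma> <= min k' F / (V' + 1 / k') powr \<gamma>"
  if "0 <= V'" "V' < V" "k <= k'"
 proof -
  have "1 / k' <= 1 / k" using that k by (intro divide_left_mono) auto
  then have l: "V' + 1 / k' <= V + 1 / k" using that by linarith
  have p': "0 < V' + 1 / k'" using that k by (simp add: add_nonneg_pos)
  have "(V' + 1 / k') powr \<gamma> <= (V + 1 / k) powr \<gamma>" using l p' \<gamma> by (intro powr_mono2) auto
  then show ?thesis using that m p' k F by (intro frac_le) auto
 qed
qed



section \<open>The approximating sequence and its limit\<close>

theorem theorem2p35:
  fixes \<Omega> :: "(real ^ 'n) set" and s T \<gamma> :: real and r q :: ennreal
    and f :: "(real ^ 'n) \<Rightarrow> real \<Rightarrow> real" and u0 :: "(real ^ 'n) \<Rightarrow> real"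
    and U :: "nat \<Rightarrow> (real ^ 'n) \<Rightarrow> real \<Rightarrow> real"
  assumes "CARD('n) > 2"
    and "bounded_lipschitz_domain \<Omega>"
    and "0 < s" "s < 1" "0 < T" "0 < \<gamma>"
    and "f \<in> LrLq r q \<Omega> T"
    and "AE (x, t) in cylinder \<Omega> T. 0 \<le> f x t"
    and "1 / r + of_nat CARD('n) / (2 * q) < 1"
    and "u0 \<in> Lspace \<infinity> (lebesgue_on \<Omega>)"
    and "AE x in lebesgue_on \<Omega>. 0 \<le> u0 x"
    and "\<And>k. k \<ge> 1 \<Longrightarrow>
           energy_solution \<Omega> T s
             (\<lambda>x t. trunc (real k) (f x t) / (U k x t + 1 / real k) powr \<gamma>)
             (\<lambda>x. trunc (real k) (u0 x)) (U k)"
    and "\<And>k. k \<ge> 1 \<Longrightarrow> AE (x, t) in cylinder \<Omega> T. 0 \<le> U k x t"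
  shows "(\<exists>c>0. \<forall>k\<ge>1. Lnorm \<infinity> (cylinder \<Omega> T) (\<lambda>(x, t). U k x t) \<le> ennreal c) \<and>
         (\<exists>u. AE (x, t) in cylinder \<Omega> T. (\<lambda>k. U k x t) \<longlonglongrightarrow> u x t) \<and>
         (\<forall>u. (AE (x, t) in cylinder \<Omega> T. (\<lambda>k. U k x t) \<longlonglongrightarrow> u x t) \<longrightarrow>
            (\<lambda>(x, t). u x t) \<in> Lspace \<infinity> (cylinder \<Omega> T) \<and>
            (\<gamma> \<le> 1 \<longrightarrow> u \<in> L2H10 \<Omega> T))"
proof -
 interpret frac \<Omega> s by unfold_locales (use assms(1-4) in \<open>auto simp: bounded_lipschitz_domain_def\<close>)
 note T = assms(5) and \<gamma> = assms(6) and es = assms(12)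
 let ?I = "{0<..<T}"
 \<comment> \<open>Index shift: equations are available for k >= 1, so j stands for k = j +
   1.\<close>
 let ?K = "%j. real (Suc j)"
 let ?th = "1 - 2 / real CARD('n)"
 have C: "\<Omega> \<times> ?I : sets borel" unfolding borel_prod[symmetric] using Om_borel by auto
 then have Cl: "\<Omega> \<times> ?I : sets lebesgue" by simp
 obtain F H dl sg C1 where dt: "datum T F H dl sg C1"
  and fF: "AE t in lborel. t : ?I --> (AE x in lborel. x : \<Omega> --> f x t = F x t)" using data_bound[OF assms(7-9)] by blast
 have F0: "0 <= F x t" for x t using dt by (simp add: datum_def)
 define K where "K = enn2real (Lnorm \<infinity> (lebesgue_on \<Omega>) u0)"
 \<comment> \<open>Above the initial data, and at least 1 so that the recursion starts where the
   source is dominated by the datum.\<close>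
 define K0 where "K0 = max 1 K"
 have K0: "1 <= K0" by (simp add: K0_def)
 obtain c where c: "c >= 1" and cb: "!!g w V G t. wsol T g w V G ==> (AE x in lborel. w x <= K0) ==>
  (AE t in lborel. t : ?I --> (AE x in lborel. 1 < V x t --> g x t <= F x t)) ==> t : G ==> AE x in lborel. V x t <= c"
  using uniform_sup_bound[OF dt T K0] by blast
 define P where "P = (%j V h w G. wsol T h w V G & rep \<Omega> (%x. trunc (?K j) (u0 x)) w &
  (\<forall>t\<in>G. rep \<Omega> (%x. U (Suc j) x t) (%x. V x t)) &
  (\<forall>t\<in>G. AE x in lborel. x : \<Omega> --> trunc (?K j) (f x t) / (U (Suc j) x t + 1 / ?K j) powr \<gamma> = h x t))"
 have "\<exists>V h w G. P j V h w G" for j unfolding P_def using energy_solution_wsol[OF T es[of "Suc j"]] by simp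
 then obtain V h w G where PV: "!!j. P j (V j) (h j) (w j) (G j)" by metis
 have ws: "wsol T (h j) (w j) (V j) (G j)" for j using PV[of j] by (simp add: P_def)
 note d = wsolD[OF ws]
 \<comment> \<open>The pointwise content of a good slice: the sign of the solution, and the source
   with \<open>trunc\<close> reduced to a minimum and f replaced by its Borel version.\<close>
 let ?S = "%j x t. 0 <= V j x t & (x : \<Omega> --> h j x t = min (?K j) (F x t) / (V j x t + 1 / ?K j) powr \<gamma>)"
 have wrep: "rep \<Omega> (%x. trunc (?K j) (u0 x)) (w j)" for j using PV[of j] by (simp add: P_def)
 have Vrep: "rep \<Omega> (%x. U (Suc j) x t) (%x. V j x t)" if "t : G j" for j t using PV[of j] that by (simp add: P_def)
 have hU: "AE x in lborel. x : \<Omega> --> trunc (?K j) (f x t) / (U (Suc j) x t + 1 / ?K j) powr \<gamma> = h j x t" if "t : G j" for j t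
  using PV[of j] that by (simp add: P_def)
 have Vz: "V j x t = 0" if "x \<notin> \<Omega>" for j x t
 proof -
  obtain a where "H0 \<Omega> (%x. V j x t) a" using d(9)[of j t] by blast
  from H0_outside[OF this that] show ?thesis .
 qed
 have VzI: "V j x t = 0" if "t \<notin> ?I" for j x t
 proof -
  have "t \<notin> G j" using d(5)[of j] that by blast
  then show ?thesis by (rule d(7))
 qed
 have hz: "h j x t = 0" if "x \<notin> \<Omega>" for j x t by (rule clean_outside[OF d(10) that])
 have wz: "w j x = 0" if "x \<notin> \<Omega>" for j x by (rule clean_outside[OF d(3) that])
 have wt: "AE x in lborel. x : \<Omega> --> w j x = min (?K j) (u0 x) & 0 <= u0 x & u0 x <= K" for j
 proof -
  have "AE x in lebesgue_on \<Omega>. w j x = min (?K j) (u0 x) & 0 <= u0 x & u0 x <= K" using rep_AE[OF wrep[of j]] assms(11) Lspace_infinity_AE[OF assms(10)]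
  proof eventually_elim
   fix x assume x: "trunc (?K j) (u0 x) = w j x" "0 <= u0 x" "\<bar>u0 x\<bar> <= enn2real (Lnorm \<infinity> (lebesgue_on \<Omega>) u0)"
   have "0 <= ?K j" by simp
   from trunc_nonneg_eq[OF x(2) this] show "w j x = min (?K j) (u0 x) & 0 <= u0 x & u0 x <= K" using x by (simp add: K_def)
  qed
  then show ?thesis unfolding AE_lebesgue_on_iff[OF Om_borel] .
 qed
 have w0: "AE x in lborel. 0 <= w j x & w j x <= K0" for j using wt[of j]
 proof eventually_elim
  fix x assume "x : \<Omega> --> w j x = min (?K j) (u0 x) & 0 <= u0 x & u0 x <= K"
  then show "0 <= w j x & w j x <= K0" using wz[of x j] by (cases "x : \<Omega>") (auto simp: K0_def)
 qed
 have wmono: "AE x in lborel. w j x <= w (Suc j) x" for j using wt[of j] wt[of "Suc j"]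
 proof eventually_elim
  fix x assume "x : \<Omega> --> w j x = min (?K j) (u0 x) & 0 <= u0 x & u0 x <= K"
   "x : \<Omega> --> w (Suc j) x = min (?K (Suc j)) (u0 x) & 0 <= u0 x & u0 x <= K"
  then show "w j x <= w (Suc j) x" using wz[of x j] wz[of x "Suc j"] by (cases "x : \<Omega>") auto
 qed
 have U0: "AE t in lborel. t : ?I --> (AE x in lborel. x : \<Omega> --> 0 <= U (Suc j) x t)" for j
 proof -
  have "AE z in cylinder \<Omega> T. (%(x, t). 0 <= U (Suc j) x t) z" using assms(13)[of "Suc j"] by simp
  from AE_lborel_prod_cylinder[OF Om_borel this] show ?thesis
  proof (eventually_elim, intro impI)
   fix t assume A: "AE x in lborel. x : \<Omega> --> t : ?I --> (case (x, t) of (x, t) => 0 <= U (Suc j) x t)" and t: "t : ?I"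
   from A show "AE x in lborel. x : \<Omega> --> 0 <= U (Suc j) x t" by eventually_elim (use t in simp)
  qed
 qed
 have UV: "AE x in lborel. x : \<Omega> --> U (Suc j) x t = V j x t" if "t : G j" for j t
  using rep_AE[OF Vrep[OF that]] unfolding AE_lebesgue_on_iff[OF Om_borel] .
 have slice: "AE t in lborel. t : ?I --> t : G j & (AE x in lborel. ?S j x t)" for j using d(6)[of j] fF U0[of j]
 proof (eventually_elim, intro impI)
  fix t assume A: "t : ?I --> t : G j" "t : ?I --> (AE x in lborel. x : \<Omega> --> f x t = F x t)"
   "t : ?I --> (AE x in lborel. x : \<Omega> --> 0 <= U (Suc j) x t)" and t: "t : ?I"
  have tG: "t : G j" using A(1) t by blast
  have fFt: "AE x in lborel. x : \<Omega> --> f x t = F x t" and U0t: "AE x in lborel. x : \<Omega> --> 0 <= U (Suc j) x t" using A(2,3) t by blast+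
  have "AE x in lborel. ?S j x t" using fFt U0t UV[OF tG] hU[OF tG]
  proof eventually_elim
   fix x assume x: "x : \<Omega> --> f x t = F x t" "x : \<Omega> --> 0 <= U (Suc j) x t" "x : \<Omega> --> U (Suc j) x t = V j x t"
    "x : \<Omega> --> trunc (?K j) (f x t) / (U (Suc j) x t + 1 / ?K j) powr \<gamma> = h j x t"
   show "?S j x t"
   proof (cases "x : \<Omega>")
    case True
    have "trunc (?K j) (F x t) = min (?K j) (F x t)" by (rule trunc_nonneg_eq[OF F0]) simp
    with x True show ?thesis by metis
   qed (simp add: Vz)
  qed
  with tG show "t : G j & (AE x in lborel. ?S j x t)" ..
 qed
 have K1: "1 <= ?K j" for j by simp
 have gF: "AE t in lborel. t : ?I --> (AE x in lborel. 1 < V j x t --> h j x t <= F x t)" for j using slice[of j]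
 proof (eventually_elim, intro impI)
  fix t assume A: "t : ?I --> t : G j & (AE x in lborel. ?S j x t)" and t: "t : ?I"
  have "AE x in lborel. ?S j x t" using A t by blast
  then show "AE x in lborel. 1 < V j x t --> h j x t <= F x t"
  proof (eventually_elim, intro impI)
   fix x assume x: "?S j x t" and V1: "1 < V j x t"
   have "x : \<Omega>" using V1 Vz[of x j t] by force
   have "min (?K j) (F x t) / (V j x t + 1 / ?K j) powr \<gamma> <= F x t" by (rule singular_quotient_bounds(1)[OF F0 _ K1 \<gamma> V1]) (use x in blast)
   then show "h j x t <= F x t" using x \<open>x : \<Omega>\<close> by simp
  qed
 qed
 have Vc: "AE x in lborel. V j x t <= c" if "t : G j" for j t by (rule cb[OF ws _ gF that]) (use w0[of j] in \<open>eventually_elim, simp\<close>)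
 \<comment> \<open>Monotonicity in k comes from the sign of the source difference: the singular
   source decreases in the solution and increases with k.\<close>
 have Vmono: "AE x in lborel. V j x t <= V (Suc j) x t" if t1: "t : G j" "t : G (Suc j)" for j t
 proof (rule comparison[OF ws ws wmono _ t1])
  show "AE t in lborel. t : ?I --> (AE x in lborel. V (Suc j) x t < V j x t --> h j x t <= h (Suc j) x t)" using slice[of j] slice[of "Suc j"]
  proof (eventually_elim, intro impI)
   fix t assume A: "t : ?I --> t : G j & (AE x in lborel. ?S j x t)"
    and A': "t : ?I --> t : G (Suc j) & (AE x in lborel. ?S (Suc j) x t)" and t: "t : ?I"
   have 1: "AE x in lborel. ?S j x t" using A t by blast
   have 2: "AE x in lborel. ?S (Suc j) x t" using A' t by blast
   from 1 2 show "AE x in lborel. V (Suc j) x t < V j x t --> h j x t <= h (Suc j) x t"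
   proof (eventually_elim, intro impI)
    fix x assume x: "?S j x t"
     and x': "?S (Suc j) x t"
     and l: "V (Suc j) x t < V j x t"
    have xO: "x : \<Omega>" using l Vz[of x j t] Vz[of x "Suc j" t] by force
    have "?K j <= ?K (Suc j)" by simp
    from singular_quotient_bounds(3)[OF F0 _ K1 \<gamma> _ l this, of x t]
    show "h j x t <= h (Suc j) x t" using x x' xO by simp
   qed
  qed
 qed
 have Vb: "(%z. V j (fst z) (snd z)) : bmb" for j using d(1)[of j] by (simp add: tmeas_def)
 have Um: "(%(x, t). U (Suc j) x t) : borel_measurable (cylinder \<Omega> T)" for j
  using es[of "Suc j"] by (simp add: energy_solution_def L2H10_def Lspace_time_def)
 \<comment> \<open>Equality on almost every slice is lifted to the cylinder; this requires a jointly
   Borel version of \<open>U\<close>, supplied by \<open>b\<close>.\<close>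
 have cylU: "AE z in cylinder \<Omega> T. (%(x, t). U (Suc j) x t) z = V j (fst z) (snd z)" for j
 proof -
  obtain b where b: "b : bmb" "AE z in cylinder \<Omega> T. (%(x, t). U (Suc j) x t) z = b z" using lebesgue_on_borel_version[OF C Um[of j]] by blast
  have "AE z in cylinder \<Omega> T. b z = V j (fst z) (snd z)"
  proof (rule AE_cylinder_of_slices[OF Om_borel])
   show "{z. b z = V j (fst z) (snd z)} : sets borel" using borel_measurable_eq[OF b(1) Vb[of j]] by simp
   show "AE t in lborel. t : ?I --> (AE x in lborel. x : \<Omega> --> b (x, t) = V j (fst (x, t)) (snd (x, t)))"
    using AE_lborel_prod_cylinder[OF Om_borel b(2)] d(6)[of j]
   proof (eventually_elim, intro impI)
    fix t assume A: "AE x in lborel. x : \<Omega> --> t : ?I --> (%(x, t). U (Suc j) x t) (x, t) = b (x, t)"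
     and tG: "t : ?I --> t : G j" and t: "t : ?I"
    have "t : G j" using tG t by blast
    from A UV[OF this] show "AE x in lborel. x : \<Omega> --> b (x, t) = V j (fst (x, t)) (snd (x, t))" by eventually_elim (use t in auto)
   qed
  qed
  with b(2) show ?thesis by eventually_elim simp
 qed
 have cylV: "AE z in cylinder \<Omega> T. 0 <= V j (fst z) (snd z) & V j (fst z) (snd z) <= c & V j (fst z) (snd z) <= V (Suc j) (fst z) (snd z)" for j
 proof (rule AE_cylinder_of_slices[OF Om_borel])
  have "{z. 0 <= V j (fst z) (snd z)} : sets borel" "{z. V j (fst z) (snd z) <= c} : sets borel"
   "{z. V j (fst z) (snd z) <= V (Suc j) (fst z) (snd z)} : sets borel"
   using borel_measurable_le[OF borel_measurable_const Vb[of j], of 0] borel_measurable_le[OF Vb[of j] borel_measurable_const, of c]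
    borel_measurable_le[OF Vb[of j] Vb[of "Suc j"]] by simp_all
  then have "{z. 0 <= V j (fst z) (snd z)} \<inter> {z. V j (fst z) (snd z) <= c} \<inter> {z. V j (fst z) (snd z) <= V (Suc j) (fst z) (snd z)} : sets borel"
   by (intro sets.Int)
  then show "{z. 0 <= V j (fst z) (snd z) & V j (fst z) (snd z) <= c & V j (fst z) (snd z) <= V (Suc j) (fst z) (snd z)} : sets borel"
   by (simp add: Int_def conj_assoc)
  show "AE t in lborel. t : ?I --> (AE x in lborel. x : \<Omega> --> 0 <= V j (fst (x, t)) (snd (x, t)) &
    V j (fst (x, t)) (snd (x, t)) <= c & V j (fst (x, t)) (snd (x, t)) <= V (Suc j) (fst (x, t)) (snd (x, t)))" using slice[of j] d(6)[of "Suc j"]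
  proof (eventually_elim, intro impI)
   fix t assume A: "t : ?I --> t : G j & (AE x in lborel. ?S j x t)"
    and A': "t : ?I --> t : G (Suc j)" and t: "t : ?I"
   have tG: "t : G j" "t : G (Suc j)" using A A' t by blast+
   have "AE x in lborel. ?S j x t" using A t by blast
   then show "AE x in lborel. x : \<Omega> --> 0 <= V j (fst (x, t)) (snd (x, t)) &
    V j (fst (x, t)) (snd (x, t)) <= c & V j (fst (x, t)) (snd (x, t)) <= V (Suc j) (fst (x, t)) (snd (x, t))"
    using Vc[OF tG(1)] Vmono[OF tG] by eventually_elim simp
  qed
 qed
 have all: "AE z in cylinder \<Omega> T. \<forall>j. (%(x, t). U (Suc j) x t) z = V j (fst z) (snd z) &
   0 <= V j (fst z) (snd z) & V j (fst z) (snd z) <= c & V j (fst z) (snd z) <= V (Suc j) (fst z) (snd z)" unfolding AE_all_countable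
 proof
  fix j
  from cylU[of j] cylV[of j] show "AE z in cylinder \<Omega> T. (%(x, t). U (Suc j) x t) z = V j (fst z) (snd z) &
   0 <= V j (fst z) (snd z) & V j (fst z) (snd z) <= c & V j (fst z) (snd z) <= V (Suc j) (fst z) (snd z)" by eventually_elim blast
 qed
 have part1: "Lnorm \<infinity> (cylinder \<Omega> T) (%(x, t). U k x t) <= ennreal c" if k: "k >= 1" for k
 proof -
  obtain j where j: "k = Suc j" using k by (cases k) auto
  show ?thesis unfolding j
  proof (rule Lnorm_infinity_le[OF Um])
   show "AE z in cylinder \<Omega> T. \<bar>case z of (x, t) => U (Suc j) x t\<bar> <= c" using cylU[of j] cylV[of j] by eventually_elim simp
  qed
 qed
 define l where "l = (%z. lim (%j. V j (fst z) (snd z)))"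
 have lb: "l : bmb" unfolding l_def by (rule borel_measurable_lim_metric[OF Vb])
 have lim: "AE z in cylinder \<Omega> T. (%j. V j (fst z) (snd z)) \<longlonglongrightarrow> l z & (%k. U k (fst z) (snd z)) \<longlonglongrightarrow> l z & 0 <= l z & l z <= c"
  using all
 proof eventually_elim
  fix z assume A: "\<forall>j. (%(x, t). U (Suc j) x t) z = V j (fst z) (snd z) &
   0 <= V j (fst z) (snd z) & V j (fst z) (snd z) <= c & V j (fst z) (snd z) <= V (Suc j) (fst z) (snd z)"
  let ?v = "%j. V j (fst z) (snd z)"
  have "incseq ?v" using A by (intro incseq_SucI) blast
  moreover have "!!j. ?v j <= c" using A by blast
  ultimately obtain y where y: "?v \<longlonglongrightarrow> y" using incseq_convergent[of ?v c] by blast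
  have "l z = y" unfolding l_def by (rule limI[OF y])
  with y have vl: "?v \<longlonglongrightarrow> l z" by simp
  have "(%j. U (Suc j) (fst z) (snd z)) = ?v" using A by (auto simp: fun_eq_iff case_prod_beta)
  with vl have "(%j. U (Suc j) (fst z) (snd z)) \<longlonglongrightarrow> l z" by simp
  then have ul: "(%k. U k (fst z) (snd z)) \<longlonglongrightarrow> l z" by (rule LIMSEQ_imp_Suc)
  have "0 <= l z" by (rule LIMSEQ_le_const[OF vl]) (use A in blast)
  moreover have "l z <= c" by (rule LIMSEQ_le_const2[OF vl]) (use A in blast)
  ultimately show "?v \<longlonglongrightarrow> l z & (%k. U k (fst z) (snd z)) \<longlonglongrightarrow> l z & 0 <= l z & l z <= c" using vl ul by blast
 qed
 have part2: "AE (x, t) in cylinder \<Omega> T. (%k. U k x t) \<longlonglongrightarrow> l (x, t)" using lim by eventually_elim (auto simp: case_prod_beta)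
 \<comment> \<open>Clipped to [0,c] and cut off outside the cylinder, so that bounds and
   measurability hold everywhere and not only a.e.\<close>
 define v where "v = (%x t. chf (\<Omega> \<times> ?I) (x, t) * max 0 (min c (l (x, t))))"
 have tv: "tmeas v" unfolding tmeas_def v_def prod.collapse using C lb by simp
 have vz: "v x t = 0" if "x \<notin> \<Omega>" for x t using that by (simp add: v_def)
 have vzI: "v x t = 0" if "t \<notin> ?I" for x t using that by (simp add: v_def)
 have v0: "0 <= v x t" "v x t <= c * chf \<Omega> x" for x t using c by (auto simp: v_def indicator_def)
 have iO: "integrable lborel (chf \<Omega>)" using Om_borel Om_fin by (intro integrable_real_indicator) auto
 have LO: "L2l (%x. b * chf \<Omega> x)" for b :: real
 proof -
  have "(%x. (b * chf \<Omega> x)\<^sup>2) = (%x. b\<^sup>2 * chf \<Omega> x)" by (auto simp: fun_eq_iff indicator_def)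
  then show ?thesis using iO Om_borel by (simp add: L2_def)
 qed
 have vb: "(%x. v x t) : borel_measurable lborel" for t using tmeas_slice[OF tv] by simp
 have vL: "L2l (%x. v x t)" for t
 proof (rule L2_bound[OF LO[of c] vb])
  show "AE x in lborel. \<bar>v x t\<bar> <= \<bar>c * chf \<Omega> x\<bar>"
  proof (rule AE_I2)
   fix x show "\<bar>v x t\<bar> <= \<bar>c * chf \<Omega> x\<bar>" using v0[of x t] by linarith
  qed
 qed
 have part3: "(%(x, t). u x t) : Lspace \<infinity> (cylinder \<Omega> T) & (\<gamma> <= 1 --> u : L2H10 \<Omega> T)"
  if uU: "AE (x, t) in cylinder \<Omega> T. (%k. U k x t) \<longlonglongrightarrow> u x t" for u
 proof -
  have ul: "AE z in cylinder \<Omega> T. (%(x, t). u x t) z = l z" using uU lim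
  proof eventually_elim
   fix z assume "case z of (x, t) => (%k. U k x t) \<longlonglongrightarrow> u x t"
    "(%j. V j (fst z) (snd z)) \<longlonglongrightarrow> l z & (%k. U k (fst z) (snd z)) \<longlonglongrightarrow> l z & 0 <= l z & l z <= c"
   then show "(%(x, t). u x t) z = l z" using LIMSEQ_unique by (auto simp: case_prod_beta)
  qed
  have um: "(%(x, t). u x t) : borel_measurable (cylinder \<Omega> T)" by (rule measurable_AE_lebesgue_on[OF Cl borel_measurable_lebesgue_on[OF lb] ul])
  have "AE z in cylinder \<Omega> T. \<bar>case z of (x, t) => u x t\<bar> <= c" using ul lim by eventually_elim simp
  from le_less_trans[OF Lnorm_infinity_le[OF um this] ennreal_less_top]
  have uL: "(%(x, t). u x t) : Lspace \<infinity> (cylinder \<Omega> T)" using um by (simp add: Lspace_def)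
  have "u : L2H10 \<Omega> T" if g1: "\<gamma> <= 1"
  proof -
   have "AE z in cylinder \<Omega> T. (%(x, t). u x t) z = l z & (%j. V j (fst z) (snd z)) \<longlonglongrightarrow> l z & 0 <= l z & l z <= c"
    using ul lim by eventually_elim blast
   from AE_lborel_prod_cylinder[OF Om_borel this]
   have st: "AE t in lborel. t : ?I --> (AE x in lborel. x : \<Omega> --> u x t = v x t & (%j. V j x t) \<longlonglongrightarrow> v x t)"
   proof (eventually_elim, intro impI)
    fix t assume A: "AE x in lborel. x : \<Omega> --> t : ?I --> (%(x, t). u x t) (x, t) = l (x, t) &
     (%j. V j (fst (x, t)) (snd (x, t))) \<longlonglongrightarrow> l (x, t) & 0 <= l (x, t) & l (x, t) <= c" and t: "t : ?I"
    from A show "AE x in lborel. x : \<Omega> --> u x t = v x t & (%j. V j x t) \<longlonglongrightarrow> v x t"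
    proof (eventually_elim, intro impI)
     fix x assume B: "x : \<Omega> --> t : ?I --> (%(x, t). u x t) (x, t) = l (x, t) &
      (%j. V j (fst (x, t)) (snd (x, t))) \<longlonglongrightarrow> l (x, t) & 0 <= l (x, t) & l (x, t) <= c" and x: "x : \<Omega>"
     have B': "u x t = l (x, t)" "(%j. V j x t) \<longlonglongrightarrow> l (x, t)" "0 <= l (x, t)" "l (x, t) <= c" using B x t by simp_all
     have "v x t = l (x, t)" using B'(3,4) x t by (simp add: v_def)
     then show "u x t = v x t & (%j. V j x t) \<longlonglongrightarrow> v x t" using B' by simp
    qed
   qed
   have sl: "AE t in lborel. t : ?I --> (\<forall>j. t : G j & (AE x in lborel. ?S j x t))"
   proof -
    have "AE t in lborel. \<forall>j. t : ?I --> t : G j & (AE x in lborel. ?S j x t)" unfolding AE_all_countable using slice by blast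
    then show ?thesis by eventually_elim blast
   qed
   \<comment> \<open>On a fixed slice the differences are dominated by c on the bounded domain,
     which turns pointwise into L2 convergence.\<close>
   have conv: "AE t in lborel. (%j. nsq (%x. V j x t - v x t)) \<longlonglongrightarrow> 0" using st sl
   proof eventually_elim
    fix t assume A: "t : ?I --> (AE x in lborel. x : \<Omega> --> u x t = v x t & (%j. V j x t) \<longlonglongrightarrow> v x t)"
     and B: "t : ?I --> (\<forall>j. t : G j & (AE x in lborel. ?S j x t))"
    show "(%j. nsq (%x. V j x t - v x t)) \<longlonglongrightarrow> 0"
    proof (cases "t : ?I")
     case True
     show ?thesis
     proof (rule sqn_dominated_tendsto[OF _ _ LO[of c]])
      show "(%x. V j x t - v x t) : borel_measurable lborel" for j using tmeas_slice[OF d(1)[of j], of t] vb[of t] by simp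
      have "AE x in lborel. x : \<Omega> --> u x t = v x t & (%j. V j x t) \<longlonglongrightarrow> v x t" using A True by blast
      then show "AE x in lborel. (%j. V j x t - v x t) \<longlonglongrightarrow> 0"
      proof eventually_elim
       fix x assume x: "x : \<Omega> --> u x t = v x t & (%j. V j x t) \<longlonglongrightarrow> v x t"
       show "(%j. V j x t - v x t) \<longlonglongrightarrow> 0"
       proof (cases "x : \<Omega>")
        case True
        then have "(%j. V j x t) \<longlonglongrightarrow> v x t" using x by blast
        then show ?thesis by (rule LIM_zero)
       qed (simp add: Vz vz)
      qed
      show "AE x in lborel. \<bar>V j x t - v x t\<bar> <= \<bar>c * chf \<Omega> x\<bar>" for j
      proof -
       have tG: "t : G j" and V0: "AE x in lborel. ?S j x t" using B True by blast+
       from V0 Vc[OF tG] show ?thesis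
       proof eventually_elim
        fix x assume "?S j x t" "V j x t <= c"
        then show "\<bar>V j x t - v x t\<bar> <= \<bar>c * chf \<Omega> x\<bar>" using v0[of x t] Vz[of x j t] by (cases "x : \<Omega>") auto
       qed
      qed
     qed
    next
     case False
     then show ?thesis by (simp add: VzI vzI sqn_def)
    qed
   qed
   \<comment> \<open>Source times solution is at most \<open>(c + 1) * F\<close>, which is
     integrated over the whole domain by \<open>slice_bound\<close> with B = 1.\<close>
   define R where "R = (%t. chf {0..T} t * ((c + 1) * (measure lborel \<Omega> powr dl * (H t + C1 * measure lborel \<Omega> powr ?th))))"
   have Hi: "integrable lborel H" "!!t. 0 <= H t" "0 <= C1" using dt by (simp_all add: datum_def)
   have Ri: "integrable lborel R"
   proof -
    have "integrable lborel (chf {0..T})" by (rule integrable_real_indicator) (use T in auto)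
    moreover have "integrable lborel (%t. chf {0..T} t * H t)" using integrable_real_mult_indicator[OF _ Hi(1), of "{0..T}"] by (simp add: mult.commute)
    ultimately have "integrable lborel (%t. ((c + 1) * measure lborel \<Omega> powr dl) * (chf {0..T} t * H t)
      + ((c + 1) * measure lborel \<Omega> powr dl * (C1 * measure lborel \<Omega> powr ?th)) * chf {0..T} t)"
     by (intro Bochner_Integration.integrable_add integrable_mult_right)
    then show ?thesis by (simp add: R_def algebra_simps)
   qed
   have R0: "0 <= R t" for t unfolding R_def using c Hi by (intro mult_nonneg_nonneg add_nonneg_nonneg) auto
   have D: "AE t in lborel. t : ?I --> slice_bound F H dl sg C1 t" using dt by (simp add: datum_def)
   have hR: "AE t in lborel. t : ?I --> ipl (%x. h j x t) (%x. V j x t) <= R t" for j using D slice[of j]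
   proof (eventually_elim, intro impI)
    fix t assume D: "t : ?I --> slice_bound F H dl sg C1 t"
     and A: "t : ?I --> t : G j & (AE x in lborel. ?S j x t)" and t: "t : ?I"
    have D': "\<forall>A\<in>sets borel. A \<subseteq> \<Omega> --> (\<forall>B>0. (LBINT x. F x t * chf A x)
       <= measure lborel A powr dl * B powr sg * (H t + C1 * (measure lborel A powr ?th / B)))" using D t by blast
    have Fi: "integrable lborel (%x. F x t * chf \<Omega> x)" using D t Om_borel by blast
    have Fb: "(LBINT x. F x t * chf \<Omega> x) <= measure lborel \<Omega> powr dl * (H t + C1 * measure lborel \<Omega> powr ?th)"
     using D'[rule_format, OF Om_borel subset_refl zero_less_one] by simp
    have tG: "t : G j" and V0: "AE x in lborel. ?S j x t" using A t by blast+
    obtain a where a: "H0 \<Omega> (%x. V j x t) a" using d(9)[of j t] by blast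
    have "ipl (%x. h j x t) (%x. V j x t) <= (LBINT x. (c + 1) * (F x t * chf \<Omega> x))" unfolding ip_def
    proof (rule integral_mono_AE)
     show "integrable lborel (%x. h j x t * V j x t)" by (rule L2_integrable_mult[OF clean_L2[OF d(10)] H0_L2[OF a]])
     show "integrable lborel (%x. (c + 1) * (F x t * chf \<Omega> x))" using Fi by (rule integrable_mult_right)
     show "AE x in lborel. h j x t * V j x t <= (c + 1) * (F x t * chf \<Omega> x)" using V0 Vc[OF tG]
     proof eventually_elim
      fix x assume x: "?S j x t" "V j x t <= c"
      show "h j x t * V j x t <= (c + 1) * (F x t * chf \<Omega> x)"
      proof (cases "x : \<Omega>")
       case True
       have "min (?K j) (F x t) / (V j x t + 1 / ?K j) powr \<gamma> * V j x t <= (c + 1) * F x t"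
        using x by (intro singular_quotient_bounds(2)[OF F0 _ K1 \<gamma> _ g1]) auto
       then show ?thesis using x(1) True by simp
      qed (simp add: Vz)
     qed
    qed
    also have "\<dots> = (c + 1) * (LBINT x. F x t * chf \<Omega> x)" by simp
    also have "\<dots> <= (c + 1) * (measure lborel \<Omega> powr dl * (H t + C1 * measure lborel \<Omega> powr ?th))" using c by (intro mult_left_mono Fb) auto
    also have "\<dots> = R t" using t by (simp add: R_def)
    finally show "ipl (%x. h j x t) (%x. V j x t) <= R t" .
   qed
   have wsq: "nsq (w j) <= K0\<^sup>2 * measure lborel \<Omega>" for j
   proof -
    have "nsq (w j) <= (LBINT x. K0\<^sup>2 * chf \<Omega> x)" unfolding sqn_def
    proof (rule integral_mono_AE)
     show "integrable lborel (%x. (w j x)\<^sup>2)" by (rule L2_integrable_sq[OF clean_L2[OF d(3)]])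
     show "integrable lborel (%x. K0\<^sup>2 * chf \<Omega> x)" using iO by (rule integrable_mult_right)
     show "AE x in lborel. (w j x)\<^sup>2 <= K0\<^sup>2 * chf \<Omega> x" using w0[of j]
     proof eventually_elim
      fix x assume x: "0 <= w j x & w j x <= K0"
      show "(w j x)\<^sup>2 <= K0\<^sup>2 * chf \<Omega> x" using x wz[of x j] by (cases "x : \<Omega>") (auto intro: power_mono)
     qed
    qed
    also have "\<dots> = K0\<^sup>2 * measure lborel \<Omega>" using Om_borel Om_fin by simp
    finally show ?thesis .
   qed
   note gb = gradient_bound[OF ws T Ri R0 hR]
   have gbK: "(LBINT t. Bf (%x. V j x t) (%x. V j x t)) <= K0\<^sup>2 * measure lborel \<Omega> / 2 + (LBINT t. R t)" for j
    using gb(1)[of j] wsq[of j] by linarith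
   note le = liminf_energy[OF d(1) d(9) tv vz vL conv gb(2) gbK]
   have Q: "integrable lborel (%t. Qf (%x. v x t))"
   proof -
    have "integrable lborel (%t. nsq (%x. v x t))"
    proof (rule Bochner_Integration.integrable_bound)
     show "integrable lborel (%t. (c\<^sup>2 * measure lborel \<Omega>) * chf {0..T} t)"
      by (rule integrable_mult_right, rule integrable_real_indicator) (use T in auto)
     show "(%t. nsq (%x. v x t)) : borel_measurable lborel" using tmeas_sqn[OF tv] by simp
     show "AE t in lborel. norm (nsq (%x. v x t)) <= norm ((c\<^sup>2 * measure lborel \<Omega>) * chf {0..T} t)"
     proof (rule AE_I2)
      fix t
      show "norm (nsq (%x. v x t)) <= norm ((c\<^sup>2 * measure lborel \<Omega>) * chf {0..T} t)"
      proof (cases "t : ?I")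
       case True
       have "nsq (%x. v x t) <= nsq (%x. c * chf \<Omega> x)" by (rule sqn_mono[OF LO vb]) (use v0[of _ t] in \<open>simp add: order_trans[OF v0(2)]\<close>)
       also have "\<dots> = c\<^sup>2 * measure lborel \<Omega>"
       proof -
        have "(%x. (c * chf \<Omega> x)\<^sup>2) = (%x. c\<^sup>2 * chf \<Omega> x)" by (auto simp: fun_eq_iff indicator_def)
        then show ?thesis using Om_borel Om_fin by (simp add: sqn_def)
       qed
       finally show ?thesis using True sqn_nonneg[of lborel "%x. v x t"] by simp
      qed (simp add: vzI sqn_def)
     qed
    qed
    then show ?thesis unfolding Qf_def using le(2) by (rule Bochner_Integration.integrable_add)
   qed
   have uv: "AE t in lborel. t : ?I --> (AE x in lborel. x : \<Omega> --> u x t = v x t)" using st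
   proof (eventually_elim, intro impI)
    fix t assume A: "t : ?I --> (AE x in lborel. x : \<Omega> --> u x t = v x t & (%j. V j x t) \<longlonglongrightarrow> v x t)" and t: "t : ?I"
    have "AE x in lborel. x : \<Omega> --> u x t = v x t & (%j. V j x t) \<longlonglongrightarrow> v x t" using A t by blast
    then show "AE x in lborel. x : \<Omega> --> u x t = v x t" by eventually_elim blast
   qed
   show ?thesis by (rule L2H10_I[OF um tv vzI uv le(1) Q])
  qed
  with uL show ?thesis by blast
 qed
 have c0: "0 < c" using c by simp
 show ?thesis
 proof (intro conjI allI impI)
  show "\<exists>c>0. \<forall>k\<ge>1. Lnorm \<infinity> (cylinder \<Omega> T) (%(x, t). U k x t) <= ennreal c" using c0 part1 by blast
  show "\<exists>u. AE (x, t) in cylinder \<Omega> T. (%k. U k x t) \<longlonglongrightarrow> u x t" by (rule exI[of _ "%x t. l (x, t)"]) (rule part2)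
  fix u assume uU: "AE (x, t) in cylinder \<Omega> T. (%k. U k x t) \<longlonglongrightarrow> u x t"
  show "(%(x, t). u x t) : Lspace \<infinity> (cylinder \<Omega> T)" using part3[OF uU] by blast
  show "u : L2H10 \<Omega> T" if "\<gamma> <= 1" using part3[OF uU] that by blast
 qed
qed

end
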